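(* Let $k$ be a field, $m$ a nonnegative integer, and $\Delta$ a $(d-1)$-dimensional simplicial complex which is $m$-Buchsbaum* over $k$. Then for every $0\le i\le d-1$ the $i$-skeleton $\Delta^{\langle i\rangle}$ is $(m+d-i-1)$-Buchsbaum* over $k$.
   Context: A simplicial complex is a finite collection of subsets of a finite ground set closed under taking subsets; $|\Delta|$ is its geometric realization, $\widetilde{H}_*(\cdot;k)$ reduced homology over $k$. $\Delta$ is Buchsbaum over $k$ if its face ring $k[\Delta]$ is a Buchsbaum ring. A $(d-1)$-dimensional complex $\Delta$ which is Buchsbaum over $k$ is Buchsbaum* over $k$ if $\dim_k \widetilde{H}_{d-2}(|\Delta|-p;k) = \dim_k \widetilde{H}_{d-2}(|\Delta|;k)$ for every $p\in|\Delta|$. For a set $\tau$ of vertices, $\Delta\smallsetminus\tau=\{\sigma\in\Delta:\sigma\cap\tau=\varnothing\}$. For an integer $m\ge0$, $\Delta$ is $m$-Buchsbaum* over $k$ if either $m=0$ and $\Delta$ is Buchsbaum over $k$, or $m\ge1$ and $\Delta\smallsetminus\tau$ is Buchsbaum* over $k$ of the same dimension as $\Delta$ for every set $\tau$ of vertices of cardinality less than $m$. The $i$-skeleton $\Delta^{\langle i\rangle}$ consists of all faces of dimension at most $i$. *)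

theory Defs
  imports
    "HOL-Homology.Homology"
    "HOL-Algebra.Algebra"
    "HOL-Library.Poly_Mapping"
    "HOL-Library.Extended_Nat"
begin

section \<open>Simplicial complexes\<close>

definition simplicial_complex :: "'v set set \<Rightarrow> bool" where
  "simplicial_complex \<Delta> \<longleftrightarrow>
     finite \<Delta> \<and> (\<forall>\<sigma>\<in>\<Delta>. finite \<sigma>) \<and> (\<forall>\<sigma>\<in>\<Delta>. \<forall>\<tau>. \<tau> \<subseteq> \<sigma> \<longrightarrow> \<tau> \<in> \<Delta>)"

abbreviation vertices :: "'v set set \<Rightarrow> 'v set" where
  "vertices \<Delta> \<equiv> \<Union>\<Delta>"

text \<open>By convention, the void complex also gets dimension \<open>-1\<close>.\<close>

definition complex_dim :: "'v set set \<Rightarrow> int" where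
  "complex_dim \<Delta> = Max (insert (-1) ((\<lambda>\<sigma>. int (card \<sigma>) - 1) ` \<Delta>))"

definition delete_vertices :: "'v set set \<Rightarrow> 'v set \<Rightarrow> 'v set set" where
  "delete_vertices \<Delta> \<tau> = {\<sigma> \<in> \<Delta>. \<sigma> \<inter> \<tau> = {}}"

definition skeleton :: "nat \<Rightarrow> 'v set set \<Rightarrow> 'v set set" where
  "skeleton i \<Delta> = {\<sigma> \<in> \<Delta>. int (card \<sigma>) - 1 \<le> int i}"

text \<open>Points are given by their barycentric coordinates, which vanish off the vertex set.\<close>

definition realization_set :: "'v set set \<Rightarrow> ('v \<Rightarrow> real) set" where
  "realization_set \<Delta> =
     {x. (\<forall>v. 0 \<le> x v) \<and> {v. x v \<noteq> 0} \<in> \<Delta> \<and> (\<Sum>v | x v \<noteq> 0. x v) = 1}"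

definition realization :: "'v set set \<Rightarrow> ('v \<Rightarrow> real) topology" where
  "realization \<Delta> = subtopology (powertop_real UNIV) (realization_set \<Delta>)"


section \<open>Reduced singular homology with coefficients in a field\<close>

text \<open>
  The library's singular chains have integer coefficients only, so the augmented singular chain
  complex over a field is set up here on top of the library's singular simplices.  In degree
  \<open>-1\<close> there is exactly one simplex, the empty one, represented by \<open>\<lambda>_. undefined\<close> (the only
  function that is extensional on the empty set); all lower degrees have none.
\<close>

definition aug_simplices :: "int \<Rightarrow> 'a topology \<Rightarrow> ((nat \<Rightarrow> real) \<Rightarrow> 'a) set" where
  "aug_simplices n T =
     (if 0 \<le> n then {f. singular_simplex (nat n) T f}
      else if n = -1 then {\<lambda>_. undefined} else {})"

definition aug_face :: "int \<Rightarrow> nat \<Rightarrow> ((nat \<Rightarrow> real) \<Rightarrow> 'a) \<Rightarrow> (nat \<Rightarrow> real) \<Rightarrow> 'a" where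
  "aug_face n i f = (if n = 0 then (\<lambda>_. undefined) else singular_face (nat n) i f)"

definition aug_chains :: "int \<Rightarrow> 'a topology \<Rightarrow> (((nat \<Rightarrow> real) \<Rightarrow> 'a) \<Rightarrow>\<^sub>0 'k::field) set" where
  "aug_chains n T = {c. Poly_Mapping.keys c \<subseteq> aug_simplices n T}"

text \<open>An \<open>n\<close>-simplex has \<open>n + 1\<close> faces; for \<open>n = 0\<close> this is the augmentation map.\<close>

definition aug_boundary ::
  "int \<Rightarrow> (((nat \<Rightarrow> real) \<Rightarrow> 'a) \<Rightarrow>\<^sub>0 'k::field) \<Rightarrow> (((nat \<Rightarrow> real) \<Rightarrow> 'a) \<Rightarrow>\<^sub>0 'k)" where
  "aug_boundary n c =
     (\<Sum>f\<in>Poly_Mapping.keys c. \<Sum>i<nat (n + 1).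
        Poly_Mapping.single (aug_face n i f) ((-1) ^ i * Poly_Mapping.lookup c f))"

definition reduced_cycles :: "int \<Rightarrow> 'a topology \<Rightarrow> (((nat \<Rightarrow> real) \<Rightarrow> 'a) \<Rightarrow>\<^sub>0 'k::field) set" where
  "reduced_cycles n T = {c \<in> aug_chains n T. aug_boundary n c = 0}"

definition reduced_boundaries :: "int \<Rightarrow> 'a topology \<Rightarrow> (((nat \<Rightarrow> real) \<Rightarrow> 'a) \<Rightarrow>\<^sub>0 'k::field) set" where
  "reduced_boundaries n T = aug_boundary (n + 1) ` aug_chains (n + 1) T"

text \<open>
  \<open>quotient_dim Z B\<close> is the dimension of \<open>Z / B\<close> for subspaces \<open>B \<subseteq> Z\<close> of a space of finitely
  supported functions: the largest number of vectors of \<open>Z\<close> linearly independent modulo \<open>B\<close>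
  (\<open>\<infinity>\<close> if unbounded).
\<close>

definition quotient_dim :: "('b \<Rightarrow>\<^sub>0 'k::field) set \<Rightarrow> ('b \<Rightarrow>\<^sub>0 'k) set \<Rightarrow> enat" where
  "quotient_dim Z B =
     (SUP S \<in> {S. finite S \<and> S \<subseteq> Z \<and>
                 (\<forall>a. (\<Sum>s\<in>S. Poly_Mapping.map ((*) (a s)) s) \<in> B \<longrightarrow> (\<forall>s\<in>S. a s = 0))}.
        enat (card S))"

definition reduced_homology_dim :: "'k::field itself \<Rightarrow> int \<Rightarrow> 'a topology \<Rightarrow> enat" where
  "reduced_homology_dim _ n T =
     quotient_dim (reduced_cycles n T :: (((nat \<Rightarrow> real) \<Rightarrow> 'a) \<Rightarrow>\<^sub>0 'k) set)
       (reduced_boundaries n T)"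


section \<open>Buchsbaum local rings\<close>

definition krull_dim :: "('a, 'm) ring_scheme \<Rightarrow> enat" where
  "krull_dim R =
     (SUP n \<in> {n. \<exists>P. (\<forall>i\<le>n. primeideal (P i) R) \<and> (\<forall>i<n. P i \<subset> P (Suc i))}. enat n)"

definition noetherian_local_ring :: "('a, 'm) ring_scheme \<Rightarrow> 'a set \<Rightarrow> bool" where
  "noetherian_local_ring R M \<longleftrightarrow>
     cring R \<and> noetherian_ring R \<and> maximalideal M R \<and> (\<forall>N. maximalideal N R \<longrightarrow> N = M)"

text \<open>
  A system of parameters: \<open>dim R\<close> elements of \<open>M\<close> generating an \<open>M\<close>-primary ideal, that is, one
  whose radical is \<open>M\<close>.
\<close>

definition system_of_parameters :: "('a, 'm) ring_scheme \<Rightarrow> 'a set \<Rightarrow> 'a list \<Rightarrow> bool" where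
  "system_of_parameters R M xs \<longleftrightarrow>
     set xs \<subseteq> M \<and> enat (length xs) = krull_dim R \<and>
     (\<forall>a\<in>M. \<exists>n::nat. a [^]\<^bsub>R\<^esub> n \<in> Idl\<^bsub>R\<^esub> (set xs))"

definition colon :: "('a, 'm) ring_scheme \<Rightarrow> 'a set \<Rightarrow> 'a set \<Rightarrow> 'a set" where
  "colon R I J = {a \<in> carrier R. \<forall>b\<in>J. a \<otimes>\<^bsub>R\<^esub> b \<in> I}"

definition weak_sequence :: "('a, 'm) ring_scheme \<Rightarrow> 'a set \<Rightarrow> 'a list \<Rightarrow> bool" where
  "weak_sequence R M xs \<longleftrightarrow>
     (\<forall>i<length xs. colon R (Idl\<^bsub>R\<^esub> (set (take i xs))) {xs ! i}
                    = colon R (Idl\<^bsub>R\<^esub> (set (take i xs))) M)"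

definition buchsbaum_local_ring :: "('a, 'm) ring_scheme \<Rightarrow> bool" where
  "buchsbaum_local_ring R \<longleftrightarrow>
     (\<exists>M. noetherian_local_ring R M \<and>
          (\<forall>xs. system_of_parameters R M xs \<longrightarrow> weak_sequence R M xs))"


section \<open>Localization\<close>

text \<open>\<open>(a, s)\<close> stands for the fraction \<open>a / s\<close>; \<open>S\<close> is meant to be a multiplicatively closed subset.\<close>

definition frac_rel :: "('a, 'm) ring_scheme \<Rightarrow> 'a set \<Rightarrow> (('a \<times> 'a) \<times> ('a \<times> 'a)) set" where
  "frac_rel R S =
     {((a, s), (b, t)). a \<in> carrier R \<and> s \<in> S \<and> b \<in> carrier R \<and> t \<in> S \<and>
        (\<exists>u\<in>S. u \<otimes>\<^bsub>R\<^esub> (a \<otimes>\<^bsub>R\<^esub> t \<ominus>\<^bsub>R\<^esub> b \<otimes>\<^bsub>R\<^esub> s) = \<zero>\<^bsub>R\<^esub>)}"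

definition fraction :: "('a, 'm) ring_scheme \<Rightarrow> 'a set \<Rightarrow> 'a \<Rightarrow> 'a \<Rightarrow> ('a \<times> 'a) set" where
  "fraction R S a s = frac_rel R S `` {(a, s)}"

text \<open>
  The operations are defined on classes as unions over representatives; all members of such a
  union coincide, because the fraction operations respect \<open>frac_rel\<close>.
\<close>

definition localization :: "('a, 'm) ring_scheme \<Rightarrow> 'a set \<Rightarrow> ('a \<times> 'a) set ring" where
  "localization R S =
     \<lparr>carrier = (carrier R \<times> S) // frac_rel R S,
      monoid.mult = (\<lambda>F G. \<Union>(a, s)\<in>F. \<Union>(b, t)\<in>G. fraction R S (a \<otimes>\<^bsub>R\<^esub> b) (s \<otimes>\<^bsub>R\<^esub> t)),
      one = fraction R S \<one>\<^bsub>R\<^esub> \<one>\<^bsub>R\<^esub>,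
      zero = fraction R S \<zero>\<^bsub>R\<^esub> \<one>\<^bsub>R\<^esub>,
      add = (\<lambda>F G. \<Union>(a, s)\<in>F. \<Union>(b, t)\<in>G.
               fraction R S (a \<otimes>\<^bsub>R\<^esub> t \<oplus>\<^bsub>R\<^esub> b \<otimes>\<^bsub>R\<^esub> s) (s \<otimes>\<^bsub>R\<^esub> t))\<rparr>"


section \<open>Face rings\<close>

text \<open>
  Polynomials in commuting variables indexed by \<open>'v\<close>: a monomial is its finitely supported
  exponent function, and the ring operations are those of the library's type class instance
  (multiplication is convolution).  Only variables from \<open>V\<close> may occur.
\<close>

definition poly_ring :: "'k::field itself \<Rightarrow> 'v set \<Rightarrow> (('v \<Rightarrow>\<^sub>0 nat) \<Rightarrow>\<^sub>0 'k) ring" where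
  "poly_ring _ V =
     \<lparr>carrier = {p. \<forall>e\<in>Poly_Mapping.keys p. Poly_Mapping.keys e \<subseteq> V},
      monoid.mult = (*), one = 1, zero = 0, add = (+)\<rparr>"

definition poly_var :: "'v \<Rightarrow> (('v \<Rightarrow>\<^sub>0 nat) \<Rightarrow>\<^sub>0 'k::field)" where
  "poly_var v = Poly_Mapping.single (Poly_Mapping.single v 1) 1"

definition stanley_reisner_ideal :: "'k::field itself \<Rightarrow> 'v set set \<Rightarrow> (('v \<Rightarrow>\<^sub>0 nat) \<Rightarrow>\<^sub>0 'k) set" where
  "stanley_reisner_ideal k \<Delta> =
     Idl\<^bsub>poly_ring k (vertices \<Delta>)\<^esub> {(\<Prod>v\<in>\<sigma>. poly_var v) | \<sigma>. \<sigma> \<subseteq> vertices \<Delta> \<and> \<sigma> \<notin> \<Delta>}"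

definition face_ring :: "'k::field itself \<Rightarrow> 'v set set \<Rightarrow> (('v \<Rightarrow>\<^sub>0 nat) \<Rightarrow>\<^sub>0 'k) set ring" where
  "face_ring k \<Delta> = poly_ring k (vertices \<Delta>) Quot stanley_reisner_ideal k \<Delta>"

definition irrelevant_ideal :: "'k::field itself \<Rightarrow> 'v set set \<Rightarrow> (('v \<Rightarrow>\<^sub>0 nat) \<Rightarrow>\<^sub>0 'k) set set" where
  "irrelevant_ideal k \<Delta> =
     Idl\<^bsub>face_ring k \<Delta>\<^esub>
       ((\<lambda>v. stanley_reisner_ideal k \<Delta> +>\<^bsub>poly_ring k (vertices \<Delta>)\<^esub> poly_var v) ` vertices \<Delta>)"


section \<open>Buchsbaum, Buchsbaum* and m-Buchsbaum* complexes\<close>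

text \<open>
  A standard graded algebra over a field is called a Buchsbaum ring if its localization at the
  irrelevant (homogeneous maximal) ideal is a Buchsbaum local ring (Stueckrad and Vogel).
\<close>

definition buchsbaum_complex :: "'k::field itself \<Rightarrow> 'v set set \<Rightarrow> bool" where
  "buchsbaum_complex k \<Delta> \<longleftrightarrow>
     buchsbaum_local_ring
       (localization (face_ring k \<Delta>) (carrier (face_ring k \<Delta>) - irrelevant_ideal k \<Delta>))"

definition buchsbaum_star :: "'k::field itself \<Rightarrow> 'v set set \<Rightarrow> bool" where
  "buchsbaum_star k \<Delta> \<longleftrightarrow>
     buchsbaum_complex k \<Delta> \<and>
     (\<forall>p \<in> realization_set \<Delta>.
        reduced_homology_dim k (complex_dim \<Delta> - 1)
          (subtopology (realization \<Delta>) (realization_set \<Delta> - {p}))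
        = reduced_homology_dim k (complex_dim \<Delta> - 1) (realization \<Delta>))"

definition m_buchsbaum_star :: "'k::field itself \<Rightarrow> nat \<Rightarrow> 'v set set \<Rightarrow> bool" where
  "m_buchsbaum_star k m \<Delta> \<longleftrightarrow>
     (m = 0 \<and> buchsbaum_complex k \<Delta>) \<or>
     (1 \<le> m \<and>
      (\<forall>\<tau>. \<tau> \<subseteq> vertices \<Delta> \<and> card \<tau> < m \<longrightarrow>
         buchsbaum_star k (delete_vertices \<Delta> \<tau>) \<and>
         complex_dim (delete_vertices \<Delta> \<tau>) = complex_dim \<Delta>))"

end

theory Submission
  imports Defs "HOL-Library.Function_Algebras"
begin

text \<open>Write \<open>d - 1\<close> for the dimension. The Buchsbaum property is turned into a combinatorial condition in the
  style of Reisner and Schenzel: the relative cochain complex of the faces containing a nonempty face \<open>F0\<close> is exact below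
  the top degree. One direction multiplies a cochain by a Laurent monomial with support \<open>F0\<close> and uses that the weak sequence of
  elementary symmetric functions of the variables (summed over all vertex sets of a given size) kills Cech cocycles; the converse
  is a diagram chase in the double complex of a Koszul and a Cech complex. Both the homology of the realization and that
  of the realization minus a point are computed by a nerve theorem: removing a point with support \<open>\<sigma>\<close> amounts to
  removing all faces that contain \<open>\<sigma>\<close>.

  After this translation it suffices to pass from \<open>\<Delta>\<close> to the skeleton of codimension one. Exactness near the top
  gives the equality of homology dimensions for the skeleton of a Buchsbaum complex. If \<open>\<Delta>\<close> is Buchsbaum*, then the equality of
  dimensions says that every cycle relative to the faces not containing \<open>\<sigma>\<close> extends to an absolute cycle; subtracting such a
  cycle keeps a bounding chain away from a vertex \<open>v\<close>, so that deleting one more vertex preserves the exactness condition.\<close>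

text \<open>The exactness condition concerns nonempty \<open>F0\<close> only: in exponent 0 the Cech
  complex of a Buchsbaum face ring computes the reduced cohomology of \<Delta> itself, which may be
  nonzero. Multiplication by one variable moves exponent 0 to a positive exponent, where the Cech
  complex is contractible; this is the origin of the extra variable in the weak-sequence condition.
  The Koszul-Cech chase yields membership in an ideal that also involves the later parameters, so
  these are raised to high powers and removed by Krull's intersection theorem. Statements about the
  local ring are made for numerators and hold up to a factor with nonzero constant term, hence the
  many multipliers \<open>s\<close>, \<open>t\<close>, \<open>S\<close>. Buchsbaum* only asserts an
  equality of dimensions, whereas the deletion argument needs an injective map. Relative exactness
  makes the map induced by the inclusion surjective, and finite dimension does the rest. Passing to
  a skeleton of codimension one trades the top dimension for one more deletable vertex: the
  exactness lost in the top degree of the large complex is exactly what compares the homology of the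
  smaller one with its punctured versions.\<close>

abbreviation coef :: "('a \<Rightarrow>\<^sub>0 'b::zero) \<Rightarrow> 'a \<Rightarrow> 'b" where "coef \<equiv> Poly_Mapping.lookup"
abbreviation mon :: "'a \<Rightarrow> 'b::zero \<Rightarrow> 'a \<Rightarrow>\<^sub>0 'b" where "mon \<equiv> Poly_Mapping.single"
abbreviation supp :: "('a \<Rightarrow>\<^sub>0 'b::zero) \<Rightarrow> 'a set" where "supp \<equiv> Poly_Mapping.keys"

section \<open>Signed sums over finite sets\<close>

definition additive_fun :: "('a::ab_group_add \<Rightarrow> 'b::ab_group_add) \<Rightarrow> bool" where
  "additive_fun h \<longleftrightarrow> (\<forall>x y. h (x + y) = h x + h y)"

lemma additive_fun_add: "additive_fun h \<Longrightarrow> h (x + y) = h x + h y"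
  by (simp add: additive_fun_def)

lemma additive_fun_0 [simp]: "additive_fun h \<Longrightarrow> h 0 = 0"
  by (metis add_cancel_right_left additive_fun_def)

lemma additive_fun_minus: "additive_fun h \<Longrightarrow> h (- x) = - h x"
  using additive_fun_add[of h "- x" x] by (simp add: eq_neg_iff_add_eq_0)

lemma additive_fun_diff: "additive_fun h \<Longrightarrow> h (x - y) = h x - h y"
  using additive_fun_add[of h x "- y"] by (simp add: additive_fun_minus)

lemma additive_fun_sum: "additive_fun h \<Longrightarrow> h (\<Sum>i\<in>A. f i) = (\<Sum>i\<in>A. h (f i))"
  by (induction A rule: infinite_finite_induct) (auto simp: additive_fun_add)

text \<open>The sign acts by negation in an arbitrary abelian group, so that the same operators
  serve field elements, Laurent polynomials and singular chains. The rank \<open>r\<close> orients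
  the sets through its order; injectivity on the finite index set is all that is asked of
  it.\<close>

definition sg :: "('i \<Rightarrow> nat) \<Rightarrow> 'i \<Rightarrow> 'i set \<Rightarrow> 'm::ab_group_add \<Rightarrow> 'm" where
  "sg r u F m = (if even (card {y \<in> F. r y < r u}) then m else - m)"

lemma sg_insert_same: "sg r u (insert u F) = sg r u F"
proof -
  have "{y \<in> insert u F. r y < r u} = {y \<in> F. r y < r u}" by auto
  then show ?thesis by (auto simp: sg_def fun_eq_iff)
qed

lemma sg_remove_same: "sg r u (F - {u}) = sg r u F"
proof -
  have "{y \<in> F - {u}. r y < r u} = {y \<in> F. r y < r u}" by auto
  then show ?thesis by (auto simp: sg_def fun_eq_iff)
qed

lemma sg_insert:
  assumes "finite F" "u \<notin> F"
  shows "sg r v (insert u F) m = (if r u < r v then - sg r v F m else sg r v F m)"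
proof (cases "r u < r v")
  case True
  then have "{y \<in> insert u F. r y < r v} = insert u {y \<in> F. r y < r v}" by auto
  then show ?thesis using assms True by (simp add: sg_def)
next
  case False
  then have "{y \<in> insert u F. r y < r v} = {y \<in> F. r y < r v}" by auto
  then show ?thesis using False by (simp add: sg_def)
qed

lemma sg_remove:
  assumes "finite F" "u \<in> F"
  shows "sg r v (F - {u}) m = (if r u < r v then - sg r v F m else sg r v F m)"
proof -
  have "insert u (F - {u}) = F" using assms by auto
  then show ?thesis using sg_insert[of "F - {u}" u r v m] assms by (simp split: if_splits)
qed

lemma sg_sg [simp]: "sg r u F (sg r u F m) = m" by (simp add: sg_def)
lemma sg_uminus [simp]: "sg r u F (- m) = - sg r u F m" by (simp add: sg_def)
lemma sg_0 [simp]: "sg r u F 0 = 0" by (simp add: sg_def)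
lemma sg_eq_0 [simp]: "sg r u F x = 0 \<longleftrightarrow> x = 0" by (simp add: sg_def)
lemma sg_add: "sg r u F (m + n) = sg r u F m + sg r u F n" by (simp add: sg_def)
lemma additive_sg: "additive_fun (sg r u F)" by (simp add: additive_fun_def sg_add)
lemma sg_hom: "additive_fun h \<Longrightarrow> h (sg r u F m) = sg r u F (h m)"
  by (simp add: sg_def additive_fun_minus)
lemma sg_commute: "sg r u F (sg t v G m) = sg t v G (sg r u F m)" by (simp add: sg_def)
lemma sg_mult: "a * sg r u F m = sg r u F (a * m)" for a :: "'r::comm_ring"
  by (simp add: sg_def)

text \<open>With the identity as weights, \<open>up\<close> is the simplicial boundary and
  \<open>dn\<close> the simplicial or Cech coboundary, both written on coefficient functions. With
  multiplications by ring elements as weights, \<open>up\<close> is a Koszul differential and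
  \<open>dn\<close> a contraction for it.\<close>

definition up where
  "up r I x z F = (\<Sum>u\<in>I - F. sg r u F (x u (z (insert u F))))"
definition dn where
  "dn r a z F = (\<Sum>u\<in>F. sg r u F (a u (z (F - {u}))))"

text \<open>Each ordered pair is cancelled against its transpose by splitting according to rank.
  Merely exchanging the two summation variables would show that twice the sum vanishes, which is
  worthless in characteristic 2.\<close>

lemma sum_antisym:
  fixes T :: "'i \<Rightarrow> 'i \<Rightarrow> 'm::ab_group_add" and r :: "'i \<Rightarrow> nat"
  assumes "finite S" "inj_on r S"
    and anti: "\<And>u v. u \<in> S \<Longrightarrow> v \<in> S \<Longrightarrow> u \<noteq> v \<Longrightarrow> T u v = - T v u"
  shows "(\<Sum>u\<in>S. \<Sum>v\<in>S - {u}. T u v) = 0"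
proof -
  have inj: "r u \<noteq> r v" if "u \<in> S" "v \<in> S" "u \<noteq> v" for u v
    using assms(2) that by (auto simp: inj_on_def)
  have split: "(\<Sum>v\<in>S - {u}. T u v) = (\<Sum>v\<in>{v\<in>S. r u < r v}. T u v) + (\<Sum>v\<in>{v\<in>S. r v < r u}. T u v)"
    if "u \<in> S" for u
  proof -
    have "S - {u} = {v\<in>S. r u < r v} \<union> {v\<in>S. r v < r u}"
      using inj that by (force simp: neq_iff)
    then show ?thesis
      using assms(1) by (simp add: sum.union_disjoint disjoint_iff)
  qed
  have "(\<Sum>u\<in>S. \<Sum>v\<in>{v\<in>S. r v < r u}. T u v) = (\<Sum>v\<in>S. \<Sum>u\<in>{u\<in>S. r v < r u}. T u v)"
    using sum.swap_restrict[OF assms(1,1), of T "\<lambda>u v. r v < r u"] by simp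
  also have "\<dots> = (\<Sum>v\<in>S. \<Sum>u\<in>{u\<in>S. r v < r u}. - T v u)"
    by (intro sum.cong refl anti) auto
  finally show ?thesis
    by (simp add: split sum.distrib sum_negf)
qed

lemma up_up:
  assumes I: "finite I" "inj_on r I" and F: "F \<subseteq> I"
    and add: "\<And>u. additive_fun (x u)" and comm: "\<And>u v m. x u (x v m) = x v (x u m)"
  shows "up r I x (up r I x z) F = 0"
proof -
  have finF: "finite F" using F I finite_subset by blast
  have "up r I x (up r I x z) F =
    (\<Sum>u\<in>I - F. \<Sum>v\<in>(I - F) - {u}. sg r u F (sg r v (insert u F) (x u (x v (z (insert v (insert u F)))))))"
    unfolding up_def
    by (intro sum.cong refl) (auto simp: additive_fun_sum[OF add] additive_fun_sum[OF additive_sg] sg_hom[OF add] 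
        intro!: sum.cong)
  also have "\<dots> = 0"
  proof (rule sum_antisym[where r = r])
    fix u v assume *: "u \<in> I - F" "v \<in> I - F" "u \<noteq> v"
    then have "r u \<noteq> r v" using I by (auto simp: inj_on_def)
    then consider "r u < r v" | "r v < r u" by linarith
    then show "sg r u F (sg r v (insert u F) (x u (x v (z (insert v (insert u F)))))) =
       - sg r v F (sg r u (insert v F) (x v (x u (z (insert u (insert v F))))))"
      using * finF by cases (auto simp: sg_insert insert_commute comm[of u v] sg_commute[of r u])
  qed (use I in \<open>auto simp: inj_on_def\<close>)
  finally show ?thesis .
qed

lemma dn_dn:
  assumes F: "finite F" "inj_on r F"
    and add: "\<And>u. additive_fun (a u)" and comm: "\<And>u v m. a u (a v m) = a v (a u m)"
  shows "dn r a (dn r a z) F = 0"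
proof -
  have "dn r a (dn r a z) F =
    (\<Sum>u\<in>F. \<Sum>v\<in>F - {u}. sg r u F (sg r v (F - {u}) (a u (a v (z (F - {u} - {v}))))))"
    unfolding dn_def
    by (intro sum.cong refl) (auto simp: additive_fun_sum[OF add] additive_fun_sum[OF additive_sg] sg_hom[OF add]
        intro!: sum.cong)
  also have "\<dots> = 0"
  proof (rule sum_antisym[where r = r])
    fix u v assume *: "u \<in> F" "v \<in> F" "u \<noteq> v"
    then have "r u \<noteq> r v" using F by (auto simp: inj_on_def)
    moreover have "F - {u} - {v} = F - {v} - {u}" by auto
    moreover consider "r u < r v" | "r v < r u" using \<open>r u \<noteq> r v\<close> by linarith
    ultimately show "sg r u F (sg r v (F - {u}) (a u (a v (z (F - {u} - {v}))))) =
       - sg r v F (sg r u (F - {v}) (a v (a u (z (F - {v} - {u})))))"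
      using * F by (cases) (auto simp: sg_remove comm[of u v] sg_commute[of r u])
  qed (use F in \<open>auto simp: inj_on_def\<close>)
  finally show ?thesis .
qed

text \<open>The mixed terms of the two composites cancel and the diagonal ones remain. If the
  weights are chosen so that the right side is the identity or multiplication by a fixed element,
  this is a homotopy formula; the contractions of the Cech, Koszul and nerve complexes are all
  obtained from it.\<close>

lemma up_dn:
  assumes I: "finite I" "inj_on r I" and F: "F \<subseteq> I"
    and addx: "\<And>u. additive_fun (x u)" and adda: "\<And>u. additive_fun (a u)"
    and comm: "\<And>u v m. x u (a v m) = a v (x u m)"
  shows "up r I x (dn r a z) F + dn r a (up r I x z) F = (\<Sum>u\<in>I. a u (x u (z F)))"
proof -
  have finF: "finite F" using F I finite_subset by blast
  \<comment> \<open>The mixed term for a vertex \<open>u\<close> added and a vertex \<open>t\<close>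
    removed; the two composites produce it with opposite signs.\<close>
  define c where "c u t = sg r u F (sg r t (insert u F) (x u (a t (z (insert u (F - {t}))))))" for u t
  have 1: "sg r u F (x u (dn r a z (insert u F))) = a u (x u (z F)) + (\<Sum>t\<in>F. c u t)" if "u \<in> I - F" for u
  proof -
    have "dn r a z (insert u F) = sg r u F (a u (z F)) + (\<Sum>t\<in>F. sg r t (insert u F) (a t (z (insert u F - {t}))))"
      unfolding dn_def using that finF by (simp add: sg_insert_same)
    also have "(\<Sum>t\<in>F. sg r t (insert u F) (a t (z (insert u F - {t})))) = (\<Sum>t\<in>F. sg r t (insert u F) (a t (z (insert u (F - {t})))))"
      using that by (intro sum.cong refl) (metis DiffD2 insert_Diff_if singletonD)
    finally show ?thesis
      by (simp add: additive_fun_add[OF addx] sg_add additive_fun_sum[OF addx] additive_fun_sum[OF additive_sg]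
          sg_hom[OF addx] comm c_def)
  qed
  have 2: "sg r t F (a t (up r I x z (F - {t}))) = a t (x t (z F)) - (\<Sum>u\<in>I - F. c u t)" if "t \<in> F" for t
  proof -
    have "I - (F - {t}) = insert t (I - F)" using that F by auto
    then have "up r I x z (F - {t}) = sg r t F (x t (z F)) + (\<Sum>u\<in>I - F. sg r u (F - {t}) (x u (z (insert u (F - {t})))))"
      unfolding up_def using that I by (simp add: sg_remove_same insert_absorb)
    moreover have "sg r t F (a t (sg r u (F - {t}) (x u (z (insert u (F - {t})))))) = - c u t" if u: "u \<in> I - F" for u
    proof -
      have "r u \<noteq> r t" "u \<notin> F" using I u that \<open>t \<in> F\<close> F by (auto simp: inj_on_def)
      then consider "r u < r t" | "r t < r u" by linarith
      then show ?thesis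
        using \<open>t \<in> F\<close> \<open>u \<notin> F\<close> finF 
        by cases (auto simp: c_def sg_insert sg_remove comm sg_hom[OF adda] sg_commute[of r u] additive_fun_minus[OF adda])
    qed
    ultimately show ?thesis
      by (simp add: additive_fun_add[OF adda] sg_add additive_fun_sum[OF adda] additive_fun_sum[OF additive_sg]
          sg_hom[OF adda] sum_negf)
  qed
  have "up r I x (dn r a z) F = (\<Sum>u\<in>I - F. a u (x u (z F))) + (\<Sum>u\<in>I - F. \<Sum>t\<in>F. c u t)"
    unfolding up_def[of r I x "dn r a z"] using 1 by (simp add: sum.distrib)
  moreover have "dn r a (up r I x z) F = (\<Sum>t\<in>F. a t (x t (z F))) - (\<Sum>t\<in>F. \<Sum>u\<in>I - F. c u t)"
    unfolding dn_def[of r a "up r I x z"] using 2 by (simp add: sum_subtractf)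
  moreover have "(\<Sum>t\<in>F. \<Sum>u\<in>I - F. c u t) = (\<Sum>u\<in>I - F. \<Sum>t\<in>F. c u t)" by (rule sum.swap)
  ultimately show ?thesis
    using sum.subset_diff[OF F I(1), of "\<lambda>u. a u (x u (z F))"] by (simp add: algebra_simps)
qed

lemma up_add: "(\<And>u. additive_fun (x u)) \<Longrightarrow> up r I x (\<lambda>F. z F + y F) F = up r I x z F + up r I x y F"
  by (simp add: up_def sg_add additive_fun_add sum.distrib)
lemma up_minus: "(\<And>u. additive_fun (x u)) \<Longrightarrow> up r I x (\<lambda>F. z F - y F) F = up r I x z F - up r I x y F"
  by (simp add: up_def additive_fun_diff[OF additive_sg] additive_fun_diff sum_subtractf)
lemma dn_add: "(\<And>u. additive_fun (x u)) \<Longrightarrow> dn r x (\<lambda>F. z F + y F) F = dn r x z F + dn r x y F"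
  by (simp add: dn_def sg_add additive_fun_add sum.distrib)
lemma dn_minus: "(\<And>u. additive_fun (x u)) \<Longrightarrow> dn r x (\<lambda>F. z F - y F) F = dn r x z F - dn r x y F"
  by (simp add: dn_def additive_fun_diff[OF additive_sg] additive_fun_diff sum_subtractf)
lemma up_hom: "additive_fun h \<Longrightarrow> (\<And>u m. h (x u m) = x u (h m)) \<Longrightarrow> h (up r I x z F) = up r I x (\<lambda>F. h (z F)) F"
  by (simp add: up_def additive_fun_sum sg_hom)
lemma dn_hom: "additive_fun h \<Longrightarrow> (\<And>u m. h (x u m) = x u (h m)) \<Longrightarrow> h (dn r x z F) = dn r x (\<lambda>F. h (z F)) F"
  by (simp add: dn_def additive_fun_sum sg_hom)

section \<open>Polynomials as finitely supported functions\<close>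

lemma pm_expand: "p = (\<Sum>e\<in>supp p. mon e (coef p e))"
proof (rule poly_mapping_eqI)
  fix x
  show "coef p x = coef (\<Sum>e\<in>supp p. mon e (coef p e)) x"
    by (cases "x \<in> supp p") (auto simp: lookup_sum lookup_single when_def in_keys_iff sum.delta)
qed

lemma pm_induct [case_names zero single add]:
  assumes "P 0" "\<And>e c. P (mon e c)" "\<And>p q. P p \<Longrightarrow> P q \<Longrightarrow> P (p + q)"
  shows "P (p :: 'a \<Rightarrow>\<^sub>0 'b::comm_monoid_add)"
proof -
  have "P (\<Sum>e\<in>A. mon e (coef p e))" if "finite A" for A
    using that by induction (auto intro: assms)
  then show ?thesis using pm_expand[of p] by (metis finite_keys)
qed

text \<open>The change of exponents induced by \<open>h\<close>, a ring homomorphism when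
  \<open>h\<close> is additive (\<open>push_mult\<close>). It embeds polynomials into Laurent
  polynomials and renames variables.\<close>

definition push :: "('a \<Rightarrow> 'b) \<Rightarrow> ('a \<Rightarrow>\<^sub>0 'k::comm_monoid_add) \<Rightarrow> ('b \<Rightarrow>\<^sub>0 'k)" where
  "push h p = (\<Sum>e\<in>supp p. mon (h e) (coef p e))"

lemma push_add: "push h (p + q) = push h p + push h q"
  unfolding push_def by (rule setsum_keys_plus_distrib) (auto simp: single_add)

lemma push_0 [simp]: "push h 0 = 0" by (simp add: push_def)

lemma push_single [simp]: "push h (mon e c) = mon (h e) c"
  by (cases "c = 0") (auto simp: push_def)

lemma push_mult:
  assumes "\<And>a b. h (a + b) = h a + h b"
  shows "push h (p * q) = push h p * push h (q :: 'a::comm_monoid_add \<Rightarrow>\<^sub>0 'k::comm_semiring_1)"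
proof (induction p rule: pm_induct)
  case (single e c)
  show ?case
    by (induction q rule: pm_induct) (auto simp: mult_single assms push_add distrib_left)
qed (auto simp: push_add distrib_right)

lemma push_uminus: "push h (- p) = - push h (p :: 'a \<Rightarrow>\<^sub>0 'k::ab_group_add)"
  by (metis push_add push_0 eq_neg_iff_add_eq_0 ab_left_minus)

lemma push_diff: "push h (p - q) = push h p - push h (q :: 'a \<Rightarrow>\<^sub>0 'k::ab_group_add)"
  using push_add[of h p "- q"] by (simp add: push_uminus)

lemma push_sum: "push h (\<Sum>i\<in>A. f i) = (\<Sum>i\<in>A. push h (f i))"
  by (induction A rule: infinite_finite_induct) (auto simp: push_add)

lemma keys_push: "supp (push h p) \<subseteq> h ` supp p"
  unfolding push_def using keys_sum[of "\<lambda>e. mon (h e) (coef p e)" "supp p"]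
  by (auto split: if_splits)

lemma lookup_push:
  assumes "inj_on h (insert e (supp p))"
  shows "coef (push h p) (h e) = coef p e"
proof -
  have "coef (push h p) (h e) = (\<Sum>x\<in>supp p. if x = e then coef p x else 0)"
    unfolding push_def lookup_sum
    by (intro sum.cong refl) (use assms in \<open>auto simp: lookup_single when_def inj_on_def\<close>)
  then show ?thesis by (auto simp: sum.delta in_keys_iff)
qed

lemma lookup_sum_single:
  "finite F \<Longrightarrow> coef (\<Sum>v\<in>F. mon v (g v)) u = (if u \<in> F then g u else 0)"
  by (auto simp: lookup_sum lookup_single when_def sum.delta)

lemma keys_plus_nat: "supp (a + b) = supp a \<union> supp (b :: 'v \<Rightarrow>\<^sub>0 nat)"
  by (auto simp: in_keys_iff lookup_add)

lemma keys_mult_ex: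
  "e \<in> supp (f * g) \<Longrightarrow> \<exists>a\<in>supp f. \<exists>b\<in>supp g. e = a + b"
  using keys_mult[of f g] by blast

section \<open>Ideals of the polynomial ring and the span of nonface monomials\<close>

definition pideal :: "'r::comm_ring_1 set \<Rightarrow> bool" where
  "pideal J \<longleftrightarrow> 0 \<in> J \<and> (\<forall>a\<in>J. \<forall>b\<in>J. a + b \<in> J) \<and> (\<forall>r. \<forall>a\<in>J. r * a \<in> J)"

lemma pideal_0: "pideal J \<Longrightarrow> 0 \<in> J" by (simp add: pideal_def)
lemma pideal_add: "pideal J \<Longrightarrow> a \<in> J \<Longrightarrow> b \<in> J \<Longrightarrow> a + b \<in> J" by (simp add: pideal_def)
lemma pideal_mult: "pideal J \<Longrightarrow> a \<in> J \<Longrightarrow> r * a \<in> J" by (simp add: pideal_def)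
lemma pideal_mult2: "pideal J \<Longrightarrow> a \<in> J \<Longrightarrow> a * r \<in> J" using pideal_mult[of J a r] by (simp add: mult.commute)
lemma pideal_minus: "pideal J \<Longrightarrow> a \<in> J \<Longrightarrow> - a \<in> J" using pideal_mult[of J a "-1"] by simp
lemma pideal_diff: "pideal J \<Longrightarrow> a \<in> J \<Longrightarrow> b \<in> J \<Longrightarrow> a - b \<in> J"
  using pideal_add[of J a "- b"] pideal_minus[of J b] by simp
lemma pideal_sum: "pideal J \<Longrightarrow> (\<And>i. i \<in> A \<Longrightarrow> f i \<in> J) \<Longrightarrow> (\<Sum>i\<in>A. f i) \<in> J"
  by (induction A rule: infinite_finite_induct) (auto intro: pideal_0 pideal_add)

text \<open>The ideal generated by \<open>J\<close> and \<open>a 0, \<dots>, a (n - 1)\<close>; in the sequel ideals of the localization are handled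
  through their saturated preimages in the polynomial ring.\<close>

definition spanmod :: "(nat \<Rightarrow> 'r::comm_ring_1) \<Rightarrow> nat \<Rightarrow> 'r set \<Rightarrow> 'r set" where
  "spanmod a r J = {p. \<exists>y. p - (\<Sum>i<r. y i * a i) \<in> J}"

lemma pideal_spanmod: "pideal J \<Longrightarrow> pideal (spanmod a r J)"
  unfolding pideal_def[of "spanmod a r J"]
proof (intro conjI ballI allI)
  assume J: "pideal J"
  show "0 \<in> spanmod a r J" unfolding spanmod_def using pideal_0[OF J] by (auto intro!: exI[of _ "\<lambda>_. 0"])
  fix p assume "p \<in> spanmod a r J"
  then obtain y where y: "p - (\<Sum>i<r. y i * a i) \<in> J" by (auto simp: spanmod_def)
  { fix q assume "q \<in> spanmod a r J"
    then obtain z where z: "q - (\<Sum>i<r. z i * a i) \<in> J" by (auto simp: spanmod_def)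
    have "(p + q) - (\<Sum>i<r. (y i + z i) * a i) = (p - (\<Sum>i<r. y i * a i)) + (q - (\<Sum>i<r. z i * a i))"
      by (simp add: distrib_right sum.distrib)
    then show "p + q \<in> spanmod a r J" unfolding spanmod_def by (simp only: mem_Collect_eq) (metis (no_types) pideal_add[OF J y z]) }
  fix t
  have "t * p - (\<Sum>i<r. (t * y i) * a i) = t * (p - (\<Sum>i<r. y i * a i))"
    by (simp add: right_diff_distrib sum_distrib_left mult.assoc)
  then show "t * p \<in> spanmod a r J" unfolding spanmod_def by (simp only: mem_Collect_eq) (metis (no_types) pideal_mult[OF J y, of t])
qed

lemma spanmod_base: "pideal J \<Longrightarrow> p \<in> J \<Longrightarrow> p \<in> spanmod a r J"
  unfolding spanmod_def by (auto intro!: exI[of _ "\<lambda>_. 0"])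

lemma spanmod_gen: "pideal J \<Longrightarrow> i < r \<Longrightarrow> a i \<in> spanmod a r J"
  unfolding spanmod_def by (auto intro!: exI[of _ "\<lambda>j. if j = i then 1 else 0"] simp: if_distrib[of "\<lambda>x. x * _"] sum.delta pideal_0 cong: if_cong)

lemma spanmod_minimal:
  assumes "pideal K" "J \<subseteq> K" "\<And>i. i < r \<Longrightarrow> a i \<in> K" shows "spanmod a r J \<subseteq> K"
proof
  fix p assume "p \<in> spanmod a r J"
  then obtain y where "p - (\<Sum>i<r. y i * a i) \<in> J" by (auto simp: spanmod_def)
  then have "(p - (\<Sum>i<r. y i * a i)) + (\<Sum>i<r. y i * a i) \<in> K"
    using assms by (intro pideal_add pideal_sum pideal_mult) auto
  then show "p \<in> K" by simp
qed

definition SR :: "'v set set \<Rightarrow> (('v \<Rightarrow>\<^sub>0 nat) \<Rightarrow>\<^sub>0 'k::field) set" where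
  "SR \<Delta> = {p. \<forall>e\<in>supp p. supp e \<notin> \<Delta>}"

lemma SR_iff: "p \<in> SR \<Delta> \<longleftrightarrow> (\<forall>e. supp e \<in> \<Delta> \<longrightarrow> coef p e = 0)"
  by (auto simp: SR_def in_keys_iff)

lemma pideal_SR:
  fixes \<Delta> :: "'v set set"
  assumes "\<And>\<sigma> \<tau>. \<sigma> \<in> \<Delta> \<Longrightarrow> \<tau> \<subseteq> \<sigma> \<Longrightarrow> \<tau> \<in> \<Delta>"
  shows "pideal (SR \<Delta> :: (('v \<Rightarrow>\<^sub>0 nat) \<Rightarrow>\<^sub>0 'k::field) set)"
  unfolding pideal_def
proof (intro conjI ballI allI)
  fix p q :: "('v \<Rightarrow>\<^sub>0 nat) \<Rightarrow>\<^sub>0 'k" assume "q \<in> SR \<Delta>"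
  then show "p * q \<in> SR \<Delta>"
    using assms by (auto simp: SR_def keys_plus_nat dest!: keys_mult_ex)
qed (auto simp: SR_iff lookup_add)

text \<open>Substitution of 0 for the variables outside \<open>V\<close>, a ring endomorphism
  (\<open>restr_mult\<close>). For the vertex set it leads back to \<open>poly_ring\<close>, for a
  face its kernel is a prime containing \<open>SR\<close>, and for the empty set it is the constant
  term.\<close>

definition restr :: "'v set \<Rightarrow> (('v \<Rightarrow>\<^sub>0 nat) \<Rightarrow>\<^sub>0 'k::comm_ring_1) \<Rightarrow> (('v \<Rightarrow>\<^sub>0 nat) \<Rightarrow>\<^sub>0 'k)" where
  "restr V p = (\<Sum>e\<in>{e\<in>supp p. supp e \<subseteq> V}. mon e (coef p e))"

lemma lookup_restr:
  "coef (restr V p) e = (if supp e \<subseteq> V then coef p e else 0)"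
  unfolding restr_def by (subst lookup_sum_single) (auto simp: in_keys_iff)

lemma restr_add: "restr V (p + q) = restr V p + restr V q"
  by (rule poly_mapping_eqI) (simp add: lookup_restr lookup_add)
lemma restr_diff: "restr V (p - q) = restr V p - restr V q"
  by (rule poly_mapping_eqI) (simp add: lookup_restr lookup_minus)
lemma restr_0 [simp]: "restr V 0 = 0"
  by (rule poly_mapping_eqI) (simp add: lookup_restr)
lemma restr_1 [simp]: "restr V 1 = 1"
  by (rule poly_mapping_eqI) (simp add: lookup_restr lookup_one when_def)
lemma restr_single: "restr V (mon e c) = (if supp e \<subseteq> V then mon e c else 0)"
  by (rule poly_mapping_eqI) (auto simp add: lookup_restr lookup_single when_def)
lemma restr_mult: "restr V (p * q) = restr V p * restr V q"
proof (induction p rule: pm_induct)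
  case (single e c)
  show ?case
    by (induction q rule: pm_induct) (auto simp: mult_single restr_single restr_add distrib_left keys_plus_nat)
qed (auto simp: restr_add distrib_right)
lemma restr_id: "(\<forall>e\<in>supp p. supp e \<subseteq> V) \<Longrightarrow> restr V p = p"
  by (rule poly_mapping_eqI) (auto simp add: lookup_restr in_keys_iff)
lemma restr_keys: "e \<in> supp (restr V p) \<Longrightarrow> supp e \<subseteq> V"
  by (auto simp: in_keys_iff lookup_restr split: if_splits)

lemma restr_empty: "restr {} p = mon 0 (coef p 0)"
  by (rule poly_mapping_eqI) (auto simp: lookup_restr lookup_single when_def)

text \<open>Setting all variables to 0 is a ring homomorphism. Consequently the elements with
  nonzero constant term, which become the denominators, are closed under products.\<close>

lemma const_mult [simp]:
  "coef (p * q) 0 = coef p 0 * coef (q :: ('v \<Rightarrow>\<^sub>0 nat) \<Rightarrow>\<^sub>0 'k::comm_ring_1) 0"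
proof -
  have "restr {} (p * q) = restr {} p * restr {} q" by (rule restr_mult)
  then have "coef (restr {} (p * q)) 0 = coef (restr {} p * restr {} q) 0" by simp
  then show ?thesis by (simp add: restr_empty mult_single)
qed

lemma prod_poly_var: "finite F \<Longrightarrow> (\<Prod>v\<in>F. poly_var v) = mon (\<Sum>v\<in>F. mon v 1) (1::'k::field)"
  by (induction F rule: finite_induct) (auto simp: poly_var_def mult_single)

lemma poly_var_power: "poly_var v ^ n = mon (mon v n) (1::'k::field)"
  by (induction n) (auto simp: poly_var_def mult_single single_add[symmetric])

lemma const_poly_var [simp]: "coef (poly_var v :: _ \<Rightarrow>\<^sub>0 'k::field) 0 = 0"
proof -
  have "mon v (1::nat) \<noteq> 0" by (metis lookup_single_eq lookup_zero one_neq_zero)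
  then show ?thesis by (simp add: poly_var_def lookup_single_not_eq)
qed

section \<open>The localized face ring\<close>

locale complex_face =
  fixes k :: "'k::field itself" and \<Delta> :: "'v set set"
  assumes sc: "simplicial_complex \<Delta>" and ne: "{} \<in> \<Delta>"
begin

abbreviation "PR \<equiv> poly_ring k (vertices \<Delta>)"
abbreviation "SRI \<equiv> stanley_reisner_ideal k \<Delta>"
abbreviation "FR \<equiv> face_ring k \<Delta>"
abbreviation "IR \<equiv> irrelevant_ideal k \<Delta>"
abbreviation "MS \<equiv> carrier FR - IR"
abbreviation "Loc \<equiv> localization FR MS"
abbreviation SRD :: "(('v \<Rightarrow>\<^sub>0 nat) \<Rightarrow>\<^sub>0 'k) set" where "SRD \<equiv> SR \<Delta>"

lemma down: "\<sigma> \<in> \<Delta> \<Longrightarrow> \<tau> \<subseteq> \<sigma> \<Longrightarrow> \<tau> \<in> \<Delta>"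
  using sc by (auto simp: simplicial_complex_def)

lemma finV: "finite (vertices \<Delta>)" using sc by (auto simp: simplicial_complex_def)

lemma pSR: "pideal SRD" by (rule pideal_SR) (rule down)

lemma PR_simps [simp]: "monoid.mult PR = (*)" "one PR = 1" "zero PR = 0" "add PR = (+)"
  by (simp_all add: poly_ring_def)

lemma PR_carrier: "p \<in> carrier PR \<longleftrightarrow> (\<forall>e\<in>supp p. supp e \<subseteq> vertices \<Delta>)"
  by (simp add: poly_ring_def)

lemma PR_mult: "p \<in> carrier PR \<Longrightarrow> q \<in> carrier PR \<Longrightarrow> p * q \<in> carrier PR"
  unfolding PR_carrier by (metis keys_mult_ex keys_plus_nat Un_least)

lemma PR_add: "p \<in> carrier PR \<Longrightarrow> q \<in> carrier PR \<Longrightarrow> p + q \<in> carrier PR"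
  unfolding PR_carrier using keys_add[of p q] by blast

lemma PR_uminus: "p \<in> carrier PR \<Longrightarrow> - p \<in> carrier PR"
  unfolding PR_carrier by (simp add: keys_def)

lemma cring_PR: "cring PR"
proof (rule cringI)
  show "abelian_group PR"
  proof (rule abelian_groupI)
    fix x assume "x \<in> carrier PR"
    then show "\<exists>y\<in>carrier PR. y \<oplus>\<^bsub>PR\<^esub> x = \<zero>\<^bsub>PR\<^esub>" by (intro bexI[of _ "- x"]) (auto intro: PR_uminus)
  qed (auto simp: PR_add algebra_simps, simp add: PR_carrier)
  show "Group.comm_monoid PR"
    by (rule comm_monoidI) (auto simp: PR_mult algebra_simps, simp add: PR_carrier)
qed (auto simp: algebra_simps)

lemma PR_a_inv: "p \<in> carrier PR \<Longrightarrow> \<ominus>\<^bsub>PR\<^esub> p = - p"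
proof -
  interpret cring PR by (rule cring_PR)
  assume p: "p \<in> carrier PR"
  show ?thesis by (rule minus_equality) (use p PR_uminus in auto)
qed

lemma PR_minus: "p \<in> carrier PR \<Longrightarrow> q \<in> carrier PR \<Longrightarrow> p \<ominus>\<^bsub>PR\<^esub> q = p - q"
  by (simp add: a_minus_def PR_a_inv)

abbreviation rs :: "(('v \<Rightarrow>\<^sub>0 nat) \<Rightarrow>\<^sub>0 'k) \<Rightarrow> (('v \<Rightarrow>\<^sub>0 nat) \<Rightarrow>\<^sub>0 'k)" where "rs \<equiv> restr (vertices \<Delta>)"

lemma rs_carrier: "rs p \<in> carrier PR"
  unfolding PR_carrier using restr_keys by blast

lemma rs_id: "p \<in> carrier PR \<Longrightarrow> rs p = p"
  unfolding PR_carrier by (rule restr_id)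

lemma rs_SR: "rs p \<in> SRD \<longleftrightarrow> p \<in> SRD"
  unfolding SR_iff by (auto simp: lookup_restr)

lemma ideal_PR_SR: "ideal (SRD \<inter> carrier PR) PR"
proof -
  interpret cring PR by (rule cring_PR)
  show ?thesis
  proof (rule idealI)
    show "ring PR" by (rule ring_axioms)
    have "\<And>x. x \<in> SRD \<inter> carrier PR \<Longrightarrow> \<ominus>\<^bsub>PR\<^esub> x \<in> SRD \<inter> carrier PR"
      by (auto simp: PR_a_inv pideal_minus[OF pSR] PR_uminus)
    then show "subgroup (SRD \<inter> carrier PR) (add_monoid PR)"
      by (intro subgroup.intro) (auto simp: PR_add pideal_add[OF pSR] pideal_0[OF pSR] a_inv_def PR_carrier[of 0])
  qed (auto simp: PR_mult pideal_mult[OF pSR] pideal_mult2[OF pSR])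
qed

text \<open>A monomial with nonface support is divisible by the squarefree monomial of that support,
  which is one of the generators.\<close>

lemma SRI_eq: "SRI = SRD \<inter> carrier PR"
proof
  interpret cring PR by (rule cring_PR)
  let ?G = "{(\<Prod>v\<in>\<sigma>. poly_var v) | \<sigma>. \<sigma> \<subseteq> vertices \<Delta> \<and> \<sigma> \<notin> \<Delta>} :: (('v \<Rightarrow>\<^sub>0 nat) \<Rightarrow>\<^sub>0 'k) set"
  have keyssum: "supp (\<Sum>v\<in>\<sigma>. mon v (1::nat)) = \<sigma>" if s: "finite \<sigma>" for \<sigma> :: "'v set"
    unfolding set_eq_iff in_keys_iff lookup_sum_single[OF s] by simp
  have G: "?G \<subseteq> SRD \<inter> carrier PR"
  proof
    fix p assume "p \<in> ?G"
    then obtain \<sigma> where s: "p = (\<Prod>v\<in>\<sigma>. poly_var v)" "\<sigma> \<subseteq> vertices \<Delta>" "\<sigma> \<notin> \<Delta>" by auto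
    then have "finite \<sigma>" using finV finite_subset by blast
    then show "p \<in> SRD \<inter> carrier PR" using s by (simp add: prod_poly_var SR_def keyssum PR_carrier del: One_nat_def)
  qed
  show "SRI \<subseteq> SRD \<inter> carrier PR"
    unfolding stanley_reisner_ideal_def by (rule genideal_minimal[OF ideal_PR_SR G])
  have idl: "ideal SRI PR" unfolding stanley_reisner_ideal_def
    by (rule genideal_ideal) (use G in auto)
  have gen: "?G \<subseteq> SRI" unfolding stanley_reisner_ideal_def by (rule genideal_self) (use G in auto)
  interpret I: ideal SRI PR by (rule idl)
  show "SRD \<inter> carrier PR \<subseteq> SRI"
  proof
    fix p assume p: "p \<in> SRD \<inter> carrier PR"
    have mon: "mon e (c::'k) \<in> SRI" if e: "supp e \<subseteq> vertices \<Delta>" "supp e \<notin> \<Delta>" for e c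
    proof -
      let ?s = "\<Sum>v\<in>supp e. mon v (1::nat)"
      have "e = ?s + (e - ?s)"
        by (rule poly_mapping_eqI) (auto simp: lookup_add lookup_minus lookup_sum_single in_keys_iff)
      then have "mon e c = (\<Prod>v\<in>supp e. poly_var v) * mon (e - ?s) c"
        by (simp add: prod_poly_var mult_single)
      moreover have "(\<Prod>v\<in>supp e. poly_var v) \<in> SRI" using gen e by blast
      moreover have "mon (e - ?s) c \<in> carrier PR"
        using e by (auto simp: PR_carrier in_keys_iff lookup_minus split: if_splits)
      ultimately show ?thesis using I.I_r_closed by simp
    qed
    have "(\<Sum>e\<in>A. mon e (coef p e)) \<in> SRI" if "finite A" "A \<subseteq> supp p" for A
      using that
    proof (induction A rule: finite_induct)
      case empty show ?case using I.zero_closed by simp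
    next
      case (insert e A)
      then have "mon e (coef p e) \<in> SRI"
        using p by (intro mon) (auto simp: SR_def PR_carrier)
      then show ?case using insert I.a_closed by simp
    qed
    then show "p \<in> SRI" using pm_expand[of p] by (metis finite_keys order_refl)
  qed
qed

lemma ideal_SRI: "ideal SRI PR" unfolding SRI_eq by (rule ideal_PR_SR)

text \<open>Classes are indexed by arbitrary polynomials: \<open>rs\<close> changes a polynomial
  only by nonface monomials, so equality of classes is membership of the difference in
  \<open>SRD\<close> (\<open>cls_eq\<close>), without any bookkeeping of carriers.\<close>

definition cls :: "(('v \<Rightarrow>\<^sub>0 nat) \<Rightarrow>\<^sub>0 'k) \<Rightarrow> (('v \<Rightarrow>\<^sub>0 nat) \<Rightarrow>\<^sub>0 'k) set" where
  "cls f = SRI +>\<^bsub>PR\<^esub> rs f"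

lemma cls_eq: "cls f = cls g \<longleftrightarrow> f - g \<in> SRD"
proof -
  interpret ideal SRI PR by (rule ideal_SRI)
  have "cls f = cls g \<longleftrightarrow> rs f \<ominus>\<^bsub>PR\<^esub> rs g \<in> SRI"
    unfolding cls_def using quotient_eq_iff_same_a_r_cos[OF ideal_SRI rs_carrier rs_carrier] by auto
  also have "\<dots> \<longleftrightarrow> rs (f - g) \<in> SRD"
    by (simp add: PR_minus rs_carrier SRI_eq restr_diff[symmetric])
  finally show ?thesis by (simp add: rs_SR)
qed

lemma carrier_FR: "carrier FR = range cls"
proof -
  have "carrier FR = (\<lambda>p. SRI +>\<^bsub>PR\<^esub> p) ` carrier PR"
    by (auto simp: face_ring_def FactRing_def A_RCOSETS_def' a_r_coset_def')
  also have "\<dots> = range cls"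
  proof (intro equalityI subsetI)
    fix x assume "x \<in> (\<lambda>p. SRI +>\<^bsub>PR\<^esub> p) ` carrier PR"
    then obtain p where "p \<in> carrier PR" "x = SRI +>\<^bsub>PR\<^esub> p" by blast
    then have "x = cls p" by (simp only: cls_def rs_id)
    then show "x \<in> range cls" by blast
  next
    fix x assume "x \<in> range cls"
    then show "x \<in> (\<lambda>p. SRI +>\<^bsub>PR\<^esub> p) ` carrier PR" unfolding cls_def using rs_carrier by blast
  qed
  finally show ?thesis .
qed

lemma cls_mult: "cls f \<otimes>\<^bsub>FR\<^esub> cls g = cls (f * g)"
proof -
  interpret ideal SRI PR by (rule ideal_SRI)
  show ?thesis
    using rcoset_mult_add[OF rs_carrier rs_carrier, of f g]
    by (simp add: face_ring_def FactRing_def cls_def restr_mult)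
qed

lemma cls_add: "cls f \<oplus>\<^bsub>FR\<^esub> cls g = cls (f + g)"
proof -
  interpret ideal SRI PR by (rule ideal_SRI)
  show ?thesis
    using a_rcos_sum[OF rs_carrier rs_carrier, of f g]
    by (simp add: face_ring_def FactRing_def cls_def restr_add)
qed

lemma cls_1: "\<one>\<^bsub>FR\<^esub> = cls 1"
  by (simp add: face_ring_def FactRing_def cls_def)

lemma cls_0: "\<zero>\<^bsub>FR\<^esub> = cls 0"
proof -
  interpret ideal SRI PR by (rule ideal_SRI)
  show ?thesis using a_coset_add_zero[OF a_subset] by (simp add: face_ring_def FactRing_def cls_def)
qed

lemma cring_FR: "cring FR"
  unfolding face_ring_def by (rule ideal.quotient_is_cring[OF ideal_SRI cring_PR])

lemma cls_minus: "cls f \<ominus>\<^bsub>FR\<^esub> cls g = cls (f - g)"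
proof -
  interpret cring FR by (rule cring_FR)
  have "\<ominus>\<^bsub>FR\<^esub> cls g = cls (- g)"
    by (rule minus_equality) (auto simp: carrier_FR cls_add cls_0)
  then show ?thesis by (simp add: a_minus_def cls_add)
qed

lemma SR_const: "f \<in> SRD \<Longrightarrow> coef f 0 = 0"
  using ne by (auto simp: SR_iff)

text \<open>Every monomial other than 1 is a multiple of a variable, and a variable off the vertex
  set is 0 in the face ring. The denominators are therefore the classes of polynomials with nonzero
  constant term; \<open>ne\<close> makes this independent of the representative.\<close>

lemma IR_eq: "IR = {cls f | f. coef f 0 = 0}"
proof
  interpret cring FR by (rule cring_FR)
  let ?I = "{cls f | f. coef f 0 = 0}"
  have idl: "ideal ?I FR"
  proof (rule idealI)
    show "ring FR" by (rule ring_axioms)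
    have inv: "\<ominus>\<^bsub>FR\<^esub> cls f = cls (- f)" for f
      by (rule minus_equality) (auto simp: carrier_FR cls_add cls_0)
    show "subgroup ?I (add_monoid FR)"
    proof (intro subgroup.intro)
      show "?I \<subseteq> carrier (add_monoid FR)" by (auto simp: carrier_FR)
      show "\<one>\<^bsub>add_monoid FR\<^esub> \<in> ?I" by (auto simp: cls_0 intro!: exI[of _ 0])
      show "x \<otimes>\<^bsub>add_monoid FR\<^esub> y \<in> ?I" if "x \<in> ?I" "y \<in> ?I" for x y
      proof -
        from that obtain f g where "x = cls f" "y = cls g" "coef f 0 = 0" "coef g 0 = 0" by auto
        then show ?thesis by (auto simp: cls_add lookup_add intro!: exI[of _ "f + g"])
      qed
      show "inv\<^bsub>add_monoid FR\<^esub> x \<in> ?I" if "x \<in> ?I" for x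
      proof -
        from that obtain f where "x = cls f" "coef f 0 = 0" by auto
        then show ?thesis using inv[of f] by (auto simp: a_inv_def intro!: exI[of _ "- f"])
      qed
    qed
    show "x \<otimes>\<^bsub>FR\<^esub> a \<in> ?I" "a \<otimes>\<^bsub>FR\<^esub> x \<in> ?I" if "a \<in> ?I" "x \<in> carrier FR" for a x
    proof -
      from that obtain f g where "a = cls f" "x = cls g" "coef f 0 = 0" by (auto simp: carrier_FR)
      then have "x \<otimes>\<^bsub>FR\<^esub> a = cls (g * f) \<and> coef (g * f) 0 = 0"
        "a \<otimes>\<^bsub>FR\<^esub> x = cls (f * g) \<and> coef (f * g) 0 = 0"
        by (auto simp: cls_mult)
      then show "x \<otimes>\<^bsub>FR\<^esub> a \<in> ?I" "a \<otimes>\<^bsub>FR\<^esub> x \<in> ?I" by blast+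
    qed
  qed
  let ?G = "(\<lambda>v. SRI +>\<^bsub>PR\<^esub> poly_var v) ` vertices \<Delta>"
  have pv: "poly_var v \<in> carrier PR" if "v \<in> vertices \<Delta>" for v
    using that by (auto simp: PR_carrier poly_var_def)
  have Gcls: "SRI +>\<^bsub>PR\<^esub> poly_var v = cls (poly_var v)" if "v \<in> vertices \<Delta>" for v
    using rs_id[OF pv[OF that]] by (simp add: cls_def)
  then have G: "?G \<subseteq> ?I" using const_poly_var by fastforce
  show "IR \<subseteq> ?I" unfolding irrelevant_ideal_def by (rule genideal_minimal[OF idl G])
  have Gc: "?G \<subseteq> carrier FR" using Gcls by (auto simp: carrier_FR)
  have id2: "ideal IR FR" unfolding irrelevant_ideal_def by (rule genideal_ideal[OF Gc])
  have gen: "?G \<subseteq> IR" unfolding irrelevant_ideal_def by (rule genideal_self[OF Gc])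
  interpret I: ideal IR FR by (rule id2)
  show "?I \<subseteq> IR"
  proof
    fix x assume "x \<in> ?I"
    then obtain f where f: "x = cls f" "coef f 0 = 0" by auto
    have mon: "cls (mon e c) \<in> IR" if "e \<noteq> 0" for e c
    proof -
      from that obtain v where v: "v \<in> supp e" by (metis all_not_in_conv keys_eq_empty)
      show ?thesis
      proof (cases "v \<in> vertices \<Delta>")
        case True
        have "e = mon v 1 + (e - mon v 1)"
          using v by (intro poly_mapping_eqI) (auto simp: lookup_add lookup_minus lookup_single when_def in_keys_iff)
        then have "mon e c = poly_var v * mon (e - mon v 1) c"
          by (simp add: poly_var_def mult_single)
        then have "cls (mon e c) = cls (poly_var v) \<otimes>\<^bsub>FR\<^esub> cls (mon (e - mon v 1) c)"
          by (simp add: cls_mult)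
        moreover have "cls (poly_var v) \<in> IR" using gen Gcls[OF True] True by force
        ultimately show ?thesis using I.I_r_closed by (simp add: carrier_FR)
      next
        case False
        then have "supp e \<notin> \<Delta>" using v by auto
        then have "cls (mon e c) = cls 0"
          unfolding cls_eq by (auto simp: SR_def)
        then show ?thesis using I.zero_closed by (simp add: cls_0)
      qed
    qed
    have "cls (\<Sum>e\<in>A. mon e (coef f e)) \<in> IR" if "finite A" "A \<subseteq> supp f" for A
      using that
    proof (induction A rule: finite_induct)
      case empty show ?case using I.zero_closed by (simp add: cls_0)
    next
      case (insert e A)
      have "cls (mon e (coef f e)) \<in> IR"
        using insert.prems f by (intro mon) (auto simp: in_keys_iff)
      then show ?case using insert I.a_closed by (simp add: cls_add[symmetric])
    qed
    then show "x \<in> IR" using pm_expand[of f] f by (metis finite_keys order_refl)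
  qed
qed

lemma cls_IR: "cls f \<in> IR \<longleftrightarrow> coef f 0 = 0"
proof -
  have "coef f 0 = 0" if "cls f = cls g" "coef g 0 = 0" for g
    using SR_const[of "f - g"] that by (simp add: cls_eq lookup_minus)
  then show ?thesis unfolding IR_eq by auto
qed

lemma MS_iff: "x \<in> MS \<longleftrightarrow> (\<exists>s. x = cls s \<and> coef s 0 \<noteq> 0)"
  by (auto simp: carrier_FR cls_IR)

lemma cls_MS: "cls s \<in> MS \<longleftrightarrow> coef s 0 \<noteq> 0"
  by (auto simp: carrier_FR cls_IR)

definition REL where
  "REL f s g t \<longleftrightarrow> (\<exists>u. coef u 0 \<noteq> 0 \<and> u * (f * t - g * s) \<in> SRD)"

lemma REL_refl: "REL f s f s"
  unfolding REL_def by (intro exI[of _ 1]) (auto simp: pideal_0[OF pSR])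

lemma REL_sym: "REL f s g t \<Longrightarrow> REL g t f s"
  unfolding REL_def
proof (elim exE conjE)
  fix u assume "u * (f * t - g * s) \<in> SRD" and u: "coef u 0 \<noteq> 0"
  then have "u * (g * s - f * t) \<in> SRD" using pideal_minus[OF pSR] by (fastforce simp: algebra_simps)
  then show "\<exists>u. coef u 0 \<noteq> 0 \<and> u * (g * s - f * t) \<in> SRD" using u by blast
qed

lemma REL_trans:
  assumes "REL f s g t" "REL g t h r" "coef t 0 \<noteq> 0"
  shows "REL f s h r"
proof -
  from assms obtain u w where u: "coef u 0 \<noteq> 0" "u * (f * t - g * s) \<in> SRD"
    and w: "coef w 0 \<noteq> 0" "w * (g * r - h * t) \<in> SRD" by (auto simp: REL_def)
  have "(w * r) * (u * (f * t - g * s)) + (u * s) * (w * (g * r - h * t)) \<in> SRD"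
    by (rule pideal_add[OF pSR pideal_mult[OF pSR u(2)] pideal_mult[OF pSR w(2)]])
  also have "(w * r) * (u * (f * t - g * s)) + (u * s) * (w * (g * r - h * t)) = (u * w * t) * (f * r - h * s)"
    by (simp add: algebra_simps)
  finally show ?thesis unfolding REL_def using u w assms(3) by (intro exI[of _ "u * w * t"]) auto
qed

lemma frac_rel_cls:
  "((cls f, cls s), (cls g, cls t)) \<in> frac_rel FR MS \<longleftrightarrow> coef s 0 \<noteq> 0 \<and> coef t 0 \<noteq> 0 \<and> REL f s g t"
proof -
  have "cls u \<otimes>\<^bsub>FR\<^esub> (cls f \<otimes>\<^bsub>FR\<^esub> cls t \<ominus>\<^bsub>FR\<^esub> cls g \<otimes>\<^bsub>FR\<^esub> cls s) = \<zero>\<^bsub>FR\<^esub> \<longleftrightarrow> u * (f * t - g * s) \<in> SRD" for u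
    by (simp add: cls_mult cls_minus cls_0 cls_eq)
  then show ?thesis
    unfolding frac_rel_def REL_def using cls_MS by (auto simp: carrier_FR MS_iff) 
qed

definition q where "q f s = fraction FR MS (cls f) (cls s)"

lemma q_mem: "coef s 0 \<noteq> 0 \<Longrightarrow> x \<in> q f s \<longleftrightarrow> (\<exists>g t. x = (cls g, cls t) \<and> coef t 0 \<noteq> 0 \<and> REL f s g t)"
proof -
  assume s: "coef s 0 \<noteq> 0"
  have "\<exists>g t. x = (cls g, cls t)" if "((cls f, cls s), x) \<in> frac_rel FR MS"
    using that unfolding frac_rel_def by (auto simp: carrier_FR)
  then have "x \<in> q f s \<longleftrightarrow> (\<exists>g t. x = (cls g, cls t) \<and> ((cls f, cls s), (cls g, cls t)) \<in> frac_rel FR MS)"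
    unfolding q_def fraction_def by auto
  then show ?thesis using s by (simp add: frac_rel_cls)
qed

lemma q_eq:
  assumes "coef s 0 \<noteq> 0" "coef t 0 \<noteq> 0"
  shows "q f s = q g t \<longleftrightarrow> REL f s g t"
proof
  assume "q f s = q g t"
  moreover have "(cls g, cls t) \<in> q g t" using assms q_mem REL_refl by blast
  ultimately have "((cls f, cls s), (cls g, cls t)) \<in> frac_rel FR MS" unfolding q_def fraction_def by auto
  then show "REL f s g t" by (simp add: frac_rel_cls)
next
  assume "REL f s g t"
  then show "q f s = q g t"
    unfolding set_eq_iff q_mem[OF assms(1)] q_mem[OF assms(2)] by (metis REL_trans REL_sym assms)
qed

lemma carrier_Loc: "carrier Loc = {q f s | f s. coef s 0 \<noteq> 0}"
proof -
  have "x \<in> carrier Loc \<longleftrightarrow> (\<exists>a\<in>carrier FR. \<exists>b\<in>MS. x = fraction FR MS a b)" for x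
    unfolding localization_def quotient_def fraction_def by auto
  also have "\<And>x. (\<exists>a\<in>carrier FR. \<exists>b\<in>MS. x = fraction FR MS a b) \<longleftrightarrow> (\<exists>f s. coef s 0 \<noteq> 0 \<and> x = q f s)"
    unfolding q_def using cls_MS by (auto simp: carrier_FR MS_iff) 
  finally show ?thesis by blast
qed

lemma LocE:
  assumes "x \<in> carrier Loc"
  obtains f s where "x = q f s" "coef s 0 \<noteq> 0"
  using assms by (auto simp: carrier_Loc)

lemma q_closed: "coef s 0 \<noteq> 0 \<Longrightarrow> q f s \<in> carrier Loc"
  by (auto simp: carrier_Loc)

lemma q_self: "coef s 0 \<noteq> 0 \<Longrightarrow> (cls f, cls s) \<in> q f s"
  using q_mem REL_refl by blast

text \<open>The product is defined as a union over representatives, so all members have to be shown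
  equal: the two witnesses of equivalence, multiplied crosswise and added, give a witness for the
  products.\<close>

lemma q_mult:
  assumes s: "coef s 0 \<noteq> 0" and t: "coef t 0 \<noteq> 0"
  shows "q f s \<otimes>\<^bsub>Loc\<^esub> q g t = q (f * g) (s * t)"
proof -
  have *: "(\<lambda>(a, s'). \<Union>(b, t')\<in>q g t. fraction FR MS (a \<otimes>\<^bsub>FR\<^esub> b) (s' \<otimes>\<^bsub>FR\<^esub> t')) x = q (f * g) (s * t)" if x: "x \<in> q f s" for x
  proof -
    from x s obtain f' s' where x': "x = (cls f', cls s')" "coef s' 0 \<noteq> 0" "REL f s f' s'" by (auto simp: q_mem)
    have "(\<lambda>(b, t'). fraction FR MS (cls f' \<otimes>\<^bsub>FR\<^esub> b) (cls s' \<otimes>\<^bsub>FR\<^esub> t')) y = q (f * g) (s * t)" if y: "y \<in> q g t" for y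
    proof -
      from y t obtain g' t' where y': "y = (cls g', cls t')" "coef t' 0 \<noteq> 0" "REL g t g' t'" by (auto simp: q_mem)
      from x' y' obtain u w where u: "coef u 0 \<noteq> 0" "u * (f * s' - f' * s) \<in> SRD"
        and w: "coef w 0 \<noteq> 0" "w * (g * t' - g' * t) \<in> SRD" by (auto simp: REL_def)
      have "(w * g * t') * (u * (f * s' - f' * s)) + (u * f' * s) * (w * (g * t' - g' * t)) \<in> SRD"
        by (rule pideal_add[OF pSR pideal_mult[OF pSR u(2)] pideal_mult[OF pSR w(2)]])
      also have "(w * g * t') * (u * (f * s' - f' * s)) + (u * f' * s) * (w * (g * t' - g' * t)) = (u * w) * (f * g * (s' * t') - f' * g' * (s * t))"
        by (simp add: algebra_simps)
      finally have "REL (f * g) (s * t) (f' * g') (s' * t')" unfolding REL_def using u w by (intro exI[of _ "u * w"]) auto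
      then have "q (f * g) (s * t) = q (f' * g') (s' * t')" using s t x' y' by (subst q_eq) auto
      then show ?thesis by (simp add: y' cls_mult q_def)
    qed
    then show ?thesis using q_self[OF t, of g] unfolding x' by auto
  qed
  then show ?thesis using q_self[OF s, of f] unfolding localization_def by auto
qed

lemma q_add:
  assumes s: "coef s 0 \<noteq> 0" and t: "coef t 0 \<noteq> 0"
  shows "q f s \<oplus>\<^bsub>Loc\<^esub> q g t = q (f * t + g * s) (s * t)"
proof -
  have *: "(\<lambda>(a, s'). \<Union>(b, t')\<in>q g t. fraction FR MS (a \<otimes>\<^bsub>FR\<^esub> t' \<oplus>\<^bsub>FR\<^esub> b \<otimes>\<^bsub>FR\<^esub> s') (s' \<otimes>\<^bsub>FR\<^esub> t')) x = q (f * t + g * s) (s * t)" if x: "x \<in> q f s" for x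
  proof -
    from x s obtain f' s' where x': "x = (cls f', cls s')" "coef s' 0 \<noteq> 0" "REL f s f' s'" by (auto simp: q_mem)
    have "(\<lambda>(b, t'). fraction FR MS (cls f' \<otimes>\<^bsub>FR\<^esub> t' \<oplus>\<^bsub>FR\<^esub> b \<otimes>\<^bsub>FR\<^esub> cls s') (cls s' \<otimes>\<^bsub>FR\<^esub> t')) y = q (f * t + g * s) (s * t)" if y: "y \<in> q g t" for y
    proof -
      from y t obtain g' t' where y': "y = (cls g', cls t')" "coef t' 0 \<noteq> 0" "REL g t g' t'" by (auto simp: q_mem)
      from x' y' obtain u w where u: "coef u 0 \<noteq> 0" "u * (f * s' - f' * s) \<in> SRD"
        and w: "coef w 0 \<noteq> 0" "w * (g * t' - g' * t) \<in> SRD" by (auto simp: REL_def)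
      have "(w * t * t') * (u * (f * s' - f' * s)) + (u * s * s') * (w * (g * t' - g' * t)) \<in> SRD"
        by (rule pideal_add[OF pSR pideal_mult[OF pSR u(2)] pideal_mult[OF pSR w(2)]])
      also have "(w * t * t') * (u * (f * s' - f' * s)) + (u * s * s') * (w * (g * t' - g' * t)) 
         = (u * w) * ((f * t + g * s) * (s' * t') - (f' * t' + g' * s') * (s * t))"
        by (simp add: algebra_simps)
      finally have "REL (f * t + g * s) (s * t) (f' * t' + g' * s') (s' * t')" unfolding REL_def using u w by (intro exI[of _ "u * w"]) auto
      then have "q (f * t + g * s) (s * t) = q (f' * t' + g' * s') (s' * t')" using s t x' y' by (subst q_eq) auto
      then show ?thesis by (simp add: y' cls_mult cls_add q_def)
    qed
    then show ?thesis using q_self[OF t, of g] unfolding x' by auto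
  qed
  then show ?thesis using q_self[OF s, of f] unfolding localization_def by auto
qed

lemma q_1: "\<one>\<^bsub>Loc\<^esub> = q 1 1" by (simp add: localization_def q_def cls_1)
lemma q_0: "\<zero>\<^bsub>Loc\<^esub> = q 0 1" by (simp add: localization_def q_def cls_1 cls_0)

lemma REL_eq: "f * t = g * s \<Longrightarrow> REL f s g t"
  unfolding REL_def by (intro exI[of _ 1]) (auto simp: pideal_0[OF pSR])

lemma qI: "coef s 0 \<noteq> 0 \<Longrightarrow> coef t 0 \<noteq> 0 \<Longrightarrow> f * t = g * s \<Longrightarrow> q f s = q g t"
  by (simp add: q_eq REL_eq)

lemma cring_Loc: "cring Loc"
proof (rule cringI)
  show "abelian_group Loc"
  proof (rule abelian_groupI)
    fix x assume "x \<in> carrier Loc"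
    then obtain f s where x: "x = q f s" "coef s 0 \<noteq> 0" by (auto simp: carrier_Loc)
    then show "\<exists>y\<in>carrier Loc. y \<oplus>\<^bsub>Loc\<^esub> x = \<zero>\<^bsub>Loc\<^esub>"
      by (intro bexI[of _ "q (- f) s"]) (auto simp: q_add q_0 q_closed q_eq intro!: REL_eq)
  qed (auto elim!: LocE simp: q_add q_0 q_eq algebra_simps intro!: q_closed REL_eq)
  show "Group.comm_monoid Loc"
    by (rule comm_monoidI) (auto elim!: LocE simp: q_mult q_1 q_eq algebra_simps intro!: q_closed REL_eq)
  fix x y z assume "x \<in> carrier Loc" "y \<in> carrier Loc" "z \<in> carrier Loc"
  then obtain f s g t h u where *: "x = q f s" "coef s 0 \<noteq> 0" "y = q g t" "coef t 0 \<noteq> 0"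
    "z = q h u" "coef u 0 \<noteq> 0" by (metis LocE)
  show "(x \<oplus>\<^bsub>Loc\<^esub> y) \<otimes>\<^bsub>Loc\<^esub> z = x \<otimes>\<^bsub>Loc\<^esub> z \<oplus>\<^bsub>Loc\<^esub> y \<otimes>\<^bsub>Loc\<^esub> z"
    using * by (simp add: q_add q_mult) (rule qI, simp_all add: algebra_simps)
qed

end

section \<open>Saturation and ideals of the localization\<close>

definition sat :: "(('v \<Rightarrow>\<^sub>0 nat) \<Rightarrow>\<^sub>0 'k::field) set \<Rightarrow> (('v \<Rightarrow>\<^sub>0 nat) \<Rightarrow>\<^sub>0 'k) set" where
  "sat J = {f. \<exists>s. coef s 0 \<noteq> 0 \<and> s * f \<in> J}"

lemma satI: "coef s 0 \<noteq> 0 \<Longrightarrow> s * f \<in> J \<Longrightarrow> f \<in> sat J" by (auto simp: sat_def)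

lemma sat_superset: "J \<subseteq> sat J" by (auto intro!: satI[of 1])

lemma sat_mono: "J \<subseteq> K \<Longrightarrow> sat J \<subseteq> sat K" by (auto simp: sat_def)

lemma pideal_sat: assumes J: "pideal J" shows "pideal (sat J)"
  unfolding pideal_def
proof (intro conjI ballI allI)
  show "0 \<in> sat J" using sat_superset pideal_0[OF J] by blast
  fix f assume "f \<in> sat J"
  then obtain s where s: "coef s 0 \<noteq> 0" "s * f \<in> J" by (auto simp: sat_def)
  { fix g assume "g \<in> sat J"
    then obtain t where t: "coef t 0 \<noteq> 0" "t * g \<in> J" by (auto simp: sat_def)
    have "t * (s * f) + s * (t * g) \<in> J" by (rule pideal_add[OF J pideal_mult[OF J s(2)] pideal_mult[OF J t(2)]])
    then show "f + g \<in> sat J" using s t by (intro satI[of "s * t"]) (auto simp: algebra_simps) }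
  fix r show "r * f \<in> sat J" using s pideal_mult[OF J s(2), of r] by (intro satI[of s]) (auto simp: algebra_simps)
qed

lemma sat_sat [simp]: "sat (sat J) = sat J"
proof
  show "sat (sat J) \<subseteq> sat J"
  proof
    fix f assume "f \<in> sat (sat J)"
    then obtain s t where "coef s 0 \<noteq> 0" "coef t 0 \<noteq> 0" "t * (s * f) \<in> J" by (auto simp: sat_def)
    then show "f \<in> sat J" by (intro satI[of "t * s"]) (auto simp: algebra_simps)
  qed
qed (rule sat_superset)

lemma max_gen:
  assumes K: "pideal K" and v: "\<And>w. poly_var w \<in> K" and g: "coef g 0 = 0"
  shows "g \<in> (K :: (('v \<Rightarrow>\<^sub>0 nat) \<Rightarrow>\<^sub>0 'k::field) set)"
proof -
  have "mon e (coef g e) \<in> K" if "e \<in> supp g" for e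
  proof -
    have "e \<noteq> 0" using that g by (auto simp: in_keys_iff)
    then obtain v where v': "v \<in> supp e" by (metis all_not_in_conv keys_eq_empty)
    have "e = (e - mon v 1) + mon v 1"
      using v' by (intro poly_mapping_eqI) (auto simp: lookup_add lookup_minus lookup_single when_def in_keys_iff)
    then have "mon e (coef g e) = mon (e - mon v 1) (coef g e) * poly_var v"
      by (simp add: poly_var_def mult_single)
    then show ?thesis using pideal_mult[OF K v] by simp
  qed
  then show ?thesis using pideal_sum[OF K] pm_expand[of g] by metis
qed

definition rad :: "'r::comm_ring_1 set \<Rightarrow> 'r set" where "rad J = {f. \<exists>n. f ^ n \<in> J}"

lemma rad_superset: "J \<subseteq> rad J" unfolding rad_def by (auto intro!: exI[of _ 1])

lemma pideal_rad: assumes J: "pideal J" shows "pideal (rad J)"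
  unfolding pideal_def
proof (intro conjI ballI allI)
  show "0 \<in> rad J" using rad_superset pideal_0[OF J] by blast
  fix f assume "f \<in> rad J"
  then obtain m where m: "f ^ m \<in> J" by (auto simp: rad_def)
  have fk: "f ^ k \<in> J" if "m \<le> k" for k
    using pideal_mult[OF J m, of "f ^ (k - m)"] that by (simp add: power_add[symmetric])
  { fix g assume "g \<in> rad J"
    then obtain n where n: "g ^ n \<in> J" by (auto simp: rad_def)
    have gk: "g ^ k \<in> J" if "n \<le> k" for k
      using pideal_mult[OF J n, of "g ^ (k - n)"] that by (simp add: power_add[symmetric])
    have "(f + g) ^ (m + n) \<in> J"
      unfolding binomial_ring
    proof (rule pideal_sum[OF J])
      fix k assume "k \<in> {..m + n}"
      then consider "m \<le> k" | "n \<le> m + n - k" by force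
      then show "of_nat ((m + n) choose k) * f ^ k * g ^ (m + n - k) \<in> J"
        by cases (auto intro: pideal_mult[OF J] pideal_mult2[OF J] fk gk simp: mult.assoc)
    qed
    then show "f + g \<in> rad J" by (auto simp: rad_def) }
  fix r show "r * f \<in> rad J" using pideal_mult[OF J m, of "r ^ m"] by (auto simp: rad_def power_mult_distrib intro!: exI[of _ m])
qed

lemma rad_of_vars:
  assumes J: "pideal J" and v: "\<And>w. \<exists>n. poly_var w ^ n \<in> J" and g: "coef g 0 = 0"
  shows "\<exists>n. g ^ n \<in> J"
  using max_gen[OF pideal_rad[OF J] _ g] v by (auto simp: rad_def)

context complex_face begin

text \<open>The extension of \<open>J\<close> to the local ring. Its contraction to polynomials is
  \<open>sat J\<close>, so membership of a fraction is decided by the numerator alone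
  (\<open>locI_mem\<close>).\<close>

definition locI where "locI J = {q f s | f s. coef s 0 \<noteq> 0 \<and> f \<in> sat J}"

lemma locI_mem:
  assumes J: "pideal J" "SRD \<subseteq> J" and s: "coef s 0 \<noteq> 0"
  shows "q f s \<in> locI J \<longleftrightarrow> f \<in> sat J"
proof
  assume "q f s \<in> locI J"
  then obtain g t where g: "q f s = q g t" "coef t 0 \<noteq> 0" "g \<in> sat J" by (auto simp: locI_def)
  then have "REL f s g t" using s by (simp add: q_eq)
  then obtain w where w: "coef w 0 \<noteq> 0" "w * (f * t - g * s) \<in> SRD" by (auto simp: REL_def)
  have "w * (f * t - g * s) + (w * s) * g \<in> sat J"
    using w(2) J(2) sat_superset[of J] by (intro pideal_add[OF pideal_sat[OF J(1)] _ pideal_mult[OF pideal_sat[OF J(1)] g(3)]]) auto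
  also have "w * (f * t - g * s) + (w * s) * g = (w * t) * f" by (simp add: algebra_simps)
  finally have *: "(w * t) * f \<in> sat J" .
  have "f \<in> sat (sat J)" by (rule satI[OF _ *]) (use w g in simp)
  then show "f \<in> sat J" by simp
qed (use s in \<open>auto simp: locI_def\<close>)

lemma q_uminus: "coef s 0 \<noteq> 0 \<Longrightarrow> \<ominus>\<^bsub>Loc\<^esub> q f s = q (- f) s"
proof -
  interpret cring Loc by (rule cring_Loc)
  assume s: "coef s 0 \<noteq> 0"
  show ?thesis
  proof (rule minus_equality)
    show "q (- f) s \<oplus>\<^bsub>Loc\<^esub> q f s = \<zero>\<^bsub>Loc\<^esub>" using s by (simp add: q_add q_0) (rule qI, simp_all)
  qed (use s in \<open>auto intro: q_closed\<close>)
qed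

lemma ideal_Loc_I:
  assumes sub: "I \<subseteq> carrier Loc" and 0: "q 0 1 \<in> I"
    and add: "\<And>f s g t. coef s 0 \<noteq> 0 \<Longrightarrow> coef t 0 \<noteq> 0 \<Longrightarrow> q f s \<in> I \<Longrightarrow> q g t \<in> I \<Longrightarrow> q (f * t + g * s) (s * t) \<in> I"
    and mult: "\<And>f s g t. coef s 0 \<noteq> 0 \<Longrightarrow> coef t 0 \<noteq> 0 \<Longrightarrow> q f s \<in> I \<Longrightarrow> q (g * f) (t * s) \<in> I"
  shows "ideal I Loc"
proof -
  interpret cring Loc by (rule cring_Loc)
  have rep: "\<exists>f s. x = q f s \<and> coef s 0 \<noteq> 0" if "x \<in> carrier Loc" for x
    using that by (auto elim!: LocE)
  have m: "x \<otimes>\<^bsub>Loc\<^esub> a \<in> I" if a: "a \<in> I" and x: "x \<in> carrier Loc" for a x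
  proof -
    have "a \<in> carrier Loc" using a sub by auto
    then obtain f s where a': "a = q f s" "coef s 0 \<noteq> 0" using rep by blast
    obtain g t where x': "x = q g t" "coef t 0 \<noteq> 0" using x rep by blast
    show ?thesis using mult[OF a'(2) x'(2), of f g] a a' x' by (simp add: q_mult)
  qed
  show ?thesis
  proof (rule idealI)
    show "ring Loc" by (rule ring_axioms)
    show "subgroup I (add_monoid Loc)"
    proof (intro subgroup.intro)
      show "I \<subseteq> carrier (add_monoid Loc)" using sub by simp
      show "\<one>\<^bsub>add_monoid Loc\<^esub> \<in> I" using 0 by (simp add: q_0)
      show "x \<otimes>\<^bsub>add_monoid Loc\<^esub> y \<in> I" if "x \<in> I" "y \<in> I" for x y
      proof -
        have "x \<in> carrier Loc" "y \<in> carrier Loc" using that sub by auto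
        then obtain f s g t where "x = q f s" "coef s 0 \<noteq> 0" "y = q g t" "coef t 0 \<noteq> 0"
          using rep by metis
        then show ?thesis using add that by (simp add: q_add)
      qed
      show "inv\<^bsub>add_monoid Loc\<^esub> x \<in> I" if x: "x \<in> I" for x
      proof -
        have "x \<in> carrier Loc" using that sub by auto
        then obtain f s where x': "x = q f s" "coef s 0 \<noteq> 0" using rep by metis
        then have "q (- 1 * f) (1 * s) \<in> I" using x by (intro mult) auto
        then have "\<ominus>\<^bsub>Loc\<^esub> x \<in> I" using x' by (simp add: q_uminus)
        then show ?thesis by (simp add: a_inv_def)
      qed
    qed
    show "x \<otimes>\<^bsub>Loc\<^esub> a \<in> I" if "a \<in> I" "x \<in> carrier Loc" for a x by (rule m[OF that])
    show "a \<otimes>\<^bsub>Loc\<^esub> x \<in> I" if "a \<in> I" "x \<in> carrier Loc" for a x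
      using m[OF that] m_comm[of x a] that sub by auto
  qed
qed

lemma ideal_locI:
  assumes J: "pideal J" "SRD \<subseteq> J"
  shows "ideal (locI J) Loc"
proof (rule ideal_Loc_I)
  note P = pideal_sat[OF J(1)]
  show "locI J \<subseteq> carrier Loc" by (auto simp: locI_def carrier_Loc)
  show "q 0 1 \<in> locI J" using pideal_0[OF P] by (simp add: locI_mem[OF J])
  fix f s g t :: "('v \<Rightarrow>\<^sub>0 nat) \<Rightarrow>\<^sub>0 'k" assume *: "coef s 0 \<noteq> 0" "coef t 0 \<noteq> 0" "q f s \<in> locI J"
  then have f: "f \<in> sat J" by (simp add: locI_mem[OF J])
  show "q (g * f) (t * s) \<in> locI J" using * pideal_mult[OF P f] by (simp add: locI_mem[OF J])
  assume "q g t \<in> locI J"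
  then have g: "g \<in> sat J" using * by (simp add: locI_mem[OF J])
  show "q (f * t + g * s) (s * t) \<in> locI J"
    using * pideal_add[OF P pideal_mult2[OF P f] pideal_mult2[OF P g]] by (simp add: locI_mem[OF J])
qed

lemma q_split: "coef w 0 \<noteq> 0 \<Longrightarrow> q (f + g) w = q f w \<oplus>\<^bsub>Loc\<^esub> q g w"
  by (simp add: q_add) (rule qI, simp_all add: algebra_simps)

text \<open>The denominators \<open>t i\<close> are units, so only the numerators matter. A
  representation of \<open>u * f\<close> by the \<open>a i\<close> modulo \<open>SRD\<close> becomes
  one of the fraction over the common denominator \<open>u * s\<close>.\<close>

lemma Idl_eq:
  assumes t: "\<And>i. i < r \<Longrightarrow> coef (t i) 0 \<noteq> 0"
  shows "Idl\<^bsub>Loc\<^esub> ((\<lambda>i. q (a i) (t i)) ` {..<r}) = locI (spanmod a r SRD)"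
proof
  interpret cring Loc by (rule cring_Loc)
  have sp: "pideal (spanmod a r SRD)" "SRD \<subseteq> spanmod a r SRD"
    using pideal_spanmod[OF pSR] spanmod_base[OF pSR] by auto
  let ?G = "(\<lambda>i. q (a i) (t i)) ` {..<r}"
  have Gc: "?G \<subseteq> carrier Loc" using t by (auto intro!: q_closed)
  show "Idl\<^bsub>Loc\<^esub> ?G \<subseteq> locI (spanmod a r SRD)"
  proof (rule genideal_minimal[OF ideal_locI[OF sp]])
    show "?G \<subseteq> locI (spanmod a r SRD)"
      using t spanmod_gen[OF pSR, of _ r a] sat_superset by (fastforce simp: locI_mem[OF sp])
  qed
  interpret I: ideal "Idl\<^bsub>Loc\<^esub> ?G" Loc by (rule genideal_ideal[OF Gc])
  show "locI (spanmod a r SRD) \<subseteq> Idl\<^bsub>Loc\<^esub> ?G"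
  proof
    fix x assume "x \<in> locI (spanmod a r SRD)"
    then obtain f s where x: "x = q f s" "coef s 0 \<noteq> 0" "f \<in> sat (spanmod a r SRD)" by (auto simp: locI_def)
    then obtain u y where u: "coef u 0 \<noteq> 0" "u * f - (\<Sum>i<r. y i * a i) \<in> SRD" by (auto simp: sat_def spanmod_def)
    let ?w = "u * s"
    have w: "coef ?w 0 \<noteq> 0" using u x by simp
    have "x = q (u * f) ?w" unfolding x(1) using x u by (intro qI) (auto simp: algebra_simps)
    also have "\<dots> = q (\<Sum>i<r. y i * a i) ?w"
    proof -
      have "?w * (u * f - (\<Sum>i<r. y i * a i)) \<in> SRD" by (rule pideal_mult[OF pSR u(2)])
      then have "REL (u * f) ?w (\<Sum>i<r. y i * a i) ?w" unfolding REL_def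
        by (intro exI[of _ 1]) (auto simp: algebra_simps)
      then show ?thesis using w by (subst q_eq) auto
    qed
    finally have x2: "x = q (\<Sum>i<r. y i * a i) ?w" .
    have "q (\<Sum>i<m. y i * a i) ?w \<in> Idl\<^bsub>Loc\<^esub> ?G" if "m \<le> r" for m
      using that
    proof (induction m)
      case 0
      have "q 0 ?w = \<zero>\<^bsub>Loc\<^esub>" unfolding q_0 using w by (intro qI) auto
      then show ?case using I.zero_closed by simp
    next
      case (Suc m)
      have "q (y m * a m) ?w = q (y m * t m) ?w \<otimes>\<^bsub>Loc\<^esub> q (a m) (t m)"
        using w t[of m] Suc.prems by (simp add: q_mult) (rule qI, simp_all add: algebra_simps)
      moreover have "q (a m) (t m) \<in> Idl\<^bsub>Loc\<^esub> ?G" using genideal_self[OF Gc] Suc.prems by auto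
      ultimately have "q (y m * a m) ?w \<in> Idl\<^bsub>Loc\<^esub> ?G" using I.I_l_closed[of "q (a m) (t m)" "q (y m * t m) ?w"] q_closed[OF w] by simp
      then show ?case using Suc I.a_closed w by (simp add: q_split)
    qed
    then show "x \<in> Idl\<^bsub>Loc\<^esub> ?G" using x2 by simp
  qed
qed

abbreviation MM :: "(('v \<Rightarrow>\<^sub>0 nat) \<Rightarrow>\<^sub>0 'k) set" where "MM \<equiv> {f. coef f 0 = 0}"

lemma pMM: "pideal MM" by (auto simp: pideal_def lookup_add)
lemma SR_MM: "SRD \<subseteq> MM" using SR_const by auto
lemma sat_MM: "sat MM = MM" by (auto simp: sat_def intro!: exI[of _ 1])
lemma locMM: "coef s 0 \<noteq> 0 \<Longrightarrow> q f s \<in> locI MM \<longleftrightarrow> coef f 0 = 0"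
  by (simp add: locI_mem[OF pMM SR_MM] sat_MM)

lemma one_in_ideal:
  assumes "ideal J Loc" "q f s \<in> J" "coef f 0 \<noteq> 0" "coef s 0 \<noteq> 0"
  shows "J = carrier Loc"
proof -
  interpret ideal J Loc by fact
  have "q s f \<otimes>\<^bsub>Loc\<^esub> q f s \<in> J" using assms by (intro I_l_closed q_closed) auto
  also have "q s f \<otimes>\<^bsub>Loc\<^esub> q f s = \<one>\<^bsub>Loc\<^esub>" using assms by (simp add: q_mult q_1) (rule qI, simp_all)
  finally show ?thesis by (rule one_imp_carrier)
qed

lemma maximal_MM: "maximalideal (locI MM) Loc"
proof (intro maximalideal.intro maximalideal_axioms.intro)
  show id: "ideal (locI MM) Loc" by (rule ideal_locI[OF pMM SR_MM])
  have "q 1 1 \<notin> locI MM" by (simp add: locMM)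
  then show "carrier Loc \<noteq> locI MM" using q_closed[of 1 1] by auto
  fix J assume J: "ideal J Loc" "locI MM \<subseteq> J" "J \<subseteq> carrier Loc"
  show "J = locI MM \<or> J = carrier Loc"
  proof (cases "J \<subseteq> locI MM")
    case False
    then obtain x where x: "x \<in> J" "x \<notin> locI MM" by blast
    then obtain f s where "x = q f s" "coef s 0 \<noteq> 0" using J(3) by (auto elim!: LocE)
    then show ?thesis using one_in_ideal[OF J(1), of f s] x by (auto simp: locMM)
  qed (use J in auto)
qed

text \<open>A fraction whose numerator has nonzero constant term is a unit, so every proper ideal
  lies in \<open>locI MM\<close>. Of the conditions on a noetherian local ring only noetherianity
  carries information here.\<close>

lemma local_iff: "noetherian_local_ring Loc M \<longleftrightarrow> noetherian_ring Loc \<and> M = locI MM"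
proof -
  have "N = locI MM" if N: "maximalideal N Loc" for N
  proof -
    interpret N: maximalideal N Loc by fact
    have id: "ideal N Loc" by (rule N.is_ideal)
    have "N \<subseteq> locI MM"
    proof
      fix x assume x: "x \<in> N"
      then obtain f s where fs: "x = q f s" "coef s 0 \<noteq> 0" using N.a_subset by (auto elim!: LocE)
      then show "x \<in> locI MM" using one_in_ideal[OF id, of f s] x N.I_notcarr by (auto simp: locMM)
    qed
    moreover have "locI MM \<subseteq> carrier Loc" by (auto simp: locI_def carrier_Loc)
    ultimately have "locI MM = N \<or> locI MM = carrier Loc"
      using N.I_maximal[OF ideal_locI[OF pMM SR_MM]] by blast
    then show ?thesis using maximalideal.I_notcarr[OF maximal_MM] by auto
  qed
  then show ?thesis unfolding noetherian_local_ring_def using cring_Loc maximal_MM by blast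
qed

text \<open>The condition on the length is added separately in \<open>buchsbaum_iff\<close>. Testing
  the variables suffices: the radical of an ideal is an ideal, and the variables generate everything
  without constant term.\<close>

definition polysop where
  "polysop r a \<longleftrightarrow> (\<forall>i<r. coef (a i) 0 = 0) \<and> (\<forall>w. \<exists>n. poly_var w ^ n \<in> sat (spanmod a r SRD))"
text \<open>One inclusion between the two colon ideals, tested on the variables as generators of the
  maximal ideal. The other inclusion holds because each \<open>a i\<close> lies in the maximal
  ideal.\<close>

definition polyweak where
  "polyweak r a \<longleftrightarrow> (\<forall>i<r. \<forall>f. f * a i \<in> sat (spanmod a i SRD) \<longrightarrow> (\<forall>w. f * poly_var w \<in> sat (spanmod a i SRD)))"

lemma q_pow: "coef s 0 \<noteq> 0 \<Longrightarrow> q f s [^]\<^bsub>Loc\<^esub> (n::nat) = q (f ^ n) (s ^ n) \<and> coef (s ^ n) 0 \<noteq> 0"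
  by (induction n) (auto simp: q_1 q_mult algebra_simps)

lemma sop_weak_iff:
  fixes a t :: "nat \<Rightarrow> (('v \<Rightarrow>\<^sub>0 nat) \<Rightarrow>\<^sub>0 'k)"
  assumes t: "\<And>i. i < r \<Longrightarrow> coef (t i) 0 \<noteq> 0"
  defines "xs \<equiv> map (\<lambda>i. q (a i) (t i)) [0..<r]"
  shows "system_of_parameters Loc (locI MM) xs \<longleftrightarrow> enat r = krull_dim Loc \<and> polysop r a"
    and "(\<forall>i<r. coef (a i) 0 = 0) \<Longrightarrow> weak_sequence Loc (locI MM) xs \<longleftrightarrow> polyweak r a"
proof -
  have sp: "pideal (spanmod a i SRD)" "SRD \<subseteq> spanmod a i SRD" for i
    using pideal_spanmod[OF pSR] spanmod_base[OF pSR] by auto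
  note psat = pideal_sat[OF sp(1)]
  have setxs: "set (take i xs) = (\<lambda>i. q (a i) (t i)) ` {..<i}" if "i \<le> r" for i
    using that by (auto simp: xs_def take_map)
  have Idl: "Idl\<^bsub>Loc\<^esub> (set (take i xs)) = locI (spanmod a i SRD)" if "i \<le> r" for i
    unfolding setxs[OF that] using t that by (intro Idl_eq) auto
  have Idl0: "Idl\<^bsub>Loc\<^esub> (set xs) = locI (spanmod a r SRD)" using Idl[of r] by (simp add: xs_def)
  have sub: "set xs \<subseteq> locI MM \<longleftrightarrow> (\<forall>i<r. coef (a i) 0 = 0)"
    using t by (auto simp add: xs_def image_subset_iff locMM)
  have "(\<forall>x\<in>locI MM. \<exists>n::nat. x [^]\<^bsub>Loc\<^esub> n \<in> locI (spanmod a r SRD)) \<longleftrightarrow> (\<forall>w. \<exists>n. poly_var w ^ n \<in> sat (spanmod a r SRD))"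
  proof
    assume L: "\<forall>x\<in>locI MM. \<exists>n::nat. x [^]\<^bsub>Loc\<^esub> n \<in> locI (spanmod a r SRD)"
    show "\<forall>w. \<exists>n. poly_var w ^ n \<in> sat (spanmod a r SRD)"
    proof
      fix w
      have "q (poly_var w) 1 \<in> locI MM" by (simp add: locMM)
      then obtain n :: nat where "q (poly_var w) 1 [^]\<^bsub>Loc\<^esub> n \<in> locI (spanmod a r SRD)" using L by blast
      then show "\<exists>n. poly_var w ^ n \<in> sat (spanmod a r SRD)"
        using q_pow[of 1 "poly_var w" n] by (auto simp: locI_mem[OF sp])
    qed
  next
    assume R: "\<forall>w. \<exists>n. poly_var w ^ n \<in> sat (spanmod a r SRD)"
    show "\<forall>x\<in>locI MM. \<exists>n::nat. x [^]\<^bsub>Loc\<^esub> n \<in> locI (spanmod a r SRD)"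
    proof
      fix x assume "x \<in> locI MM"
      then obtain f s where x: "x = q f s" "coef s 0 \<noteq> 0" "coef f 0 = 0" 
        by (auto simp: locI_def sat_MM)
      from rad_of_vars[OF psat _ x(3), of r] R obtain n where "f ^ n \<in> sat (spanmod a r SRD)" by blast
      then show "\<exists>n::nat. x [^]\<^bsub>Loc\<^esub> n \<in> locI (spanmod a r SRD)"
        using q_pow[OF x(2), of f n] x(1) by (intro exI[of _ n]) (simp add: locI_mem[OF sp])
    qed
  qed
  then show "system_of_parameters Loc (locI MM) xs \<longleftrightarrow> enat r = krull_dim Loc \<and> polysop r a"
    unfolding system_of_parameters_def polysop_def sub Idl0 by (auto simp: xs_def)
  assume a0: "\<forall>i<r. coef (a i) 0 = 0"
  have "(colon Loc (Idl\<^bsub>Loc\<^esub> (set (take i xs))) {xs ! i} = colon Loc (Idl\<^bsub>Loc\<^esub> (set (take i xs))) (locI MM))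
     \<longleftrightarrow> (\<forall>f. f * a i \<in> sat (spanmod a i SRD) \<longrightarrow> (\<forall>w. f * poly_var w \<in> sat (spanmod a i SRD)))" if i: "i < r" for i
  proof -
    have xi: "xs ! i = q (a i) (t i)" using i by (simp add: xs_def)
    have c1: "q f s \<in> colon Loc (locI (spanmod a i SRD)) {xs ! i} \<longleftrightarrow> f * a i \<in> sat (spanmod a i SRD)"
      if s: "coef s 0 \<noteq> 0" for f s
      using s t[OF i] by (simp add: colon_def xi q_mult q_closed locI_mem[OF sp])
    have c2: "q f s \<in> colon Loc (locI (spanmod a i SRD)) (locI MM) \<longleftrightarrow> (\<forall>w. f * poly_var w \<in> sat (spanmod a i SRD))"
      if s: "coef s 0 \<noteq> 0" for f s
    proof -
      have "q f s \<in> colon Loc (locI (spanmod a i SRD)) (locI MM) \<longleftrightarrow> (\<forall>g\<in>MM. f * g \<in> sat (spanmod a i SRD))"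
      proof -
        have "(\<forall>b\<in>locI MM. q f s \<otimes>\<^bsub>Loc\<^esub> b \<in> locI (spanmod a i SRD)) \<longleftrightarrow> (\<forall>g t. coef t 0 \<noteq> 0 \<and> g \<in> MM \<longrightarrow> q f s \<otimes>\<^bsub>Loc\<^esub> q g t \<in> locI (spanmod a i SRD))"
          by (auto simp: locI_def[of MM] sat_MM)
        also have "\<dots> \<longleftrightarrow> (\<forall>g t. coef (t :: ('v \<Rightarrow>\<^sub>0 nat) \<Rightarrow>\<^sub>0 'k) 0 \<noteq> 0 \<and> g \<in> MM \<longrightarrow> f * g \<in> sat (spanmod a i SRD))"
          using s by (simp add: q_mult locI_mem[OF sp])
        also have "\<dots> \<longleftrightarrow> (\<forall>g\<in>MM. f * g \<in> sat (spanmod a i SRD))"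
        proof -
          have "\<exists>t :: ('v \<Rightarrow>\<^sub>0 nat) \<Rightarrow>\<^sub>0 'k. coef t 0 \<noteq> 0" by (rule exI[of _ 1]) simp
          then show ?thesis by blast
        qed
        finally show ?thesis using s by (simp add: colon_def q_closed)
      qed
      also have "\<dots> \<longleftrightarrow> (\<forall>w. f * poly_var w \<in> sat (spanmod a i SRD))"
      proof
        assume R: "\<forall>w. f * poly_var w \<in> sat (spanmod a i SRD)"
        have "pideal {g. f * g \<in> sat (spanmod a i SRD)}"
          unfolding pideal_def using pideal_0[OF psat] pideal_add[OF psat] pideal_mult[OF psat]
          by (auto simp: distrib_left mult.left_commute[of f])
        then show "\<forall>g\<in>MM. f * g \<in> sat (spanmod a i SRD)" using max_gen[of "{g. f * g \<in> sat (spanmod a i SRD)}"] R by auto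
      qed auto
      finally show ?thesis .
    qed
    have ext: "colon Loc A B = colon Loc A C \<longleftrightarrow> (\<forall>f s. coef s 0 \<noteq> 0 \<longrightarrow> (q f s \<in> colon Loc A B \<longleftrightarrow> q f s \<in> colon Loc A C))" for A B C
    proof
      assume R: "\<forall>f s. coef s 0 \<noteq> 0 \<longrightarrow> (q f s \<in> colon Loc A B \<longleftrightarrow> q f s \<in> colon Loc A C)"
      have "x \<in> carrier Loc" if "x \<in> colon Loc A B \<or> x \<in> colon Loc A C" for x using that by (auto simp: colon_def)
      then have "x \<in> colon Loc A B \<longleftrightarrow> x \<in> colon Loc A C" for x using R LocE[of x] by metis
      then show "colon Loc A B = colon Loc A C" by blast
    qed simp
    \<comment> \<open>The reverse inclusion of colon ideals: whatever multiplies the maximal ideal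
      into the given ideal also multiplies \<open>a i\<close> into it.\<close>
    have bk: "f * a i \<in> sat (spanmod a i SRD)" if "\<forall>w. f * poly_var w \<in> sat (spanmod a i SRD)" for f
    proof -
      have "q f 1 \<in> colon Loc (locI (spanmod a i SRD)) (locI MM)" using that c2[of 1 f] by simp
      moreover have "xs ! i \<in> locI MM" using a0 i t by (simp add: xi locMM)
      ultimately have "q f 1 \<in> colon Loc (locI (spanmod a i SRD)) {xs ! i}" by (auto simp: colon_def)
      then show ?thesis using c1[of 1 f] by simp
    qed
    have ex1: "\<exists>s. coef (s :: ('v \<Rightarrow>\<^sub>0 nat) \<Rightarrow>\<^sub>0 'k) 0 \<noteq> 0" by (rule exI[of _ 1]) simp
    show ?thesis
      unfolding Idl[OF less_imp_le[OF i]] ext using bk ex1 by (auto simp: c1 c2)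
  qed
  then show "weak_sequence Loc (locI MM) xs \<longleftrightarrow> polyweak r a"
    unfolding weak_sequence_def polyweak_def by (simp add: xs_def)
qed

theorem buchsbaum_iff:
  "buchsbaum_complex k \<Delta> \<longleftrightarrow> noetherian_ring Loc \<and> (\<forall>r a. enat r = krull_dim Loc \<and> polysop r a \<longrightarrow> polyweak r a)"
proof -
  have 1: "buchsbaum_complex k \<Delta> \<longleftrightarrow> noetherian_ring Loc \<and> (\<forall>xs. system_of_parameters Loc (locI MM) xs \<longrightarrow> weak_sequence Loc (locI MM) xs)"
    unfolding buchsbaum_complex_def buchsbaum_local_ring_def local_iff by auto
  have 2: "\<exists>r a t. xs = map (\<lambda>i. q (a i) (t i)) [0..<r] \<and> (\<forall>i<r. coef (t i) 0 \<noteq> 0)"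
    if "system_of_parameters Loc (locI MM) xs" for xs
  proof -
    have "\<forall>i<length xs. \<exists>f s. xs ! i = q f s \<and> coef s 0 \<noteq> 0"
      using that unfolding system_of_parameters_def locI_def by (auto simp: subset_iff) (metis nth_mem)
    then obtain a t where "\<forall>i<length xs. xs ! i = q (a i) (t i) \<and> coef (t i) 0 \<noteq> 0" by metis
    then show ?thesis by (intro exI[of _ "length xs"] exI[of _ a] exI[of _ t]) (auto intro: nth_equalityI)
  qed
  show ?thesis unfolding 1
  proof (intro conj_cong refl iffI allI impI)
    fix r a assume L: "\<forall>xs. system_of_parameters Loc (locI MM) xs \<longrightarrow> weak_sequence Loc (locI MM) xs"
      and R: "enat r = krull_dim Loc \<and> polysop r a"
    then have "\<forall>i<r. coef (a i) 0 = 0" by (auto simp: polysop_def)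
    then show "polyweak r a" using L R sop_weak_iff[of r "\<lambda>_. 1" a] by auto
  next
    fix xs assume R: "\<forall>r a. enat r = krull_dim Loc \<and> polysop r a \<longrightarrow> polyweak r a"
      and s: "system_of_parameters Loc (locI MM) xs"
    from 2[OF s] obtain r a t where xs: "xs = map (\<lambda>i. q (a i) (t i)) [0..<r]" and t: "\<forall>i<r. coef (t i) 0 \<noteq> 0" by blast
    then have p: "enat r = krull_dim Loc" "polysop r a" using s sop_weak_iff(1)[of r t a] by auto
    then have "\<forall>i<r. coef (a i) 0 = 0" by (auto simp: polysop_def)
    then show "weak_sequence Loc (locI MM) xs" using R p t sop_weak_iff(2)[of r t a] xs by auto
  qed
qed

section \<open>Noetherian arguments: Krull's intersection theorem and passage to
  subcomplexes\<close>

lemma chain_Union_mem: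
  assumes N: "noetherian_ring Loc" and C: "C \<noteq> {}" "subset.chain {N. pideal N \<and> SRD \<subseteq> N \<and> sat N = N} C"
  shows "\<Union>C \<in> C"
proof -
  interpret noetherian_ring Loc by fact
  let ?A = "{N. pideal N \<and> SRD \<subseteq> N \<and> sat N = N}"
  have CA: "C \<subseteq> ?A" and ch: "\<And>x y. x \<in> C \<Longrightarrow> y \<in> C \<Longrightarrow> x \<subseteq> y \<or> y \<subseteq> x"
    using C by (auto simp: subset_chain_def)
  have mono: "locI x \<subseteq> locI y" if "x \<subseteq> y" for x y using sat_mono[OF that] by (auto simp: locI_def)
  have "subset.chain {I. ideal I Loc} (locI ` C)"
    unfolding subset_chain_def
  proof (intro conjI ballI subsetI)
    fix x assume "x \<in> locI ` C"
    then show "x \<in> {I. ideal I Loc}" using CA ideal_locI by auto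
    fix y assume "y \<in> locI ` C"
    then show "x \<subseteq> y \<or> y \<subseteq> x" using \<open>x \<in> locI ` C\<close> ch mono by (metis imageE)
  qed
  then have "\<Union>(locI ` C) \<in> locI ` C" using C(1) by (intro ideal_chain_is_trivial) auto
  then obtain x where x: "x \<in> C" "\<Union>(locI ` C) = locI x" by auto
  have "y \<subseteq> x" if y: "y \<in> C" for y
  proof
    fix f assume "f \<in> y"
    then have "f \<in> sat y" using sat_superset by blast
    then have "q f 1 \<in> locI y" using y CA by (subst locI_mem) auto
    then have "q f 1 \<in> locI x" using x y by blast
    then have "f \<in> sat x" using x(1) CA by (subst (asm) locI_mem) auto
    then show "f \<in> x" using x(1) CA by auto
  qed
  then have "\<Union>C = x" using x(1) by blast
  then show ?thesis using x by simp
qed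

text \<open>If \<open>y\<close> were outside \<open>sat Q\<close>, one could take a saturated ideal
  \<open>M\<close> over \<open>Q\<close> that is maximal among those with \<open>y\<close> outside
  and \<open>MM\<close> times \<open>y\<close> inside. Modulo such an \<open>M\<close> each
  \<open>b j\<close> is nilpotent, so \<open>M\<close> contains a common power of all of them, and
  the hypothesis for this exponent puts \<open>y\<close> into \<open>M\<close>.\<close>

lemma krull_intersection:
  assumes N: "noetherian_ring Loc" and Q: "pideal Q" "SRD \<subseteq> Q"
    and b: "\<And>j. j < m \<Longrightarrow> coef (b j) 0 = 0"
    and y: "\<And>n. y \<in> sat (spanmod (\<lambda>j. b j ^ n) m Q)"
  shows "y \<in> sat Q"
proof (rule ccontr)
  assume yQ: "y \<notin> sat Q"
  define B where "B = {N. pideal N \<and> SRD \<subseteq> N \<and> sat N = N}"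
  define A where "A = {N \<in> B. Q \<subseteq> N \<and> y \<notin> N \<and> (\<forall>m\<in>MM. m * y \<in> N)}"
  have "\<exists>N. N \<in> A"
  proof -
    \<comment> \<open>This is \<open>Q\<close> plus \<open>MM\<close> times \<open>y\<close>. It
      does not contain \<open>y\<close>, even after saturation: from
      \<open>(s - m) * y \<in> Q\<close>, where \<open>s - m\<close> has nonzero constant term,
      \<open>y \<in> sat Q\<close> would follow. This is Nakayama's argument.\<close>
    define K where "K = {p. \<exists>m\<in>MM. p - m * y \<in> Q}"
    have pK: "pideal K"
      unfolding pideal_def
    proof (intro conjI ballI allI)
      show "0 \<in> K" using pideal_0[OF Q(1)] by (auto simp: K_def intro!: exI[of _ 0])
      fix p assume "p \<in> K" then obtain m where m: "m \<in> MM" "p - m * y \<in> Q" by (auto simp: K_def)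
      { fix p' assume "p' \<in> K" then obtain m' where m': "m' \<in> MM" "p' - m' * y \<in> Q" by (auto simp: K_def)
        have "(p + p') - (m + m') * y \<in> Q" using pideal_add[OF Q(1) m(2) m'(2)] by (simp add: algebra_simps)
        then show "p + p' \<in> K" using m m' pideal_add[OF pMM] by (auto simp: K_def intro!: bexI[of _ "m + m'"]) }
      fix r
      have "r * p - (r * m) * y \<in> Q" using pideal_mult[OF Q(1) m(2), of r] by (simp add: algebra_simps)
      moreover have "r * m \<in> MM" using m by simp
      ultimately show "r * p \<in> K" unfolding K_def by blast
    qed
    have QK: "Q \<subseteq> K" by (auto simp: K_def intro!: exI[of _ 0])
    have "y \<notin> sat K"
    proof
      assume "y \<in> sat K"
      then obtain s m where s: "coef s 0 \<noteq> 0" and m: "m \<in> MM" "s * y - m * y \<in> Q" by (auto simp: sat_def K_def)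
      then have "y \<in> sat Q" by (intro satI[of "s - m"]) (auto simp: lookup_minus left_diff_distrib)
      then show False using yQ by simp
    qed
    moreover have "m * y \<in> sat K" if "m \<in> MM" for m
      using that pideal_0[OF Q(1)] sat_superset by (auto simp: K_def intro!: set_mp[OF sat_superset] bexI[of _ m])
    ultimately have "sat K \<in> A" unfolding A_def B_def using pideal_sat[OF pK] QK Q(2) sat_superset[of K] by auto
    then show ?thesis by blast
  qed
  then have "\<exists>M\<in>A. \<forall>Z\<in>A. M \<subseteq> Z \<longrightarrow> Z = M"
  proof (intro subset_Zorn_nonempty)
    fix C assume C: "C \<noteq> {}" "subset.chain A C"
    then have "subset.chain B C" by (auto simp: subset_chain_def A_def)
    then have "\<Union>C \<in> C" using chain_Union_mem[OF N C(1)] by (simp add: B_def)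
    then show "\<Union>C \<in> A" using C by (auto simp: subset_chain_def)
  qed auto
  then obtain M where M: "M \<in> A" and Mmax: "\<And>Z. Z \<in> A \<Longrightarrow> M \<subseteq> Z \<Longrightarrow> Z = M" by blast
  have pM: "pideal M" and satM: "sat M = M" and QM: "Q \<subseteq> M" and yM: "y \<notin> M" and My: "\<And>m. m \<in> MM \<Longrightarrow> m * y \<in> M"
    and SM: "SRD \<subseteq> M" using M by (auto simp: A_def B_def)
  have pow: "\<exists>t. b j ^ t \<in> M" if j: "j < m" for j
  proof -
    let ?c = "b j"
    \<comment> \<open>The colon ideals of \<open>M\<close> by the powers of \<open>?c\<close> form
      an ascending chain of saturated ideals, which becomes stationary at some exponent
      \<open>t\<close>.\<close>
    define L where "L t = {f. ?c ^ t * f \<in> M}" for t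
    have LB: "L t \<in> B" for t
    proof -
      have "pideal (L t)" unfolding pideal_def L_def using pideal_0[OF pM] pideal_add[OF pM] pideal_mult[OF pM]
        by (auto simp: distrib_left mult.left_commute[of "?c ^ t"])
      moreover have "sat (L t) \<subseteq> L t"
      proof
        fix f assume "f \<in> sat (L t)"
        then obtain s where "coef s 0 \<noteq> 0" "?c ^ t * (s * f) \<in> M" by (auto simp: sat_def L_def)
        then have "?c ^ t * f \<in> sat M" by (intro satI[of s]) (auto simp: algebra_simps)
        then show "f \<in> L t" using satM by (simp add: L_def)
      qed
      moreover have "SRD \<subseteq> L t" using SM pideal_mult[OF pM] by (auto simp: L_def)
      ultimately show ?thesis using sat_superset[of "L t"] by (auto simp: B_def)
    qed
    have Lmono: "L t \<subseteq> L t'" if t: "t \<le> t'" for t t'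
    proof
      fix f assume "f \<in> L t"
      then have "?c ^ (t' - t) * (?c ^ t * f) \<in> M" using pideal_mult[OF pM, of "?c ^ t * f" "?c ^ (t' - t)"] by (simp add: L_def)
      then show "f \<in> L t'" using t by (simp add: L_def mult.assoc[symmetric] power_add[symmetric])
    qed
    have "subset.chain B (range L)" unfolding subset_chain_def using LB Lmono by (auto) (metis nat_le_linear subsetD)
    then have "\<Union>(range L) \<in> range L" using chain_Union_mem[OF N, of "range L"] by (simp add: B_def)
    then obtain t where t: "\<Union>(range L) = L t" by auto
    define K where "K = sat (spanmod (\<lambda>_. ?c ^ t) 1 M)"
    have pK: "pideal K" unfolding K_def by (intro pideal_sat pideal_spanmod pM)
    have MK: "M \<subseteq> K" unfolding K_def using sat_superset spanmod_base[OF pM] by blast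
    \<comment> \<open>Suppose \<open>s * y\<close> equals \<open>z * ?c ^ t\<close> modulo
      \<open>M\<close>. Multiplying by \<open>?c\<close>, and using that \<open>?c * y\<close> is in
      \<open>M\<close>, puts \<open>z\<close> into the next colon ideal, hence into
      \<open>L t\<close> by stability; then \<open>s * y\<close>, and so \<open>y\<close>, would lie
      in \<open>M\<close>. Maximality of \<open>M\<close> now forces the power of \<open>?c\<close>
      into \<open>M\<close>.\<close>
    have "y \<notin> K"
    proof
      assume "y \<in> K"
      then obtain s z where s: "coef s 0 \<noteq> 0" "s * y - z * ?c ^ t \<in> M" by (auto simp: K_def sat_def spanmod_def)
      have "?c * (s * y - z * ?c ^ t) \<in> M" by (rule pideal_mult[OF pM s(2)])
      moreover have "s * (?c * y) \<in> M" using My b[OF j] pideal_mult[OF pM] by auto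
      ultimately have "s * (?c * y) - ?c * (s * y - z * ?c ^ t) \<in> M" by (intro pideal_diff[OF pM])
      also have "s * (?c * y) - ?c * (s * y - z * ?c ^ t) = ?c ^ Suc t * z" by (simp add: algebra_simps)
      finally have "z \<in> L (Suc t)" by (simp add: L_def)
      then have "z \<in> L t" using t by blast
      then have "(s * y - z * ?c ^ t) + ?c ^ t * z \<in> M" using s by (intro pideal_add[OF pM]) (auto simp: L_def)
      then have "s * y \<in> M" by (simp add: algebra_simps)
      then have "y \<in> sat M" using s by (intro satI)
      then show False using satM yM by simp
    qed
    then have "K \<in> A" unfolding A_def B_def using pK MK SM QM My by (auto simp: K_def)
    then have "K = M" using Mmax MK by blast
    moreover have "?c ^ t \<in> K" unfolding K_def using sat_superset spanmod_gen[OF pM, of 0 1 "\<lambda>_. ?c ^ t"] by auto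
    ultimately show ?thesis by blast
  qed
  then obtain t where t: "\<And>j. j < m \<Longrightarrow> b j ^ t j \<in> M" by metis
  define n where "n = (\<Sum>j<m. t j)"
  have "b j ^ n \<in> M" if j: "j < m" for j
  proof -
    have "t j \<le> n" unfolding n_def using j by (intro member_le_sum) auto
    then have "b j ^ n = b j ^ (n - t j) * b j ^ t j" by (simp add: power_add[symmetric])
    then show ?thesis using pideal_mult[OF pM t[OF j]] by simp
  qed
  then have "spanmod (\<lambda>j. b j ^ n) m Q \<subseteq> M" by (intro spanmod_minimal pM QM)
  then have "y \<in> sat M" using y[of n] sat_mono by blast
  then show False using satM yM by simp
qed

end

text \<open>The local ring of the subcomplex is a quotient of the one of \<Delta>: an ideal is
  pulled back along numerators and denominators, is finitely generated there, and the generators are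
  pushed forward. Skeleta and vertex deletions inherit noetherianity in this way from a complex
  already known to be Buchsbaum.\<close>

lemma noetherian_transfer:
  fixes k :: "'k::field itself" and \<Delta> \<Delta>' :: "'v set set"
  assumes "complex_face \<Delta>" "complex_face \<Delta>'" "\<Delta>' \<subseteq> \<Delta>"
    and N: "noetherian_ring (localization (face_ring k \<Delta>) (carrier (face_ring k \<Delta>) - irrelevant_ideal k \<Delta>))"
  shows "noetherian_ring (localization (face_ring k \<Delta>') (carrier (face_ring k \<Delta>') - irrelevant_ideal k \<Delta>'))"
proof -
  interpret A: complex_face k \<Delta> by fact
  interpret B: complex_face k \<Delta>' by fact
  interpret LA: noetherian_ring A.Loc by (rule N)
  interpret LB: cring B.Loc by (rule B.cring_Loc)
  have SRsub: "A.SRD \<subseteq> B.SRD" using assms(3) by (auto simp: SR_def)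
  define pre where "pre I = {A.q f s | f s. coef s 0 \<noteq> 0 \<and> B.q f s \<in> I}" for I
  have pre_mem: "A.q f s \<in> pre I \<longleftrightarrow> B.q f s \<in> I" if s: "coef s 0 \<noteq> 0" for f s I
  proof
    assume "A.q f s \<in> pre I"
    then obtain g t where g: "A.q f s = A.q g t" "coef t 0 \<noteq> 0" "B.q g t \<in> I" by (auto simp: pre_def)
    then have "A.REL f s g t" using s by (simp add: A.q_eq)
    then have "B.REL f s g t" using SRsub unfolding A.REL_def B.REL_def by blast
    then show "B.q f s \<in> I" using s g by (simp add: B.q_eq[symmetric])
  qed (use s in \<open>auto simp: pre_def\<close>)
  have ipre: "ideal (pre I) A.Loc" if "ideal I B.Loc" for I
  proof (rule A.ideal_Loc_I)
    interpret I: ideal I B.Loc by fact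
    show "pre I \<subseteq> carrier A.Loc" by (auto simp: pre_def intro: A.q_closed)
    show "A.q 0 1 \<in> pre I" using I.zero_closed by (simp add: pre_mem B.q_0)
    fix f s g t :: "('v \<Rightarrow>\<^sub>0 nat) \<Rightarrow>\<^sub>0 'k" assume *: "coef s 0 \<noteq> 0" "coef t 0 \<noteq> 0" "A.q f s \<in> pre I"
    then show "A.q (g * f) (t * s) \<in> pre I" using I.I_l_closed[of "B.q f s" "B.q g t"]
      by (simp add: pre_mem B.q_mult B.q_closed)
    assume "A.q g t \<in> pre I"
    then show "A.q (f * t + g * s) (s * t) \<in> pre I" using * I.a_closed[of "B.q f s" "B.q g t"]
      by (simp add: pre_mem B.q_add)
  qed
  show ?thesis
  proof (rule LB.noetherian_ringI)
    fix I assume I: "ideal I B.Loc"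
    obtain S where S: "S \<subseteq> carrier A.Loc" "finite S" "pre I = Idl\<^bsub>A.Loc\<^esub> S" using LA.finetely_gen[OF ipre[OF I]] by blast
    have "\<forall>x\<in>S. \<exists>f s. x = A.q f s \<and> coef s 0 \<noteq> 0" using S(1) by (auto elim!: A.LocE)
    then obtain F G where FG: "\<And>x. x \<in> S \<Longrightarrow> x = A.q (F x) (G x) \<and> coef (G x) 0 \<noteq> 0" by metis
    define T where "T = (\<lambda>x. B.q (F x) (G x)) ` S"
    have Tc: "T \<subseteq> carrier B.Loc" using FG by (auto simp: T_def intro: B.q_closed)
    have SI: "S \<subseteq> pre I" using LA.genideal_self[OF S(1)] S(3) by simp
    have "T \<subseteq> I" 
    proof
      fix y assume "y \<in> T" then obtain x where x: "x \<in> S" "y = B.q (F x) (G x)" by (auto simp: T_def)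
      then show "y \<in> I" using SI FG[OF x(1)] pre_mem by (metis subsetD)
    qed
    then have 1: "Idl\<^bsub>B.Loc\<^esub> T \<subseteq> I" by (rule LB.genideal_minimal[OF I])
    have iT: "ideal (Idl\<^bsub>B.Loc\<^esub> T) B.Loc" by (rule LB.genideal_ideal[OF Tc])
    have "S \<subseteq> pre (Idl\<^bsub>B.Loc\<^esub> T)"
    proof
      fix x assume x: "x \<in> S"
      then have "B.q (F x) (G x) \<in> Idl\<^bsub>B.Loc\<^esub> T" using LB.genideal_self[OF Tc] by (auto simp: T_def)
      then show "x \<in> pre (Idl\<^bsub>B.Loc\<^esub> T)" using FG[OF x] pre_mem by metis
    qed
    then have 2: "pre I \<subseteq> pre (Idl\<^bsub>B.Loc\<^esub> T)" unfolding S(3) by (rule LA.genideal_minimal[OF ipre[OF iT]])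
    have "I \<subseteq> Idl\<^bsub>B.Loc\<^esub> T"
    proof
      fix x assume x: "x \<in> I"
      then have "x \<in> carrier B.Loc" using ideal.Icarr[OF I] by auto
      then obtain f s where fs: "x = B.q f s" "coef s 0 \<noteq> 0" by (rule B.LocE)
      have "A.q f s \<in> pre I" using x fs by (simp add: pre_mem)
      then have "A.q f s \<in> pre (Idl\<^bsub>B.Loc\<^esub> T)" using 2 by blast
      then show "x \<in> Idl\<^bsub>B.Loc\<^esub> T" using fs by (simp add: pre_mem)
    qed
    then show "\<exists>A\<subseteq>carrier B.Loc. finite A \<and> I = Idl\<^bsub>B.Loc\<^esub> A" using 1 Tc S(2) by (intro exI[of _ T]) (auto simp: T_def)
  qed
qed

section \<open>Krull dimension of the localized face ring\<close>

text \<open>Gaussian elimination of one coordinate: a vector with nonzero entry at \<open>t\<close>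
  clears this entry in all others and is then set aside, which lowers both cardinalities by
  one.\<close>

lemma lin_dep:
  fixes w :: "'s \<Rightarrow> 't \<Rightarrow> 'k::field"
  assumes "finite T" "finite S" "card T < card S"
  shows "\<exists>c. (\<exists>s\<in>S. c s \<noteq> 0) \<and> (\<forall>t\<in>T. (\<Sum>s\<in>S. c s * w s t) = 0)"
  using assms
proof (induction T arbitrary: S w rule: finite_induct)
  case empty
  then obtain s where "s \<in> S" by (metis all_not_in_conv card.empty less_irrefl)
  then show ?case by (intro exI[of _ "\<lambda>_. 1"]) auto
next
  case (insert t T)
  show ?case
  proof (cases "\<forall>s\<in>S. w s t = 0")
    case True
    have "card T < card S" using insert by simp
    then obtain c where "\<exists>s\<in>S. c s \<noteq> 0" "\<forall>t\<in>T. (\<Sum>s\<in>S. c s * w s t) = 0"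
      using insert.IH[OF insert.prems(1)] by blast
    then show ?thesis using True by (intro exI[of _ c]) (auto intro!: sum.neutral)
  next
    case False
    then obtain s0 where s0: "s0 \<in> S" "w s0 t \<noteq> 0" by blast
    define S' where "S' = S - {s0}"
    have fS': "finite S'" "card T < card S'" using insert s0 by (auto simp: S'_def card_Diff_singleton)
    define w' where "w' s x = w s x - w s t / w s0 t * w s0 x" for s x
    obtain c where c: "\<exists>s\<in>S'. c s \<noteq> 0" "\<forall>x\<in>T. (\<Sum>s\<in>S'. c s * w' s x) = 0"
      using insert.IH[OF fS', of w'] by blast
    define c' where "c' s = (if s = s0 then - (\<Sum>s\<in>S'. c s * w s t) / w s0 t else c s)" for s
    have sumc: "(\<Sum>s\<in>S. c' s * w s x) = (\<Sum>s\<in>S'. c s * w' s x)" for x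
    proof -
      have "(\<Sum>s\<in>S. c' s * w s x) = c' s0 * w s0 x + (\<Sum>s\<in>S'. c' s * w s x)"
        unfolding S'_def using insert.prems(1) s0 by (simp add: sum.remove)
      also have "(\<Sum>s\<in>S'. c' s * w s x) = (\<Sum>s\<in>S'. c s * w s x)"
        by (intro sum.cong) (auto simp: c'_def S'_def)
      also have "c' s0 * w s0 x = - (\<Sum>s\<in>S'. c s * (w s t / w s0 t * w s0 x))"
        by (simp add: c'_def sum_distrib_right sum_divide_distrib sum_negf[symmetric] mult.assoc)
      finally show ?thesis by (simp add: w'_def right_diff_distrib sum_subtractf)
    qed
    have "(\<Sum>s\<in>S'. c s * w' s t) = 0" using s0 by (simp add: w'_def)
    then show ?thesis using c sumc by (intro exI[of _ c']) (auto simp: c'_def S'_def)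
  qed
qed

text \<open>The variables in \<open>F\<close> are renamed by natural numbers. Exponents indexed by
  \<open>nat\<close> are linearly ordered, so those polynomials have no zero divisors, and the
  renaming is injective on exponents supported in \<open>F\<close>.\<close>

lemma restr_domain:
  fixes f g :: "('v \<Rightarrow>\<^sub>0 nat) \<Rightarrow>\<^sub>0 'k::field"
  assumes F: "finite F" and fg: "restr F f * restr F g = 0"
  shows "restr F f = 0 \<or> restr F g = 0"
proof -
  obtain r :: "'v \<Rightarrow> nat" where r: "inj_on r F" using finite_imp_inj_to_nat_seg[OF F] by blast
  define h :: "('v \<Rightarrow>\<^sub>0 nat) \<Rightarrow> (nat \<Rightarrow>\<^sub>0 nat)" where "h = push r"
  have hadd: "h (a + b) = h a + h b" for a b by (simp add: h_def push_add)
  have inj: "inj_on h {e. supp e \<subseteq> F}"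
  proof (rule inj_onI)
    fix a b assume ab: "a \<in> {e. supp e \<subseteq> F}" "b \<in> {e. supp e \<subseteq> F}" "h a = h b"
    show "a = b"
    proof (rule poly_mapping_eqI)
      fix v
      show "coef a v = coef b v"
      proof (cases "v \<in> F")
        case True
        then have "inj_on r (insert v (supp a))" "inj_on r (insert v (supp b))"
          using ab True by (intro inj_on_subset[OF r]; blast)+
        then show ?thesis using ab(3) lookup_push unfolding h_def by metis
      next
        case False
        then have "v \<notin> supp a" "v \<notin> supp b" using ab by auto
        then show ?thesis by (simp add: in_keys_iff)
      qed
    qed
  qed
  have z: "restr F p = 0" if "push h (restr F p) = 0" for p :: "('v \<Rightarrow>\<^sub>0 nat) \<Rightarrow>\<^sub>0 'k"
  proof (rule poly_mapping_eqI)
    fix e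
    show "coef (restr F p) e = coef 0 e"
    proof (cases "supp e \<subseteq> F")
      case True
      have "inj_on h (insert e (supp (restr F p)))"
        using True restr_keys by (intro inj_on_subset[OF inj]) blast
      then show ?thesis using lookup_push[of h e "restr F p"] that by simp
    qed (simp add: lookup_restr)
  qed
  have "push h (restr F f) * push h (restr F g) = 0"
    using push_mult[OF hadd, of "restr F f" "restr F g"] fg by simp
  then have "push h (restr F f) = 0 \<or> push h (restr F g) = 0" by simp
  then show ?thesis using z by blast
qed

text \<open>In a relation the least power of \<open>y 0\<close> can be cancelled, since
  \<open>y 0\<close> is outside the prime \<open>p 0\<close>. Modulo the next prime all terms still
  divisible by \<open>y 0\<close> disappear, and a nontrivial relation among the remaining elements
  is left. A long chain of primes thus produces algebraically independent elements.\<close>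

lemma prime_chain_independent:
  fixes p :: "nat \<Rightarrow> (('v \<Rightarrow>\<^sub>0 nat) \<Rightarrow>\<^sub>0 'k::field) set"
  assumes "\<And>i. i \<le> n \<Longrightarrow> pideal (p i)" "\<And>i f g. i \<le> n \<Longrightarrow> f * g \<in> p i \<Longrightarrow> f \<in> p i \<or> g \<in> p i"
    and "\<And>i. i \<le> n \<Longrightarrow> 1 \<notin> p i" "\<And>i. i < n \<Longrightarrow> p i \<subseteq> p (Suc i)"
    and "\<And>i. i < n \<Longrightarrow> y i \<in> p (Suc i)" "\<And>i. i < n \<Longrightarrow> y i \<notin> p i"
    and "finite S" "S \<noteq> {}" "\<And>\<alpha>. \<alpha> \<in> S \<Longrightarrow> length \<alpha> = n" "\<And>\<alpha>. \<alpha> \<in> S \<Longrightarrow> c \<alpha> \<noteq> 0"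
  shows "(\<Sum>\<alpha>\<in>S. mon 0 (c \<alpha>) * (\<Prod>i<n. y i ^ (\<alpha> ! i))) \<notin> p 0"
  using assms
proof (induction n arbitrary: p y S c)
  case 0
  then have S: "S = {[]}" by auto
  show ?case
  proof
    assume "(\<Sum>\<alpha>\<in>S. mon 0 (c \<alpha>) * (\<Prod>i<0. y i ^ (\<alpha> ! i))) \<in> p 0"
    then have "mon 0 (c []) \<in> p 0" by (simp add: S)
    then have "mon 0 (inverse (c [])) * mon 0 (c []) \<in> p 0"
      using 0(1) by (intro pideal_mult) auto
    also have "mon 0 (inverse (c [])) * mon 0 (c []) = (1 :: ('v \<Rightarrow>\<^sub>0 nat) \<Rightarrow>\<^sub>0 'k)"
      using 0(10)[of "[]"] S by (simp add: mult_single)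
    finally show False using 0(3) by simp
  qed
next
  case (Suc n)
  have P: "pideal (p 0)" "pideal (p 1)" using Suc.prems(1) by auto
  define m where "m = Min (hd ` S)"
  define T where "T \<alpha> = mon 0 (c \<alpha>) * (\<Prod>i<n. y (Suc i) ^ (tl \<alpha> ! i))" for \<alpha>
  have m: "m \<le> hd \<alpha>" if "\<alpha> \<in> S" for \<alpha> using that Suc.prems(7) by (auto simp: m_def)
  have "m \<in> hd ` S" unfolding m_def using Suc.prems(7,8) by (intro Min_in) auto
  then obtain \<alpha>0 where a0: "\<alpha>0 \<in> S" "hd \<alpha>0 = m" by auto
  have term_eq: "mon 0 (c \<alpha>) * (\<Prod>i<Suc n. y i ^ (\<alpha> ! i)) = y 0 ^ m * (y 0 ^ (hd \<alpha> - m) * T \<alpha>)" if a: "\<alpha> \<in> S" for \<alpha>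
  proof -
    obtain x xs where x: "\<alpha> = x # xs" using Suc.prems(9)[OF a] by (cases \<alpha>) auto
    have "y 0 ^ x = y 0 ^ m * y 0 ^ (x - m)" using m[OF a] by (simp add: x power_add[symmetric])
    then show ?thesis by (simp add: x T_def prod.lessThan_Suc_shift mult.assoc mult.left_commute del: prod.lessThan_Suc)
  qed
  show ?case
  proof
    assume "(\<Sum>\<alpha>\<in>S. mon 0 (c \<alpha>) * (\<Prod>i<Suc n. y i ^ (\<alpha> ! i))) \<in> p 0"
    then have "y 0 ^ m * (\<Sum>\<alpha>\<in>S. y 0 ^ (hd \<alpha> - m) * T \<alpha>) \<in> p 0"
      using term_eq by (simp add: sum_distrib_left)
    moreover have "y 0 ^ j \<notin> p 0" for j
      using Suc.prems(2)[of 0] Suc.prems(3)[of 0] Suc.prems(6)[of 0] by (induction j) auto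
    ultimately have "(\<Sum>\<alpha>\<in>S. y 0 ^ (hd \<alpha> - m) * T \<alpha>) \<in> p 0" using Suc.prems(2)[of 0] by blast
    then have 1: "(\<Sum>\<alpha>\<in>S. y 0 ^ (hd \<alpha> - m) * T \<alpha>) \<in> p 1" using Suc.prems(4)[of 0] by auto
    let ?S1 = "{\<alpha>\<in>S. hd \<alpha> = m}" and ?S2 = "{\<alpha>\<in>S. hd \<alpha> \<noteq> m}"
    have S12: "S = ?S1 \<union> ?S2" by auto
    have sp: "(\<Sum>\<alpha>\<in>S. y 0 ^ (hd \<alpha> - m) * T \<alpha>) = (\<Sum>\<alpha>\<in>?S1. T \<alpha>) + (\<Sum>\<alpha>\<in>?S2. y 0 ^ (hd \<alpha> - m) * T \<alpha>)"
      by (subst S12, subst sum.union_disjoint) (use Suc.prems(7) in auto)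
    have 2: "(\<Sum>\<alpha>\<in>?S2. y 0 ^ (hd \<alpha> - m) * T \<alpha>) \<in> p 1"
    proof (rule pideal_sum[OF P(2)])
      fix \<alpha> assume "\<alpha> \<in> ?S2"
      then have "0 < hd \<alpha> - m" using m[of \<alpha>] by auto
      then obtain j where "hd \<alpha> - m = Suc j" by (metis gr0_implies_Suc)
      then have "y 0 ^ (hd \<alpha> - m) * T \<alpha> = (y 0 ^ j * T \<alpha>) * y 0" by (simp add: mult_ac)
      then show "y 0 ^ (hd \<alpha> - m) * T \<alpha> \<in> p 1" using pideal_mult[OF P(2)] Suc.prems(5)[of 0] by simp
    qed
    have 3: "(\<Sum>\<alpha>\<in>?S1. T \<alpha>) \<in> p 1" using pideal_diff[OF P(2) 1 2] sp by simp
    define S' where "S' = tl ` ?S1"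
    have inj: "inj_on tl ?S1"
      using Suc.prems(9) by (intro inj_onI) (metis (mono_tags, lifting) length_0_conv list.collapse mem_Collect_eq nat.distinct(1))
    have cons: "\<alpha> = m # tl \<alpha>" if "\<alpha> \<in> ?S1" for \<alpha> using that Suc.prems(9)[of \<alpha>] by (cases \<alpha>) auto
    have "(\<Sum>\<alpha>\<in>S'. mon 0 (c (m # \<alpha>)) * (\<Prod>i<n. y (Suc i) ^ (\<alpha> ! i))) = (\<Sum>\<alpha>\<in>?S1. T \<alpha>)"
      unfolding S'_def sum.reindex[OF inj] by (intro sum.cong refl) (simp add: T_def cons[symmetric])
    moreover have "(\<Sum>\<alpha>\<in>S'. mon 0 (c (m # \<alpha>)) * (\<Prod>i<n. y (Suc i) ^ (\<alpha> ! i))) \<notin> p (Suc 0)"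
    proof (rule Suc.IH[of "\<lambda>i. p (Suc i)" "\<lambda>i. y (Suc i)" S' "\<lambda>\<alpha>. c (m # \<alpha>)"])
      show "finite S'" "S' \<noteq> {}" using Suc.prems(7) a0 by (auto simp: S'_def)
      show "length \<alpha> = n" if "\<alpha> \<in> S'" for \<alpha> using that Suc.prems(9) by (auto simp: S'_def)
      show "c (m # \<alpha>) \<noteq> 0" if "\<alpha> \<in> S'" for \<alpha> using that Suc.prems(10) cons by (auto simp: S'_def) 
    qed (use Suc.prems in auto)
    ultimately show False using 3 by simp
  qed
qed

section \<open>Two bounds for the Krull dimension\<close>

context complex_face begin

definition tdeg :: "('v \<Rightarrow>\<^sub>0 nat) \<Rightarrow> nat" where "tdeg e = (\<Sum>v\<in>vertices \<Delta>. coef e v)"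
definition degb :: "nat \<Rightarrow> (('v \<Rightarrow>\<^sub>0 nat) \<Rightarrow>\<^sub>0 'k) \<Rightarrow> bool" where "degb D f \<longleftrightarrow> (\<forall>e\<in>supp f. tdeg e \<le> D)"

lemma degb_mult: "degb D f \<Longrightarrow> degb E g \<Longrightarrow> degb (D + E) (f * g)"
  unfolding degb_def
proof
  fix e assume *: "\<forall>e\<in>supp f. tdeg e \<le> D" "\<forall>e\<in>supp g. tdeg e \<le> E" "e \<in> supp (f * g)"
  then obtain a b where "a \<in> supp f" "b \<in> supp g" "e = a + b" using keys_mult_ex by blast
  then show "tdeg e \<le> D + E" using * by (simp add: tdeg_def lookup_add sum.distrib add_mono)
qed

lemma degb_1: "degb 0 1" by (simp add: degb_def tdeg_def)

lemma degb_power: "degb D f \<Longrightarrow> degb (n * D) (f ^ n)"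
  by (induction n) (auto simp: degb_1 degb_mult)

lemma degb_mono: "degb D f \<Longrightarrow> D \<le> E \<Longrightarrow> degb E f" by (auto simp: degb_def)

lemma degb_prod: "finite A \<Longrightarrow> (\<And>i. i \<in> A \<Longrightarrow> degb (D i) (f i)) \<Longrightarrow> degb (\<Sum>i\<in>A. D i) (\<Prod>i\<in>A. f i)"
  by (induction A rule: finite_induct) (auto simp: degb_1 degb_mult)

text \<open>A count of monomials. The power products of \<open>y 0, ..., y d\<close> with all
  exponents below \<open>N\<close> number N^(d+1) and have degree at most \<open>B\<close>, which is
  linear in \<open>N\<close>; the monomials of degree at most \<open>B\<close> supported on faces
  number at most card \<Delta> times (B+1)^d. For large \<open>N\<close> there are more products
  than monomials, and linear algebra gives the relation.\<close>

lemma alg_dependent: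
  fixes y :: "nat \<Rightarrow> (('v \<Rightarrow>\<^sub>0 nat) \<Rightarrow>\<^sub>0 'k)"
  assumes d: "\<And>\<sigma>. \<sigma> \<in> \<Delta> \<Longrightarrow> card \<sigma> \<le> d"
  shows "\<exists>S c. finite S \<and> S \<noteq> {} \<and> (\<forall>\<alpha>\<in>S. length \<alpha> = Suc d \<and> c \<alpha> \<noteq> 0) \<and>
     (\<Sum>\<alpha>\<in>S. mon 0 (c \<alpha>) * (\<Prod>i<Suc d. y i ^ (\<alpha> ! i))) \<in> SRD"
proof -
  define D where "D = Max (insert 0 (\<Union>i\<le>d. tdeg ` supp (y i)))"
  have degy: "degb D (y i)" if "i \<le> d" for i
    unfolding degb_def D_def using that by (auto intro!: Max_ge)
  have finD: "finite \<Delta>" using sc by (simp add: simplicial_complex_def)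
  \<comment> \<open>Chosen such that the bound for the number of monomials becomes (N - 1) * N^d,
    just below N^(d+1).\<close>
  define N where "N = card \<Delta> * ((d + 1) * D + 1) ^ d + 1"
  define B where "B = (d + 1) * (N * D)"
  define box where "box = {\<alpha>. set \<alpha> \<subseteq> {..<N} \<and> length \<alpha> = Suc d}"
  define T where "T = {e. supp e \<in> \<Delta> \<and> tdeg e \<le> B}"
  have finbox: "finite box" "card box = N ^ Suc d"
    unfolding box_def by (auto simp: finite_lists_length_eq card_lists_length_eq)
  define Ts where "Ts \<sigma> = {e :: 'v \<Rightarrow>\<^sub>0 nat. supp e \<subseteq> \<sigma> \<and> (\<forall>v\<in>\<sigma>. coef e v \<le> B)}" for \<sigma>
  have Ts: "finite (Ts \<sigma>) \<and> card (Ts \<sigma>) \<le> (B + 1) ^ d" if s: "\<sigma> \<in> \<Delta>" for \<sigma>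
  proof -
    have fs: "finite \<sigma>" using s sc by (auto simp: simplicial_complex_def)
    let ?h = "\<lambda>e. restrict (coef e) \<sigma>"
    have inj: "inj_on ?h (Ts \<sigma>)"
    proof (rule inj_onI, rule poly_mapping_eqI)
      fix a b v assume ab: "a \<in> Ts \<sigma>" "b \<in> Ts \<sigma>" "?h a = ?h b"
      show "coef a v = coef b v"
      proof (cases "v \<in> \<sigma>")
        case True then show ?thesis using fun_cong[OF ab(3), of v] by simp
      next
        case False
        then have "v \<notin> supp a" "v \<notin> supp b" using ab by (auto simp: Ts_def)
        then show ?thesis by (simp add: in_keys_iff)
      qed
    qed
    have sub: "?h ` Ts \<sigma> \<subseteq> PiE \<sigma> (\<lambda>_. {..B})" by (auto simp: Ts_def)
    have fP: "finite (PiE \<sigma> (\<lambda>_. {..B}))" using fs by (simp add: finite_PiE)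
    have "card (Ts \<sigma>) \<le> card (PiE \<sigma> (\<lambda>_. {..B}))" by (rule card_inj_on_le[OF inj sub fP])
    also have "\<dots> = (B + 1) ^ card \<sigma>" using fs by (simp add: card_PiE)
    also have "\<dots> \<le> (B + 1) ^ d" by (rule power_increasing) (use d[OF s] in auto)
    finally show ?thesis using inj_on_finite[OF inj sub fP] by simp
  qed
  have TT: "T \<subseteq> (\<Union>\<sigma>\<in>\<Delta>. Ts \<sigma>)"
  proof
    fix e assume e: "e \<in> T"
    have "coef e v \<le> B" if "v \<in> supp e" for v
    proof -
      have "v \<in> vertices \<Delta>" using that e by (auto simp: T_def)
      then have "coef e v \<le> tdeg e" unfolding tdeg_def using finV by (intro member_le_sum) auto
      then show ?thesis using e by (simp add: T_def)
    qed
    then show "e \<in> (\<Union>\<sigma>\<in>\<Delta>. Ts \<sigma>)" using e by (auto simp: T_def Ts_def intro!: bexI[of _ "supp e"])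
  qed
  have fU: "finite (\<Union>\<sigma>\<in>\<Delta>. Ts \<sigma>)" using finD Ts by auto
  have finT: "finite T" by (rule finite_subset[OF TT fU])
  have "card T \<le> card (\<Union>\<sigma>\<in>\<Delta>. Ts \<sigma>)" by (rule card_mono[OF fU TT])
  also have "\<dots> \<le> (\<Sum>\<sigma>\<in>\<Delta>. card (Ts \<sigma>))" by (rule card_UN_le[OF finD])
  also have "\<dots> \<le> (\<Sum>\<sigma>\<in>\<Delta>. (B + 1) ^ d)" by (rule sum_mono) (use Ts in blast)
  also have "\<dots> = card \<Delta> * (B + 1) ^ d" by simp
  also have "\<dots> \<le> card \<Delta> * (N * ((d + 1) * D + 1)) ^ d"
  proof -
    have "B + 1 \<le> B + N" by (simp add: N_def)
    also have "B + N = N * ((d + 1) * D + 1)" by (simp add: B_def algebra_simps)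
    finally show ?thesis by (intro mult_left_mono power_mono) auto
  qed
  also have "\<dots> = (N - 1) * N ^ d"
  proof -
    have "N - 1 = card \<Delta> * ((d + 1) * D + 1) ^ d" by (simp add: N_def)
    then show ?thesis by (simp only: power_mult_distrib) (simp add: mult_ac)
  qed
  also have "\<dots> < N ^ Suc d" by (simp add: N_def)
  finally have "card T < card box" by (simp add: finbox)
  from lin_dep[OF finT finbox(1) this, of "\<lambda>\<alpha> e. coef (\<Prod>i<Suc d. y i ^ (\<alpha> ! i)) e"]
  obtain c where c: "\<exists>\<alpha>\<in>box. c \<alpha> \<noteq> 0" "\<And>e. e \<in> T \<Longrightarrow> (\<Sum>\<alpha>\<in>box. c \<alpha> * coef (\<Prod>i<Suc d. y i ^ (\<alpha> ! i)) e) = 0"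
    by blast
  define S where "S = {\<alpha>\<in>box. c \<alpha> \<noteq> 0}"
  have degp: "degb B (\<Prod>i<Suc d. y i ^ (\<alpha> ! i))" if "\<alpha> \<in> box" for \<alpha>
  proof -
    have "degb (\<Sum>i<Suc d. (\<alpha> ! i) * D) (\<Prod>i<Suc d. y i ^ (\<alpha> ! i))"
      by (intro degb_prod degb_power degy) auto
    moreover have "(\<Sum>i<Suc d. (\<alpha> ! i) * D) \<le> (\<Sum>i<Suc d. N * D)"
    proof (rule sum_mono)
      fix i assume "i \<in> {..<Suc d}"
      then have "\<alpha> ! i \<in> set \<alpha>" using that by (auto simp: box_def)
      then have "\<alpha> ! i < N" using that by (auto simp: box_def)
      then show "(\<alpha> ! i) * D \<le> N * D" by simp
    qed
    ultimately show ?thesis by (auto simp: B_def elim!: degb_mono)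
  qed
  have cm: "coef (mon 0 a * p) e = a * coef p e" for a :: 'k and p e
    by (simp flip: mult_map_scale_conv_mult add: Poly_Mapping.map.rep_eq when_def)
  have "(\<Sum>\<alpha>\<in>S. mon 0 (c \<alpha>) * (\<Prod>i<Suc d. y i ^ (\<alpha> ! i))) \<in> SRD"
    unfolding SR_iff
  proof (intro allI impI)
    fix e :: "'v \<Rightarrow>\<^sub>0 nat" assume e: "supp e \<in> \<Delta>"
    have "coef (\<Sum>\<alpha>\<in>S. mon 0 (c \<alpha>) * (\<Prod>i<Suc d. y i ^ (\<alpha> ! i))) e
      = (\<Sum>\<alpha>\<in>S. c \<alpha> * coef (\<Prod>i<Suc d. y i ^ (\<alpha> ! i)) e)"
      by (simp only: lookup_sum cm)
    also have "\<dots> = (\<Sum>\<alpha>\<in>box. c \<alpha> * coef (\<Prod>i<Suc d. y i ^ (\<alpha> ! i)) e)"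
      by (rule sum.mono_neutral_left) (auto simp: S_def finbox)
    also have "\<dots> = 0"
    proof (cases "e \<in> T")
      case True then show ?thesis by (rule c(2))
    next
      case False
      then have "\<not> tdeg e \<le> B" using e by (simp add: T_def)
      then have "e \<notin> supp (\<Prod>i<Suc d. y i ^ (\<alpha> ! i))" if "\<alpha> \<in> box" for \<alpha>
        using degp[OF that] by (auto simp: degb_def)
      then show ?thesis by (intro sum.neutral) (auto simp: in_keys_iff)
    qed
    finally show "coef (\<Sum>\<alpha>\<in>S. mon 0 (c \<alpha>) * (\<Prod>i<Suc d. y i ^ (\<alpha> ! i))) e = 0" .
  qed
  moreover have "finite S" "S \<noteq> {}" "\<forall>\<alpha>\<in>S. length \<alpha> = Suc d \<and> c \<alpha> \<noteq> 0"
    using c(1) finbox(1) by (auto simp: S_def box_def[symmetric]) (simp add: box_def)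
  ultimately show ?thesis by blast
qed

text \<open>A chain with more than \<open>d\<close> strict inclusions would give
  \<open>d + 1\<close> elements that are algebraically independent modulo its lowest prime, against
  \<open>alg_dependent\<close>. The primes are contracted to polynomials along fractions with
  denominator 1.\<close>

lemma krull_dim_le:
  assumes d: "\<And>\<sigma>. \<sigma> \<in> \<Delta> \<Longrightarrow> card \<sigma> \<le> d"
  shows "krull_dim Loc \<le> enat d"
  unfolding krull_dim_def
proof (rule SUP_least)
  fix n assume "n \<in> {n. \<exists>P. (\<forall>i\<le>n. primeideal (P i) Loc) \<and> (\<forall>i<n. P i \<subset> P (Suc i))}"
  then obtain P where P: "\<And>i. i \<le> n \<Longrightarrow> primeideal (P i) Loc" "\<And>i. i < n \<Longrightarrow> P i \<subset> P (Suc i)" by auto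
  have "n \<le> d"
  proof (rule ccontr)
    assume "\<not> n \<le> d"
    then have nd: "Suc d \<le> n" by simp
    define p where "p i = {f. q f 1 \<in> P i}" for i
    have pid: "pideal (p i)" if i: "i \<le> n" for i
    proof -
      interpret primeideal "P i" Loc by (rule P(1)[OF i])
      show ?thesis unfolding pideal_def
      proof (intro conjI ballI allI)
        show "0 \<in> p i" using additive_subgroup.zero_closed[OF is_additive_subgroup] by (simp add: p_def q_0)
        fix f assume f: "f \<in> p i"
        show "r * f \<in> p i" for r using I_l_closed[of "q f 1" "q r 1"] f by (simp add: p_def q_mult q_closed)
        show "f + g \<in> p i" if "g \<in> p i" for g using additive_subgroup.a_closed[OF is_additive_subgroup, of "q f 1" "q g 1"] f that by (simp add: p_def q_add)
      qed
    qed
    have prime: "f \<in> p i \<or> g \<in> p i" if "i \<le> n" "f * g \<in> p i" for i f g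
    proof -
      interpret primeideal "P i" Loc by (rule P(1)[OF that(1)])
      show ?thesis using I_prime[of "q f 1" "q g 1"] that(2) by (simp add: p_def q_mult q_closed)
    qed
    have one: "1 \<notin> p i" if "i \<le> n" for i
    proof -
      interpret primeideal "P i" Loc by (rule P(1)[OF that(1)])
      show ?thesis using one_in_ideal[OF is_ideal, of 1 1] I_notcarr by (auto simp: p_def)
    qed
    have "\<exists>f. f \<in> p (Suc i) \<and> f \<notin> p i" if i: "i < n" for i
    proof -
      interpret A: primeideal "P i" Loc by (rule P(1)) (use i in simp)
      interpret B: primeideal "P (Suc i)" Loc by (rule P(1)) (use i in simp)
      obtain x where x: "x \<in> P (Suc i)" "x \<notin> P i" using P(2)[OF i] by blast
      then have "x \<in> carrier Loc" using B.Icarr by auto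
      then obtain f s where fs: "x = q f s" "coef s 0 \<noteq> 0" by (rule LocE)
      have "q s 1 \<otimes>\<^bsub>Loc\<^esub> x \<in> P (Suc i)" using x(1) by (intro B.I_l_closed q_closed) auto
      also have "q s 1 \<otimes>\<^bsub>Loc\<^esub> x = q f 1" unfolding fs using fs(2) by (simp add: q_mult) (rule qI, simp_all)
      finally have 1: "f \<in> p (Suc i)" by (simp add: p_def)
      have "f \<notin> p i"
      proof
        assume "f \<in> p i"
        then have "q 1 s \<otimes>\<^bsub>Loc\<^esub> q f 1 \<in> P i" using fs by (intro A.I_l_closed q_closed) (auto simp: p_def)
        also have "q 1 s \<otimes>\<^bsub>Loc\<^esub> q f 1 = x" unfolding fs using fs(2) by (simp add: q_mult)
        finally show False using x by simp
      qed
      then show ?thesis using 1 by blast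
    qed
    then obtain y where y: "\<And>i. i < n \<Longrightarrow> y i \<in> p (Suc i) \<and> y i \<notin> p i" by metis
    obtain S c where S: "finite S" "S \<noteq> {}" "\<forall>\<alpha>\<in>S. length \<alpha> = Suc d \<and> c \<alpha> \<noteq> 0"
      "(\<Sum>\<alpha>\<in>S. mon 0 (c \<alpha>) * (\<Prod>i<Suc d. y i ^ (\<alpha> ! i))) \<in> SRD"
      using alg_dependent[OF d, of y] by blast
    have "SRD \<subseteq> p 0"
    proof
      fix f assume "f \<in> SRD"
      then have "REL f 1 0 1" by (auto simp: REL_def intro!: exI[of _ 1])
      then have "q f 1 = q 0 1" by (simp add: q_eq)
      then show "f \<in> p 0" using pideal_0[OF pid[of 0]] by (simp add: p_def)
    qed
    moreover have "(\<Sum>\<alpha>\<in>S. mon 0 (c \<alpha>) * (\<Prod>i<Suc d. y i ^ (\<alpha> ! i))) \<notin> p 0"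
    proof (rule prime_chain_independent)
      show "p i \<subseteq> p (Suc i)" if "i < Suc d" for i using P(2)[of i] that nd by (auto simp: p_def)
    qed (use pid prime one y nd S in auto)
    ultimately show False using S(4) by blast
  qed
  then show "enat n \<le> enat d" by simp
qed

text \<open>Removing the vertices of \<sigma> one at a time gives a descending flag of faces; the
  kernels of the restrictions to these faces form a strictly ascending chain of primes, separated by
  the variable just removed.\<close>

lemma krull_dim_ge:
  assumes s: "\<sigma> \<in> \<Delta>"
  shows "enat (card \<sigma>) \<le> krull_dim Loc"
proof -
  have fs: "finite \<sigma>" using s sc by (auto simp: simplicial_complex_def)
  define n where "n = card \<sigma>"
  obtain b where b: "bij_betw b {..<n} \<sigma>" using ex_bij_betw_nat_finite[OF fs] by (auto simp: n_def atLeast0LessThan)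
  define F where "F i = b ` {i..<n}" for i
  have F\<Delta>: "F i \<in> \<Delta>" for i
  proof -
    have "F i \<subseteq> \<sigma>" using b by (auto simp: F_def bij_betw_def)
    then show ?thesis using s down by blast
  qed
  define PF :: "nat \<Rightarrow> (('v \<Rightarrow>\<^sub>0 nat) \<Rightarrow>\<^sub>0 'k) set" where "PF i = {f. restr (F i) f = 0}" for i
  have pid: "pideal (PF i)" for i by (auto simp: pideal_def PF_def restr_add restr_mult)
  have finF: "finite (F i)" for i by (simp add: F_def)
  have prime: "f \<in> PF i \<or> g \<in> PF i" if "f * g \<in> PF i" for f g i
    using that restr_domain[OF finF] by (auto simp: PF_def restr_mult)
  have SRP: "SRD \<subseteq> PF i" for i
  proof
    fix f assume f: "f \<in> SRD"
    have "coef (restr (F i) f) e = 0" for e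
      using f down[OF F\<Delta>[of i], of "supp e"] by (auto simp: lookup_restr SR_iff)
    then show "f \<in> PF i" by (auto simp: PF_def intro: poly_mapping_eqI)
  qed
  have notin: "s \<notin> PF i" if "coef s 0 \<noteq> 0" for s i
  proof
    assume "s \<in> PF i"
    then have "coef (restr (F i) s) 0 = 0" by (simp add: PF_def)
    then show False using that by (simp add: lookup_restr)
  qed
  have satP: "sat (PF i) = PF i" for i
  proof
    show "sat (PF i) \<subseteq> PF i" unfolding sat_def using prime notin by blast
  qed (rule sat_superset)
  note mem = locI_mem[OF pid SRP, unfolded satP]
  have pr: "primeideal (locI (PF i)) Loc" for i
  proof (intro primeideal.intro primeideal_axioms.intro)
    show "ideal (locI (PF i)) Loc" by (rule ideal_locI[OF pid SRP])
    show "cring Loc" by (rule cring_Loc)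
    have "q 1 1 \<notin> locI (PF i)" using notin[of 1 i] by (simp add: mem)
    then show "carrier Loc \<noteq> locI (PF i)" using q_closed[of 1 1] by auto
    fix a b assume "a \<in> carrier Loc" "b \<in> carrier Loc" and ab: "a \<otimes>\<^bsub>Loc\<^esub> b \<in> locI (PF i)"
    then obtain f s g t where *: "a = q f s" "coef s 0 \<noteq> 0" "b = q g t" "coef t 0 \<noteq> 0"
      by (metis LocE)
    then have "f * g \<in> PF i" using ab by (simp add: q_mult mem)
    then show "a \<in> locI (PF i) \<or> b \<in> locI (PF i)" using prime * by (simp add: mem)
  qed
  have strict: "locI (PF i) \<subset> locI (PF (Suc i))" if i: "i < n" for i
  proof
    have sub: "F (Suc i) \<subseteq> F i" by (auto simp: F_def)
    have "PF i \<subseteq> PF (Suc i)"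
    proof
      fix f assume f: "f \<in> PF i"
      have "coef (restr (F (Suc i)) f) e = 0" for e
      proof -
        have "coef (restr (F i) f) e = 0" using f by (simp add: PF_def)
        then show ?thesis using sub by (auto simp: lookup_restr split: if_splits)
      qed
      then show "f \<in> PF (Suc i)" by (auto simp: PF_def intro: poly_mapping_eqI)
    qed
    then show "locI (PF i) \<subseteq> locI (PF (Suc i))" using sat_mono unfolding locI_def by blast
    have bi: "b i \<in> F i" using i by (auto simp: F_def)
    have bi2: "b i \<notin> F (Suc i)"
    proof
      assume "b i \<in> F (Suc i)"
      then obtain x where x: "b i = b x" "Suc i \<le> x" "x < n" by (auto simp: F_def)
      then have "i = x" using b i by (intro inj_onD[of b "{..<n}"]) (auto simp: bij_betw_def)
      then show False using x by simp
    qed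
    have "poly_var (b i) \<in> PF (Suc i)" "poly_var (b i) \<notin> PF i"
      proof -
      have nz: "mon e (1::'k) \<noteq> 0" for e :: "'v \<Rightarrow>\<^sub>0 nat" by (metis lookup_single_eq lookup_zero zero_neq_one)
      show "poly_var (b i) \<in> PF (Suc i)" "poly_var (b i) \<notin> PF i"
        using bi bi2 nz by (simp_all add: PF_def poly_var_def restr_single)
    qed
    then have "q (poly_var (b i)) 1 \<in> locI (PF (Suc i))" "q (poly_var (b i)) 1 \<notin> locI (PF i)" by (auto simp: mem)
    then show "locI (PF i) \<noteq> locI (PF (Suc i))" by blast
  qed
  have "\<exists>P. (\<forall>i\<le>n. primeideal (P i) Loc) \<and> (\<forall>i<n. P i \<subset> P (Suc i))"
    using pr strict by (intro exI[of _ "\<lambda>i. locI (PF i)"]) auto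
  then have "n \<in> {n. \<exists>P. (\<forall>i\<le>n. primeideal (P i) Loc) \<and> (\<forall>i<n. P i \<subset> P (Suc i))}" by blast
  then show ?thesis unfolding krull_dim_def n_def[symmetric] by (rule SUP_upper)
qed

end

section \<open>Cech complexes of Laurent polynomials\<close>

definition il :: "('v \<Rightarrow>\<^sub>0 nat) \<Rightarrow> ('v \<Rightarrow>\<^sub>0 int)" where
  "il e = (\<Sum>v\<in>supp e. mon v (int (coef e v)))"

lemma lookup_il [simp]: "coef (il e) v = int (coef e v)"
  unfolding il_def by (subst lookup_sum_single) (auto simp: in_keys_iff)

lemma il_add: "il (a + b) = il a + il b" by (rule poly_mapping_eqI) (simp add: lookup_add)
lemma il_inj: "il a = il b \<longleftrightarrow> a = b"
proof
  assume "il a = il b"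
  then have "\<And>v. int (coef a v) = int (coef b v)" by (metis lookup_il)
  then show "a = b" by (intro poly_mapping_eqI) simp
qed simp
lemma il_0 [simp]: "il 0 = 0" by (simp add: il_def)

definition lau :: "(('v \<Rightarrow>\<^sub>0 nat) \<Rightarrow>\<^sub>0 'k::field) \<Rightarrow> (('v \<Rightarrow>\<^sub>0 int) \<Rightarrow>\<^sub>0 'k)" where "lau = push il"

lemma lau_add: "lau (f + g) = lau f + lau g" by (simp add: lau_def push_add)
lemma lau_diff: "lau (f - g) = lau f - lau g" by (simp add: lau_def push_diff)
lemma lau_uminus: "lau (- f) = - lau f" by (simp add: lau_def push_uminus)
lemma lau_mult: "lau (f * g) = lau f * lau g" by (simp add: lau_def push_mult il_add)
lemma lau_0 [simp]: "lau 0 = 0" by (simp add: lau_def)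
lemma lau_1 [simp]: "lau 1 = 1" by (simp add: lau_def flip: single_one)
lemma lau_sum: "lau (\<Sum>i\<in>A. f i) = (\<Sum>i\<in>A. lau (f i))" by (simp add: lau_def push_sum)
lemma lookup_lau: "coef (lau f) (il e) = coef f e"
  unfolding lau_def by (rule lookup_push) (auto intro: inj_onI simp: il_inj)
lemma keys_lau: "e \<in> supp (lau f) \<Longrightarrow> \<exists>e'\<in>supp f. e = il e'"
  unfolding lau_def using keys_push[of il f] by auto
lemma lau_inj: "lau f = lau g \<Longrightarrow> f = g"
  by (rule poly_mapping_eqI) (metis lookup_lau)

lemma lookup_mult_single:
  "coef (p * mon e c) (y + e) = coef p y * (c :: 'k::comm_ring_1)"
  for y :: "'a::cancel_comm_monoid_add"
  by (induction p rule: pm_induct) (auto simp: mult_single lookup_single when_def distrib_right lookup_add)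

definition xm :: "'v set \<Rightarrow> int \<Rightarrow> (('v \<Rightarrow>\<^sub>0 int) \<Rightarrow>\<^sub>0 'k::field)" where
  "xm F n = mon (\<Sum>v\<in>F. mon v n) 1"

definition xA :: "'v set \<Rightarrow> nat \<Rightarrow> (('v \<Rightarrow>\<^sub>0 nat) \<Rightarrow>\<^sub>0 'k::field)" where
  "xA F n = mon (\<Sum>v\<in>F. mon v n) 1"

lemma lau_xA: "finite F \<Longrightarrow> lau (xA F n) = xm F (int n)"
proof -
  assume F: "finite F"
  have "il (\<Sum>v\<in>F. mon v n) = (\<Sum>v\<in>F. mon v (int n))"
    by (rule poly_mapping_eqI) (simp add: lookup_sum_single[OF F])
  then show ?thesis by (simp add: xA_def lau_def xm_def)
qed

lemma xm_add: "xm F (m + n) = xm F m * xm F n"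
  by (simp add: xm_def mult_single single_add sum.distrib)
lemma xm_0 [simp]: "xm F 0 = 1" by (simp add: xm_def)
lemma xm_inv: "xm F (- n) * (xm F n * f) = f" "xm F n * (xm F (- n) * f) = f"
  by (simp_all flip: mult.assoc xm_add)
lemma xm_union: "finite F \<Longrightarrow> finite G \<Longrightarrow> F \<inter> G = {} \<Longrightarrow> xm (F \<union> G) n = xm F n * xm G n"
  by (simp add: xm_def mult_single sum.union_disjoint)
lemma xm_empty [simp]: "xm {} n = 1" by (simp add: xm_def)
lemma xm_single: "xm {w} (int n) = lau (poly_var w ^ n)"
  by (simp add: poly_var_power lau_def xm_def) (simp add: il_def)

text \<open>For an ideal \<open>J\<close> this is the localization of \<open>J\<close> at the product of the variables in \<open>F\<close>; in particular \<open>JF UNIV F\<close>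
  is the localized polynomial ring.\<close>

definition JF where "JF J F = {f. \<exists>n::nat. \<exists>j\<in>J. xm F (int n) * f = lau j}"

lemma JF_mono: "J \<subseteq> K \<Longrightarrow> JF J F \<subseteq> JF K F" by (auto simp: JF_def)

lemma JF_E: assumes "f \<in> JF J F" obtains n j where "j \<in> J" "xm F (int n) * f = lau j"
  using assms by (auto simp: JF_def)

lemma JF_I: "j \<in> J \<Longrightarrow> xm F (int n) * f = lau j \<Longrightarrow> f \<in> JF J F" by (auto simp: JF_def)

lemma JF_lau: "j \<in> J \<Longrightarrow> lau j \<in> JF J F" by (rule JF_I[of j J F 0]) auto

lemma JF_add:
  assumes J: "pideal J" and F: "finite F" and f: "f \<in> JF J F" and g: "g \<in> JF J F"
  shows "f + g \<in> JF J F"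
proof -
  from f obtain n j where j: "j \<in> J" "xm F (int n) * f = lau j" by (rule JF_E)
  from g obtain m i where i: "i \<in> J" "xm F (int m) * g = lau i" by (rule JF_E)
  have "xm F (int (m + n)) * (f + g) = xm F (int m) * (xm F (int n) * f) + xm F (int n) * (xm F (int m) * g)"
    by (simp add: xm_add algebra_simps)
  also have "\<dots> = lau (xA F m * j + xA F n * i)" by (simp add: j i lau_add lau_mult lau_xA[OF F])
  finally show ?thesis by (rule JF_I[rotated]) (intro pideal_add[OF J] pideal_mult[OF J] j i)
qed

lemma JF_mult:
  assumes J: "pideal J" and F: "finite F" and f: "f \<in> JF J F" and g: "g \<in> JF UNIV F"
  shows "f * g \<in> JF J F"
proof -
  from f obtain n j where j: "j \<in> J" "xm F (int n) * f = lau j" by (rule JF_E)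
  from g obtain m i where i: "xm F (int m) * g = lau i" by (rule JF_E)
  have "xm F (int (n + m)) * (f * g) = (xm F (int n) * f) * (xm F (int m) * g)"
    by (simp add: xm_add mult_ac)
  also have "\<dots> = lau (j * i)" by (simp add: j i lau_mult)
  finally show ?thesis by (rule JF_I[rotated]) (intro pideal_mult2[OF J] j)
qed

lemma JF_lmult: "pideal J \<Longrightarrow> finite F \<Longrightarrow> f \<in> JF J F \<Longrightarrow> lau a * f \<in> JF J F"
  using JF_mult[of J F f "lau a"] JF_lau[of a UNIV F] by (simp add: mult.commute)

lemma JF_lmult2: "pideal J \<Longrightarrow> finite F \<Longrightarrow> a \<in> J \<Longrightarrow> f \<in> JF UNIV F \<Longrightarrow> lau a * f \<in> JF J F"
  using JF_mult[of J F "lau a" f] JF_lau[of a J F] by simp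

lemma JF_0: "pideal J \<Longrightarrow> 0 \<in> JF J F" by (rule JF_I[of 0 J F 0]) (auto intro: pideal_0)

lemma JF_minus: "pideal J \<Longrightarrow> finite F \<Longrightarrow> f \<in> JF J F \<Longrightarrow> - f \<in> JF J F"
  using JF_lmult[of J F f "-1"] by (simp add: lau_uminus)

lemma JF_diff: "pideal J \<Longrightarrow> finite F \<Longrightarrow> f \<in> JF J F \<Longrightarrow> g \<in> JF J F \<Longrightarrow> f - g \<in> JF J F"
  using JF_add[of J F f "- g"] JF_minus[of J F g] by simp

lemma JF_sum: "pideal J \<Longrightarrow> finite F \<Longrightarrow> (\<And>i. i \<in> A \<Longrightarrow> f i \<in> JF J F) \<Longrightarrow> (\<Sum>i\<in>A. f i) \<in> JF J F"
  by (induction A rule: infinite_finite_induct) (auto simp: JF_0 JF_add)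

lemma JF_sg: "pideal J \<Longrightarrow> finite F \<Longrightarrow> f \<in> JF J F \<Longrightarrow> sg r u G f \<in> JF J F"
  by (simp add: sg_def JF_minus)

lemma pideal_UNIV [simp]: "pideal UNIV" by (simp add: pideal_def)

lemma JF_subset:
  fixes f :: "('v \<Rightarrow>\<^sub>0 int) \<Rightarrow>\<^sub>0 'k::field"
  assumes J: "pideal J" and G: "finite G" "F \<subseteq> G" and f: "f \<in> JF J F"
  shows "f \<in> JF J G"
proof -
  have F: "finite F" "finite (G - F)" using G finite_subset by auto
  from f obtain n j where j: "j \<in> J" "xm F (int n) * f = lau j" by (rule JF_E)
  have "(xm G (int n) :: ('v \<Rightarrow>\<^sub>0 int) \<Rightarrow>\<^sub>0 'k) = xm (G - F) (int n) * xm F (int n)"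
    using xm_union[of "G - F" F "int n"] F G by (simp add: Un_absorb2 Diff_disjoint inf_commute)
  then have "xm G (int n) * f = lau (xA (G - F) n * j)" by (simp add: mult.assoc j lau_mult lau_xA[OF F(2)])
  then show ?thesis by (rule JF_I[rotated]) (intro pideal_mult[OF J] j)
qed

text \<open>A high power of the variable clears its denominators. The bound is stated for all larger
  exponents so that a single one can later serve finitely many sets at once.\<close>

lemma JF_remove:
  fixes f :: "('v \<Rightarrow>\<^sub>0 int) \<Rightarrow>\<^sub>0 'k::field"
  assumes J: "pideal J" and F: "finite F" "w \<notin> F" and f: "f \<in> JF J (insert w F)"
  shows "\<exists>N0. \<forall>N\<ge>N0. lau (poly_var w ^ N) * f \<in> JF J F"
proof -
  from f obtain n j where j: "j \<in> J" "xm (insert w F) (int n) * f = lau j" by (rule JF_E)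
  have "(xm (insert w F) (int n) :: ('v \<Rightarrow>\<^sub>0 int) \<Rightarrow>\<^sub>0 'k) = xm F (int n) * xm {w} (int n)"
    using xm_union[of F "{w}" "int n"] F by simp
  then have *: "xm F (int n) * (lau (poly_var w ^ n) * f) = lau j"
    using j(2) by (simp add: mult.assoc xm_single[symmetric])
  have "lau (poly_var w ^ N) * f \<in> JF J F" if N: "n \<le> N" for N
  proof -
    have "(lau (poly_var w ^ N) :: ('v \<Rightarrow>\<^sub>0 int) \<Rightarrow>\<^sub>0 'k) = lau (poly_var w ^ (N - n)) * lau (poly_var w ^ n)"
      using N by (simp flip: lau_mult power_add)
    then have "xm F (int n) * (lau (poly_var w ^ N) * f) = lau (poly_var w ^ (N - n)) * (xm F (int n) * (lau (poly_var w ^ n) * f))"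
      by (simp add: mult_ac)
    also have "\<dots> = lau (poly_var w ^ (N - n) * j)" by (simp only: * lau_mult)
    finally show ?thesis by (rule JF_I[rotated]) (intro pideal_mult[OF J] j)
  qed
  then show ?thesis by blast
qed

text \<open>Unfolds membership modulo \<open>x\<close> and up to saturation; the price is one
  multiplier with nonzero constant term, which depends on \<open>F\<close> and
  \<open>f\<close>.\<close>

lemma JF_sat_plus:
  assumes J: "pideal J" and F: "finite F" and f: "f \<in> JF (sat (spanmod (\<lambda>_. x) 1 J)) F"
  shows "\<exists>s. coef s 0 \<noteq> 0 \<and> (\<exists>g\<in>JF UNIV F. lau s * f - lau x * g \<in> JF J F)"
proof -
  from f obtain n j where j: "j \<in> sat (spanmod (\<lambda>_. x) 1 J)" "xm F (int n) * f = lau j" by (rule JF_E)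
  then obtain s z where s: "coef s 0 \<noteq> 0" "s * j - z * x \<in> J" by (auto simp: sat_def spanmod_def)
  define g where "g = xm F (- int n) * lau z"
  have g: "xm F (int n) * g = lau z" by (simp add: g_def xm_inv)
  have "xm F (int n) * (lau s * f - lau x * g) = lau (s * j - z * x)"
    using j(2) g by (simp add: right_diff_distrib lau_diff lau_mult mult.left_commute[of "xm F (int n)"] mult.commute[of "lau z"])
  then have "lau s * f - lau x * g \<in> JF J F" by (rule JF_I[rotated]) (rule s)
  moreover have "g \<in> JF UNIV F" by (rule JF_I[OF UNIV_I g])
  ultimately show ?thesis using s by blast
qed

text \<open>The variable of a vertex \<open>w \<in> F\<close> is invertible in the localization at
  \<open>F\<close>. There the weak condition, that \<open>x * a \<in> J\<close> implies
  \<open>poly_var w * a \<in> J\<close>, says that \<open>x\<close> is a nonzerodivisor modulo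
  \<open>J\<close>.\<close>

lemma JF_weak:
  fixes f :: "('v \<Rightarrow>\<^sub>0 int) \<Rightarrow>\<^sub>0 'k::field"
  assumes J: "pideal J" and F: "finite F" "w \<in> F" and f: "f \<in> JF UNIV F" "lau x * f \<in> JF J F"
    and weak: "\<And>a. x * a \<in> J \<Longrightarrow> poly_var w * a \<in> J"
  shows "f \<in> JF J F"
proof -
  from f(1) obtain n a where a: "xm F (int n) * f = lau a" by (rule JF_E)
  from f(2) obtain m j where j: "j \<in> J" "xm F (int m) * (lau x * f) = lau j" by (rule JF_E)
  have 1: "lau (x * (xA F m * a)) = lau (xA F n * j)"
  proof -
    have "lau (x * (xA F m * a)) = lau x * (xm F (int m) * (xm F (int n) * f))"
      using a by (simp add: lau_mult lau_xA[OF F(1)])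
    also have "\<dots> = xm F (int n) * (xm F (int m) * (lau x * f))" by (simp add: mult_ac)
    finally show ?thesis using j(2) by (simp add: lau_mult lau_xA[OF F(1)])
  qed
  have "x * (xA F m * a) \<in> J" using lau_inj[OF 1] pideal_mult[OF J j(1)] by simp
  then have 2: "poly_var w * (xA F m * a) \<in> J" by (rule weak)
  have "F = insert w (F - {w})" using F by auto
  then have "(xm F 1 :: ('v \<Rightarrow>\<^sub>0 int) \<Rightarrow>\<^sub>0 'k) = xm {w} 1 * xm (F - {w}) 1"
    using xm_union[of "{w}" "F - {w}" 1] F by auto
  also have "\<dots> = lau (poly_var w) * lau (xA (F - {w}) 1)"
  proof -
    have "(xm {w} (int 1) :: ('v \<Rightarrow>\<^sub>0 int) \<Rightarrow>\<^sub>0 'k) = lau (poly_var w ^ 1)" by (rule xm_single)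
    moreover have "lau (xA (F - {w}) 1) = (xm (F - {w}) (int 1) :: ('v \<Rightarrow>\<^sub>0 int) \<Rightarrow>\<^sub>0 'k)" by (rule lau_xA) (use F in simp)
    ultimately show ?thesis by simp
  qed
  finally have x1: "(xm F 1 :: ('v \<Rightarrow>\<^sub>0 int) \<Rightarrow>\<^sub>0 'k) = lau (poly_var w) * lau (xA (F - {w}) 1)" .
  have "xm F (int (m + n + 1)) * f = xm F (int m) * (xm F 1 * (xm F (int n) * f))"
    by (simp add: xm_add mult_ac)
  also have "\<dots> = lau (xA (F - {w}) 1 * (poly_var w * (xA F m * a)))"
    unfolding a by (simp add: x1 lau_mult lau_xA[OF F(1)] mult_ac)
  finally show ?thesis by (rule JF_I[rotated]) (intro pideal_mult[OF J] 2)
qed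

abbreviation "idw \<equiv> (\<lambda>_ m. m)"

lemma additive_id [simp]: "additive_fun (\<lambda>m. m)" by (simp add: additive_fun_def)
lemma additive_lmult [simp]: "additive_fun (\<lambda>m. a * m)" for a :: "'r::comm_ring" by (simp add: additive_fun_def distrib_left)

section \<open>Cech cocycles modulo an ideal\<close>

locale ordered_complex = complex_face k \<Delta> for k :: "'k::field itself" and \<Delta> :: "'v set set" +
  fixes r :: "'v \<Rightarrow> nat"
  assumes inj_r: "inj_on r (vertices \<Delta>)"
begin

abbreviation "V \<equiv> vertices \<Delta>"
abbreviation D :: "('v set \<Rightarrow> (('v \<Rightarrow>\<^sub>0 int) \<Rightarrow>\<^sub>0 'k)) \<Rightarrow> 'v set \<Rightarrow> (('v \<Rightarrow>\<^sub>0 int) \<Rightarrow>\<^sub>0 'k)" where "D \<equiv> dn r idw"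

lemma finF: "F \<subseteq> V \<Longrightarrow> finite F" using finV finite_subset by blast

lemma DD: "F \<subseteq> V \<Longrightarrow> D (D z) F = 0"
  using finF inj_r by (intro dn_dn) (auto intro: inj_on_subset)

lemma D_JF:
  assumes J: "pideal J" and F: "F \<subseteq> V" "card F = p" and b: "\<And>G. G \<subseteq> V \<Longrightarrow> Suc (card G) = p \<Longrightarrow> b G \<in> JF J G"
  shows "D b F \<in> JF J F"
  unfolding dn_def
proof (intro JF_sum[OF J finF[OF F(1)]] JF_sg[OF J finF[OF F(1)]])
  fix u assume u: "u \<in> F"
  have "b (F - {u}) \<in> JF J (F - {u})" using F u finF[OF F(1)] card_Suc_Diff1[of F u] by (intro b) (auto simp del: card_Diff_insert)
  then show "b (F - {u}) \<in> JF J F" by (rule JF_subset[OF J finF[OF F(1)], rotated]) auto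
qed

definition coch where "coch J p c \<longleftrightarrow> (\<forall>F\<subseteq>V. card F = p \<longrightarrow> c F \<in> JF J F)"
text \<open>Cochains of the quotient by \<open>J\<close> are represented by Laurent polynomials, so
  that being a cocycle or a coboundary is a membership condition. Degree is the cardinality of the
  vertex sets; in \<open>cobd\<close>, \<open>Suc (card G) = p\<close> leaves no lower cochains when
  \<open>p = 0\<close>.\<close>

definition cocyc where "cocyc J p c \<longleftrightarrow> coch UNIV p c \<and> coch J (Suc p) (D c)"
definition cobd where "cobd J p c \<longleftrightarrow> (\<exists>b. (\<forall>G\<subseteq>V. Suc (card G) = p \<longrightarrow> b G \<in> JF UNIV G) \<and> coch J p (\<lambda>F. c F - D b F))"

text \<open>Annihilators of cohomology classes are ideals; this lets \<open>rad_of_vars\<close> pass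
  from powers of variables to powers of arbitrary elements without constant term.\<close>

lemma cobd_ideal:
  assumes J: "pideal J"
  shows "pideal {g. cobd J p (\<lambda>F. lau g * c F)}"
  unfolding pideal_def mem_Collect_eq
proof (intro conjI ballI allI, unfold mem_Collect_eq)
  show "cobd J p (\<lambda>F. lau 0 * c F)"
    unfolding cobd_def coch_def by (intro exI[of _ "\<lambda>_. 0"]) (auto simp: dn_def JF_0[OF J] JF_0)
  fix g assume "cobd J p (\<lambda>F. lau g * c F)"
  then obtain b where b: "\<And>G. G \<subseteq> V \<Longrightarrow> Suc (card G) = p \<Longrightarrow> b G \<in> JF UNIV G"
    "\<And>F. F \<subseteq> V \<Longrightarrow> card F = p \<Longrightarrow> lau g * c F - D b F \<in> JF J F" unfolding cobd_def coch_def by blast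
  { fix h assume "cobd J p (\<lambda>F. lau h * c F)"
    then obtain b' where b': "\<And>G. G \<subseteq> V \<Longrightarrow> Suc (card G) = p \<Longrightarrow> b' G \<in> JF UNIV G"
      "\<And>F. F \<subseteq> V \<Longrightarrow> card F = p \<Longrightarrow> lau h * c F - D b' F \<in> JF J F" unfolding cobd_def coch_def by blast
    show "cobd J p (\<lambda>F. lau (g + h) * c F)"
      unfolding cobd_def coch_def
    proof (intro exI[of _ "\<lambda>G. b G + b' G"] conjI allI impI)
      fix G assume "G \<subseteq> V" "Suc (card G) = p"
      then show "b G + b' G \<in> JF UNIV G" using b b' finF by (intro JF_add) auto
    next
      fix F assume F: "F \<subseteq> V" "card F = p"
      have "(lau g * c F - D b F) + (lau h * c F - D b' F) \<in> JF J F" using b b' F finF by (intro JF_add[OF J]) auto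
      then show "lau (g + h) * c F - D (\<lambda>G. b G + b' G) F \<in> JF J F"
        by (simp add: dn_add lau_add algebra_simps)
    qed }
  fix a
  show "cobd J p (\<lambda>F. lau (a * g) * c F)"
    unfolding cobd_def coch_def
  proof (intro exI[of _ "\<lambda>G. lau a * b G"] conjI allI impI)
    fix G assume "G \<subseteq> V" "Suc (card G) = p"
    then show "lau a * b G \<in> JF UNIV G" using b finF by (intro JF_lmult) auto
  next
    fix F assume F: "F \<subseteq> V" "card F = p"
    have "D (\<lambda>G. lau a * b G) F = lau a * D b F"
      by (rule dn_hom[symmetric, of "\<lambda>m. lau a * m"]) auto
    moreover have "lau a * (lau g * c F - D b F) \<in> JF J F" using b F finF by (intro JF_lmult[OF J]) auto
    ultimately show "lau (a * g) * c F - D (\<lambda>G. lau a * b G) F \<in> JF J F"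
      by (simp add: lau_mult algebra_simps)
  qed
qed

lemma cobd_base:
  assumes J: "pideal J" and c: "coch UNIV p c" and g: "g \<in> J"
  shows "cobd J p (\<lambda>F. lau g * c F)"
  unfolding cobd_def coch_def
proof (intro exI[of _ "\<lambda>_. 0"] conjI allI impI)
  fix F assume "F \<subseteq> V" "card F = p"
  then have "lau g * c F \<in> JF J F" using c g finF by (intro JF_lmult2[OF J]) (auto simp: coch_def)
  then show "lau g * c F - D (\<lambda>_. 0) F \<in> JF J F" by (simp add: dn_def)
qed (auto intro: JF_0)

text \<open>Contraction with the vertex \<open>w\<close> uses the value at \<open>insert w G\<close>
  as a value at \<open>G\<close>. The power of the variable clears the denominators in
  \<open>w\<close> which this introduces, both in \<open>c\<close> and in its coboundary.\<close>

lemma cobd_var: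
  assumes J: "pideal J" and c: "cocyc J p c" and w: "w \<in> V"
  shows "\<exists>N. cobd J p (\<lambda>F. lau (poly_var w ^ N) * c F)"
proof -
  have finP: "finite {G. G \<subseteq> V}" using finV by (simp add: Pow_def[symmetric])
  define good where "good N \<longleftrightarrow> (\<forall>G\<subseteq>V. w \<notin> G \<longrightarrow> (Suc (card G) = p \<longrightarrow> lau (poly_var w ^ N) * c (insert w G) \<in> JF UNIV G) \<and>
      (card G = p \<longrightarrow> lau (poly_var w ^ N) * D c (insert w G) \<in> JF J G))" for N
  have "\<exists>N0. \<forall>N\<ge>N0. (Suc (card G) = p \<longrightarrow> lau (poly_var w ^ N) * c (insert w G) \<in> JF UNIV G) \<and>
      (card G = p \<longrightarrow> lau (poly_var w ^ N) * D c (insert w G) \<in> JF J G)" if G: "G \<subseteq> V" "w \<notin> G" for G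
  proof -
    have fG: "finite G" and ins: "insert w G \<subseteq> V" using G w finF by auto
    have 1: "\<exists>N1. \<forall>N\<ge>N1. Suc (card G) = p \<longrightarrow> lau (poly_var w ^ N) * c (insert w G) \<in> JF UNIV G"
    proof (cases "Suc (card G) = p")
      case True
      then have "c (insert w G) \<in> JF UNIV (insert w G)" using c ins fG G by (auto simp: cocyc_def coch_def)
      then show ?thesis using JF_remove[OF pideal_UNIV fG G(2)] by blast
    qed auto
    have 2: "\<exists>N1. \<forall>N\<ge>N1. card G = p \<longrightarrow> lau (poly_var w ^ N) * D c (insert w G) \<in> JF J G"
    proof (cases "card G = p")
      case True
      then have "D c (insert w G) \<in> JF J (insert w G)" using c ins fG G by (auto simp: cocyc_def coch_def)
      then show ?thesis using JF_remove[OF J fG G(2)] by blast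
    qed auto
    from 1 2 obtain N1 N2 where N1: "\<forall>N\<ge>N1. Suc (card G) = p \<longrightarrow> lau (poly_var w ^ N) * c (insert w G) \<in> JF UNIV G"
      and N2: "\<forall>N\<ge>N2. card G = p \<longrightarrow> lau (poly_var w ^ N) * D c (insert w G) \<in> JF J G" by blast
    show ?thesis by (rule exI[of _ "max N1 N2"]) (use N1 N2 in simp)
  qed
  then obtain N0 where N0: "\<And>G N. G \<subseteq> V \<Longrightarrow> w \<notin> G \<Longrightarrow> N0 G \<le> N \<Longrightarrow> (Suc (card G) = p \<longrightarrow> lau (poly_var w ^ N) * c (insert w G) \<in> JF UNIV G) \<and>
      (card G = p \<longrightarrow> lau (poly_var w ^ N) * D c (insert w G) \<in> JF J G)" by metis
  define N where "N = Max (N0 ` {G. G \<subseteq> V})"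
  have N0N: "N0 G \<le> N" if "G \<subseteq> V" for G unfolding N_def using finP that by (intro Max_ge) auto
  \<comment> \<open>Only \<open>w\<close> carries weight, so the right side of \<open>up_dn\<close>
    is multiplication by the power of its variable: this multiplication is homotopic to
    zero.\<close>
  define x where "x u m = (if u = w then lau (poly_var w ^ N) * m else 0)" for u and m :: "('v \<Rightarrow>\<^sub>0 int) \<Rightarrow>\<^sub>0 'k"
  have addx: "additive_fun (x u)" for u by (simp add: x_def additive_fun_def distrib_left)
  have upx: "up r V x z F = (if w \<in> F then 0 else sg r w F (lau (poly_var w ^ N) * z (insert w F)))" for z F
  proof -
    have "up r V x z F = (\<Sum>u\<in>V - F. if u = w then sg r w F (lau (poly_var w ^ N) * z (insert w F)) else 0)"
      unfolding up_def by (intro sum.cong refl) (auto simp: x_def)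
    then show ?thesis using w finV by (auto simp: sum.delta)
  qed
  have master: "up r V x (D c) F + D (up r V x c) F = lau (poly_var w ^ N) * c F" if F: "F \<subseteq> V" for F
  proof -
    have "up r V x (D c) F + D (up r V x c) F = (\<Sum>u\<in>V. x u (c F))"
      by (rule up_dn[OF finV inj_r F]) (auto simp: addx)
    also have "\<dots> = lau (poly_var w ^ N) * c F" using w finV by (simp add: x_def sum.delta)
    finally show ?thesis .
  qed
  show ?thesis
    unfolding cobd_def coch_def
  proof (intro exI[of _ N] exI[of _ "up r V x c"] conjI allI impI)
    fix G assume G: "G \<subseteq> V" "Suc (card G) = p"
    then show "up r V x c G \<in> JF UNIV G"
      using N0[OF G(1) _ N0N] finF[OF G(1)] by (auto simp: upx JF_0 intro!: JF_sg)
  next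
    fix F assume F: "F \<subseteq> V" "card F = p"
    have "lau (poly_var w ^ N) * c F - D (up r V x c) F = up r V x (D c) F" using master[OF F(1)] by (simp add: algebra_simps)
    also have "\<dots> \<in> JF J F" using N0[OF F(1) _ N0N] F finF[OF F(1)] by (auto simp: upx JF_0[OF J] intro!: JF_sg[OF J])
    finally show "lau (poly_var w ^ N) * c F - D (up r V x c) F \<in> JF J F" .
  qed
qed

lemma var_SR: "w \<notin> V \<Longrightarrow> poly_var w \<in> SRD" by (auto simp: SR_def poly_var_def)

lemma cobd_pow:
  assumes J: "pideal J" "SRD \<subseteq> J" and c: "cocyc J p c" and x: "coef x 0 = 0"
  shows "\<exists>N\<ge>1. cobd J p (\<lambda>F. lau (x ^ N) * c F)"
proof -
  define T where "T = {g. cobd J p (\<lambda>F. lau g * c F)}"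
  have T: "pideal T" unfolding T_def by (rule cobd_ideal[OF J(1)])
  have "\<exists>n. poly_var w ^ n \<in> T" for w
  proof (cases "w \<in> V")
    case True then show ?thesis using cobd_var[OF J(1) c] by (auto simp: T_def)
  next
    case False
    then have "poly_var w ^ 1 \<in> J" using var_SR J(2) by auto
    then show ?thesis using cobd_base[OF J(1)] c unfolding T_def cocyc_def by blast
  qed
  then obtain n where n: "x ^ n \<in> T" using rad_of_vars[OF T _ x] by blast
  \<comment> \<open>The exponent has to be positive, because \<open>Wk\<close> speaks about positive
    powers only.\<close>
  then have "x ^ Suc n \<in> T" using pideal_mult[OF T n, of x] by simp
  then show ?thesis by (intro exI[of _ "Suc n"]) (simp add: T_def)
qed

text \<open>\<open>xs\<close> is a weak sequence modulo \<open>J\<close>, with every element allowed to be replaced by a power.\<close>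

primrec Wk where
  "Wk J [] \<longleftrightarrow> True"
| "Wk J (x # xs) \<longleftrightarrow> coef x 0 = 0 \<and>
     (\<forall>N\<ge>1. (\<forall>f w. x ^ N * f \<in> J \<longrightarrow> poly_var w * f \<in> J) \<and> Wk (sat (spanmod (\<lambda>_. x ^ N) 1 J)) xs)"

text \<open>A connecting homomorphism along the sequence. Some power of \<open>x\<close> kills the
  class of \<open>c\<close>, so \<open>x ^ N\<close> times \<open>c\<close> is \<open>D b\<close>
  modulo \<open>J\<close>, and \<open>b\<close> is a cocycle of one degree less modulo
  \<open>J\<close> and \<open>x ^ N\<close>. The rest of the sequence makes the variable kill
  \<open>b\<close>; the resulting equation can be divided by \<open>x ^ N\<close>, a nonzerodivisor
  on nonempty sets by \<open>JF_weak\<close>. Each degree consumes one element of the sequence,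
  whence \<open>p < length xs\<close>.\<close>

theorem cech_killed:
  assumes "pideal J" "SRD \<subseteq> J" "sat J = J" "Wk J xs" "p < length xs" "cocyc J p c"
  shows "\<exists>s. coef s 0 \<noteq> 0 \<and> cobd J p (\<lambda>F. lau (s * poly_var w) * c F)"
  using assms
proof (induction xs arbitrary: J p c)
  case (Cons x xs)
  note J = Cons.prems(1,2)
  have x0: "coef x 0 = 0" using Cons.prems(4) by simp
  from cobd_pow[OF J Cons.prems(6) x0] obtain N where N: "1 \<le> N" "cobd J p (\<lambda>F. lau (x ^ N) * c F)" by blast
  have weak: "\<And>f w. x ^ N * f \<in> J \<Longrightarrow> poly_var w * f \<in> J" using Cons.prems(4) N(1) by auto
  have cU: "\<And>F. F \<subseteq> V \<Longrightarrow> card F = p \<Longrightarrow> c F \<in> JF UNIV F" using Cons.prems(6) by (auto simp: cocyc_def coch_def)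
  from N(2) obtain b where b: "\<And>G. G \<subseteq> V \<Longrightarrow> Suc (card G) = p \<Longrightarrow> b G \<in> JF UNIV G"
    "\<And>F. F \<subseteq> V \<Longrightarrow> card F = p \<Longrightarrow> lau (x ^ N) * c F - D b F \<in> JF J F" unfolding cobd_def coch_def by blast
  show ?case
  proof (cases p)
    case 0
    \<comment> \<open>On the empty set no variable is invertible, so the weak condition is used as
      it stands and contributes the factor \<open>poly_var w\<close>.\<close>
    have "lau (x ^ N) * c {} \<in> JF J {}" using b(2)[of "{}"] 0 by (simp add: dn_def)
    then obtain j where j: "j \<in> J" "lau (x ^ N) * c {} = lau j" by (auto elim!: JF_E)
    obtain a where a: "c {} = lau a" using cU[of "{}"] 0 by (auto elim!: JF_E)
    have "x ^ N * a = j" using j a by (intro lau_inj) (simp add: lau_mult)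
    then have "poly_var w * a \<in> J" using weak j by simp
    then have "lau (1 * poly_var w) * c {} \<in> JF J {}" using JF_lau by (simp add: a flip: lau_mult)
    then have "cobd J p (\<lambda>F. lau (1 * poly_var w) * c F)" unfolding cobd_def coch_def
    proof (intro exI[of _ "\<lambda>_. 0"] conjI allI impI)
      fix F assume "lau (1 * poly_var w) * c {} \<in> JF J {}" "F \<subseteq> V" "card F = p"
      moreover from this have "F = {}" using 0 finF by auto
      ultimately show "lau (1 * poly_var w) * c F - D (\<lambda>_. 0) F \<in> JF J F" by (simp add: dn_def)
    qed (use 0 in auto)
    then show ?thesis by (intro exI[of _ 1]) auto
  next
    case (Suc p')
    define J' where "J' = sat (spanmod (\<lambda>_. x ^ N) 1 J)"
    have pJ': "pideal J'" unfolding J'_def by (intro pideal_sat pideal_spanmod J)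
    have JJ': "J \<subseteq> J'" unfolding J'_def using sat_superset spanmod_base[OF J(1)] by blast
    have xJ': "x ^ N \<in> J'" unfolding J'_def using sat_superset spanmod_gen[OF J(1), of 0 1 "\<lambda>_. x ^ N"] by auto
    have "cocyc J' p' b" unfolding cocyc_def coch_def
    proof (intro conjI allI impI)
      fix F assume F: "F \<subseteq> V" "card F = Suc p'"
      have 1: "lau (x ^ N) * c F \<in> JF J' F" using F Suc cU finF xJ' by (intro JF_lmult2[OF pJ']) auto
      have 2: "lau (x ^ N) * c F - D b F \<in> JF J' F" using b(2)[OF F(1)] F Suc JF_mono[OF JJ'] by auto
      have "lau (x ^ N) * c F - (lau (x ^ N) * c F - D b F) \<in> JF J' F"
        by (rule JF_diff[OF pJ' finF[OF F(1)] 1 2])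
      then show "D b F \<in> JF J' F" by simp
    qed (use b Suc in auto)
    moreover have "SRD \<subseteq> J'" using JJ' J by blast
    moreover have "sat J' = J'" by (simp add: J'_def)
    moreover have "Wk J' xs" using Cons.prems(4) N(1) by (simp add: J'_def)
    moreover have "p' < length xs" using Cons.prems(5) Suc by simp
    ultimately obtain s where s: "coef s 0 \<noteq> 0" "cobd J' p' (\<lambda>F. lau (s * poly_var w) * b F)"
      using Cons.IH[OF pJ', of p' b] by blast
    then obtain e where e: "\<And>G. G \<subseteq> V \<Longrightarrow> card G = p' \<Longrightarrow> lau (s * poly_var w) * b G - D e G \<in> JF J' G"
      unfolding cobd_def coch_def by blast
    define y where "y G = lau (s * poly_var w) * b G - D e G" for G
    have "\<exists>t g. coef t 0 \<noteq> 0 \<and> (G \<subseteq> V \<longrightarrow> card G = p' \<longrightarrow> g \<in> JF UNIV G \<and> lau t * y G - lau (x ^ N) * g \<in> JF J G)" for G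
    proof (cases "G \<subseteq> V \<and> card G = p'")
      case True
      then have "y G \<in> JF J' G" unfolding y_def using e by simp
      then show ?thesis using JF_sat_plus[OF J(1) finF, of G "y G" "x ^ N"] True unfolding J'_def by blast
    qed (auto intro!: exI[of _ 1])
    then obtain t g where t: "\<And>G. coef (t G) 0 \<noteq> 0"
      and g: "\<And>G. G \<subseteq> V \<Longrightarrow> card G = p' \<Longrightarrow> g G \<in> JF UNIV G \<and> lau (t G) * y G - lau (x ^ N) * g G \<in> JF J G" by metis
    define P where "P = {G. G \<subseteq> V}"
    have finP: "finite P" using finV by (simp add: P_def Pow_def[symmetric])
    \<comment> \<open>The multipliers \<open>t G\<close> vary with the set, while a coboundary mixes
      values at different sets; their product is a multiplier common to all.\<close>
    define s' where "s' = (\<Prod>G\<in>P. t G)"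
    have "coef (\<Prod>G\<in>Q. t G) 0 \<noteq> 0" if "finite Q" for Q using that t by (induction Q rule: finite_induct) auto
    then have s'0: "coef s' 0 \<noteq> 0" using finP by (simp add: s'_def)
    define f where "f G = lau (\<Prod>H\<in>P - {G}. t H) * g G" for G
    define h where "h G = lau s' * y G - lau (x ^ N) * f G" for G
    have fh: "f G \<in> JF UNIV G" "h G \<in> JF J G" if G: "G \<subseteq> V" "card G = p'" for G
    proof -
      show "f G \<in> JF UNIV G" unfolding f_def using g[OF G] finF[OF G(1)] by (intro JF_lmult) auto
      have "s' = (\<Prod>H\<in>P - {G}. t H) * t G" unfolding s'_def using G finP by (subst prod.remove[of _ G]) (auto simp: P_def mult.commute)
      then have "h G = lau (\<Prod>H\<in>P - {G}. t H) * (lau (t G) * y G - lau (x ^ N) * g G)"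
        by (simp add: h_def f_def lau_mult algebra_simps)
      then show "h G \<in> JF J G" using g[OF G] finF[OF G(1)] by (simp add: JF_lmult[OF J(1)])
    qed
    have "cobd J p (\<lambda>F. lau ((s' * s) * poly_var w) * c F)"
      unfolding cobd_def coch_def
    proof (intro exI[of _ f] conjI allI impI)
      fix F assume F: "F \<subseteq> V" "card F = p"
      have fF: "finite F" by (rule finF[OF F(1)])
      obtain v where v: "v \<in> F" using F Suc by fastforce
      let ?a = "lau (s' * s * poly_var w)"
      have Dy: "D y F = lau (s * poly_var w) * D b F"
      proof -
        have "D y F = D (\<lambda>G. lau (s * poly_var w) * b G) F - D (D e) F" unfolding y_def by (rule dn_minus) simp
        also have "D (\<lambda>G. lau (s * poly_var w) * b G) F = lau (s * poly_var w) * D b F"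
          by (rule dn_hom[symmetric]) auto
        finally show ?thesis using DD[OF F(1)] by simp
      qed
      have "D h F = lau s' * D y F - lau (x ^ N) * D f F"
      proof -
        have "D h F = D (\<lambda>G. lau s' * y G) F - D (\<lambda>G. lau (x ^ N) * f G) F" unfolding h_def by (rule dn_minus) simp
        also have "D (\<lambda>G. lau s' * y G) F = lau s' * D y F" by (rule dn_hom[symmetric]) auto
        also have "D (\<lambda>G. lau (x ^ N) * f G) F = lau (x ^ N) * D f F" by (rule dn_hom[symmetric]) auto
        finally show ?thesis .
      qed
      then have "lau (x ^ N) * (?a * c F - D f F) = D h F + ?a * (lau (x ^ N) * c F - D b F)"
        using Dy by (simp add: lau_mult algebra_simps)
      moreover have "D h F \<in> JF J F" by (rule D_JF[OF J(1) F]) (use fh Suc in auto)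
      moreover have "?a * (lau (x ^ N) * c F - D b F) \<in> JF J F" by (rule JF_lmult[OF J(1) fF b(2)[OF F]])
      ultimately have "lau (x ^ N) * (?a * c F - D f F) \<in> JF J F" using JF_add[OF J(1) fF] by simp
      moreover have "?a * c F - D f F \<in> JF UNIV F"
        using cU[OF F] D_JF[OF pideal_UNIV F, of f] fh Suc by (intro JF_diff JF_lmult fF) auto
      ultimately show "?a * c F - D f F \<in> JF J F"
        using JF_weak[OF J(1) fF v] weak by blast
    qed (use fh Suc in auto)
    then show ?thesis using s s'0 by (intro exI[of _ "s' * s"]) auto
  qed
qed simp

end

section \<open>Exactness conditions implied by the Buchsbaum property\<close>

text \<open>The vertices of \<open>F0\<close> are never removed, so up to a shift and signs these
  are the cochains of the link of \<open>F0\<close>; the condition says that the reduced cohomology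
  of the link vanishes in dimension p - card F0 - 1.\<close>

definition cochain_exact :: "('v \<Rightarrow> nat) \<Rightarrow> 'k::field itself \<Rightarrow> 'v set set \<Rightarrow> 'v set \<Rightarrow> nat \<Rightarrow> bool" where
  "cochain_exact r k \<Delta> F0 p \<longleftrightarrow> (\<forall>g :: 'v set \<Rightarrow> 'k.
     (\<forall>F\<in>\<Delta>. F0 \<subseteq> F \<longrightarrow> card F = Suc p \<longrightarrow> (\<Sum>u\<in>F - F0. sg r u F (g (F - {u}))) = 0) \<longrightarrow>
     (\<exists>h. \<forall>F\<in>\<Delta>. F0 \<subseteq> F \<longrightarrow> card F = p \<longrightarrow> g F = (\<Sum>u\<in>F - F0. sg r u F (h (F - {u})))))"

definition neg :: "('v \<Rightarrow>\<^sub>0 int) \<Rightarrow> 'v set" where "neg e = {v. coef e v < 0}"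

lemma il_ex: assumes "\<And>v. 0 \<le> coef e v" shows "\<exists>e'. e = il e' \<and> supp e' = supp e"
proof -
  define e' where "e' = (\<Sum>v\<in>supp e. mon v (nat (coef e v)))"
  have l: "coef e' v = nat (coef e v)" for v
    unfolding e'_def by (subst lookup_sum_single) (auto simp: in_keys_iff)
  have "e = il e'" using assms by (intro poly_mapping_eqI) (simp add: l)
  moreover have "supp e' = supp e"
    using assms by (auto simp: in_keys_iff l) (metis order_antisym)
  ultimately show ?thesis by blast
qed

lemma lookup_xm_mult:
  "coef (xm F n * f) (y + (\<Sum>v\<in>F. mon v n)) = coef f y"
  using lookup_mult_single[of f "\<Sum>v\<in>F. mon v n" 1 y] by (simp add: xm_def mult.commute)

lemma JF_UNIV_I:
  assumes F: "finite F" and n: "\<And>e. e \<in> supp f \<Longrightarrow> neg e \<subseteq> F"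
  shows "f \<in> JF UNIV F"
proof -
  have "mon e c \<in> JF UNIV F" if e: "neg e \<subseteq> F" for e c
  proof -
    define n where "n = nat (Max (insert 0 ((\<lambda>v. - coef e v) ` F)))"
    have n: "- coef e v \<le> int n" if "v \<in> F" for v
      unfolding n_def using F that by (auto simp: le_nat_iff)
    let ?e = "(\<Sum>v\<in>F. mon v (int n)) + e"
    have "0 \<le> coef ?e v" for v
      using n[of v] e by (auto simp: lookup_add lookup_sum_single[OF F] neg_def) (meson in_mono mem_Collect_eq not_le)
    then obtain e' where "?e = il e'" using il_ex by metis
    then have "xm F (int n) * mon e c = lau (mon e' c)"
      by (simp add: xm_def mult_single lau_def)
    then show ?thesis by (rule JF_I[OF UNIV_I])
  qed
  then have "(\<Sum>e\<in>supp f. mon e (coef f e)) \<in> JF UNIV F"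
    using n F by (intro JF_sum) auto
  then show ?thesis using pm_expand[of f] by simp
qed

lemma JF_UNIV_D:
  assumes F: "finite F" and f: "f \<in> JF UNIV F" and e: "e \<in> supp f"
  shows "neg e \<subseteq> F"
proof
  fix v assume v: "v \<in> neg e"
  from f obtain n j where j: "xm F (int n) * f = lau j" by (rule JF_E)
  have "coef (lau j) (e + (\<Sum>v\<in>F. mon v (int n))) \<noteq> 0"
    using e by (simp flip: j add: lookup_xm_mult in_keys_iff)
  then obtain e' where "e + (\<Sum>v\<in>F. mon v (int n)) = il e'" using keys_lau in_keys_iff by metis
  then have "coef (e + (\<Sum>v\<in>F. mon v (int n))) v \<ge> 0" by simp
  then show "v \<in> F" using v by (auto simp: lookup_add lookup_sum_single[OF F] neg_def split: if_splits)
qed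

context ordered_complex begin

text \<open>Hochster's multigraded description of the localized face ring: the monomial with
  exponent \<open>e\<close> exists in the localization at \<open>F\<close> when its negative
  coordinates lie in \<open>F\<close>, and it vanishes there when its support together with
  \<open>F\<close> is not a face. The converse is \<open>JF_SR_D\<close>.\<close>

lemma JF_SR_I:
  assumes F: "F \<subseteq> V" and n: "\<And>e. e \<in> supp f \<Longrightarrow> neg e \<subseteq> F \<and> supp e \<union> F \<notin> \<Delta>"
  shows "f \<in> JF SRD F"
proof -
  note fF = finF[OF F]
  have "f \<in> JF UNIV F" using n by (intro JF_UNIV_I[OF fF]) auto
  then obtain n j where j: "xm F (int n) * f = lau j" by (rule JF_E)
  \<comment> \<open>One factor more than clearing the denominators takes: it guarantees that every
    resulting monomial contains all of \<open>F\<close> in its support.\<close>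
  have 1: "xm F (int (Suc n)) * f = lau (xA F 1 * j)"
  proof -
    have "xm F (int (Suc n)) = xm F (int 1) * (xm F (int n) :: ('v \<Rightarrow>\<^sub>0 int) \<Rightarrow>\<^sub>0 'k)" by (simp only: xm_add[symmetric]) simp
    then show ?thesis by (simp add: mult.assoc j lau_mult lau_xA[OF fF])
  qed
  have "xA F 1 * j \<in> SRD"
    unfolding SR_def mem_Collect_eq
  proof
    fix e assume e: "e \<in> supp (xA F 1 * j)"
    have "supp (xA F 1 :: ('v \<Rightarrow>\<^sub>0 nat) \<Rightarrow>\<^sub>0 'k) \<subseteq> {\<Sum>v\<in>F. mon v 1}" by (simp add: xA_def)
    then obtain b where b: "b \<in> supp j" "e = (\<Sum>v\<in>F. mon v 1) + b"
      using keys_mult_ex[OF e] by blast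
    let ?y = "il b - (\<Sum>v\<in>F. mon v (int n))"
    have "coef f ?y = coef (lau j) (il b)"
      using lookup_xm_mult[of F "int n" f ?y] by (simp add: j)
    then have "?y \<in> supp f" using b by (simp add: lookup_lau in_keys_iff)
    then have y: "supp ?y \<union> F \<notin> \<Delta>" using n by blast
    have "supp e = supp ?y \<union> F"
      unfolding b(2) keys_plus_nat
      by (auto simp: in_keys_iff lookup_minus lookup_sum_single[OF fF] split: if_splits)
    then show "supp e \<notin> \<Delta>" using y by simp
  qed
  then show ?thesis using 1 by (rule JF_I)
qed

lemma JF_SR_D:
  assumes F: "F \<subseteq> V" and f: "f \<in> JF SRD F" and e: "supp e \<union> F \<in> \<Delta>"
  shows "coef f e = 0"
proof -
  note fF = finF[OF F]
  from f obtain n j where j: "j \<in> SRD" "xm F (int n) * f = lau j" by (rule JF_E)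
  let ?y = "e + (\<Sum>v\<in>F. mon v (int n))"
  have 1: "coef f e = coef (lau j) ?y" by (simp flip: j(2) add: lookup_xm_mult)
  show ?thesis
  proof (rule ccontr)
    assume "coef f e \<noteq> 0"
    then have "?y \<in> supp (lau j)" using 1 by (simp add: in_keys_iff)
    then obtain e' where e': "e' \<in> supp j" "?y = il e'" using keys_lau by blast
    have "supp e' \<subseteq> supp e \<union> F"
    proof
      fix v assume "v \<in> supp e'"
      then have "coef ?y v \<noteq> 0" by (simp add: e'(2) in_keys_iff)
      then show "v \<in> supp e \<union> F" by (auto simp: lookup_add lookup_sum_single[OF fF] in_keys_iff split: if_splits)
    qed
    then have "supp e' \<in> \<Delta>" using down[OF e] by blast
    then show False using j(1) e'(1) by (auto simp: SR_def)
  qed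
qed

text \<open>Restriction to a face maps to a domain, and a multiplier with nonzero constant term does
  not become 0 there. Hence \<open>s * f \<in> SRD\<close> forces \<open>f\<close> to restrict to 0
  on every face.\<close>

lemma sat_SRD: "sat SRD = SRD"
proof
  show "sat SRD \<subseteq> SRD"
  proof
    fix f assume "f \<in> sat SRD"
    then obtain s where s: "coef s 0 \<noteq> 0" "s * f \<in> SRD" by (auto simp: sat_def)
    show "f \<in> SRD" unfolding SR_iff
    proof (intro allI impI)
      fix e :: "'v \<Rightarrow>\<^sub>0 nat" assume e: "supp e \<in> \<Delta>"
      let ?R = "restr (supp e)"
      have "?R (s * f) = 0"
      proof (rule poly_mapping_eqI)
        fix x show "coef (?R (s * f)) x = coef 0 x"
          using s(2) down[OF e, of "supp x"] by (simp add: lookup_restr SR_iff)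
      qed
      then have "?R s = 0 \<or> ?R f = 0" by (intro restr_domain) (auto simp: restr_mult)
      moreover have "?R s \<noteq> 0"
      proof
        assume "?R s = 0"
        then have "coef (?R s) 0 = 0" by simp
        then show False using s(1) by (simp add: lookup_restr)
      qed
      ultimately have "coef (?R f) e = 0" by simp
      then show "coef f e = 0" by (simp add: lookup_restr)
    qed
  qed
qed (rule sat_superset)

text \<open>The elementary symmetric function of degree \<open>i + 1\<close>: powers of \<open>theta 0, \<dots>, theta (d - 1)\<close> form a system of parameters.\<close>

definition theta :: "nat \<Rightarrow> (('v \<Rightarrow>\<^sub>0 nat) \<Rightarrow>\<^sub>0 'k)" where
  "theta i = (\<Sum>F\<in>{F. F \<subseteq> V \<and> card F = Suc i}. xA F 1)"

lemma keys_xA: "finite F \<Longrightarrow> n \<noteq> 0 \<Longrightarrow> supp (\<Sum>v\<in>F. mon v n) = F" for n :: nat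
  unfolding set_eq_iff in_keys_iff by (simp add: lookup_sum_single)

lemma xA_SR: "F \<subseteq> V \<Longrightarrow> F \<notin> \<Delta> \<Longrightarrow> xA F 1 \<in> SRD"
  using finF[of F] by (simp add: SR_def xA_def keys_xA del: One_nat_def)

lemma theta_0: "coef (theta i) 0 = 0"
  unfolding theta_def lookup_sum
proof (rule sum.neutral, rule ballI)
  fix F assume F: "F \<in> {F. F \<subseteq> V \<and> card F = Suc i}"
  then have "supp (\<Sum>v\<in>F. mon v (1::nat)) \<noteq> {}" using finF[of F] by (auto simp: keys_xA simp del: One_nat_def)
  then have "(\<Sum>v\<in>F. mon v (1::nat)) \<noteq> 0" by (metis keys_zero)
  then show "coef (xA F 1 :: ('v \<Rightarrow>\<^sub>0 nat) \<Rightarrow>\<^sub>0 'k) 0 = 0" by (simp add: xA_def lookup_single_not_eq)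
qed

lemma xA_union_int: "finite F \<Longrightarrow> finite G \<Longrightarrow> xA F 1 * xA G 1 = xA (F \<union> G) 1 * (xA (F \<inter> G) 1 :: ('v \<Rightarrow>\<^sub>0 nat) \<Rightarrow>\<^sub>0 'k)"
  using sum.union_inter[of F G "\<lambda>v. mon v (1::nat)"] by (simp add: xA_def mult_single)

text \<open>Descending induction on \<open>F\<close>. Multiplying \<open>theta i\<close>, for
  \<open>Suc i = card F\<close>, by the monomial of \<open>F\<close> gives the square of that
  monomial plus multiples of monomials of the strictly larger sets \<open>F \<union> G\<close>,
  which are in the radical by induction. Nonfaces are in \<open>SRD\<close> anyway.\<close>

lemma theta_rad:
  assumes d: "\<And>\<sigma>. \<sigma> \<in> \<Delta> \<Longrightarrow> card \<sigma> \<le> d" and T: "pideal T" "SRD \<subseteq> T" "\<And>i. i < d \<Longrightarrow> theta i \<in> rad T"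
  shows "F \<subseteq> V \<Longrightarrow> F \<noteq> {} \<Longrightarrow> xA F 1 \<in> rad T"
proof (induction "card V - card F" arbitrary: F rule: less_induct)
  case less
  note R = pideal_rad[OF T(1)]
  show ?case
  proof (cases "F \<in> \<Delta>")
    case False
    then show ?thesis using xA_SR[OF less.prems(1)] T(2) rad_superset by blast
  next
    case True
    have fF: "finite F" by (rule finF[OF less.prems(1)])
    have cF: "card F \<ge> 1" using less.prems(2) fF by (simp add: Suc_leI card_gt_0_iff)
    define i where "i = card F - 1"
    have i: "Suc i = card F" "i < d" using d[OF True] cF by (auto simp: i_def)
    let ?S = "{G. G \<subseteq> V \<and> card G = Suc i}"
    have finS: "finite ?S" using finV by simp
    have FS: "F \<in> ?S" using less.prems i by simp
    have "xA F 1 * xA G 1 \<in> rad T" if G: "G \<in> ?S - {F}" for G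
    proof -
      have fG: "finite G" "G \<subseteq> V" using G finF by auto
      have "\<not> G \<subseteq> F" using G i fF card_subset_eq[of F G] by auto
      then have "card F < card (F \<union> G)" using fF fG by (intro psubset_card_mono) auto
      moreover have "card (F \<union> G) \<le> card V" using less.prems(1) fG(2) finV by (intro card_mono) auto
      ultimately have "xA (F \<union> G) 1 \<in> rad T" using less.prems fG by (intro less.hyps) auto
      then show ?thesis unfolding xA_union_int[OF fF fG(1)] by (rule pideal_mult2[OF R])
    qed
    then have 1: "(\<Sum>G\<in>?S - {F}. xA F 1 * xA G 1) \<in> rad T" by (rule pideal_sum[OF R])
    have 2: "xA F 1 * theta i \<in> rad T" using T(3)[OF i(2)] by (rule pideal_mult[OF R])
    have "xA F 1 * theta i = xA F 1 * xA F 1 + (\<Sum>G\<in>?S - {F}. xA F 1 * xA G 1)"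
      unfolding theta_def sum_distrib_left using sum.remove[OF finS FS] by simp
    then have "xA F 1 ^ 2 \<in> rad T" using pideal_diff[OF R 2 1] by (simp add: power2_eq_square)
    then obtain n where "(xA F 1 ^ 2) ^ n \<in> T" by (auto simp: rad_def)
    then show ?thesis unfolding rad_def mem_Collect_eq by (metis power_mult)
  qed
qed

text \<open>Arbitrary positive exponents are allowed because the recursion of \<open>Wk\<close>
  replaces each element by a power of unknown size.\<close>

lemma theta_polysop:
  assumes d: "\<And>\<sigma>. \<sigma> \<in> \<Delta> \<Longrightarrow> card \<sigma> \<le> d" and N: "\<And>i. N i \<ge> (1::nat)"
  shows "polysop d (\<lambda>i. theta i ^ N i)"
  unfolding polysop_def
proof (intro conjI allI impI)
  show "coef (theta i ^ N i) 0 = 0" if "i < d" for i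
  proof -
    obtain n where "N i = Suc n" using N[of i] by (metis Suc_le_D One_nat_def)
    then show ?thesis by (simp add: theta_0)
  qed
  fix w
  let ?T = "spanmod (\<lambda>i. theta i ^ N i) d SRD"
  have T: "pideal ?T" "SRD \<subseteq> ?T" using pideal_spanmod[OF pSR] spanmod_base[OF pSR] by auto
  have th: "theta i \<in> rad ?T" if "i < d" for i
    using spanmod_gen[OF pSR that, of "\<lambda>i. theta i ^ N i"] by (auto simp: rad_def)
  show "\<exists>n. poly_var w ^ n \<in> sat ?T"
  proof (cases "w \<in> V")
    case True
    have "xA {w} 1 \<in> rad ?T" by (rule theta_rad[OF d T th]) (use True in auto)
    then show ?thesis using sat_superset[of ?T] by (auto simp: rad_def xA_def poly_var_def)
  next
    case False
    then have "poly_var w ^ 1 \<in> ?T" using var_SR T(2) by auto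
    then show ?thesis using sat_superset by blast
  qed
qed

text \<open>Saturating after every new generator or only once at the end makes no difference. This
  reconciles the recursion of \<open>Wk\<close> with the initial segments occurring in
  \<open>polyweak\<close>.\<close>

lemma sat_spanmod_step:
  assumes J: "pideal J"
  shows "sat (spanmod (\<lambda>_. x) 1 (sat (spanmod a i J))) = sat (spanmod (a(i := x)) (Suc i) J)"
proof
  let ?a = "a(i := x)"
  have P: "pideal (spanmod a i J)" by (rule pideal_spanmod[OF J])
  have P1: "pideal (sat (spanmod ?a (Suc i) J))" by (intro pideal_sat pideal_spanmod J)
  have "a l \<in> spanmod ?a (Suc i) J" if "l < i" for l
    using spanmod_gen[OF J, of l "Suc i" ?a] that by simp
  then have "spanmod a i J \<subseteq> spanmod ?a (Suc i) J"
    using spanmod_base[OF J] by (intro spanmod_minimal pideal_spanmod J) auto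
  then have "sat (spanmod a i J) \<subseteq> sat (spanmod ?a (Suc i) J)" by (rule sat_mono)
  moreover have "x \<in> sat (spanmod ?a (Suc i) J)"
    using spanmod_gen[OF J, of i "Suc i" ?a] sat_superset by auto
  ultimately have "spanmod (\<lambda>_. x) 1 (sat (spanmod a i J)) \<subseteq> sat (spanmod ?a (Suc i) J)"
    by (intro spanmod_minimal P1) auto
  then show "sat (spanmod (\<lambda>_. x) 1 (sat (spanmod a i J))) \<subseteq> sat (spanmod ?a (Suc i) J)"
    by (rule subset_trans[OF sat_mono]) simp
  have P2: "pideal (spanmod (\<lambda>_. x) 1 (sat (spanmod a i J)))" by (intro pideal_sat pideal_spanmod J)
  have sub: "spanmod a i J \<subseteq> spanmod (\<lambda>_. x) 1 (sat (spanmod a i J))"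
    using sat_superset[of "spanmod a i J"] spanmod_base[OF pideal_sat[OF P]] by blast
  have "?a l \<in> spanmod (\<lambda>_. x) 1 (sat (spanmod a i J))" if "l < Suc i" for l
  proof (cases "l = i")
    case True then show ?thesis using spanmod_gen[OF pideal_sat[OF P], of 0 1 "\<lambda>_. x"] by simp
  next
    case False then show ?thesis using spanmod_gen[OF J, of l i a] that sub by auto
  qed
  then have "spanmod ?a (Suc i) J \<subseteq> spanmod (\<lambda>_. x) 1 (sat (spanmod a i J))"
    using sub spanmod_base[OF J] by (intro spanmod_minimal P2) auto
  then show "sat (spanmod ?a (Suc i) J) \<subseteq> sat (spanmod (\<lambda>_. x) 1 (sat (spanmod a i J)))" by (rule sat_mono)
qed

text \<open>The power chosen at position \<open>i\<close> has to be remembered for all later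
  positions, so the induction runs over all exponent functions, and the hypothesis is applied to the
  one updated at \<open>i\<close>.\<close>

lemma Wk_theta:
  assumes w: "\<And>N. (\<And>i. N i \<ge> (1::nat)) \<Longrightarrow> polyweak d (\<lambda>i. theta i ^ N i)"
  shows "i \<le> d \<Longrightarrow> (\<And>i. N i \<ge> (1::nat)) \<Longrightarrow> Wk (sat (spanmod (\<lambda>i. theta i ^ N i) i SRD)) (map theta [i..<d])"
proof (induction "d - i" arbitrary: i N)
  case (Suc m)
  then have i: "i < d" "[i..<d] = i # [Suc i..<d]" by (auto simp: upt_conv_Cons)
  show ?case unfolding i list.map Wk.simps
  proof (intro conjI allI impI theta_0)
    fix n :: nat assume n: "1 \<le> n"
    define N' where "N' = N(i := n)"
    have N': "N' j \<ge> 1" for j using Suc.prems n by (simp add: N'_def)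
    have upd: "(\<lambda>j. theta j ^ N' j) = (\<lambda>j. theta j ^ N j)(i := theta i ^ n)" by (auto simp: N'_def fun_eq_iff)
    have eq: "spanmod (\<lambda>j. theta j ^ N' j) i SRD = spanmod (\<lambda>j. theta j ^ N j) i SRD"
      unfolding spanmod_def by (simp add: N'_def)
    show "poly_var w * f \<in> sat (spanmod (\<lambda>i. theta i ^ N i) i SRD)"
      if "theta i ^ n * f \<in> sat (spanmod (\<lambda>i. theta i ^ N i) i SRD)" for f w
    proof -
      have "f * theta i ^ N' i \<in> sat (spanmod (\<lambda>j. theta j ^ N' j) i SRD)"
        using that unfolding eq by (simp add: N'_def mult.commute)
      then have "f * poly_var w \<in> sat (spanmod (\<lambda>j. theta j ^ N' j) i SRD)"
        using w[of N', OF N'] i(1) unfolding polyweak_def by blast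
      then show ?thesis unfolding eq by (simp add: mult.commute)
    qed
    have "Wk (sat (spanmod (\<lambda>i. theta i ^ N' i) (Suc i) SRD)) (map theta [Suc i..<d])"
      using Suc.hyps(2) i N' by (intro Suc.hyps(1)) auto
    then show "Wk (sat (spanmod (\<lambda>_. theta i ^ n) 1 (sat (spanmod (\<lambda>i. theta i ^ N i) i SRD)))) (map theta [Suc i..<d])"
      unfolding sat_spanmod_step[OF pSR] upd .
  qed
qed simp

theorem buchsbaum_imp_cochain_exact:
  assumes B: "buchsbaum_complex k \<Delta>" and d: "\<And>\<sigma>. \<sigma> \<in> \<Delta> \<Longrightarrow> card \<sigma> \<le> d" "\<exists>\<sigma>\<in>\<Delta>. card \<sigma> = d"
    and F0: "F0 \<in> \<Delta>" "F0 \<noteq> {}" and p: "p < d"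
  shows "cochain_exact r k \<Delta> F0 p"
proof -
  have dim: "krull_dim Loc = enat d"
  proof (rule order_antisym)
    show "krull_dim Loc \<le> enat d" by (rule krull_dim_le[OF d(1)])
    obtain \<sigma> where "\<sigma> \<in> \<Delta>" "card \<sigma> = d" using d(2) by blast
    then show "enat d \<le> krull_dim Loc" using krull_dim_ge by blast
  qed
  have all: "\<forall>r a. enat r = krull_dim Loc \<and> polysop r a \<longrightarrow> polyweak r a"
    using B unfolding buchsbaum_iff by (rule conjunct2)
  have "polyweak d (\<lambda>i. theta i ^ N i)" if N: "\<And>i. N i \<ge> (1::nat)" for N
  proof (rule all[rule_format], rule conjI)
    show "polysop d (\<lambda>i. theta i ^ N i)" by (rule theta_polysop[OF d(1) N])
  qed (simp add: dim)
  then have "Wk (sat (spanmod (\<lambda>i. theta i ^ 1) 0 SRD)) (map theta [0..<d])"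
    by (intro Wk_theta[of d 0 "\<lambda>_. 1"]) auto
  moreover have "spanmod (\<lambda>i. theta i ^ 1) 0 SRD = SRD" by (auto simp: spanmod_def)
  ultimately have W: "Wk SRD (map theta [0..<d])" by (simp add: sat_SRD)
  have F0V: "F0 \<subseteq> V" using F0 by auto
  have fF0: "finite F0" by (rule finF[OF F0V])
  obtain v where v: "v \<in> F0" using F0 by blast
  \<comment> \<open>Exponent -2 on \<open>F0\<close> leaves room for multiplication by one variable
    of \<open>F0\<close>: in the resulting exponent \<open>e1\<close> all coordinates on
    \<open>F0\<close> are still negative. Both exponents thus have support and negative set
    \<open>F0\<close>, so they select the same faces.\<close>
  define e2 :: "'v \<Rightarrow>\<^sub>0 int" where "e2 = (\<Sum>u\<in>F0. mon u (-2))"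
  have le2: "coef e2 u = (if u \<in> F0 then -2 else 0)" for u
    unfolding e2_def by (rule lookup_sum_single[OF fF0])
  have neg2: "neg e2 = F0" by (auto simp: neg_def le2)
  have keys2: "supp e2 = F0" by (auto simp: in_keys_iff le2 split: if_splits)
  define e1 where "e1 = mon v 1 + e2"
  have le1: "coef e1 u = (if u = v then -1 else if u \<in> F0 then -2 else 0)" for u
    using v by (auto simp: e1_def lookup_add le2 lookup_single when_def)
  have keys1: "supp e1 = F0" using v by (auto simp: in_keys_iff le1 split: if_splits)
  have neg1: "neg e1 = F0" using v by (auto simp: neg_def le1 split: if_splits)
  show ?thesis
    unfolding cochain_exact_def
  proof (intro allI impI)
    fix g :: "'v set \<Rightarrow> 'k"
    assume g: "\<forall>F\<in>\<Delta>. F0 \<subseteq> F \<longrightarrow> card F = Suc p \<longrightarrow> (\<Sum>u\<in>F - F0. sg r u F (g (F - {u}))) = 0"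
    define c where "c F = (if F0 \<subseteq> F \<and> F \<in> \<Delta> then mon e2 (g F) else 0)" for F
    have cU: "c F \<in> JF UNIV F" if "F \<subseteq> V" for F
      using finF[OF that] neg2 by (auto simp: c_def JF_0 intro!: JF_UNIV_I split: if_splits)
    have "cocyc SRD p c"
      unfolding cocyc_def coch_def
    proof (intro conjI allI impI cU)
      fix F assume F: "F \<subseteq> V" "card F = Suc p"
      have DU: "D c F \<in> JF UNIV F" by (rule D_JF[OF pideal_UNIV F]) (rule cU)
      show "D c F \<in> JF SRD F"
      proof (cases "F \<in> \<Delta>")
        case False
        show ?thesis
        proof (rule JF_SR_I[OF F(1)], rule conjI)
          fix e assume e: "e \<in> supp (D c F)"
          show "neg e \<subseteq> F" by (rule JF_UNIV_D[OF finF[OF F(1)] DU e])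
          show "supp e \<union> F \<notin> \<Delta>" using False down by blast
        qed
      next
        case True
        have "D c F = 0"
        proof (cases "F0 \<subseteq> F")
          case False
          then show ?thesis unfolding dn_def c_def by (intro sum.neutral) auto
        next
          case F0F: True
          have "D c F = (\<Sum>u\<in>F - F0. sg r u F (c (F - {u})))"
            unfolding dn_def by (rule sum.mono_neutral_right) (use finF[OF F(1)] in \<open>auto simp: c_def\<close>)
          also have "\<dots> = (\<Sum>u\<in>F - F0. mon e2 (sg r u F (g (F - {u}))))"
          proof (rule sum.cong[OF refl])
            fix u assume u: "u \<in> F - F0"
            have "F - {u} \<in> \<Delta>" using True down by blast
            then have "c (F - {u}) = mon e2 (g (F - {u}))" using u F0F by (auto simp: c_def)
            then show "sg r u F (c (F - {u})) = mon e2 (sg r u F (g (F - {u})))"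
              by (simp add: sg_def single_uminus)
          qed
          also have "\<dots> = mon e2 (\<Sum>u\<in>F - F0. sg r u F (g (F - {u})))"
            by (rule additive_fun_sum[symmetric]) (simp add: additive_fun_def single_add)
          also have "\<dots> = 0" using g True F0F F by simp
          finally show ?thesis .
        qed
        then show ?thesis by (simp add: JF_0[OF pSR])
      qed
    qed
    then obtain s where s: "coef s 0 \<noteq> 0" "cobd SRD p (\<lambda>F. lau (s * poly_var v) * c F)"
      using cech_killed[OF pSR order_refl sat_SRD W, of p c v] p by auto
    then obtain b where b: "\<And>G. G \<subseteq> V \<Longrightarrow> Suc (card G) = p \<Longrightarrow> b G \<in> JF UNIV G"
      "\<And>F. F \<subseteq> V \<Longrightarrow> card F = p \<Longrightarrow> lau (s * poly_var v) * c F - D b F \<in> JF SRD F" unfolding cobd_def coch_def by blast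
    \<comment> \<open>At exponent \<open>e1\<close> only the constant term of \<open>s\<close>
      contributes to the product with \<open>poly_var v\<close> and \<open>c F\<close>; comparing
      coefficients there leaves a division by a nonzero field element.\<close>
    define s0 where "s0 = coef s 0"
    define h where "h G = coef (b G) e1 / s0" for G
    have "g F = (\<Sum>u\<in>F - F0. sg r u F (h (F - {u})))" if F: "F \<in> \<Delta>" "F0 \<subseteq> F" "card F = p" for F
    proof -
      have FV: "F \<subseteq> V" using F by auto
      have "supp e1 \<union> F \<in> \<Delta>" using keys1 F by (simp add: Un_absorb1)
      then have "coef (lau (s * poly_var v) * c F - D b F) e1 = 0"
        by (intro JF_SR_D[OF FV b(2)[OF FV F(3)]])
      then have 1: "coef (lau (s * poly_var v) * c F) e1 = coef (D b F) e1" by (simp add: lookup_minus)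
      have il1: "mon v 1 = il (mon v 1)" by (simp add: il_def)
      have "coef (lau (s * poly_var v) * c F) e1 = coef (s * poly_var v) (mon v 1) * g F"
        unfolding e1_def using F by (simp add: c_def lookup_mult_single il1 lookup_lau)
      also have "coef (s * poly_var v) (mon v 1) = s0"
        using lookup_mult_single[of s "mon v 1" 1 0] by (simp add: poly_var_def s0_def)
      finally have 2: "s0 * g F = coef (D b F) e1" using 1 by simp
      have "coef (D b F) e1 = (\<Sum>u\<in>F. sg r u F (coef (b (F - {u})) e1))"
        unfolding dn_def lookup_sum by (rule sum.cong) (auto simp: sg_def)
      \<comment> \<open>A negative coordinate at \<open>u\<close> requires \<open>u\<close> in the
        denominator, so \<open>b (F - {u})\<close> has no term with exponent \<open>e1\<close> when
        \<open>u \<in> F0\<close>.\<close>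
      also have "\<dots> = (\<Sum>u\<in>F - F0. sg r u F (coef (b (F - {u})) e1))"
      proof (rule sum.mono_neutral_right)
        show "\<forall>u\<in>F - (F - F0). sg r u F (coef (b (F - {u})) e1) = 0"
        proof
          fix u assume u: "u \<in> F - (F - F0)"
          have "b (F - {u}) \<in> JF UNIV (F - {u})"
            using FV u F(3) finF[OF FV] card_Suc_Diff1[of F u] by (intro b) (auto simp del: card_Diff_insert)
          then have "e1 \<notin> supp (b (F - {u}))"
            using JF_UNIV_D[of "F - {u}" "b (F - {u})" e1] finF[OF FV] neg1 u by auto
          then show "sg r u F (coef (b (F - {u})) e1) = 0" by (simp add: in_keys_iff)
        qed
      qed (use finF[OF FV] in auto)
      also have "\<dots> = s0 * (\<Sum>u\<in>F - F0. sg r u F (h (F - {u})))"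
        unfolding sum_distrib_left using s by (intro sum.cong) (auto simp: h_def sg_mult s0_def)
      finally show ?thesis using 2 s by (simp add: s0_def)
    qed
    then show "\<exists>h. \<forall>F\<in>\<Delta>. F0 \<subseteq> F \<longrightarrow> card F = p \<longrightarrow> g F = (\<Sum>u\<in>F - F0. sg r u F (h (F - {u})))" by blast
  qed
qed


section \<open>The Buchsbaum property from exactness conditions\<close>

text \<open>\<open>\<Omega>\<close> is a set of Laurent exponents: the elements of the localized face ring (up to the ideal) supported in degrees in \<open>\<Omega>\<close>.\<close>

definition graded_part where
  "graded_part \<Omega> F = {f :: ('v \<Rightarrow>\<^sub>0 int) \<Rightarrow>\<^sub>0 'k. \<forall>e\<in>supp f. neg e \<subseteq> F \<and> (e \<in> \<Omega> \<or> supp e \<union> F \<notin> \<Delta>)}"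

text \<open>Closure of the exponents under multiplication by monomials; the graded parts are then
  modules over the polynomial ring (\<open>graded_part_lmult\<close>).\<close>

definition up_closed where "up_closed \<Omega> \<longleftrightarrow> (\<forall>e\<in>\<Omega>. \<forall>x :: 'v \<Rightarrow>\<^sub>0 nat. il x + e \<in> \<Omega>)"

lemma graded_part_0: "0 \<in> graded_part \<Omega> F" by (simp add: graded_part_def)
lemma graded_part_add: "f \<in> graded_part \<Omega> F \<Longrightarrow> g \<in> graded_part \<Omega> F \<Longrightarrow> f + g \<in> graded_part \<Omega> F"
  unfolding graded_part_def using keys_add[of f g] by blast
lemma graded_part_minus: "f \<in> graded_part \<Omega> F \<Longrightarrow> - f \<in> graded_part \<Omega> F"
  unfolding graded_part_def by (simp add: in_keys_iff)
lemma graded_part_diff: "f \<in> graded_part \<Omega> F \<Longrightarrow> g \<in> graded_part \<Omega> F \<Longrightarrow> f - g \<in> graded_part \<Omega> F"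
  using graded_part_add[of f \<Omega> F "- g"] graded_part_minus by simp
lemma graded_part_sum: "(\<And>i. i \<in> A \<Longrightarrow> f i \<in> graded_part \<Omega> F) \<Longrightarrow> (\<Sum>i\<in>A. f i) \<in> graded_part \<Omega> F"
  by (induction A rule: infinite_finite_induct) (auto simp: graded_part_0 graded_part_add)
lemma graded_part_sg: "f \<in> graded_part \<Omega> F \<Longrightarrow> sg \<rho> u G f \<in> graded_part \<Omega> F" by (simp add: sg_def graded_part_minus)
lemma graded_part_mono: "\<Omega> \<subseteq> \<Omega>' \<Longrightarrow> f \<in> graded_part \<Omega> F \<Longrightarrow> f \<in> graded_part \<Omega>' F" unfolding graded_part_def by blast
lemma graded_part_subset: "F \<subseteq> G \<Longrightarrow> f \<in> graded_part \<Omega> F \<Longrightarrow> f \<in> graded_part \<Omega> G"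
  unfolding graded_part_def mem_Collect_eq
proof
  fix e assume FG: "F \<subseteq> G" and *: "\<forall>e\<in>supp f. neg e \<subseteq> F \<and> (e \<in> \<Omega> \<or> supp e \<union> F \<notin> \<Delta>)" and e: "e \<in> supp f"
  have "supp e \<union> G \<in> \<Delta> \<Longrightarrow> supp e \<union> F \<in> \<Delta>" by (erule down) (use FG in auto)
  then show "neg e \<subseteq> G \<and> (e \<in> \<Omega> \<or> supp e \<union> G \<notin> \<Delta>)" using * e FG by blast
qed

lemma graded_part_UNIV: "finite F \<Longrightarrow> graded_part UNIV F = JF UNIV F"
proof
  assume F: "finite F"
  show "graded_part UNIV F \<subseteq> JF UNIV F" by (auto simp: graded_part_def intro!: JF_UNIV_I[OF F])
  show "JF UNIV F \<subseteq> graded_part UNIV F" using JF_UNIV_D[OF F] unfolding graded_part_def by blast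
qed

lemma graded_part_empty: "F \<subseteq> V \<Longrightarrow> graded_part {} F = JF SRD F"
proof
  assume F: "F \<subseteq> V"
  show "graded_part {} F \<subseteq> JF SRD F" by (auto simp: graded_part_def intro!: JF_SR_I[OF F])
  show "JF SRD F \<subseteq> graded_part {} F"
  proof
    fix f assume f: "f \<in> JF SRD F"
    have fU: "f \<in> JF UNIV F" using f JF_mono[of SRD UNIV F] by blast
    show "f \<in> graded_part {} F" unfolding graded_part_def mem_Collect_eq
    proof
      fix e assume e: "e \<in> supp f"
      then have "supp e \<union> F \<notin> \<Delta>" using JF_SR_D[OF F f] by (auto simp: in_keys_iff)
      then show "neg e \<subseteq> F \<and> (e \<in> {} \<or> supp e \<union> F \<notin> \<Delta>)" using JF_UNIV_D[OF finF[OF F] fU e] by blast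
    qed
  qed
qed

text \<open>Coordinates outside \<open>F\<close> are nonnegative, so multiplication by a monomial
  cannot shrink the support together with \<open>F\<close>. Terms that vanish modulo the
  Stanley-Reisner ideal therefore continue to vanish.\<close>

lemma graded_part_lmult_gen:
  assumes f: "f \<in> graded_part \<Omega> F" and a: "\<And>x e. x \<in> supp a \<Longrightarrow> e \<in> \<Omega> \<Longrightarrow> il x + e \<in> \<Omega>'"
  shows "lau a * f \<in> graded_part \<Omega>' F"
  unfolding graded_part_def mem_Collect_eq
proof
  fix e' assume "e' \<in> supp (lau a * f)"
  then obtain y e where ye: "y \<in> supp (lau a)" "e \<in> supp f" "e' = y + e" using keys_mult_ex by blast
  then obtain x where x: "x \<in> supp a" "y = il x" using keys_lau by blast
  have e: "neg e \<subseteq> F" "e \<in> \<Omega> \<or> supp e \<union> F \<notin> \<Delta>" using f ye(2) by (auto simp: graded_part_def)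
  have n: "neg e' \<subseteq> neg e" unfolding ye(3) x(2) neg_def by (auto simp: lookup_add)
  have "supp e \<union> F \<subseteq> supp e' \<union> F"
  proof
    fix v assume v: "v \<in> supp e \<union> F"
    show "v \<in> supp e' \<union> F"
    proof (cases "v \<in> F")
      case False
      then have "coef e v \<noteq> 0" "\<not> coef e v < 0" using v e(1) by (auto simp: neg_def in_keys_iff)
      then have "coef e' v \<noteq> 0" by (simp add: ye(3) x(2) lookup_add)
      then show ?thesis by (simp add: in_keys_iff)
    qed simp
  qed
  then have "supp e \<union> F \<notin> \<Delta> \<Longrightarrow> supp e' \<union> F \<notin> \<Delta>" using down by blast
  then show "neg e' \<subseteq> F \<and> (e' \<in> \<Omega>' \<or> supp e' \<union> F \<notin> \<Delta>)" using e n a[OF x(1), of e] ye(3) x(2) by blast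
qed

lemma graded_part_lmult: "up_closed \<Omega> \<Longrightarrow> f \<in> graded_part \<Omega> F \<Longrightarrow> lau a * f \<in> graded_part \<Omega> F"
  by (rule graded_part_lmult_gen) (auto simp: up_closed_def)

lemma up_closed_triv [simp]: "up_closed UNIV" "up_closed {}" by (auto simp: up_closed_def)

lemma D_graded_part:
  assumes F: "F \<subseteq> V" "card F = p" and b: "\<And>G. G \<subseteq> V \<Longrightarrow> Suc (card G) = p \<Longrightarrow> b G \<in> graded_part \<Omega> G"
  shows "D b F \<in> graded_part \<Omega> F"
  unfolding dn_def
proof (intro graded_part_sum graded_part_sg)
  fix u assume u: "u \<in> F"
  have "b (F - {u}) \<in> graded_part \<Omega> (F - {u})" using F u finF[OF F(1)] card_Suc_Diff1[of F u] by (intro b) (auto simp del: card_Diff_insert)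
  then show "b (F - {u}) \<in> graded_part \<Omega> F" by (rule graded_part_subset[rotated]) auto
qed

text \<open>Exactness in Cech degree \<open>l\<close> of the subquotient with exponents in \<Omega>
  but not in \<Omega>': what lies in \<Omega>', or dies in the face ring, counts as zero.\<close>

definition exact_at where
  "exact_at \<Omega> \<Omega>' l \<longleftrightarrow> (\<forall>c. (\<forall>F\<subseteq>V. card F = l \<longrightarrow> c F \<in> graded_part \<Omega> F) \<longrightarrow> (\<forall>F\<subseteq>V. card F = Suc l \<longrightarrow> D c F \<in> graded_part \<Omega>' F) \<longrightarrow>
     (\<exists>b. (\<forall>G\<subseteq>V. Suc (card G) = l \<longrightarrow> b G \<in> graded_part \<Omega> G) \<and> (\<forall>F\<subseteq>V. card F = l \<longrightarrow> c F - D b F \<in> graded_part \<Omega>' F)))"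

definition local_exact where
  "local_exact e l \<longleftrightarrow> (\<forall>g :: 'v set \<Rightarrow> 'k.
     (\<forall>F\<subseteq>V. neg e \<subseteq> F \<longrightarrow> supp e \<union> F \<in> \<Delta> \<longrightarrow> card F = Suc l \<longrightarrow> (\<Sum>u\<in>F - neg e. sg r u F (g (F - {u}))) = 0) \<longrightarrow>
     (\<exists>h. \<forall>F\<subseteq>V. neg e \<subseteq> F \<longrightarrow> supp e \<union> F \<in> \<Delta> \<longrightarrow> card F = l \<longrightarrow> g F = (\<Sum>u\<in>F - neg e. sg r u F (h (F - {u})))))"

lemma lookup_D: "coef (D b F) e = (\<Sum>u\<in>F. sg r u F (coef (b (F - {u})) e))"
  unfolding dn_def lookup_sum by (rule sum.cong) (auto simp: sg_def)

text \<open>The Cech differential preserves exponents, so the complex is a direct sum over them. A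
  cochain involves finitely many exponents, and the solutions for these are added up.\<close>

lemma exact_at_I:
  assumes sub: "\<Omega>' \<subseteq> \<Omega>" and loc: "\<And>e. e \<in> \<Omega> \<Longrightarrow> e \<notin> \<Omega>' \<Longrightarrow> local_exact e l"
  shows "exact_at \<Omega> \<Omega>' l"
  unfolding exact_at_def
proof (intro allI impI)
  fix c assume c: "\<forall>F\<subseteq>V. card F = l \<longrightarrow> c F \<in> graded_part \<Omega> F" and Dc: "\<forall>F\<subseteq>V. card F = Suc l \<longrightarrow> D c F \<in> graded_part \<Omega>' F"
  define E where "E = (\<Union>F\<in>{F. F \<subseteq> V}. supp (c F)) \<inter> (\<Omega> - \<Omega>')"
  have finE: "finite E" unfolding E_def using finV by (intro finite_Int) (auto simp: Pow_def[symmetric])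
  have split: "(\<Sum>u\<in>F. sg r u F (coef (b (F - {u})) e)) = (\<Sum>u\<in>F - neg e. sg r u F (coef (b (F - {u})) e))"
    if F: "F \<subseteq> V" and b: "\<And>u. u \<in> F \<Longrightarrow> u \<in> neg e \<Longrightarrow> coef (b (F - {u})) e = 0" for F e and b :: "'v set \<Rightarrow> ('v \<Rightarrow>\<^sub>0 int) \<Rightarrow>\<^sub>0 'k"
    using finF[OF F] b by (intro sum.mono_neutral_right) auto
  have "\<exists>h. e \<in> \<Omega> - \<Omega>' \<longrightarrow> (\<forall>F\<subseteq>V. neg e \<subseteq> F \<longrightarrow> supp e \<union> F \<in> \<Delta> \<longrightarrow> card F = l \<longrightarrow>
      coef (c F) e = (\<Sum>u\<in>F - neg e. sg r u F (h (F - {u}))))" for e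
  proof (cases "e \<in> \<Omega> - \<Omega>'")
    case True
    then have le: "local_exact e l" using loc by auto
    have "(\<Sum>u\<in>F - neg e. sg r u F (coef (c (F - {u})) e)) = 0"
      if F: "F \<subseteq> V" "neg e \<subseteq> F" "supp e \<union> F \<in> \<Delta>" "card F = Suc l" for F
    proof -
      have "D c F \<in> graded_part \<Omega>' F" using Dc F by blast
      then have "e \<notin> supp (D c F)" using True F by (auto simp: graded_part_def)
      then have "coef (D c F) e = 0" by (simp add: in_keys_iff)
      moreover have "coef (c (F - {u})) e = 0" if u: "u \<in> F" "u \<in> neg e" for u
      proof -
        have "c (F - {u}) \<in> graded_part \<Omega> (F - {u})" 
        proof -
          have "F - {u} \<subseteq> V" "card (F - {u}) = l" using F u finF[OF F(1)] card_Suc_Diff1[of F u] by auto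
          then show ?thesis using c by blast
        qed
        then have "e \<notin> supp (c (F - {u}))" using u(2) unfolding graded_part_def by blast
        then show ?thesis by (simp add: in_keys_iff)
      qed
      ultimately show ?thesis using split[OF F(1), of e c] by (simp add: lookup_D)
    qed
    then have "\<forall>F\<subseteq>V. neg e \<subseteq> F \<longrightarrow> supp e \<union> F \<in> \<Delta> \<longrightarrow> card F = Suc l \<longrightarrow> (\<Sum>u\<in>F - neg e. sg r u F (coef (c (F - {u})) e)) = 0"
      by simp
    from le[unfolded local_exact_def, THEN spec[where x = "\<lambda>F. coef (c F) e"], THEN mp, OF this]
    obtain h where "\<forall>F\<subseteq>V. neg e \<subseteq> F \<longrightarrow> supp e \<union> F \<in> \<Delta> \<longrightarrow> card F = l \<longrightarrow>
      coef (c F) e = (\<Sum>u\<in>F - neg e. sg r u F (h (F - {u})))" ..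
    then show ?thesis by (intro exI[of _ h] impI)
  qed auto
  then have "\<forall>e. \<exists>h. e \<in> \<Omega> - \<Omega>' \<longrightarrow> (\<forall>F\<subseteq>V. neg e \<subseteq> F \<longrightarrow> supp e \<union> F \<in> \<Delta> \<longrightarrow> card F = l \<longrightarrow>
      coef (c F) e = (\<Sum>u\<in>F - neg e. sg r u F (h (F - {u}))))" by (rule allI)
  from choice[OF this] obtain h where h': "\<forall>e. e \<in> \<Omega> - \<Omega>' \<longrightarrow> (\<forall>F\<subseteq>V. neg e \<subseteq> F \<longrightarrow> supp e \<union> F \<in> \<Delta> \<longrightarrow> card F = l \<longrightarrow>
      coef (c F) e = (\<Sum>u\<in>F - neg e. sg r u F (h e (F - {u}))))" ..
  have h: "\<And>e F. e \<in> \<Omega> - \<Omega>' \<Longrightarrow> F \<subseteq> V \<Longrightarrow> neg e \<subseteq> F \<Longrightarrow> supp e \<union> F \<in> \<Delta> \<Longrightarrow> card F = l \<Longrightarrow>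
      coef (c F) e = (\<Sum>u\<in>F - neg e. sg r u F (h e (F - {u})))" using h' by simp
  define b where "b G = (\<Sum>e\<in>E. mon e (if neg e \<subseteq> G then h e G else 0))" for G
  have lb: "coef (b G) e = (if e \<in> E \<and> neg e \<subseteq> G then h e G else 0)" for G e
    unfolding b_def by (subst lookup_sum_single[OF finE]) auto
  have bAO: "b G \<in> graded_part \<Omega> G" for G
  proof -
    have "neg e \<subseteq> G \<and> e \<in> \<Omega>" if "e \<in> supp (b G)" for e
      using that by (auto simp: in_keys_iff lb E_def split: if_splits)
    then show ?thesis unfolding graded_part_def by blast
  qed
  have "c F - D b F \<in> graded_part \<Omega>' F" if F: "F \<subseteq> V" "card F = l" for F
  proof -
    have cF: "c F \<in> graded_part \<Omega> F" using c F by blast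
    have "c F - D b F \<in> graded_part \<Omega> F" by (intro graded_part_diff cF D_graded_part[OF F]) (rule bAO)
    moreover have "e \<in> \<Omega>' \<or> supp e \<union> F \<notin> \<Delta>" if e: "e \<in> supp (c F - D b F)" "e \<in> \<Omega>" "neg e \<subseteq> F" for e
    proof (rule ccontr)
      assume "\<not> ?thesis"
      then have n: "e \<in> \<Omega> - \<Omega>'" "supp e \<union> F \<in> \<Delta>" using e by auto
      have "coef (D b F) e = (\<Sum>u\<in>F - neg e. sg r u F (coef (b (F - {u})) e))"
        unfolding lookup_D by (rule split[OF F(1)]) (auto simp: lb)
      also have "\<dots> = coef (c F) e"
      proof (cases "e \<in> E")
        case True
        have "(\<Sum>u\<in>F - neg e. sg r u F (coef (b (F - {u})) e)) = (\<Sum>u\<in>F - neg e. sg r u F (h e (F - {u})))"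
          by (rule sum.cong) (use True e(3) in \<open>auto simp: lb\<close>)
        then show ?thesis using h[OF n(1) F(1) e(3) n(2) F(2)] by simp
      next
        case False
        then have "e \<notin> supp (c F)" using n(1) F(1) by (auto simp: E_def)
        then show ?thesis using False by (simp add: lb in_keys_iff)
      qed
      finally have "coef (c F - D b F) e = 0" by (simp add: lookup_minus)
      then show False using e(1) by (simp add: in_keys_iff)
    qed
    ultimately show ?thesis unfolding graded_part_def by blast
  qed
  then show "\<exists>b. (\<forall>G\<subseteq>V. Suc (card G) = l \<longrightarrow> b G \<in> graded_part \<Omega> G) \<and> (\<forall>F\<subseteq>V. card F = l \<longrightarrow> c F - D b F \<in> graded_part \<Omega>' F)"
    using bAO by blast
qed

text \<open>A vertex \<open>w\<close> with positive exponent is in the support already, so adding it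
  to \<open>F\<close> does not affect whether \<open>supp e \<union> F\<close> is a face. The piece
  is a cone with apex \<open>w\<close>, and \<open>up_dn\<close> contracts it.\<close>

lemma local_exact_pos:
  assumes w: "0 < coef e w"
  shows "local_exact e l"
proof (cases "w \<in> V")
  case False
  have "w \<in> supp e" using w by (auto simp: in_keys_iff)
  then have "supp e \<union> F \<notin> \<Delta>" for F using False by blast
  then show ?thesis unfolding local_exact_def by blast
next
  case True
  have wk: "w \<in> supp e" "w \<notin> neg e" using w by (auto simp: in_keys_iff neg_def)
  show ?thesis unfolding local_exact_def
  proof (intro allI impI)
    fix g :: "'v set \<Rightarrow> 'k"
    assume g: "\<forall>F\<subseteq>V. neg e \<subseteq> F \<longrightarrow> supp e \<union> F \<in> \<Delta> \<longrightarrow> card F = Suc l \<longrightarrow> (\<Sum>u\<in>F - neg e. sg r u F (g (F - {u}))) = 0"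
    define g' where "g' F = (if neg e \<subseteq> F then g F else 0)" for F
    define x where "x u m = (if u = w then m else 0)" for u and m :: 'k
    have addx: "additive_fun (x u)" for u by (simp add: x_def additive_fun_def)
    have upx: "up r V x z F = (if w \<in> F then 0 else sg r w F (z (insert w F)))" for z F
    proof -
      have "up r V x z F = (\<Sum>u\<in>V - F. if u = w then sg r w F (z (insert w F)) else 0)"
        unfolding up_def by (intro sum.cong refl) (auto simp: x_def)
      then show ?thesis using True finV by (auto simp: sum.delta)
    qed
    have master: "up r V x (dn r idw g') F + dn r idw (up r V x g') F = g' F" if F: "F \<subseteq> V" for F
    proof -
      have "up r V x (dn r idw g') F + dn r idw (up r V x g') F = (\<Sum>u\<in>V. x u (g' F))"
        by (rule up_dn[OF finV inj_r F]) (auto simp: addx)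
      also have "\<dots> = g' F" using True finV by (simp add: x_def sum.delta)
      finally show ?thesis .
    qed
    have "g F = (\<Sum>u\<in>F - neg e. sg r u F (up r V x g' (F - {u})))"
      if F: "F \<subseteq> V" "neg e \<subseteq> F" "supp e \<union> F \<in> \<Delta>" "card F = l" for F
    proof -
      have "up r V x (dn r idw g') F = 0"
      proof (cases "w \<in> F")
        case False
        let ?F = "insert w F"
        have "dn r idw g' ?F = (\<Sum>u\<in>?F - neg e. sg r u ?F (g' (?F - {u})))"
          unfolding dn_def by (rule sum.mono_neutral_right) (use finF[OF F(1)] in \<open>auto simp: g'_def\<close>)
        also have "\<dots> = (\<Sum>u\<in>?F - neg e. sg r u ?F (g (?F - {u})))"
          by (rule sum.cong) (use F(2) in \<open>auto simp: g'_def\<close>)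
        also have "\<dots> = 0"
        proof -
          have "supp e \<union> ?F = supp e \<union> F" using wk by auto
          moreover have "?F \<subseteq> V" "neg e \<subseteq> ?F" "card ?F = Suc l" using F True False finF[OF F(1)] by auto
          ultimately show ?thesis using g F(3) by presburger
        qed
        finally show ?thesis using upx[of "dn r idw g'" F] False by simp
      qed (simp add: upx)
      then have "g F = dn r idw (up r V x g') F" using master[OF F(1)] F(2) by (simp add: g'_def)
      also have "\<dots> = (\<Sum>u\<in>F - neg e. sg r u F (up r V x g' (F - {u})))"
        unfolding dn_def
      proof (rule sum.mono_neutral_right)
        show "\<forall>u\<in>F - (F - neg e). sg r u F (up r V x g' (F - {u})) = 0"
          using wk(2) by (auto simp: upx g'_def)
      qed (use finF[OF F(1)] in auto)
      finally show ?thesis .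
    qed
    then show "\<exists>h. \<forall>F\<subseteq>V. neg e \<subseteq> F \<longrightarrow> supp e \<union> F \<in> \<Delta> \<longrightarrow> card F = l \<longrightarrow> g F = (\<Sum>u\<in>F - neg e. sg r u F (h (F - {u})))"
      by (intro exI[of _ "up r V x g'"]) blast
  qed
qed

text \<open>For a nonpositive exponent the support equals the negative set, so the relevant sets are
  the faces containing \<open>neg e\<close>. With \<open>local_exact_pos\<close> this covers all
  exponents but 0, the one that sees the cohomology of \<Delta> itself.\<close>

lemma local_exact_neg:
  assumes e: "\<And>v. coef e v \<le> 0" "e \<noteq> 0" and L: "\<And>F0. F0 \<in> \<Delta> \<Longrightarrow> F0 \<noteq> {} \<Longrightarrow> cochain_exact r k \<Delta> F0 l"
  shows "local_exact e l"
proof -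
  have nk: "neg e = supp e" using e(1) by (auto simp: neg_def in_keys_iff order.strict_iff_order)
  have ne: "neg e \<noteq> {}" unfolding nk using e(2) by simp
  show ?thesis
  proof (cases "neg e \<in> \<Delta>")
    case False
    then have "\<not> (neg e \<subseteq> F \<and> supp e \<union> F \<in> \<Delta>)" for F using down by blast
    then show ?thesis unfolding local_exact_def by blast
  next
    case True
    have cochain_exact: "cochain_exact r k \<Delta> (neg e) l" by (rule L[OF True ne])
    have iff: "(F \<subseteq> V \<and> neg e \<subseteq> F \<and> supp e \<union> F \<in> \<Delta>) \<longleftrightarrow> (F \<in> \<Delta> \<and> neg e \<subseteq> F)" for F
      unfolding nk[symmetric] by (metis Un_absorb1 Union_upper)
    show ?thesis unfolding local_exact_def
    proof (intro allI impI)
      fix g :: "'v set \<Rightarrow> 'k"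
      assume g: "\<forall>F\<subseteq>V. neg e \<subseteq> F \<longrightarrow> supp e \<union> F \<in> \<Delta> \<longrightarrow> card F = Suc l \<longrightarrow> (\<Sum>u\<in>F - neg e. sg r u F (g (F - {u}))) = 0"
      then have "\<forall>F\<in>\<Delta>. neg e \<subseteq> F \<longrightarrow> card F = Suc l \<longrightarrow> (\<Sum>u\<in>F - neg e. sg r u F (g (F - {u}))) = 0"
        using iff by blast
      then obtain h where "\<forall>F\<in>\<Delta>. neg e \<subseteq> F \<longrightarrow> card F = l \<longrightarrow> g F = (\<Sum>u\<in>F - neg e. sg r u F (h (F - {u})))"
        using cochain_exact unfolding cochain_exact_def by blast
      then show "\<exists>h. \<forall>F\<subseteq>V. neg e \<subseteq> F \<longrightarrow> supp e \<union> F \<in> \<Delta> \<longrightarrow> card F = l \<longrightarrow> g F = (\<Sum>u\<in>F - neg e. sg r u F (h (F - {u})))"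
        using iff by blast
    qed
  qed
qed

text \<open>The Koszul differential, applied to a family of Cech cochains indexed by sets of positions.\<close>

abbreviation KU where "KU n a z P F \<equiv> up (\<lambda>i. i) {..<n} (\<lambda>i m. lau (a i) * m) (\<lambda>P. z P F) P"

section \<open>The double complex of Koszul and Cech cochains\<close>

lemma KU_graded_part:
  assumes "up_closed \<Omega>" and P: "P \<subseteq> {..<n}" "card P = l"
    and z: "\<And>P. P \<subseteq> {..<n} \<Longrightarrow> card P = Suc l \<Longrightarrow> z P F \<in> graded_part \<Omega> F"
  shows "KU n a z P F \<in> graded_part \<Omega> F"
  unfolding up_def
proof (intro graded_part_sum graded_part_sg graded_part_lmult assms(1))
  fix i assume i: "i \<in> {..<n} - P"
  have "finite P" using P(1) finite_subset by blast
  then show "z (insert i P) F \<in> graded_part \<Omega> F" using i P by (intro z) auto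
qed

lemma KU_D: "KU n a (\<lambda>P F. D (z P) F) P F = D (\<lambda>F. KU n a z P F) F"
proof -
  have "KU n a (\<lambda>P F. D (z P) F) P F = (\<Sum>u\<in>{..<n} - P. \<Sum>v\<in>F. sg (\<lambda>i. i) u P (sg r v F (lau (a u) * z (insert u P) (F - {v}))))"
    by (simp add: up_def dn_def sum_distrib_left additive_fun_sum[OF additive_sg] sg_mult)
  also have "\<dots> = (\<Sum>v\<in>F. \<Sum>u\<in>{..<n} - P. sg r v F (sg (\<lambda>i. i) u P (lau (a u) * z (insert u P) (F - {v}))))"
    by (subst sum.swap) (intro sum.cong refl sg_commute)
  also have "\<dots> = D (\<lambda>F. KU n a z P F) F"
    by (simp add: up_def dn_def additive_fun_sum[OF additive_sg])
  finally show ?thesis .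
qed

lemma KU_KU: "P \<subseteq> {..<n} \<Longrightarrow> up (\<lambda>i. i) {..<n} (\<lambda>i m. lau (a i) * m) (up (\<lambda>i. i) {..<n} (\<lambda>i m. lau (a i) * m) z) P = 0"
  by (rule up_up) (auto simp: mult.left_commute)

lemma KU_diff: "up (\<lambda>i. i) {..<n} (\<lambda>i m. lau (a i) * m) (\<lambda>P. z P - y P) P = up (\<lambda>i. i) {..<n} (\<lambda>i m. lau (a i) * m) z P - up (\<lambda>i. i) {..<n} (\<lambda>i m. lau (a i) * m) y P"
  by (rule up_minus) simp

lemma D_diff: "D (\<lambda>F. z F - y F) F = D z F - D y F" by (rule dn_minus) simp

text \<open>Makes a total cycle a total boundary modulo \<Omega>', by descending induction on the
  Cech degree. After subtraction of the Koszul image of the correction found one degree higher,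
  \<open>Z l\<close> is a Cech cocycle, and exactness supplies the next correction. In the highest
  degree the Koszul image is zero, which starts the induction.\<close>

lemma tot:
  assumes up: "up_closed \<Omega>" "up_closed \<Omega>'" "\<Omega>' \<subseteq> \<Omega>" and ex: "\<And>l. l < n \<Longrightarrow> exact_at \<Omega> \<Omega>' l"
    and Z: "\<And>l P F. l < n \<Longrightarrow> P \<subseteq> {..<n} \<Longrightarrow> card P = Suc l \<Longrightarrow> F \<subseteq> V \<Longrightarrow> card F = l \<Longrightarrow> Z l P F \<in> graded_part \<Omega> F"
    and cyc: "\<And>l P F. l < n \<Longrightarrow> P \<subseteq> {..<n} \<Longrightarrow> card P = Suc l \<Longrightarrow> F \<subseteq> V \<Longrightarrow> card F = Suc l \<Longrightarrow> KU n a (Z (Suc l)) P F - D (Z l P) F \<in> graded_part \<Omega>' F"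
  shows "\<exists>W. (\<forall>l P G. P \<subseteq> {..<n} \<longrightarrow> card P = Suc l \<longrightarrow> G \<subseteq> V \<longrightarrow> Suc (card G) = l \<longrightarrow> W l P G \<in> graded_part \<Omega> G) \<and>
    (\<forall>l<n. \<forall>P\<subseteq>{..<n}. \<forall>F\<subseteq>V. card P = Suc l \<longrightarrow> card F = l \<longrightarrow> Z l P F - KU n a (W (Suc l)) P F - D (W l P) F \<in> graded_part \<Omega>' F)"
proof -
  have "\<exists>W. (\<forall>l P G. P \<subseteq> {..<n} \<longrightarrow> card P = Suc l \<longrightarrow> G \<subseteq> V \<longrightarrow> Suc (card G) = l \<longrightarrow> W l P G \<in> graded_part \<Omega> G) \<and>
    (\<forall>l. t \<le> l \<longrightarrow> l < n \<longrightarrow> (\<forall>P\<subseteq>{..<n}. \<forall>F\<subseteq>V. card P = Suc l \<longrightarrow> card F = l \<longrightarrow> Z l P F - KU n a (W (Suc l)) P F - D (W l P) F \<in> graded_part \<Omega>' F))"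
    if "t \<le> n" for t
    using that
  proof (induction "n - t" arbitrary: t)
    case 0
    then show ?case by (intro exI[of _ "\<lambda>_ _ _. 0"]) (auto simp: graded_part_0)
  next
    case (Suc m)
    then have t: "t < n" by simp
    have "m = n - Suc t" "Suc t \<le> n" using Suc.hyps(2) t by auto
    from Suc.hyps(1)[OF this] obtain W where
      W12: "(\<forall>l P G. P \<subseteq> {..<n} \<longrightarrow> card P = Suc l \<longrightarrow> G \<subseteq> V \<longrightarrow> Suc (card G) = l \<longrightarrow> W l P G \<in> graded_part \<Omega> G) \<and>
    (\<forall>l. Suc t \<le> l \<longrightarrow> l < n \<longrightarrow> (\<forall>P\<subseteq>{..<n}. \<forall>F\<subseteq>V. card P = Suc l \<longrightarrow> card F = l \<longrightarrow> Z l P F - KU n a (W (Suc l)) P F - D (W l P) F \<in> graded_part \<Omega>' F))" ..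
    then have W1: "\<And>l P G. P \<subseteq> {..<n} \<Longrightarrow> card P = Suc l \<Longrightarrow> G \<subseteq> V \<Longrightarrow> Suc (card G) = l \<Longrightarrow> W l P G \<in> graded_part \<Omega> G" by blast
    have W2: "\<And>l P F. Suc t \<le> l \<Longrightarrow> l < n \<Longrightarrow> P \<subseteq> {..<n} \<Longrightarrow> F \<subseteq> V \<Longrightarrow> card P = Suc l \<Longrightarrow> card F = l \<Longrightarrow> Z l P F - KU n a (W (Suc l)) P F - D (W l P) F \<in> graded_part \<Omega>' F"
      using W12 by blast
    have "\<exists>b. P \<subseteq> {..<n} \<longrightarrow> card P = Suc t \<longrightarrow> ((\<forall>G\<subseteq>V. Suc (card G) = t \<longrightarrow> b G \<in> graded_part \<Omega> G) \<and>
       (\<forall>F\<subseteq>V. card F = t \<longrightarrow> (Z t P F - KU n a (W (Suc t)) P F) - D b F \<in> graded_part \<Omega>' F))" for P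
    proof (cases "P \<subseteq> {..<n} \<and> card P = Suc t")
      case True
      then have P: "P \<subseteq> {..<n}" "card P = Suc t" by auto
      define c where "c F = Z t P F - KU n a (W (Suc t)) P F" for F
      have c1: "c F \<in> graded_part \<Omega> F" if F: "F \<subseteq> V" "card F = t" for F
        unfolding c_def using F by (intro graded_part_diff Z t P KU_graded_part[OF up(1) P]) (auto intro: W1)
      have c2: "D c F \<in> graded_part \<Omega>' F" if F: "F \<subseteq> V" "card F = Suc t" for F
      proof -
        have "D c F = D (Z t P) F - KU n a (\<lambda>P F. D (W (Suc t) P) F) P F"
          unfolding c_def by (simp add: D_diff KU_D)
        also have "\<dots> = (KU n a (Z (Suc t)) P F - KU n a (\<lambda>P F. D (W (Suc t) P) F) P F) - (KU n a (Z (Suc t)) P F - D (Z t P) F)" by simp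
        finally have *: "D c F = (KU n a (Z (Suc t)) P F - KU n a (\<lambda>P F. D (W (Suc t) P) F) P F) - (KU n a (Z (Suc t)) P F - D (Z t P) F)" .
        have "KU n a (Z (Suc t)) P F - KU n a (\<lambda>P F. D (W (Suc t) P) F) P F \<in> graded_part \<Omega>' F"
        proof (cases "Suc t = n")
          case True
          \<comment> \<open>No index is left to be added to \<open>P\<close>, so both Koszul images
            are empty sums.\<close>
          then have "P = {..<n}" using P by (intro card_subset_eq) auto
          then show ?thesis by (simp add: up_def graded_part_0)
        next
          case False
          then have tn: "Suc t < n" using t by simp
          have "KU n a (Z (Suc t)) P F - KU n a (\<lambda>P F. D (W (Suc t) P) F) P F
            = KU n a (\<lambda>P F. Z (Suc t) P F - KU n a (W (Suc (Suc t))) P F - D (W (Suc t) P) F) P F"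
            by (simp add: KU_diff KU_KU[OF P(1)])
          also have "\<dots> \<in> graded_part \<Omega>' F" by (rule KU_graded_part[OF up(2) P]) (use W2[of "Suc t" _ F] tn F in auto)
          finally show ?thesis .
        qed
        then show ?thesis unfolding * by (rule graded_part_diff) (rule cyc[OF t P F])
      qed
      have "exact_at \<Omega> \<Omega>' t" by (rule ex[OF t])
      then obtain b where "\<forall>G\<subseteq>V. Suc (card G) = t \<longrightarrow> b G \<in> graded_part \<Omega> G" "\<forall>F\<subseteq>V. card F = t \<longrightarrow> c F - D b F \<in> graded_part \<Omega>' F"
        unfolding exact_at_def using c1 c2 by blast
      then show ?thesis unfolding c_def by blast
    qed auto
    then have "\<forall>P. \<exists>b. P \<subseteq> {..<n} \<longrightarrow> card P = Suc t \<longrightarrow> ((\<forall>G\<subseteq>V. Suc (card G) = t \<longrightarrow> b G \<in> graded_part \<Omega> G) \<and>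
       (\<forall>F\<subseteq>V. card F = t \<longrightarrow> (Z t P F - KU n a (W (Suc t)) P F) - D b F \<in> graded_part \<Omega>' F))" by (rule allI)
    from choice[OF this] obtain b where b': "\<forall>P. P \<subseteq> {..<n} \<longrightarrow> card P = Suc t \<longrightarrow> ((\<forall>G\<subseteq>V. Suc (card G) = t \<longrightarrow> b P G \<in> graded_part \<Omega> G) \<and>
       (\<forall>F\<subseteq>V. card F = t \<longrightarrow> (Z t P F - KU n a (W (Suc t)) P F) - D (b P) F \<in> graded_part \<Omega>' F))" ..
    have b: "\<And>P G. P \<subseteq> {..<n} \<Longrightarrow> card P = Suc t \<Longrightarrow> G \<subseteq> V \<Longrightarrow> Suc (card G) = t \<Longrightarrow> b P G \<in> graded_part \<Omega> G"
      "\<And>P F. P \<subseteq> {..<n} \<Longrightarrow> card P = Suc t \<Longrightarrow> F \<subseteq> V \<Longrightarrow> card F = t \<Longrightarrow> (Z t P F - KU n a (W (Suc t)) P F) - D (b P) F \<in> graded_part \<Omega>' F"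
      using b' by simp_all
    define W' where "W' = W(t := b)"
    have W't: "W' t = b" and W'n: "l \<noteq> t \<Longrightarrow> W' l = W l" for l by (simp_all add: W'_def)
    show ?case
    proof (intro exI[of _ W'] conjI allI impI)
      fix l P G assume "P \<subseteq> {..<n}" "card P = Suc l" "G \<subseteq> V" "Suc (card G) = l"
      then show "W' l P G \<in> graded_part \<Omega> G" using b(1) W1 by (cases "l = t") (auto simp: W't W'n)
    next
      fix l P F assume *: "t \<le> l" "l < n" "P \<subseteq> {..<n}" "F \<subseteq> V" "card P = Suc l" "card F = l"
      show "Z l P F - KU n a (W' (Suc l)) P F - D (W' l P) F \<in> graded_part \<Omega>' F"
      proof (cases "l = t")
        case True then show ?thesis using b(2)[OF *(3) _ *(4)] * by (simp add: W't W'n)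
      next
        case False then show ?thesis using W2[of l P F] * by (simp add: W'n)
      qed
    qed
  qed
  from this[of 0] show ?thesis by simp
qed

text \<open>The relation \<open>z\<close> is completed to a total cycle. On a nonempty set some
  variable is invertible, hence so is, up to the multiplier \<open>S\<close>, the ideal of the
  parameters; the Koszul direction is contractible there and yields the higher components. Cech
  exactness then turns the total cycle into a boundary, first in the nonzero nonpositive exponents
  and, after multiplication by \<open>poly_var v\<close>, in the positive ones. The component at the
  empty set is the claim.\<close>

lemma koszul_killed:
  fixes a z :: "nat \<Rightarrow> (('v \<Rightarrow>\<^sub>0 nat) \<Rightarrow>\<^sub>0 'k)"
  assumes L: "\<And>F0 l. F0 \<in> \<Delta> \<Longrightarrow> F0 \<noteq> {} \<Longrightarrow> l < d \<Longrightarrow> cochain_exact r k \<Delta> F0 l" and nd: "n \<le> d"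
    and sop: "polysop n a" and z: "(\<Sum>i<n. a i * z i) \<in> SRD" and i: "i < n"
  shows "\<exists>t y. coef t 0 \<noteq> 0 \<and> t * poly_var v * z i - (\<Sum>j\<in>{..<n} - {i}. a j * y j) \<in> SRD"
proof -
  have "\<forall>w. \<exists>N s y. coef s 0 \<noteq> 0 \<and> s * poly_var w ^ N - (\<Sum>i<n. y i * a i) \<in> SRD"
  proof
    fix w
    have "\<exists>N. poly_var w ^ N \<in> sat (spanmod a n SRD)" using sop by (simp add: polysop_def)
    then show "\<exists>N s y. coef s 0 \<noteq> 0 \<and> s * poly_var w ^ N - (\<Sum>i<n. y i * a i) \<in> SRD"
      unfolding sat_def spanmod_def by blast
  qed
  from choice[OF this] obtain N where "\<forall>w. \<exists>s y. coef s 0 \<noteq> 0 \<and> s * poly_var w ^ N w - (\<Sum>i<n. y i * a i) \<in> SRD" ..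
  from choice[OF this] obtain s where "\<forall>w. \<exists>y. coef (s w) 0 \<noteq> 0 \<and> s w * poly_var w ^ N w - (\<Sum>i<n. y i * a i) \<in> SRD" ..
  from choice[OF this] obtain y where "\<forall>w. coef (s w) 0 \<noteq> 0 \<and> s w * poly_var w ^ N w - (\<Sum>i<n. y w i * a i) \<in> SRD" ..
  then have sN: "\<And>w. coef (s w) 0 \<noteq> 0" "\<And>w. s w * poly_var w ^ N w - (\<Sum>i<n. y w i * a i) \<in> SRD" by simp_all
  \<comment> \<open>One multiplier for all vertices: \<open>S\<close> times a power of each variable
    lies in the ideal of the parameters modulo \<open>SRD\<close>.\<close>
  define S where "S = (\<Prod>w\<in>V. s w)"
  have "coef (\<Prod>w\<in>Q. s w) 0 \<noteq> 0" if "finite Q" for Q using that sN by (induction Q rule: finite_induct) auto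
  then have S0: "coef S 0 \<noteq> 0" using finV by (simp add: S_def)
  define y' where "y' w i = (\<Prod>u\<in>V - {w}. s u) * y w i" for w i
  have S: "S * poly_var w ^ N w - (\<Sum>i<n. y' w i * a i) \<in> SRD" if "w \<in> V" for w
  proof -
    have "S = (\<Prod>u\<in>V - {w}. s u) * s w" unfolding S_def using that finV by (subst prod.remove[of _ w]) (auto simp: mult.commute)
    then have "S * poly_var w ^ N w - (\<Sum>i<n. y' w i * a i) = (\<Prod>u\<in>V - {w}. s u) * (s w * poly_var w ^ N w - (\<Sum>i<n. y w i * a i))"
      by (simp add: y'_def right_diff_distrib sum_distrib_left mult.assoc)
    then show ?thesis using pideal_mult[OF pSR sN(2)] by simp
  qed
  define w where "w F = (SOME u :: 'v. u \<in> F)" for F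
  have w: "w F \<in> F" if "F \<noteq> {}" for F unfolding w_def using that by (simp add: some_in_eq)
  \<comment> \<open>The component on \<open>F\<close> is the Koszul contraction of
    \<open>D (Z l)\<close>: contract with the coefficients that express a power of the variable of
    some \<open>w F \<in> F\<close>, and divide by this power. \<open>Min\<close> merely reads off
    the index from the singletons \<open>P\<close> that occur for \<open>l = 0\<close>.\<close>
  define Z where "Z = rec_nat (\<lambda>P F. lau (z (Min P))) (\<lambda>l Zq P F. xm {w F} (- int (N (w F))) * dn (\<lambda>i. i) (\<lambda>i m. lau (y' (w F) i) * m) (\<lambda>P. D (Zq P) F) P)"
  have Z0: "Z 0 P F = lau (z (Min P))" for P F by (simp add: Z_def)
  have ZS: "Z (Suc l) P F = xm {w F} (- int (N (w F))) * dn (\<lambda>i. i) (\<lambda>i m. lau (y' (w F) i) * m) (\<lambda>P. D (Z l P) F) P" for l P F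
    by (simp add: Z_def)
  have ZA: "Z l P F \<in> graded_part UNIV F" if "F \<subseteq> V" "card F = l" for l P F
    using that
  proof (induction l arbitrary: P F)
    case 0
    then show ?case using finF[of F] JF_lau[of "z (Min P)" UNIV F] by (simp add: Z0 graded_part_UNIV)
  next
    case (Suc l)
    have fF: "finite F" by (rule finF[OF Suc.prems(1)])
    have wF: "w F \<in> F" using Suc.prems by (intro w) auto
    have 1: "D (Z l P') F \<in> graded_part UNIV F" for P' by (rule D_graded_part[OF Suc.prems]) (use Suc.IH in auto)
    have 2: "dn (\<lambda>i. i) (\<lambda>i m. lau (y' (w F) i) * m) (\<lambda>P. D (Z l P) F) P \<in> graded_part UNIV F"
      unfolding dn_def[of "\<lambda>i. i"] by (intro graded_part_sum graded_part_sg graded_part_lmult 1) simp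
    have "xm {w F} (- int (N (w F))) \<in> JF UNIV {w F}"
      by (rule JF_I[of 1 UNIV "{w F}" "N (w F)"]) (simp_all flip: xm_add)
    then have "xm {w F} (- int (N (w F))) \<in> JF UNIV F" by (rule JF_subset[OF pideal_UNIV fF, rotated]) (use wF in auto)
    then have "dn (\<lambda>i. i) (\<lambda>i m. lau (y' (w F) i) * m) (\<lambda>P. D (Z l P) F) P * xm {w F} (- int (N (w F))) \<in> JF UNIV F"
      using 2 by (intro JF_mult[OF pideal_UNIV fF]) (auto simp: graded_part_UNIV[OF fF])
    then show ?case by (simp add: ZS graded_part_UNIV[OF fF] mult.commute)
  qed
  have KA: "D (Z l P) F \<in> graded_part UNIV F" if "F \<subseteq> V" "card F = Suc l" for l P F
    by (rule D_graded_part[OF that]) (use ZA in auto)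
  \<comment> \<open>By \<open>up_dn\<close> the Koszul differential of the contraction is
    \<open>S\<close> times \<open>D (Z l)\<close>, up to terms in the Stanley-Reisner ideal and a
    contraction of the Koszul differential of \<open>D (Z l)\<close>. The latter vanishes by
    assumption \<open>K\<close>, which \<open>Kall\<close> establishes inductively.\<close>
  have step: "KU n a (Z (Suc l)) P F - lau S * D (Z l P) F \<in> graded_part {} F"
    if P: "P \<subseteq> {..<n}" "card P = Suc l" and F: "F \<subseteq> V" "card F = Suc l"
      and K: "\<And>P. P \<subseteq> {..<n} \<Longrightarrow> card P = l \<Longrightarrow> D (\<lambda>F. KU n a (Z l) P F) F \<in> graded_part {} F" for l P F
  proof -
    have fF: "finite F" by (rule finF[OF F(1)])
    have finP: "finite P" using P(1) finite_subset by blast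
    define u where "u = w F"
    have uF: "u \<in> F" unfolding u_def using F by (intro w) auto
    then have uV: "u \<in> V" using F by blast
    define xu :: "('v \<Rightarrow>\<^sub>0 int) \<Rightarrow>\<^sub>0 'k" where "xu = xm {u} (- int (N u))"
    define Y where "Y P = D (Z l P) F" for P
    define Yd where "Yd = dn (\<lambda>i. i) (\<lambda>i m. lau (y' u i) * m) Y"
    define Yu where "Yu = up (\<lambda>i. i) {..<n} (\<lambda>i m. lau (a i) * m) Y"
    define R where "R = dn (\<lambda>i. i) (\<lambda>i m. lau (y' u i) * m) Yu P"
    define Q where "Q = up (\<lambda>i. i) {..<n} (\<lambda>i m. lau (a i) * m) Yd P"
    have xuJ: "xu \<in> JF UNIV F"
    proof -
      have "xu \<in> JF UNIV {u}" unfolding xu_def by (rule JF_I[of 1 UNIV "{u}" "N u"]) (simp_all flip: xm_add)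
      then show ?thesis by (rule JF_subset[OF pideal_UNIV fF, rotated]) (use uF in auto)
    qed
    have xu1: "xu * lau (poly_var u ^ N u) = 1" unfolding xu_def xm_single[symmetric] by (simp flip: xm_add)
    have 1: "KU n a (Z (Suc l)) P F = xu * Q"
    proof -
      have "xu * Q = up (\<lambda>i. i) {..<n} (\<lambda>i m. lau (a i) * m) (\<lambda>P. xu * Yd P) P"
        unfolding Q_def by (rule up_hom[of "\<lambda>m. xu * m"]) (auto simp: mult.left_commute)
      then show ?thesis by (simp add: ZS Yd_def Y_def[abs_def] xu_def u_def Q_def)
    qed
    have 2: "Q + R
        = (\<Sum>i\<in>{..<n}. lau (y' u i) * (lau (a i) * Y P))"
      unfolding Q_def R_def Yd_def Yu_def by (rule up_dn) (use P in \<open>auto simp: mult.left_commute\<close>)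
    define j where "j = S * poly_var u ^ N u - (\<Sum>i<n. y' u i * a i)"
    have j: "j \<in> SRD" unfolding j_def by (rule S[OF uV])
    have "(\<Sum>i\<in>{..<n}. lau (y' u i) * (lau (a i) * Y P)) = lau (\<Sum>i<n. y' u i * a i) * Y P"
      by (simp add: lau_sum lau_mult sum_distrib_right mult.assoc)
    also have "(\<Sum>i<n. y' u i * a i) = S * poly_var u ^ N u - j" by (simp add: j_def)
    finally have "Q + R = lau (S * poly_var u ^ N u - j) * Y P" by (rule trans[OF 2])
    then have 3: "Q = lau S * lau (poly_var u ^ N u) * Y P - (lau j * Y P + R)"
      by (simp add: lau_diff lau_mult algebra_simps)
    have "KU n a (Z (Suc l)) P F = lau S * (xu * lau (poly_var u ^ N u)) * Y P - xu * (lau j * Y P + R)"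
      unfolding 1 3 by (simp add: algebra_simps)
    then have eq: "KU n a (Z (Suc l)) P F - lau S * D (Z l P) F = - ((lau j * Y P + R) * xu)"
      unfolding xu1 by (simp add: Y_def mult.commute[of xu])
    have "Yu P' \<in> graded_part {} F" if "P' \<subseteq> {..<n}" "card P' = l" for P'
    proof -
      have "Yu P' = D (\<lambda>F. KU n a (Z l) P' F) F" unfolding Yu_def Y_def[abs_def] by (rule KU_D)
      then show ?thesis using K[OF that] by simp
    qed
    have "R \<in> graded_part {} F"
      unfolding R_def dn_def
    proof (intro graded_part_sum graded_part_sg graded_part_lmult)
      fix i assume i: "i \<in> P"
      have "P - {i} \<subseteq> {..<n}" "card (P - {i}) = l" using P finP i by (auto simp: card_Diff_singleton)
      then show "Yu (P - {i}) \<in> graded_part {} F" by (rule \<open>\<And>P'. P' \<subseteq> {..<n} \<Longrightarrow> card P' = l \<Longrightarrow> Yu P' \<in> graded_part {} F\<close>)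
    qed simp
    then have "R \<in> JF SRD F" by (simp add: graded_part_empty[OF F(1)])
    moreover have "lau j * Y P \<in> JF SRD F"
      using KA[OF F, of P] by (intro JF_lmult2[OF pSR fF j]) (simp add: Y_def graded_part_UNIV[OF fF])
    ultimately have "(lau j * Y P + R) * xu \<in> JF SRD F"
      by (intro JF_mult[OF pSR fF _ xuJ] JF_add[OF pSR fF])
    then show ?thesis unfolding eq graded_part_empty[OF F(1)] by (rule JF_minus[OF pSR fF])
  qed
  have Kall: "D (\<lambda>F. KU n a (Z l) P F) F \<in> graded_part {} F"
    if "P \<subseteq> {..<n}" "card P = l" "F \<subseteq> V" "card F = Suc l" for l P F
    using that
  proof (induction l arbitrary: P F)
    case (0 P F)
    have "P = {}" using 0 finite_subset[OF 0(1)] by simp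
    have "KU n a (Z 0) P G \<in> graded_part {} G" if G: "G \<subseteq> V" "Suc (card G) = Suc 0" for G
    proof -
      have "G = {}" using G finF[of G] by simp
      have "KU n a (Z 0) P G = lau (\<Sum>i<n. a i * z i)"
        by (simp add: \<open>P = {}\<close> up_def Z0 sg_def lau_sum lau_mult)
      then show ?thesis using JF_lau[OF z, of G] by (simp add: graded_part_empty[OF G(1)])
    qed
    then show ?case by (intro D_graded_part[OF 0(3,4)])
  next
    case (Suc l P F)
    have "D (\<lambda>F. KU n a (Z (Suc l)) P F - lau S * D (Z l P) F) F \<in> graded_part {} F"
    proof (rule D_graded_part[OF Suc.prems(3,4)])
      fix G assume G: "G \<subseteq> V" "Suc (card G) = Suc (Suc l)"
      then show "KU n a (Z (Suc l)) P G - lau S * D (Z l P) G \<in> graded_part {} G"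
        using Suc.prems by (intro step Suc.IH) auto
    qed
    moreover have "D (\<lambda>F. lau S * D (Z l P) F) F = 0"
    proof -
      have "D (\<lambda>F. lau S * D (Z l P) F) F = lau S * D (D (Z l P)) F"
        by (rule dn_hom[symmetric, of "\<lambda>m. lau S * m"]) auto
      then show ?thesis by (simp add: DD[OF Suc.prems(3)])
    qed
    ultimately show ?case by (simp add: D_diff)
  qed
  note Zc = step[OF _ _ _ _ Kall]
  \<comment> \<open>Descending powers of \<open>S\<close> absorb the multiplier in
    \<open>step\<close>: the components now satisfy the cycle condition without any factor.\<close>
  define Z' where "Z' l P F = lau (S ^ (n - l)) * Z l P F" for l P F
  \<comment> \<open>The complement of \<Omega>1 consists of the nonzero nonpositive exponents, where
    the hypothesis gives exactness; in \<Omega>2 every exponent has a positive coordinate and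
    exactness is unconditional. They differ only in the exponent 0.\<close>
  define \<Omega>1 :: "('v \<Rightarrow>\<^sub>0 int) set" where "\<Omega>1 = {e. e = 0 \<or> (\<exists>v. 0 < coef e v)}"
  define \<Omega>2 :: "('v \<Rightarrow>\<^sub>0 int) set" where "\<Omega>2 = {e. \<exists>v. 0 < coef e v}"
  have pos: "\<exists>v. 0 < coef (il x + e) v" if "0 < coef e v" for x :: "'v \<Rightarrow>\<^sub>0 nat" and e v
    using that by (intro exI[of _ v]) (simp add: lookup_add)
  have u2: "up_closed \<Omega>2" unfolding up_closed_def \<Omega>2_def using pos by blast
  have u1: "up_closed \<Omega>1" unfolding up_closed_def
  proof (intro ballI allI)
    fix e and x :: "'v \<Rightarrow>\<^sub>0 nat" assume "e \<in> \<Omega>1"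
    then consider "e = 0" | v where "0 < coef e v" by (auto simp: \<Omega>1_def)
    then show "il x + e \<in> \<Omega>1"
    proof cases
      case 1
      show ?thesis
      proof (cases "x = 0")
        case False
        then obtain u where "u \<in> supp x" by (metis all_not_in_conv keys_eq_empty)
        then have "0 < coef (il x + e) u" using 1 by (simp add: in_keys_iff)
        then show ?thesis unfolding \<Omega>1_def by blast
      qed (simp add: 1 \<Omega>1_def)
    next
      case 2 then show ?thesis using pos unfolding \<Omega>1_def by blast
    qed
  qed
  have ex1: "exact_at UNIV \<Omega>1 l" if "l < n" for l
  proof (rule exact_at_I)
    fix e assume "e \<notin> \<Omega>1"
    then have "e \<noteq> 0" "\<And>v. coef e v \<le> 0" by (auto simp: \<Omega>1_def not_less)
    then show "local_exact e l" using L that nd by (intro local_exact_neg) auto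
  qed simp
  have ex2: "exact_at \<Omega>2 {} l" for l
    by (rule exact_at_I) (auto simp: \<Omega>2_def intro: local_exact_pos)
  have Z'A: "Z' l P F \<in> graded_part UNIV F" if "F \<subseteq> V" "card F = l" for l P F
    unfolding Z'_def by (intro graded_part_lmult ZA that) simp
  have KUl: "up (\<lambda>i. i) {..<n} (\<lambda>i m. lau (a i) * m) (\<lambda>P. lau b * U P) P = lau b * up (\<lambda>i. i) {..<n} (\<lambda>i m. lau (a i) * m) U P" for b U P
    by (rule up_hom[symmetric, of "\<lambda>m. lau b * m"]) (auto simp: mult.left_commute)
  have Dl: "D (\<lambda>F. lau b * U F) F = lau b * D U F" for b U F
    by (rule dn_hom[symmetric, of "\<lambda>m. lau b * m"]) auto
  have Z'c: "KU n a (Z' (Suc l)) P F - D (Z' l P) F \<in> graded_part {} F"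
    if l: "l < n" and *: "P \<subseteq> {..<n}" "card P = Suc l" "F \<subseteq> V" "card F = Suc l" for l P F
  proof -
    have "S ^ (n - l) = S ^ (n - Suc l) * S" using l by (metis Suc_diff_Suc power_Suc2)
    then have "KU n a (Z' (Suc l)) P F - D (Z' l P) F = lau (S ^ (n - Suc l)) * (KU n a (Z (Suc l)) P F - lau S * D (Z l P) F)"
      unfolding Z'_def KUl Dl by (simp only: lau_mult right_diff_distrib mult.assoc)
    also have "\<dots> \<in> graded_part {} F" by (intro graded_part_lmult Zc *) auto
    finally show ?thesis .
  qed
  have "\<exists>W. (\<forall>l P G. P \<subseteq> {..<n} \<longrightarrow> card P = Suc l \<longrightarrow> G \<subseteq> V \<longrightarrow> Suc (card G) = l \<longrightarrow> W l P G \<in> graded_part UNIV G) \<and>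
    (\<forall>l<n. \<forall>P\<subseteq>{..<n}. \<forall>F\<subseteq>V. card P = Suc l \<longrightarrow> card F = l \<longrightarrow> Z' l P F - KU n a (W (Suc l)) P F - D (W l P) F \<in> graded_part \<Omega>1 F)"
  proof (rule tot[OF _ u1 _ ex1 Z'A])
    fix l P F assume "l < n" "P \<subseteq> {..<n}" "card P = Suc l" "F \<subseteq> V" "card F = Suc l"
    then have "KU n a (Z' (Suc l)) P F - D (Z' l P) F \<in> graded_part {} F" by (rule Z'c)
    then show "KU n a (Z' (Suc l)) P F - D (Z' l P) F \<in> graded_part \<Omega>1 F" by (rule graded_part_mono[rotated]) simp
  qed auto
  then obtain W where W12: "(\<forall>l P G. P \<subseteq> {..<n} \<longrightarrow> card P = Suc l \<longrightarrow> G \<subseteq> V \<longrightarrow> Suc (card G) = l \<longrightarrow> W l P G \<in> graded_part UNIV G) \<and>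
    (\<forall>l<n. \<forall>P\<subseteq>{..<n}. \<forall>F\<subseteq>V. card P = Suc l \<longrightarrow> card F = l \<longrightarrow> Z' l P F - KU n a (W (Suc l)) P F - D (W l P) F \<in> graded_part \<Omega>1 F)" ..
  define Z2 where "Z2 l P F = Z' l P F - KU n a (W (Suc l)) P F - D (W l P) F" for l P F
  have Z2A: "Z2 l P F \<in> graded_part \<Omega>1 F" if "l < n" "P \<subseteq> {..<n}" "card P = Suc l" "F \<subseteq> V" "card F = l" for l P F
    unfolding Z2_def using W12 that by blast
  \<comment> \<open>A single variable carries exponent 0 into \<Omega>2 and bridges the gap between
    the two ranges of exactness.\<close>
  define Z3 where "Z3 l P F = lau (poly_var v) * Z2 l P F" for l P F
  have Z3A: "Z3 l P F \<in> graded_part \<Omega>2 F" if "l < n" "P \<subseteq> {..<n}" "card P = Suc l" "F \<subseteq> V" "card F = l" for l P F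
    unfolding Z3_def
  proof (rule graded_part_lmult_gen[OF Z2A[OF that]])
    fix x e assume x: "x \<in> supp (poly_var v :: ('v \<Rightarrow>\<^sub>0 nat) \<Rightarrow>\<^sub>0 'k)" and e: "e \<in> \<Omega>1"
    have x1: "x = mon v 1" using x by (simp add: poly_var_def)
    show "il x + e \<in> \<Omega>2"
    proof (cases "e = 0")
      case True
      then have "0 < coef (il x + e) v" by (simp add: x1)
      then show ?thesis unfolding \<Omega>2_def by blast
    next
      case False
      then show ?thesis using e pos unfolding \<Omega>1_def \<Omega>2_def by blast
    qed
  qed
  have Z3c: "KU n a (Z3 (Suc l)) P F - D (Z3 l P) F \<in> graded_part {} F"
    if l: "l < n" and *: "P \<subseteq> {..<n}" "card P = Suc l" "F \<subseteq> V" "card F = Suc l" for l P F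
  proof -
    have "KU n a (Z2 (Suc l)) P F - D (Z2 l P) F = KU n a (Z' (Suc l)) P F - D (Z' l P) F"
      unfolding Z2_def by (simp add: KU_diff KU_KU[OF *(1)] D_diff KU_D DD[OF *(3)])
    then have "KU n a (Z3 (Suc l)) P F - D (Z3 l P) F = lau (poly_var v) * (KU n a (Z' (Suc l)) P F - D (Z' l P) F)"
      unfolding Z3_def KUl Dl by (simp flip: right_diff_distrib)
    also have "\<dots> \<in> graded_part {} F" by (intro graded_part_lmult Z'c l *) simp
    finally show ?thesis .
  qed
  have "\<exists>W2. (\<forall>l P G. P \<subseteq> {..<n} \<longrightarrow> card P = Suc l \<longrightarrow> G \<subseteq> V \<longrightarrow> Suc (card G) = l \<longrightarrow> W2 l P G \<in> graded_part \<Omega>2 G) \<and>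
    (\<forall>l<n. \<forall>P\<subseteq>{..<n}. \<forall>F\<subseteq>V. card P = Suc l \<longrightarrow> card F = l \<longrightarrow> Z3 l P F - KU n a (W2 (Suc l)) P F - D (W2 l P) F \<in> graded_part {} F)"
    by (rule tot[of \<Omega>2 "{}" n Z3 a]) (simp_all add: u2 ex2 Z3A Z3c)
  then obtain W2 where W2: "(\<forall>l P G. P \<subseteq> {..<n} \<longrightarrow> card P = Suc l \<longrightarrow> G \<subseteq> V \<longrightarrow> Suc (card G) = l \<longrightarrow> W2 l P G \<in> graded_part \<Omega>2 G) \<and>
    (\<forall>l<n. \<forall>P\<subseteq>{..<n}. \<forall>F\<subseteq>V. card P = Suc l \<longrightarrow> card F = l \<longrightarrow> Z3 l P F - KU n a (W2 (Suc l)) P F - D (W2 l P) F \<in> graded_part {} F)" ..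
  have D0: "D U {} = 0" for U by (simp add: dn_def)
  \<comment> \<open>Cech coboundaries vanish on the empty set, so there the component at
    \<open>{i}\<close> is a Koszul boundary modulo \<open>SRD\<close>, a combination of the
    \<open>a l\<close> with \<open>l \<noteq> i\<close>.\<close>
  define \<epsilon> where "\<epsilon> = Z3 0 {i} {} - KU n a (W2 (Suc 0)) {i} {}"
  have "0 < n" using i by simp
  then have "Z3 0 {i} {} - KU n a (W2 (Suc 0)) {i} {} - D (W2 0 {i}) {} \<in> graded_part {} {}"
    using W2 i by auto
  then have "\<epsilon> \<in> JF SRD {}" by (simp add: \<epsilon>_def D0 graded_part_empty[of "{}"])
  then obtain j' where j': "j' \<in> SRD" "\<epsilon> = lau j'" by (auto elim!: JF_E)
  have "\<exists>u. W2 (Suc 0) {l, i} {} + lau (poly_var v) * W (Suc 0) {l, i} {} = lau u" if l: "l \<in> {..<n} - {i}" for l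
  proof -
    have P: "{l, i} \<subseteq> {..<n}" "card {l, i} = Suc (Suc 0)" using l i by auto
    then have "W2 (Suc 0) {l, i} {} \<in> graded_part \<Omega>2 {}" "W (Suc 0) {l, i} {} \<in> graded_part UNIV {}" using W2 W12 by auto
    then have "W2 (Suc 0) {l, i} {} + lau (poly_var v) * W (Suc 0) {l, i} {} \<in> graded_part UNIV {}"
      by (intro graded_part_add graded_part_lmult) (auto intro: graded_part_mono[of \<Omega>2])
    then have "W2 (Suc 0) {l, i} {} + lau (poly_var v) * W (Suc 0) {l, i} {} \<in> JF UNIV {}" by (simp add: graded_part_UNIV)
    then show ?thesis by (auto elim!: JF_E)
  qed
  then have "\<forall>l\<in>{..<n} - {i}. \<exists>u. W2 (Suc 0) {l, i} {} + lau (poly_var v) * W (Suc 0) {l, i} {} = lau u" by (rule ballI)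
  from bchoice[OF this] obtain \<omega> where "\<forall>l\<in>{..<n} - {i}. W2 (Suc 0) {l, i} {} + lau (poly_var v) * W (Suc 0) {l, i} {} = lau (\<omega> l)" ..
  then have om: "\<And>l. l \<in> {..<n} - {i} \<Longrightarrow> W2 (Suc 0) {l, i} {} + lau (poly_var v) * W (Suc 0) {l, i} {} = lau (\<omega> l)" by (rule bspec)
  have "lau (S ^ n * poly_var v * z i) = Z3 0 {i} {} + lau (poly_var v) * KU n a (W (Suc 0)) {i} {}"
  proof -
    have "lau (S ^ n * poly_var v * z i) = lau (poly_var v) * (lau (S ^ n) * lau (z i))" by (simp add: lau_mult mult_ac)
    then show ?thesis by (simp add: Z3_def Z2_def Z'_def Z0 D0 right_diff_distrib)
  qed
  also have "\<dots> = \<epsilon> + (KU n a (W2 (Suc 0)) {i} {} + lau (poly_var v) * KU n a (W (Suc 0)) {i} {})" by (simp add: \<epsilon>_def)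
  also have "KU n a (W2 (Suc 0)) {i} {} + lau (poly_var v) * KU n a (W (Suc 0)) {i} {}
     = (\<Sum>l\<in>{..<n} - {i}. lau (a l * sg (\<lambda>i. i) l {i} (\<omega> l)))"
  proof -
    have "KU n a (W2 (Suc 0)) {i} {} + lau (poly_var v) * KU n a (W (Suc 0)) {i} {}
      = (\<Sum>l\<in>{..<n} - {i}. sg (\<lambda>i. i) l {i} (lau (a l) * (W2 (Suc 0) {l, i} {} + lau (poly_var v) * W (Suc 0) {l, i} {})))"
      unfolding up_def sum_distrib_left sum.distrib[symmetric]
      by (intro sum.cong refl) (simp add: sg_add[symmetric] sg_mult distrib_left mult.left_commute)
    also have "\<dots> = (\<Sum>l\<in>{..<n} - {i}. lau (a l * sg (\<lambda>i. i) l {i} (\<omega> l)))"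
    proof (intro sum.cong refl)
      fix l assume l: "l \<in> {..<n} - {i}"
      show "sg (\<lambda>i. i) l {i} (lau (a l) * (W2 (Suc 0) {l, i} {} + lau (poly_var v) * W (Suc 0) {l, i} {})) = lau (a l * sg (\<lambda>i. i) l {i} (\<omega> l))"
        unfolding om[OF l] by (simp add: sg_def lau_mult lau_uminus)
    qed
    finally show ?thesis .
  qed
  finally have "lau (S ^ n * poly_var v * z i - (\<Sum>l\<in>{..<n} - {i}. a l * sg (\<lambda>i. i) l {i} (\<omega> l))) = lau j'"
    using j'(2) by (simp add: lau_diff lau_sum)
  then have "S ^ n * poly_var v * z i - (\<Sum>l\<in>{..<n} - {i}. a l * sg (\<lambda>i. i) l {i} (\<omega> l)) = j'" by (rule lau_inj)
  then have "S ^ n * poly_var v * z i - (\<Sum>l\<in>{..<n} - {i}. a l * sg (\<lambda>i. i) l {i} (\<omega> l)) \<in> SRD" using j'(1) by simp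
  moreover have "coef (S ^ n) 0 \<noteq> 0" using S0 by (induction n) auto
  ultimately show ?thesis by (intro exI[of _ "S ^ n"] exI[of _ "\<lambda>l. sg (\<lambda>i. i) l {i} (\<omega> l)"]) auto
qed

text \<open>\<open>koszul_killed\<close> expresses the product with a variable through all other
  parameters, including those after position \<open>i\<close>. Raising the later ones to arbitrarily
  high powers keeps a system of parameters, and \<open>krull_intersection\<close> then removes
  them.\<close>

theorem cochain_exact_imp_buchsbaum:
  assumes L: "\<And>F0 l. F0 \<in> \<Delta> \<Longrightarrow> F0 \<noteq> {} \<Longrightarrow> l < d \<Longrightarrow> cochain_exact r k \<Delta> F0 l" and d: "\<And>\<sigma>. \<sigma> \<in> \<Delta> \<Longrightarrow> card \<sigma> \<le> d"
    and N: "noetherian_ring Loc"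
  shows "buchsbaum_complex k \<Delta>"
  unfolding buchsbaum_iff
proof (intro conjI N allI impI)
  fix n a assume *: "enat n = krull_dim Loc \<and> polysop n a"
  have nd: "n \<le> d" using krull_dim_le[OF d] * by (metis enat_ord_simps(1))
  have sop: "polysop n a" using * by simp
  have a0: "\<And>i. i < n \<Longrightarrow> coef (a i) 0 = 0" using sop by (simp add: polysop_def)
  show "polyweak n a"
    unfolding polyweak_def
  proof (intro allI impI)
    fix i f v assume i: "i < n" and f: "f * a i \<in> sat (spanmod a i SRD)"
    have pQ: "pideal (spanmod a i SRD)" "SRD \<subseteq> spanmod a i SRD"
      using pideal_spanmod[OF pSR] spanmod_base[OF pSR] by auto
    from f obtain s y where s: "coef s 0 \<noteq> 0" "s * (f * a i) - (\<Sum>l<i. y l * a l) \<in> SRD"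
      by (auto simp: sat_def spanmod_def)
    show "f * poly_var v \<in> sat (spanmod a i SRD)"
    proof (rule krull_intersection[OF N pQ, of "n - Suc i" "\<lambda>j. a (Suc i + j)"])
      show "coef (a (Suc i + j)) 0 = 0" if "j < n - Suc i" for j using that by (intro a0) simp
      fix M :: nat
      \<comment> \<open>\<open>Suc M\<close> instead of \<open>M\<close> keeps the constant term
        zero also for \<open>M = 0\<close>.\<close>
      define a' where "a' l = (if l \<le> i then a l else a l ^ Suc M)" for l
      \<comment> \<open>The given membership read as a relation with coefficient
        \<open>s * f\<close> at position \<open>i\<close>. Its later coefficients are 0, so it
        survives the change of the later parameters.\<close>
      define z where "z l = (if l < i then - y l else if l = i then s * f else 0)" for l
      let ?T = "spanmod a' n SRD"
      have pT: "pideal ?T" "SRD \<subseteq> ?T" using pideal_spanmod[OF pSR] spanmod_base[OF pSR] by auto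
      have "a l \<in> rad ?T" if "l < n" for l
      proof -
        have "a' l \<in> ?T" by (rule spanmod_gen[OF pSR that])
        then have "\<exists>m. a l ^ m \<in> ?T"
        proof (cases "l \<le> i")
          case True then show ?thesis using \<open>a' l \<in> ?T\<close> by (intro exI[of _ 1]) (simp add: a'_def)
        next
          case False then show ?thesis using \<open>a' l \<in> ?T\<close> by (intro exI[of _ "Suc M"]) (simp add: a'_def)
        qed
        then show ?thesis by (simp add: rad_def)
      qed
      then have sub: "spanmod a n SRD \<subseteq> rad ?T" using pT rad_superset[of ?T] by (intro spanmod_minimal pideal_rad) auto
      have sop': "polysop n a'"
        unfolding polysop_def
      proof (intro conjI allI impI)
        show "coef (a' l) 0 = 0" if "l < n" for l using a0[OF that] by (simp add: a'_def)
        fix w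
        have "\<exists>m. poly_var w ^ m \<in> sat (spanmod a n SRD)" using sop by (simp add: polysop_def)
        then obtain m t where t: "coef t 0 \<noteq> 0" "t * poly_var w ^ m \<in> spanmod a n SRD"
          unfolding sat_def by blast
        then obtain e where "(t * poly_var w ^ m) ^ e \<in> ?T" using sub by (auto simp: rad_def)
        then have "t ^ e * poly_var w ^ (m * e) \<in> ?T" by (simp add: power_mult_distrib power_mult)
        moreover have "coef (t ^ e) 0 \<noteq> 0" using t(1) by (induction e) auto
        ultimately show "\<exists>n. poly_var w ^ n \<in> sat ?T" by (intro exI[of _ "m * e"] satI[of "t ^ e"])
      qed
      have "(\<Sum>l<n. a' l * z l) = (\<Sum>l<Suc i. a' l * z l)"
        by (rule sum.mono_neutral_right) (use i in \<open>auto simp: z_def\<close>)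
      also have "\<dots> = s * (f * a i) - (\<Sum>l<i. y l * a l)"
      proof -
        have "(\<Sum>l<i. a' l * z l) = - (\<Sum>l<i. y l * a l)"
          unfolding sum_negf[symmetric] by (rule sum.cong) (auto simp: a'_def z_def)
        then show ?thesis by (simp add: a'_def z_def mult_ac)
      qed
      finally have zS: "(\<Sum>l<n. a' l * z l) \<in> SRD" using s(2) by simp
      obtain t y' where t: "coef t 0 \<noteq> 0" "t * poly_var v * z i - (\<Sum>j\<in>{..<n} - {i}. a' j * y' j) \<in> SRD"
        using koszul_killed[OF L nd sop' zS i, of v] by blast
      let ?U = "spanmod (\<lambda>j. a (Suc i + j) ^ M) (n - Suc i) (spanmod a i SRD)"
      have pU: "pideal ?U" by (rule pideal_spanmod[OF pQ(1)])
      have QU: "spanmod a i SRD \<subseteq> ?U" using spanmod_base[OF pQ(1)] by blast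
      have "a' j \<in> ?U" if j: "j \<in> {..<n} - {i}" for j
      proof (cases "j < i")
        case True
        then show ?thesis using spanmod_gen[OF pSR True, of a] QU by (auto simp: a'_def)
      next
        case False
        then have "i < j" "j < n" using j by auto
        then have "a (Suc i + (j - Suc i)) ^ M \<in> ?U"
          by (intro spanmod_gen[OF pQ(1), of "j - Suc i" "n - Suc i" "\<lambda>j. a (Suc i + j) ^ M"]) simp
        then show ?thesis using pideal_mult[OF pU, of "a j ^ M" "a j"] \<open>i < j\<close> by (simp add: a'_def)
      qed
      then have "(\<Sum>j\<in>{..<n} - {i}. a' j * y' j) \<in> ?U" by (intro pideal_sum[OF pU] pideal_mult2[OF pU])
      moreover have "t * poly_var v * z i - (\<Sum>j\<in>{..<n} - {i}. a' j * y' j) \<in> ?U" using t(2) pQ(2) QU by blast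
      ultimately have "t * poly_var v * z i - (\<Sum>j\<in>{..<n} - {i}. a' j * y' j) + (\<Sum>j\<in>{..<n} - {i}. a' j * y' j) \<in> ?U"
        by (intro pideal_add[OF pU])
      then have "(t * s) * (f * poly_var v) \<in> ?U" by (simp add: z_def mult_ac)
      then show "f * poly_var v \<in> sat ?U" using t(1) s(1) by (intro satI[of "t * s"]) auto
    qed
  qed
qed

end

section \<open>Singular chains over a field\<close>

abbreviation scal :: "'k::field \<Rightarrow> ('b \<Rightarrow>\<^sub>0 'k) \<Rightarrow> ('b \<Rightarrow>\<^sub>0 'k)" where "scal a p \<equiv> Poly_Mapping.map ((*) a) p"

lemma lookup_scal [simp]: "coef (scal a p) x = a * coef p x"
  by (simp add: Poly_Mapping.map.rep_eq when_def)

lemma scal_add: "scal a (p + q) = scal a p + scal a q"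
  by (rule poly_mapping_eqI) (simp add: lookup_add distrib_left)

text \<open>The comparison runs along a linear relation instead of a map, since zigzags have no
  canonical end point. A total relation that reflects boundaries sends an independent family, by any
  choice of related elements, injectively to an independent family.\<close>

lemma quotient_dim_le:
  fixes Z B :: "('b \<Rightarrow>\<^sub>0 'k::field) set" and Z' B' :: "('c \<Rightarrow>\<^sub>0 'k) set"
  assumes tot: "\<And>z. z \<in> Z \<Longrightarrow> \<exists>c\<in>Z'. R z c"
    and add: "\<And>z c z' c'. R z c \<Longrightarrow> R z' c' \<Longrightarrow> R (z + z') (c + c')"
    and sc: "\<And>a z c. R z c \<Longrightarrow> R (scal a z) (scal a c)"
    and 0: "R 0 0" "0 \<in> B'" and bd: "\<And>z c. R z c \<Longrightarrow> c \<in> B' \<Longrightarrow> z \<in> B"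
  shows "quotient_dim Z B \<le> quotient_dim Z' B'"
  unfolding quotient_dim_def[of Z B]
proof (rule SUP_least)
  fix S assume S: "S \<in> {S. finite S \<and> S \<subseteq> Z \<and> (\<forall>a. (\<Sum>s\<in>S. scal (a s) s) \<in> B \<longrightarrow> (\<forall>s\<in>S. a s = 0))}"
  then have fS: "finite S" and simp_cycles: "S \<subseteq> Z" and ind: "\<And>a. (\<Sum>s\<in>S. scal (a s) s) \<in> B \<Longrightarrow> \<forall>s\<in>S. a s = 0" by auto
  have "\<forall>s\<in>S. \<exists>c. c \<in> Z' \<and> R s c" using tot simp_cycles by blast
  from bchoice[OF this] obtain \<rho> where \<rho>: "\<forall>s\<in>S. \<rho> s \<in> Z' \<and> R s (\<rho> s)" ..
  have sumR: "R (\<Sum>s\<in>T. scal (a s) s) (\<Sum>s\<in>T. scal (a s) (\<rho> s))" if "finite T" "T \<subseteq> S" for T a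
    using that
  proof (induction T rule: finite_induct)
    case (insert s T)
    have "R (scal (a s) s + (\<Sum>s\<in>T. scal (a s) s)) (scal (a s) (\<rho> s) + (\<Sum>s\<in>T. scal (a s) (\<rho> s)))"
      using insert \<rho> by (intro add sc) auto
    then show ?case using insert by simp
  qed (simp add: 0)
  have inj: "inj_on \<rho> S"
  proof (rule inj_onI, rule ccontr)
    fix s t assume st: "s \<in> S" "t \<in> S" "\<rho> s = \<rho> t" "s \<noteq> t"
    define a where "a x = (if x = s then 1 else if x = t then - 1 else 0 :: 'k)" for x
    have "(\<Sum>x\<in>S. scal (a x) (\<rho> x)) = 0"
    proof (rule poly_mapping_eqI)
      fix y
      have "(\<Sum>x\<in>S. a x * coef (\<rho> x) y) = (\<Sum>x\<in>{s, t}. a x * coef (\<rho> x) y)"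
        by (rule sum.mono_neutral_right) (use fS st in \<open>auto simp: a_def\<close>)
      also have "\<dots> = 0" using st by (simp add: a_def)
      finally show "coef (\<Sum>x\<in>S. scal (a x) (\<rho> x)) y = coef 0 y" by (simp add: lookup_sum)
    qed
    then have "(\<Sum>x\<in>S. scal (a x) x) \<in> B" using sumR[OF fS order_refl, of a] bd 0(2) by auto
    then have "a s = 0" using ind st by blast
    then show False by (simp add: a_def)
  qed
  have "\<rho> ` S \<in> {S. finite S \<and> S \<subseteq> Z' \<and> (\<forall>a. (\<Sum>s\<in>S. scal (a s) s) \<in> B' \<longrightarrow> (\<forall>s\<in>S. a s = 0))}"
  proof (intro CollectI conjI allI impI)
    fix a assume "(\<Sum>y\<in>\<rho> ` S. scal (a y) y) \<in> B'"
    then have "(\<Sum>s\<in>S. scal (a (\<rho> s)) (\<rho> s)) \<in> B'" by (simp add: sum.reindex[OF inj])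
    then have "(\<Sum>s\<in>S. scal (a (\<rho> s)) s) \<in> B" using sumR[OF fS order_refl, of "\<lambda>s. a (\<rho> s)"] bd by blast
    then have "\<forall>s\<in>S. a (\<rho> s) = 0" by (rule ind)
    then show "\<forall>y\<in>\<rho> ` S. a y = 0" by simp
  qed (use fS \<rho> in auto)
  then have "enat (card (\<rho> ` S)) \<le> quotient_dim Z' B'" unfolding quotient_dim_def by (rule SUP_upper)
  then show "enat (card S) \<le> quotient_dim Z' B'" by (simp add: card_image[OF inj])
qed

lemma quotient_dim_eq:
  fixes Z B :: "('b \<Rightarrow>\<^sub>0 'k::field) set" and Z' B' :: "('c \<Rightarrow>\<^sub>0 'k) set"
  assumes "\<And>z. z \<in> Z \<Longrightarrow> \<exists>c\<in>Z'. R z c" "\<And>c. c \<in> Z' \<Longrightarrow> \<exists>z\<in>Z. R z c"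
    and "\<And>z c z' c'. R z c \<Longrightarrow> R z' c' \<Longrightarrow> R (z + z') (c + c')"
    and "\<And>a z c. R z c \<Longrightarrow> R (scal a z) (scal a c)"
    and "R 0 0" "0 \<in> B" "0 \<in> B'" and "\<And>z c. R z c \<Longrightarrow> c \<in> B' \<longleftrightarrow> z \<in> B"
  shows "quotient_dim Z B = quotient_dim Z' B'"
proof (rule order_antisym)
  show "quotient_dim Z B \<le> quotient_dim Z' B'" by (rule quotient_dim_le[of Z Z' R B' B]) (use assms in auto)
  show "quotient_dim Z' B' \<le> quotient_dim Z B" by (rule quotient_dim_le[of Z' Z "\<lambda>c z. R z c" B B']) (use assms in auto)
qed

text \<open>Change of coefficients for an integral chain, scaled by \<open>a\<close>. Together with
  \<open>kext\<close> it transports operators on integral chains, such as subdivision and its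
  homotopy, to coefficients in the field.\<close>

definition kz :: "'k::field \<Rightarrow> ('b \<Rightarrow>\<^sub>0 int) \<Rightarrow> ('b \<Rightarrow>\<^sub>0 'k)" where
  "kz a z = (\<Sum>g\<in>supp z. mon g (a * of_int (coef z g)))"

lemma lookup_kz [simp]: "coef (kz a z) g = a * of_int (coef z g)"
  unfolding kz_def by (subst lookup_sum_single) (auto simp: in_keys_iff)

lemma kz_simps [simp]: "kz 0 z = 0" "kz a 0 = 0" "kz a (frag_of x) = mon x a"
  by (rule poly_mapping_eqI, simp add: lookup_single when_def)+
lemma kz_add: "kz (a + b) z = kz a z + kz b z" "kz a (y + z) = kz a y + kz a z" "kz a (y - z) = kz a y - kz a z"
  by (rule poly_mapping_eqI, simp add: lookup_add lookup_minus algebra_simps)+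
lemma kz_cmul: "kz a (frag_cmul n z) = kz (a * of_int n) z" by (rule poly_mapping_eqI) simp
lemma kz_sum: "kz a (\<Sum>i\<in>A. f i) = (\<Sum>i\<in>A. kz a (f i))"
  by (induction A rule: infinite_finite_induct) (auto simp: kz_add)
lemma keys_kz: "supp (kz a z) \<subseteq> supp z" by (auto simp: in_keys_iff)

definition kext :: "('a \<Rightarrow> 'b \<Rightarrow>\<^sub>0 int) \<Rightarrow> ('a \<Rightarrow>\<^sub>0 'k::field) \<Rightarrow> ('b \<Rightarrow>\<^sub>0 'k)" where
  "kext T c = (\<Sum>f\<in>supp c. kz (coef c f) (T f))"

lemma kext_add: "kext T (c + d) = kext T c + kext T d"
  unfolding kext_def by (rule setsum_keys_plus_distrib) (auto simp: kz_add)
lemma kext_0 [simp]: "kext T 0 = 0" by (simp add: kext_def)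
lemma additive_kext: "additive_fun (kext T)" by (simp add: additive_fun_def kext_add)
lemmas kext_diff = additive_fun_diff[OF additive_kext]
lemmas kext_sum = additive_fun_sum[OF additive_kext]
lemma kext_single [simp]: "kext T (mon f a) = kz a (T f)"
  by (cases "a = 0") (auto simp: kext_def)
lemma kext_scal: "kext T (scal a c) = scal a (kext T c)"
proof (induction c rule: pm_induct)
  case (single e b)
  have "scal a (mon e b) = mon e (a * b)"
    by (rule poly_mapping_eqI) (simp add: lookup_single when_def)
  then show ?case by (simp, intro poly_mapping_eqI) simp
next
  case zero
  have "scal a (0 :: 'a \<Rightarrow>\<^sub>0 'b) = 0" "scal a (0 :: 'c \<Rightarrow>\<^sub>0 'b) = 0" by (rule poly_mapping_eqI, simp)+
  then show ?case by simp
qed (simp add: kext_add scal_add)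
lemma kext_kz: "kext S (kz a z) = kz a (frag_extend S z)"
  using subset_UNIV by (induction z rule: frag_induction) (auto simp: kz_add kext_diff frag_extend_diff)
lemma kext_kext: "kext S (kext T c) = kext (\<lambda>f. frag_extend S (T f)) c"
  unfolding kext_def[of T] kext_def[of "\<lambda>f. frag_extend S (T f)"] by (simp add: kext_sum kext_kz)
lemma kext_cong: "(\<And>f. f \<in> supp c \<Longrightarrow> S f = T f) \<Longrightarrow> kext S c = kext T c"
  unfolding kext_def by (rule sum.cong) auto
lemma kext_plus: "kext (\<lambda>f. S f + T f) c = kext S c + kext T c"
  by (simp add: kext_def kz_add sum.distrib)
lemma kext_minus: "kext (\<lambda>f. S f - T f) c = kext S c - kext T c"
  by (simp add: kext_def kz_add sum_subtractf)
lemma kext_id: "kext frag_of c = c" using pm_expand[of c] by (simp add: kext_def)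
lemma kext_zero: "kext (\<lambda>_. 0) c = 0" by (simp add: kext_def)
lemma keys_kext: "supp (kext T c) \<subseteq> (\<Union>f\<in>supp c. supp (T f))"
  unfolding kext_def using keys_sum[of "\<lambda>f. kz (coef c f) (T f)" "supp c"] keys_kz by fastforce

text \<open>The augmented boundary of one simplex as an integral chain. \<open>aug_boundary\<close>
  is its linear extension, so its identities are checked on single simplices over the
  integers.\<close>

definition ab :: "int \<Rightarrow> ((nat \<Rightarrow> real) \<Rightarrow> 'a) \<Rightarrow> 'a chain" where
  "ab n f = (\<Sum>i<nat (n + 1). frag_cmul ((- 1) ^ i) (frag_of (aug_face n i f)))"

lemma aug_boundary_kext: "aug_boundary n (c :: ((nat \<Rightarrow> real) \<Rightarrow> 'a) \<Rightarrow>\<^sub>0 'k::field) = kext (ab n) c"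
proof -
  have "kz a (ab n f) = (\<Sum>i<nat (n + 1). mon (aug_face n i f) ((-1) ^ i * a))" for a :: 'k and f :: "(nat \<Rightarrow> real) \<Rightarrow> 'a"
    unfolding ab_def kz_sum by (intro sum.cong refl) (simp add: kz_cmul mult.commute)
  then show ?thesis by (simp add: aug_boundary_def kext_def)
qed

lemma ab_pos: "ab (int (Suc p)) f = chain_boundary (Suc p) (frag_of f)"
proof -
  have "nat (int (Suc p) + 1) = Suc (Suc p)" by simp
  then have "ab (int (Suc p)) f = (\<Sum>i<Suc (Suc p). frag_cmul ((- 1) ^ i) (frag_of (aug_face (int (Suc p)) i f)))" unfolding ab_def by simp
  also have "\<dots> = (\<Sum>i\<le>Suc p. frag_cmul ((- 1) ^ i) (frag_of (singular_face (Suc p) i f)))"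
    unfolding lessThan_Suc_atMost by (intro sum.cong refl) (simp add: aug_face_def del: of_nat_Suc)
  finally show ?thesis by (simp add: chain_boundary_of del: sum.atMost_Suc)
qed

lemma ab_0: "ab 0 f = frag_of (\<lambda>_. undefined)" by (simp add: ab_def aug_face_def)
lemma ab_neg: "ab (- 1) f = 0" by (simp add: ab_def)

lemma chain_boundary_ext: "frag_extend (ab (int (Suc p))) c = chain_boundary (Suc p) c"
  unfolding chain_boundary_def by (simp add: ab_pos[abs_def] chain_boundary_of del: sum.atMost_Suc of_nat_Suc)

text \<open>The dimension is shifted by one: the empty simplex gets degree 0, degrees are natural
  numbers, and they match cardinalities of faces.\<close>

abbreviation Sx :: "nat \<Rightarrow> 'a topology \<Rightarrow> ((nat \<Rightarrow> real) \<Rightarrow> 'a) set" where "Sx m X' \<equiv> aug_simplices (int m - 1) X'"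

lemma nat_ss: "nat (int (Suc p) - 1) = p" by simp

lemma Sx_0: "Sx 0 T = {\<lambda>_. undefined}" by (simp add: aug_simplices_def)
lemma Sx_Suc: "Sx (Suc p) T = {f. singular_simplex p T f}" by (simp add: aug_simplices_def)

lemma ab_keys:
  assumes "f \<in> Sx (Suc m) T" shows "supp (ab (int m) f) \<subseteq> Sx m T"
proof (cases m)
  case 0 then show ?thesis by (simp add: ab_0 aug_simplices_def)
next
  case (Suc p)
  have "singular_chain (Suc p) T (frag_of f)" using assms unfolding Suc Sx_Suc by (simp add: singular_chain_of)
  then have "singular_chain p T (chain_boundary (Suc p) (frag_of f))" by (rule singular_chain_boundary_alt)
  then show ?thesis unfolding Suc Sx_Suc ab_pos by (simp add: singular_chain_def)
qed

lemma ab_ab: assumes "f \<in> Sx (Suc m) T" shows "frag_extend (ab (int m - 1)) (ab (int m) f) = 0"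
proof (cases m)
  case 0 then show ?thesis by (simp add: ab_0 ab_neg)
next
  case (Suc p)
  have f: "singular_simplex (Suc p) T f" using assms unfolding Suc Sx_Suc by simp
  show ?thesis
  proof (cases p)
    case 0
    have "ab 1 f = frag_of (singular_face 1 0 f) - frag_of (singular_face 1 1 f)"
      using ab_pos[of 0 f] by (simp add: chain_boundary_of)
    then show ?thesis by (simp add: Suc 0 frag_extend_diff ab_0)
  next
    case (Suc p')
    have "singular_chain (Suc (Suc p')) T (frag_of f)" using f Suc by (simp add: singular_chain_of)
    then have "chain_boundary (Suc p') (chain_boundary (Suc (Suc p')) (frag_of f)) = 0" by (rule chain_boundary_boundary_alt)
    moreover have "frag_extend (ab (int m - 1)) (ab (int m) f) = frag_extend (ab (int (Suc p'))) (ab (int (Suc (Suc p'))) f)"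
      by (simp add: \<open>m = Suc p\<close> Suc)
    ultimately show ?thesis unfolding ab_pos chain_boundary_ext by simp
  qed
qed

lemma aug_boundary_boundary: "c \<in> aug_chains (int (Suc m) - 1) T \<Longrightarrow> aug_boundary (int m - 1) (aug_boundary (int m) c) = 0"
  unfolding aug_boundary_kext kext_kext
proof -
  assume c: "c \<in> aug_chains (int (Suc m) - 1) T"
  have "kext (\<lambda>f. frag_extend (ab (int m - 1)) (ab (int m) f)) c = kext (\<lambda>_. 0) c"
    by (rule kext_cong) (use c ab_ab in \<open>auto simp: aug_chains_def\<close>)
  then show "kext (\<lambda>f. frag_extend (ab (int m - 1)) (ab (int m) f)) c = 0" by (simp add: kext_zero)
qed

text \<open>Homotopy invariance replaces the cycle by its image under a constant map, and this image
  bounds: in positive dimension because it lives on a point, in dimension 0 because it is the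
  augmentation, which vanishes, times a point.\<close>

lemma contractible_integral:
  fixes T :: "'a topology"
  assumes T: "contractible_space T" "topspace T \<noteq> {}" and z: "supp z \<subseteq> Sx m T" "frag_extend (ab (int m - 1)) z = 0"
  shows "\<exists>y. supp y \<subseteq> Sx (Suc m) T \<and> frag_extend (ab (int m)) y = z"
proof (cases m)
  case 0
  obtain a where a: "a \<in> topspace T" using T(2) by blast
  let ?s = "\<lambda>x\<in>standard_simplex 0. a"
  have s: "singular_simplex 0 T ?s" using a by (simp add: singular_simplex_def)
  have "z = frag_cmul (coef z (\<lambda>_. undefined)) (frag_of (\<lambda>_. undefined))"
    using z(1) 0 by (intro poly_mapping_eqI) (auto simp: aug_simplices_def lookup_single when_def in_keys_iff)
  then have "frag_extend (ab (int m)) (frag_cmul (coef z (\<lambda>_. undefined)) (frag_of ?s)) = z"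
    by (simp add: 0 frag_extend_cmul ab_0)
  moreover have "supp (frag_cmul (coef z (\<lambda>_. undefined)) (frag_of ?s)) \<subseteq> Sx (Suc m) T"
    using s keys_cmul[of _ "frag_of ?s"] by (force simp: 0 aug_simplices_def)
  ultimately show ?thesis by blast
next
  case (Suc p)
  obtain a where hom: "homotopic_with (\<lambda>x. True) T T id (\<lambda>x. a)" using T(1) by (auto simp: contractible_space_def)
  then have contc: "continuous_map T T (\<lambda>x. a)" using homotopic_with_imp_continuous_maps by blast
  then have a: "a \<in> topspace T" using T(2) by (simp add: continuous_map_const)
  have zc: "singular_chain p T z" using z(1) Suc by (simp add: aug_simplices_def singular_chain_def)
  have cyc: "singular_relcycle p T {} z"
  proof (cases p)
    case 0 then show ?thesis using zc by (simp add: singular_cycle chain_boundary_def)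
  next
    case (Suc p') then show ?thesis using zc z(2) \<open>m = Suc p\<close> chain_boundary_ext[of p' z] by (simp add: singular_cycle)
  qed
  have "homotopic_with (\<lambda>h. h \<in> {} \<rightarrow> {}) T T id (\<lambda>x. a)" using hom by (rule homotopic_with_mono) auto
  then have "homologous_rel p T {} (chain_map p id z) (chain_map p (\<lambda>x. a) z)"
    by (rule homotopic_imp_homologous_rel_chain_maps[OF _ cyc])
  then have h1: "singular_relboundary p T {} (z - chain_map p (\<lambda>x. a) z)"
    using zc by (simp add: homologous_rel_def chain_map_id_gen)
  have "singular_relboundary p T {} (chain_map p (\<lambda>x. a) z)"
  proof (cases p)
    case 0
    let ?s = "\<lambda>x\<in>standard_simplex 0. a"
    have "chain_map 0 (\<lambda>x. a) z = frag_extend (\<lambda>f. frag_of ?s) z"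
      by (simp add: chain_map_def o_def simplex_map_def)
    also have "\<dots> = frag_extend (\<lambda>g. frag_of ?s) (frag_extend (frag_of o (\<lambda>f. (\<lambda>_. undefined) :: (nat \<Rightarrow> real) \<Rightarrow> 'a)) z)"
      by (simp only: frag_extend_compose) (simp add: o_def)
    also have "frag_extend (frag_of o (\<lambda>f. (\<lambda>_. undefined) :: (nat \<Rightarrow> real) \<Rightarrow> 'a)) z = frag_extend (ab (int m - 1)) z"
      by (simp add: Suc 0 ab_0[abs_def] o_def)
    finally show ?thesis using z(2) 0 by simp
  next
    case (Suc p')
    let ?A = "subtopology T {a}"
    have ts: "topspace ?A = {a}" using a by auto
    have "continuous_map T ?A (\<lambda>x. a)" using contc a by (simp add: continuous_map_in_subtopology)
    then have "singular_relcycle p ?A {} (chain_map p (\<lambda>x. a) z)"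
      by (rule singular_relcycle_chain_map[OF cyc]) auto
    then have "singular_relboundary p ?A {} (chain_map p (\<lambda>x. a) z)"
      using singular_boundary_eq_cycle_singleton[OF ts, of p] Suc by auto
    then have "singular_relboundary p (subtopology T (topspace T)) {} (chain_map p (\<lambda>x. a) z)"
      by (rule singular_boundary_mono[rotated]) (use a in auto)
    then show ?thesis by (simp add: subtopology_topspace)
  qed
  then have "singular_relboundary p T {} z" using singular_relboundary_add[OF h1] by fastforce
  then obtain y where "singular_chain (Suc p) T y" "chain_boundary (Suc p) y = z" by (auto simp: singular_boundary)
  then show ?thesis using chain_boundary_ext[of p y] Suc by (intro exI[of _ y]) (simp add: singular_chain_def aug_simplices_def nat_ss del: of_nat_Suc)
qed

text \<open>Other coefficients require more than integral acyclicity, namely a chain contraction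
  given on simplices, which extends linearly. It is chosen degree by degree: the chain obtained from
  a simplex by subtracting the contraction of its boundary is a cycle and can be filled.\<close>

primrec ctr :: "'a topology \<Rightarrow> nat \<Rightarrow> ((nat \<Rightarrow> real) \<Rightarrow> 'a) \<Rightarrow> 'a chain" where
  "ctr T 0 f = (SOME y. supp y \<subseteq> Sx 1 T \<and> frag_extend (ab 0) y = frag_of f)"
| "ctr T (Suc m) f = (SOME y. supp y \<subseteq> Sx (Suc (Suc m)) T \<and>
      frag_extend (ab (int (Suc m))) y = frag_of f - frag_extend (ctr T m) (ab (int m) f))"

lemma ctr_0:
  assumes T: "contractible_space T" "topspace T \<noteq> {}" and f: "f \<in> Sx 0 T"
  shows "supp (ctr T 0 f) \<subseteq> Sx 1 T" "frag_extend (ab 0) (ctr T 0 f) = frag_of f"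
proof -
  have "\<exists>y. supp y \<subseteq> Sx (Suc 0) T \<and> frag_extend (ab (int 0)) y = frag_of f"
    by (rule contractible_integral[OF T]) (use f in \<open>auto simp: ab_neg\<close>)
  then have "\<exists>y. supp y \<subseteq> Sx 1 T \<and> frag_extend (ab 0) y = frag_of f" by simp
  from someI_ex[OF this] show "supp (ctr T 0 f) \<subseteq> Sx 1 T" "frag_extend (ab 0) (ctr T 0 f) = frag_of f"
    unfolding ctr.simps by blast+
qed

lemma ctr_Suc:
  assumes T: "contractible_space T" "topspace T \<noteq> {}"
  shows "f \<in> Sx (Suc m) T \<Longrightarrow> supp (ctr T (Suc m) f) \<subseteq> Sx (Suc (Suc m)) T \<and>
      frag_extend (ab (int (Suc m))) (ctr T (Suc m) f) = frag_of f - frag_extend (ctr T m) (ab (int m) f)"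
proof (induction m arbitrary: f)
  case (0 f)
  have k: "supp (frag_extend (ctr T 0) (ab (int 0) f)) \<subseteq> Sx (Suc 0) T"
  proof (rule subset_trans[OF keys_frag_extend], rule UN_least)
    fix g assume "g \<in> supp (ab (int 0) f)"
    then have "g \<in> Sx 0 T" using ab_keys[OF 0] by blast
    then show "supp (ctr T 0 g) \<subseteq> Sx (Suc 0) T" using ctr_0[OF T] by simp
  qed
  have "\<exists>y. supp y \<subseteq> Sx (Suc (Suc 0)) T \<and> frag_extend (ab (int (Suc 0))) y = frag_of f - frag_extend (ctr T 0) (ab (int 0) f)"
  proof (rule contractible_integral[OF T])
    show "supp (frag_of f - frag_extend (ctr T 0) (ab (int 0) f)) \<subseteq> Sx (Suc 0) T"
      using keys_diff[of "frag_of f" "frag_extend (ctr T 0) (ab (int 0) f)"] k 0 by auto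
    have u: "(\<lambda>_. undefined) \<in> Sx 0 T" unfolding Sx_0 by simp
    show "frag_extend (ab (int (Suc 0) - 1)) (frag_of f - frag_extend (ctr T 0) (ab (int 0) f)) = 0"
      using ctr_0(2)[OF T u] by (simp add: frag_extend_diff ab_0 del: ctr.simps)
  qed
  from someI_ex[OF this] show ?case unfolding ctr.simps .
next
  case (Suc m f)
  let ?w = "frag_extend (ctr T (Suc m)) (ab (int (Suc m)) f)"
  have abk: "\<And>g. g \<in> supp (ab (int (Suc m)) f) \<Longrightarrow> g \<in> Sx (Suc m) T" using ab_keys[OF Suc.prems] by blast
  have k: "supp ?w \<subseteq> Sx (Suc (Suc m)) T"
    by (rule subset_trans[OF keys_frag_extend], rule UN_least) (use Suc.IH abk in blast)
  have lin: "frag_extend S (frag_extend R z) = frag_extend (\<lambda>g. frag_extend S (R g)) z" for S :: "((nat \<Rightarrow> real) \<Rightarrow> 'a) \<Rightarrow> 'a chain" and R :: "((nat \<Rightarrow> real) \<Rightarrow> 'a) \<Rightarrow> 'a chain" and z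
    using subset_UNIV by (induction z rule: frag_induction) (auto simp: frag_extend_diff)
  have "frag_extend (ab (int (Suc m))) ?w = frag_extend (\<lambda>g. frag_of g - frag_extend (ctr T m) (ab (int m) g)) (ab (int (Suc m)) f)"
    unfolding lin by (rule frag_extend_eq) (use Suc.IH abk in blast)
  also have "\<dots> = frag_extend frag_of (ab (int (Suc m)) f) - frag_extend (ctr T m) (frag_extend (ab (int m)) (ab (int (Suc m)) f))"
  proof -
    have "frag_extend (\<lambda>g. frag_of g - frag_extend (ctr T m) (ab (int m) g)) z = frag_extend frag_of z - frag_extend (\<lambda>g. frag_extend (ctr T m) (ab (int m) g)) z" for z
      using subset_UNIV by (induction z rule: frag_induction) (auto simp: frag_extend_diff)
    then show ?thesis unfolding lin .
  qed
  also have "frag_extend (ab (int m)) (ab (int (Suc m)) f) = 0" using ab_ab[OF Suc.prems] by simp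
  finally have w: "frag_extend (ab (int (Suc m))) ?w = ab (int (Suc m)) f" by (simp add: frag_expansion[symmetric] del: ctr.simps of_nat_Suc)
  have "\<exists>y. supp y \<subseteq> Sx (Suc (Suc (Suc m))) T \<and> frag_extend (ab (int (Suc (Suc m)))) y = frag_of f - ?w"
  proof (rule contractible_integral[OF T])
    show "supp (frag_of f - ?w) \<subseteq> Sx (Suc (Suc m)) T"
      using keys_diff[of "frag_of f" ?w] k Suc.prems by auto
    show "frag_extend (ab (int (Suc (Suc m)) - 1)) (frag_of f - ?w) = 0"
      using w by (simp add: frag_extend_diff del: ctr.simps)
  qed
  from someI_ex[OF this] show ?case unfolding ctr.simps(2)[of T "Suc m"] .
qed

theorem contractible_acyclic:
  assumes T: "contractible_space T" "topspace T \<noteq> {}" and c: "c \<in> aug_chains (int m - 1) T" "m \<ge> 1 \<Longrightarrow> aug_boundary (int m - 1) c = 0"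
  shows "\<exists>b\<in>aug_chains (int m) T. aug_boundary (int m) b = (c :: ((nat \<Rightarrow> real) \<Rightarrow> 'a) \<Rightarrow>\<^sub>0 'k::field)"
proof (intro bexI)
  have ck: "\<And>f. f \<in> supp c \<Longrightarrow> f \<in> Sx m T" using c(1) by (auto simp: aug_chains_def)
  show "kext (ctr T m) c \<in> aug_chains (int m) T" unfolding aug_chains_def mem_Collect_eq
  proof (rule subset_trans[OF keys_kext], rule UN_least)
    fix f assume f: "f \<in> supp c"
    show "supp (ctr T m f) \<subseteq> aug_simplices (int m) T"
      using ctr_0[OF T] ctr_Suc[OF T] ck[OF f] by (cases m) (auto simp del: ctr.simps)
  qed
  show "aug_boundary (int m) (kext (ctr T m) c) = c"
  proof (cases m)
    case 0
    have "kext (\<lambda>f. frag_extend (ab (int m)) (ctr T m f)) c = kext frag_of c"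
      by (rule kext_cong) (use ctr_0[OF T] ck 0 in \<open>simp del: ctr.simps\<close>)
    then show ?thesis by (simp add: aug_boundary_kext kext_kext kext_id)
  next
    case (Suc n)
    have "kext (\<lambda>f. frag_extend (ab (int m)) (ctr T m f)) c = kext (\<lambda>f. frag_of f - frag_extend (ctr T n) (ab (int n) f)) c"
      by (rule kext_cong) (use ctr_Suc[OF T] ck Suc in \<open>simp del: ctr.simps\<close>)
    also have "\<dots> = c - kext (ctr T n) (kext (ab (int n)) c)" by (simp add: kext_minus kext_id kext_kext)
    also have "kext (ab (int n)) c = 0" using c(2) Suc by (simp add: aug_boundary_kext)
    finally show ?thesis by (simp add: aug_boundary_kext kext_kext)
  qed
qed

lemma subdivision_homotopy:
  "\<exists>h. (\<forall>p. h p 0 = (0 :: 'a chain)) \<and> (\<forall>p c1 c2. h p (c1 - c2) = h p c1 - h p c2) \<and>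
    (\<forall>p T c. singular_chain p T c \<longrightarrow> singular_chain (Suc p) T (h p c)) \<and>
    (\<forall>p T c. singular_chain p T c \<longrightarrow> chain_boundary (Suc p) (h p c) + h (p - Suc 0) (chain_boundary p c) = (singular_subdivision p ^^ n) c - c)"
  by (rule chain_homotopic_iterated_singular_subdivision[of n]) blast

text \<open>The simplices contained in a single cover set. The empty simplex counts as small even
  when there are no cover sets.\<close>

definition small :: "('v \<Rightarrow> 'a set) \<Rightarrow> 'v set \<Rightarrow> 'a topology \<Rightarrow> nat \<Rightarrow> ((nat \<Rightarrow> real) \<Rightarrow> 'a) set" where
  "small U V T m = (if m = 0 then Sx 0 T else (\<Union>v\<in>V. Sx m (subtopology T (U v))))"

text \<open>Iterated subdivision makes a chain small, and the subdivision homotopy is natural, so it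
  takes simplices in a cover set to chains in the same set. \<open>H'\<close> is this homotopy one
  degree lower; it is applied to the boundary of \<open>c\<close>, so a small boundary contributes
  only a small correction.\<close>

lemma subdivision_k:
  fixes T :: "'a topology"
  assumes U: "\<And>v. v \<in> V \<Longrightarrow> openin T (U v)" "topspace T \<subseteq> (\<Union>v\<in>V. U v)"
    and c: "c \<in> aug_chains (int p) T"
  shows "\<exists>s H H'. supp s \<subseteq> small U V T (Suc p) \<and> H c \<in> aug_chains (int (Suc p)) T \<and>
    (\<forall>e::((nat \<Rightarrow> real) \<Rightarrow> 'a) \<Rightarrow>\<^sub>0 'k::field. p \<ge> 1 \<longrightarrow> supp e \<subseteq> small U V T p \<longrightarrow> supp (H' e) \<subseteq> small U V T (Suc p)) \<and> H' 0 = 0 \<and>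
    aug_boundary (int (Suc p)) (H c) + (if p = 0 then 0 else H' (aug_boundary (int p) c)) = s - c"
proof -
  have cs: "singular_simplex p T f" if "f \<in> supp c" for f
    using c that by (auto simp: aug_chains_def aug_simplices_def)
  have "\<exists>n. \<forall>m f'. n \<le> m \<longrightarrow> f' \<in> supp ((singular_subdivision p ^^ m) (frag_of f)) \<longrightarrow> (\<exists>W\<in>U ` V. f' \<in> standard_simplex p \<rightarrow> W)"
    if f: "f \<in> supp c" for f
  proof -
    have "singular_chain p T (frag_of f)" using cs[OF f] by (simp add: singular_chain_of)
    then show ?thesis
      by (rule sufficient_iterated_singular_subdivision_exists[of "U ` V" T, rotated 2]) (use U in auto)
  qed
  then have "\<forall>f\<in>supp c. \<exists>n. \<forall>m f'. n \<le> m \<longrightarrow> f' \<in> supp ((singular_subdivision p ^^ m) (frag_of f)) \<longrightarrow> (\<exists>W\<in>U ` V. f' \<in> standard_simplex p \<rightarrow> W)" by (rule ballI)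
  from bchoice[OF this] obtain N where N: "\<forall>f\<in>supp c. \<forall>m f'. N f \<le> m \<longrightarrow> f' \<in> supp ((singular_subdivision p ^^ m) (frag_of f)) \<longrightarrow> (\<exists>W\<in>U ` V. f' \<in> standard_simplex p \<rightarrow> W)" ..
  \<comment> \<open>The smallness bounds persist under further subdivision, so the sum of the bounds
    works for all simplices of \<open>c\<close>.\<close>
  define n where "n = (\<Sum>f\<in>supp c. N f)"
  have Nn: "N f \<le> n" if "f \<in> supp c" for f unfolding n_def using that by (intro member_le_sum) auto
  obtain h where h0: "\<And>p. h p 0 = (0 :: 'a chain)" and hd: "\<And>p c1 c2. h p (c1-c2) = h p c1 - h p c2"
    and hc: "\<And>p T c. singular_chain p T c \<Longrightarrow> singular_chain (Suc p) T (h p c)"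
    and hb: "\<And>p T c. singular_chain p T c \<Longrightarrow> chain_boundary (Suc p) (h p c) + h (p - Suc 0) (chain_boundary p c) = (singular_subdivision p ^^ n) c - c"
    using subdivision_homotopy[of n] by blast
  have hext: "h p z = frag_extend (\<lambda>f. h p (frag_of f)) z" for p z
    using subset_UNIV by (induction z rule: frag_induction) (auto simp: h0 hd frag_extend_diff)
  have hp1: "h p z1 = frag_extend (\<lambda>f. h p (frag_of f)) z1" for p z1 by (rule hext)
  define H :: "(((nat \<Rightarrow> real) \<Rightarrow> 'a) \<Rightarrow>\<^sub>0 'k) \<Rightarrow> _" where "H = kext (\<lambda>f. h p (frag_of f))"
  define H' :: "(((nat \<Rightarrow> real) \<Rightarrow> 'a) \<Rightarrow>\<^sub>0 'k) \<Rightarrow> _" where "H' = kext (\<lambda>f. h (p - Suc 0) (frag_of f))"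
  define s where "s = kext (\<lambda>f. (singular_subdivision p ^^ n) (frag_of f)) c"
  show ?thesis
  proof (intro exI conjI allI impI)
    have sdc: "singular_chain p T ((singular_subdivision p ^^ n) z)" if "singular_chain p T z" for z
      using that by (induction n) (auto intro: singular_chain_singular_subdivision)
    show "supp s \<subseteq> small U V T (Suc p)"
      unfolding s_def
    proof (rule subset_trans[OF keys_kext], rule UN_least, rule subsetI)
      fix f g assume f: "f \<in> supp c" and g: "g \<in> supp ((singular_subdivision p ^^ n) (frag_of f))"
      then have "\<exists>W\<in>U ` V. g \<in> standard_simplex p \<rightarrow> W" using N Nn by blast
      then obtain v where v: "v \<in> V" "g \<in> standard_simplex p \<rightarrow> U v" by blast
      have "singular_simplex p T g" using sdc[of "frag_of f"] cs[OF f] g by (auto simp: singular_chain_of singular_chain_def)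
      then have "singular_simplex p (subtopology T (U v)) g" using v by (auto simp: singular_simplex_subtopology)
      then show "g \<in> small U V T (Suc p)" using v by (auto simp: small_def aug_simplices_def)
    qed
    show "H c \<in> aug_chains (int (Suc p)) T"
      unfolding H_def aug_chains_def mem_Collect_eq
    proof (rule subset_trans[OF keys_kext], rule UN_least)
      fix f assume "f \<in> supp c"
      then show "supp (h p (frag_of f)) \<subseteq> aug_simplices (int (Suc p)) T"
        using hc[of p T "frag_of f"] cs by (auto simp: singular_chain_of singular_chain_def aug_simplices_def simp del: of_nat_Suc)
    qed
    show "H' 0 = 0" by (simp add: H'_def)
    show "supp (H' e) \<subseteq> small U V T (Suc p)" if p: "1 \<le> p" and e: "supp e \<subseteq> small U V T p" for e
      unfolding H'_def
    proof (rule subset_trans[OF keys_kext], rule UN_least)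
      fix f assume f: "f \<in> supp e"
      obtain p' where p': "p = Suc p'" using p by (cases p) auto
      obtain v where v: "v \<in> V" "singular_simplex p' (subtopology T (U v)) f"
      proof -
        have "f \<in> small U V T (Suc p')" using e f p' by blast
        then show ?thesis using that unfolding small_def Sx_Suc by auto
      qed
      then have "singular_chain (Suc p') (subtopology T (U v)) (h p' (frag_of f))" by (intro hc) (simp add: singular_chain_of)
      then show "supp (h (p - Suc 0) (frag_of f)) \<subseteq> small U V T (Suc p)"
        using v p' by (auto simp: small_def aug_simplices_def singular_chain_def nat_ss simp del: of_nat_Suc)
    qed
    have "kext (\<lambda>f. frag_extend (ab (int (Suc p))) (h p (frag_of f)) + (if p = 0 then 0 else h (p - Suc 0) (chain_boundary p (frag_of f)))) c
        = kext (\<lambda>f. (singular_subdivision p ^^ n) (frag_of f) - frag_of f) c"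
    proof (rule kext_cong)
      fix f assume f: "f \<in> supp c"
      have "singular_chain p T (frag_of f)" using cs[OF f] by (simp add: singular_chain_of)
      from hb[OF this] show "frag_extend (ab (int (Suc p))) (h p (frag_of f)) + (if p = 0 then 0 else h (p - Suc 0) (chain_boundary p (frag_of f))) = (singular_subdivision p ^^ n) (frag_of f) - frag_of f"
        unfolding chain_boundary_ext by (auto simp: chain_boundary_def h0)
    qed
    then have e: "kext (\<lambda>f. frag_extend (ab (int (Suc p))) (h p (frag_of f))) c + kext (\<lambda>f. if p = 0 then 0 else h (p - Suc 0) (chain_boundary p (frag_of f))) c = s - c"
      by (simp add: kext_plus kext_minus kext_id s_def)
    have e2: "kext (\<lambda>f. if p = 0 then 0 else h (p - Suc 0) (chain_boundary p (frag_of f))) c = (if p = 0 then 0 else H' (aug_boundary (int p) c))"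
    proof (cases p)
      case (Suc p')
      have "kext (\<lambda>f. h p' (chain_boundary (Suc p') (frag_of f))) c = kext (\<lambda>f. frag_extend (\<lambda>f. h p' (frag_of f)) (ab (int (Suc p')) f)) c"
        by (rule kext_cong) (simp only: ab_pos hext[symmetric])
      then show ?thesis by (simp add: Suc H'_def aug_boundary_kext kext_kext)
    qed (simp add: kext_zero)
    show "aug_boundary (int (Suc p)) (H c) + (if p = 0 then 0 else H' (aug_boundary (int p) c)) = s - c"
      using e unfolding e2 by (simp add: H_def aug_boundary_kext kext_kext)
  qed
qed

section \<open>The nerve theorem\<close>

text \<open>The rows with second index at least 1 and the columns with first index at least 1 are
  exact, including surjectivity at their lower ends. The two remaining edges are not assumed exact;
  their homologies are to be compared.\<close>

locale double_complex =
  fixes G :: "nat \<Rightarrow> nat \<Rightarrow> 'a::ab_group_add set" and d e :: "nat \<Rightarrow> 'a \<Rightarrow> 'a"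
  assumes G_diff: "x \<in> G p m \<Longrightarrow> y \<in> G p m \<Longrightarrow> x - y \<in> G p m"
    and d_add: "additive_fun (d p)" and e_add: "additive_fun (e p)"
    and d_in: "x \<in> G (Suc p) m \<Longrightarrow> d (Suc p) x \<in> G p m"
    and e_in: "x \<in> G p (Suc m) \<Longrightarrow> e (Suc m) x \<in> G p m"
    and dd: "x \<in> G (Suc (Suc p)) m \<Longrightarrow> d (Suc p) (d (Suc (Suc p)) x) = 0"
    and ee: "x \<in> G p (Suc (Suc m)) \<Longrightarrow> e (Suc m) (e (Suc (Suc m)) x) = 0"
    and comm: "x \<in> G (Suc p) (Suc m) \<Longrightarrow> d (Suc p) (e (Suc m) x) = e (Suc m) (d (Suc p) x)"
    and row: "x \<in> G p (Suc m) \<Longrightarrow> (p \<ge> 1 \<Longrightarrow> d p x = 0) \<Longrightarrow> \<exists>y\<in>G (Suc p) (Suc m). d (Suc p) y = x"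
    and col: "x \<in> G (Suc p) m \<Longrightarrow> (m \<ge> 1 \<Longrightarrow> e m x = 0) \<Longrightarrow> \<exists>y\<in>G (Suc p) (Suc m). e (Suc m) y = x"
begin

text \<open>The zigzag relation between the two edges of a double complex with exact rows and columns.\<close>

definition zigzag where
  "zigzag N z c \<longleftrightarrow> (\<exists>A Y. A 0 = z \<and> A N = c \<and>
     (\<forall>j<N. Y j \<in> G (Suc j) (N - j) \<and> A j = d (Suc j) (Y j) \<and> A (Suc j) = e (N - j) (Y j)))"

lemma zigzag_total:
  assumes z: "z \<in> G 0 N" "N \<ge> 1 \<Longrightarrow> e N z = 0"
  shows "\<exists>c\<in>G N 0. zigzag N z c \<and> (N \<ge> 1 \<longrightarrow> d N c = 0)"
proof -
  have "\<exists>A Y. A 0 = z \<and> (\<forall>i<j. Y i \<in> G (Suc i) (N - i) \<and> A i = d (Suc i) (Y i) \<and> A (Suc i) = e (N - i) (Y i)) \<and>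
      A j \<in> G j (N - j) \<and> (j \<ge> 1 \<longrightarrow> d j (A j) = 0) \<and> (N - j \<ge> 1 \<longrightarrow> e (N - j) (A j) = 0)" if "j \<le> N" for j
    using that
  proof (induction j)
    case 0
    then show ?case using z by (intro exI[of _ "\<lambda>_. z"] exI[of _ "\<lambda>_. 0"]) auto
  next
    case (Suc j)
    then have "j \<le> N" by simp
    from Suc.IH[OF this] obtain A Y where A0: "A 0 = z" and AY: "\<forall>i<j. Y i \<in> G (Suc i) (N - i) \<and> A i = d (Suc i) (Y i) \<and> A (Suc i) = e (N - i) (Y i)"
      and Aj: "A j \<in> G j (N - j)" "j \<ge> 1 \<longrightarrow> d j (A j) = 0" "N - j \<ge> 1 \<longrightarrow> e (N - j) (A j) = 0" by blast
    obtain m where m: "N - j = Suc m" using Suc.prems by (metis Suc_diff_Suc Suc_le_lessD)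
    have m': "N - Suc j = m" using m by simp
    from row[of "A j" j m] Aj m obtain y where y: "y \<in> G (Suc j) (Suc m)" "d (Suc j) y = A j" by auto
    define A' where "A' = A(Suc j := e (Suc m) y)"
    define Y' where "Y' = Y(j := y)"
    have "d (Suc j) (e (Suc m) y) = 0" using comm[OF y(1)] y(2) Aj(3) m by simp
    moreover have "m \<ge> 1 \<longrightarrow> e m (e (Suc m) y) = 0" using y(1) ee[of y "Suc j"] by (cases m) auto
    moreover have "e (Suc m) y \<in> G (Suc j) m" by (rule e_in[OF y(1)])
    moreover have "\<forall>i<Suc j. Y' i \<in> G (Suc i) (N - i) \<and> A' i = d (Suc i) (Y' i) \<and> A' (Suc i) = e (N - i) (Y' i)"
    proof (intro allI impI)
      fix i assume "i < Suc j"
      then consider "i < j" | "i = j" by linarith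
      then show "Y' i \<in> G (Suc i) (N - i) \<and> A' i = d (Suc i) (Y' i) \<and> A' (Suc i) = e (N - i) (Y' i)"
        using AY y m by cases (auto simp: A'_def Y'_def)
    qed
    ultimately show ?case using A0 m' by (intro exI[of _ A'] exI[of _ Y']) (auto simp: A'_def)
  qed
  from this[of N] obtain A Y where "A 0 = z" "\<forall>i<N. Y i \<in> G (Suc i) (N - i) \<and> A i = d (Suc i) (Y i) \<and> A (Suc i) = e (N - i) (Y i)"
    "A N \<in> G N 0" "N \<ge> 1 \<longrightarrow> d N (A N) = 0" by auto
  then show ?thesis unfolding zigzag_def by blast
qed

text \<open>Along the staircase each \<open>A j\<close> is both-ways a boundary: \<open>A j\<close>
  is \<open>e\<close> of \<open>d\<close> of some \<open>E\<close>. Then \<open>Y j\<close> minus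
  the vertical boundary of \<open>E\<close> is a row cycle, and a filling of it plays the role of
  \<open>E\<close> at the next step.\<close>

lemma zigzag_bd:
  assumes zc: "zigzag N z c" and b: "b \<in> G 0 (Suc N)" "z = e (Suc N) b"
  shows "\<exists>x\<in>G (Suc N) 0. c = d (Suc N) x"
proof -
  from zc obtain A Y where A: "A 0 = z" "A N = c" and AY: "\<And>j. j < N \<Longrightarrow> Y j \<in> G (Suc j) (N - j) \<and> A j = d (Suc j) (Y j) \<and> A (Suc j) = e (N - j) (Y j)"
    unfolding zigzag_def by blast
  have "\<exists>E\<in>G (Suc j) (Suc N - j). A j = e (Suc N - j) (d (Suc j) E)" if "j \<le> N" for j
    using that
  proof (induction j)
    case 0
    from row[OF b(1)] obtain E where "E \<in> G (Suc 0) (Suc N)" "d (Suc 0) E = b" by auto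
    then show ?case using A b by auto
  next
    case (Suc j)
    then obtain E where E: "E \<in> G (Suc j) (Suc N - j)" "A j = e (Suc N - j) (d (Suc j) E)" by auto
    obtain m where m: "N - j = Suc m" using Suc.prems by (metis Suc_diff_Suc Suc_le_lessD)
    have m1: "Suc N - j = Suc (Suc m)" "Suc N - Suc j = Suc m" "j < N" using m by auto
    have Y: "Y j \<in> G (Suc j) (Suc m)" "A j = d (Suc j) (Y j)" "A (Suc j) = e (Suc m) (Y j)" using AY[OF m1(3)] m by auto
    have eE: "e (Suc (Suc m)) E \<in> G (Suc j) (Suc m)" using E(1) m1 by (intro e_in) simp
    have "d (Suc j) (Y j - e (Suc (Suc m)) E) = 0"
      using Y(2) E m1 comm[of E j "Suc m"] by (simp add: additive_fun_diff[OF d_add])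
    then obtain E' where E': "E' \<in> G (Suc (Suc j)) (Suc m)" "d (Suc (Suc j)) E' = Y j - e (Suc (Suc m)) E"
      using row[OF G_diff[OF Y(1) eE]] by auto
    have "e (Suc m) (d (Suc (Suc j)) E') = A (Suc j)"
      unfolding E'(2) using ee[of E "Suc j" m] E(1) m1 Y(3) by (simp add: additive_fun_diff[OF e_add])
    then have "A (Suc j) = e (Suc N - Suc j) (d (Suc (Suc j)) E')" unfolding m1 by simp
    moreover have "E' \<in> G (Suc (Suc j)) (Suc N - Suc j)" using E'(1) unfolding m1 .
    ultimately show ?case by blast
  qed
  from this[of N] obtain E where E: "E \<in> G (Suc N) (Suc 0)" "c = e (Suc 0) (d (Suc N) E)" using A by auto
  then show ?thesis using comm[OF E(1)] e_in[OF E(1)] by metis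
qed

lemma zigzag_add: assumes "zigzag N z c" "zigzag N z' c'" and G: "\<And>x y p m. x \<in> G p m \<Longrightarrow> y \<in> G p m \<Longrightarrow> x + y \<in> G p m" shows "zigzag N (z + z') (c + c')"
proof -
  from assms obtain A Y A' Y' where *: "A 0 = z" "A N = c" "\<And>j. j < N \<Longrightarrow> Y j \<in> G (Suc j) (N - j) \<and> A j = d (Suc j) (Y j) \<and> A (Suc j) = e (N - j) (Y j)"
    "A' 0 = z'" "A' N = c'" "\<And>j. j < N \<Longrightarrow> Y' j \<in> G (Suc j) (N - j) \<and> A' j = d (Suc j) (Y' j) \<and> A' (Suc j) = e (N - j) (Y' j)"
    unfolding zigzag_def by blast
  show ?thesis unfolding zigzag_def
    by (rule exI[of _ "\<lambda>j. A j + A' j"], rule exI[of _ "\<lambda>j. Y j + Y' j"])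
      (use * G in \<open>simp add: additive_fun_add[OF d_add] additive_fun_add[OF e_add]\<close>)
qed

lemma zigzag_map:
  assumes "zigzag N z c" "\<And>x p m. x \<in> G p m \<Longrightarrow> s x \<in> G p m" "\<And>x p. s (d p x) = d p (s x)" "\<And>x p. s (e p x) = e p (s x)"
  shows "zigzag N (s z) (s c)"
proof -
  from assms(1) obtain A Y where *: "A 0 = z" "A N = c" "\<And>j. j < N \<Longrightarrow> Y j \<in> G (Suc j) (N - j) \<and> A j = d (Suc j) (Y j) \<and> A (Suc j) = e (N - j) (Y j)"
    unfolding zigzag_def by blast
  show ?thesis unfolding zigzag_def
    by (rule exI[of _ "\<lambda>j. s (A j)"], rule exI[of _ "\<lambda>j. s (Y j)"]) (use * assms(2-4) in simp)
qed

end

text \<open>The hypotheses are symmetric under transposition, so each statement about zigzags also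
  holds in the opposite direction.\<close>

lemma double_complex_swap: "double_complex G d e \<Longrightarrow> double_complex (\<lambda>p m. G m p) e d"
proof -
  assume "double_complex G d e"
  then interpret double_complex G d e .
  show ?thesis
  proof
    show "\<And>x y p m. x \<in> G m p \<Longrightarrow> y \<in> G m p \<Longrightarrow> x - y \<in> G m p" by (rule G_diff)
    show "\<And>x p m. x \<in> G (Suc m) (Suc p) \<Longrightarrow> e (Suc p) (d (Suc m) x) = d (Suc m) (e (Suc p) x)" by (rule comm[symmetric])
  qed (rule d_add e_add d_in e_in dd ee row col; assumption?)+
qed

lemma zigzag_swap:
  assumes "double_complex G d e" and zc: "double_complex.zigzag G d e N z c"
  shows "double_complex.zigzag (\<lambda>p m. G m p) e d N c z"
proof -
  interpret A: double_complex G d e by fact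
  interpret B: double_complex "\<lambda>p m. G m p" e d by (rule double_complex_swap) fact
  from zc obtain A Y where *: "A 0 = z" "A N = c" "\<And>j. j < N \<Longrightarrow> Y j \<in> G (Suc j) (N - j) \<and> A j = d (Suc j) (Y j) \<and> A (Suc j) = e (N - j) (Y j)"
    unfolding A.zigzag_def by blast
  show ?thesis unfolding B.zigzag_def
  proof (rule exI[of _ "\<lambda>j. A (N - j)"], rule exI[of _ "\<lambda>j. Y (N - Suc j)"], intro conjI allI impI)
    fix j assume j: "j < N"
    have n: "Suc (N - Suc j) = N - j" "N - (N - Suc j) = Suc j" "N - Suc j < N" using j by auto
    from *(3)[OF n(3)] show "Y (N - Suc j) \<in> G (N - j) (Suc j)" "A (N - j) = e (Suc j) (Y (N - Suc j))" "A (N - Suc j) = d (N - j) (Y (N - Suc j))"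
      unfolding n by auto
  qed (use * in auto)
qed

section \<open>Simplicial chains and the double complex of a good cover\<close>

definition simp_chains where "simp_chains K N = {c. supp c \<subseteq> {F \<in> K. card F = N}}"
definition simp_cycles where "simp_cycles r V K N = {c :: 'v set \<Rightarrow>\<^sub>0 'k::field. c \<in> simp_chains K N \<and> (\<forall>F. up r V idw (coef c) F = 0)}"
definition simp_boundaries where "simp_boundaries r V K N = {c :: 'v set \<Rightarrow>\<^sub>0 'k::field. c \<in> simp_chains K N \<and> (\<exists>b\<in>simp_chains K (Suc N). \<forall>F. coef c F = up r V idw (coef b) F)}"

definition pr :: "('a \<Rightarrow> bool) \<Rightarrow> ('a \<Rightarrow>\<^sub>0 'k::field) \<Rightarrow> ('a \<Rightarrow>\<^sub>0 'k)" where
  "pr P c = (\<Sum>f\<in>{f\<in>supp c. P f}. mon f (coef c f))"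

lemma lookup_pr [simp]: "coef (pr P c) f = (if P f then coef c f else 0)"
  unfolding pr_def by (subst lookup_sum_single) (auto simp: in_keys_iff)

lemma additive_pr: "additive_fun (pr P)"
  unfolding additive_fun_def by (intro allI poly_mapping_eqI) (simp add: lookup_add)

text \<open>\<open>K\<close> is the nerve of the cover, and \<open>V\<close> may contain indices of
  empty cover sets. This happens for complexes obtained by deleting vertices, which keep the ambient
  vertex set.\<close>

locale nerve =
  fixes r :: "'v \<Rightarrow> nat" and V :: "'v set" and K :: "'v set set" and T :: "'a topology" and U :: "'v \<Rightarrow> 'a set"
  assumes finV: "finite V" and inj_r: "inj_on r V" and KV: "\<And>F. F \<in> K \<Longrightarrow> F \<subseteq> V"
    and Kdown: "\<And>F G. F \<in> K \<Longrightarrow> G \<subseteq> F \<Longrightarrow> G \<in> K" and K0: "{} \<in> K"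
    and opn: "\<And>v. v \<in> V \<Longrightarrow> openin T (U v)" and cov: "topspace T \<subseteq> (\<Union>v\<in>V. U v)"
    and contr: "\<And>F. F \<in> K \<Longrightarrow> F \<noteq> {} \<Longrightarrow> contractible_space (subtopology T (\<Inter>v\<in>F. U v))"
    and nonem: "\<And>F. F \<subseteq> V \<Longrightarrow> F \<noteq> {} \<Longrightarrow> F \<in> K \<longleftrightarrow> topspace T \<inter> (\<Inter>v\<in>F. U v) \<noteq> {}"
begin

text \<open>The empty face carries only the small simplices, those lying in some cover set, and not
  all simplices of \<open>T\<close>; otherwise the augmented rows would not be exact.\<close>

definition GS where "GS F m = (if F = {} then small U V T m else Sx m (subtopology T (\<Inter>v\<in>F. U v)))"
definition GG :: "nat \<Rightarrow> nat \<Rightarrow> ('v set \<Rightarrow> (((nat \<Rightarrow> real) \<Rightarrow> 'a) \<Rightarrow>\<^sub>0 'k::field)) set" where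
  "GG p m = {z. \<forall>F. supp (z F) \<subseteq> (if F \<in> K \<and> card F = p then GS F m else {})}"
definition dd where "dd (p::nat) z = (\<lambda>F. up r V idw z F)"
definition bb :: "nat \<Rightarrow> ('v set \<Rightarrow> (((nat \<Rightarrow> real) \<Rightarrow> 'a) \<Rightarrow>\<^sub>0 'k::field)) \<Rightarrow> _" where "bb m z = (\<lambda>F. aug_boundary (int m - 1) (z F))"

lemma Sx_mono: "A \<subseteq> B \<Longrightarrow> f \<in> Sx m (subtopology T A) \<Longrightarrow> f \<in> Sx m (subtopology T B)"
  by (cases m) (auto simp: aug_simplices_def intro: singular_simplex_mono)

lemma Sx_sub: "f \<in> Sx m (subtopology T A) \<Longrightarrow> f \<in> Sx m T"
  by (cases m) (auto simp: aug_simplices_def singular_simplex_subtopology)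

lemma small_sub: "f \<in> small U V T m \<Longrightarrow> f \<in> Sx m T"
  by (auto simp: small_def Sx_sub split: if_splits)

lemma small_I: "v \<in> V \<Longrightarrow> f \<in> Sx m (subtopology T (U v)) \<Longrightarrow> f \<in> small U V T m"
  by (cases m) (auto simp: small_def aug_simplices_def)

lemma GS_mono: assumes "F \<subseteq> G" "G \<in> K" "f \<in> GS G m" shows "f \<in> GS F m"
proof (cases "F = {}")
  case True
  show ?thesis
  proof (cases "G = {}")
    case False
    then obtain v where v: "v \<in> G" by blast
    then have "v \<in> V" using KV assms(2) by blast
    moreover have "f \<in> Sx m (subtopology T (U v))" using assms(3) False v by (auto simp: GS_def intro: Sx_mono[rotated])
    ultimately show ?thesis using True small_I by (simp add: GS_def)
  qed (use assms in auto)
next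
  case False
  then have "G \<noteq> {}" "(\<Inter>v\<in>G. U v) \<subseteq> (\<Inter>v\<in>F. U v)" using assms(1) by auto
  then show ?thesis using Sx_mono assms(3) False by (simp add: GS_def)
qed

lemma GS_small: "F \<in> K \<Longrightarrow> f \<in> GS F m \<Longrightarrow> f \<in> small U V T m"
  using GS_mono[of "{}" F f m] by (simp add: GS_def)

lemma ab_GS: assumes "F \<in> K" "f \<in> GS F (Suc m)" "g \<in> supp (ab (int m) f)" shows "g \<in> GS F m"
proof (cases "F = {}")
  case True
  then obtain v where v: "v \<in> V" "f \<in> Sx (Suc m) (subtopology T (U v))" using assms(2) by (auto simp: GS_def small_def)
  then have "g \<in> Sx m (subtopology T (U v))" using ab_keys[OF v(2)] assms(3) by blast
  then show ?thesis using True v small_I by (simp add: GS_def)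
next
  case False
  then show ?thesis using ab_keys[of f m "subtopology T (\<Inter>v\<in>F. U v)"] assms by (auto simp: GS_def)
qed

lemma GG_keys: assumes "z \<in> GG p m" "f \<in> supp (z F)" shows "F \<in> K \<and> card F = p \<and> f \<in> GS F m"
proof -
  have "f \<in> (if F \<in> K \<and> card F = p then GS F m else {})" using assms unfolding GG_def by blast
  then show ?thesis by (simp split: if_splits)
qed
lemma GG_zero: assumes "z \<in> GG p m" "\<not> (F \<in> K \<and> card F = p)" shows "z F = 0"
proof -
  have "supp (z F) = {}" using GG_keys[OF assms(1)] assms(2) by blast
  then show ?thesis by (simp only: keys_eq_empty)
qed
lemma GG_I: "(\<And>F f. f \<in> supp (z F) \<Longrightarrow> F \<in> K \<and> card F = p \<and> f \<in> GS F m) \<Longrightarrow> z \<in> GG p m"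
  unfolding GG_def by (intro CollectI allI subsetI) (simp only: if_True split: if_splits; blast)

lemma finK: "F \<in> K \<Longrightarrow> finite F" using KV finV finite_subset by blast

lemma keys_sg: "supp (sg \<rho> u F c) = supp c" by (simp add: sg_def)

lemma GG_dd_in: "x \<in> GG (Suc p) m \<Longrightarrow> dd n x \<in> GG p m"
proof (rule GG_I)
  fix F f assume x: "x \<in> GG (Suc p) m" and f: "f \<in> supp (dd n x F)"
  then obtain u where u: "u \<in> V - F" "f \<in> supp (x (insert u F))"
    using keys_sum[of "\<lambda>u. sg r u F (x (insert u F))" "V - F"] by (auto simp: dd_def up_def keys_sg)
  then have g: "insert u F \<in> K" "card (insert u F) = Suc p" "f \<in> GS (insert u F) m" using GG_keys[OF x] by auto
  have "finite F" using finK[OF g(1)] by simp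
  then show "F \<in> K \<and> card F = p \<and> f \<in> GS F m" using g u Kdown[OF g(1), of F] GS_mono[OF _ g(1,3), of F] by auto
qed

text \<open>Every small simplex picks a cover set that contains it. Sorting chains by this choice
  gives projections with sum 1, and \<open>up_dn\<close> makes \<open>dn r a\<close> a contraction.
  In degree 0 there is only the empty simplex, whose row is the simplicial chain complex of
  \<open>K\<close>; hence the index \<open>Suc m\<close>.\<close>

lemma GG_row:
  assumes x: "x \<in> GG p (Suc m)" "p \<ge> 1 \<Longrightarrow> dd p x = (0 :: 'v set \<Rightarrow> (((nat \<Rightarrow> real) \<Rightarrow> 'a) \<Rightarrow>\<^sub>0 'k::field))"
  shows "\<exists>y\<in>GG (Suc p) (Suc m). dd (Suc p) y = x"
proof -
  define vf where "vf f = (SOME v. v \<in> V \<and> f \<in> Sx (Suc m) (subtopology T (U v)))" for f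
  have vf: "vf f \<in> V \<and> f \<in> Sx (Suc m) (subtopology T (U (vf f)))" if "f \<in> small U V T (Suc m)" for f
    unfolding vf_def by (rule someI_ex) (use that in \<open>auto simp: small_def simp del: of_nat_Suc\<close>)
  define a :: "'v \<Rightarrow> (((nat \<Rightarrow> real) \<Rightarrow> 'a) \<Rightarrow>\<^sub>0 'k) \<Rightarrow> _" where "a u = pr (\<lambda>f. vf f = u)" for u
  define y where "y = dn r a x"
  have y: "y \<in> GG (Suc p) (Suc m)"
  proof (rule GG_I)
    fix F f assume f: "f \<in> supp (y F)"
    then obtain u where u: "u \<in> F" "f \<in> supp (a u (x (F - {u})))"
      using keys_sum[of "\<lambda>u. sg r u F (a u (x (F - {u})))" F] by (auto simp: y_def dn_def keys_sg)
    then have u2: "f \<in> supp (x (F - {u}))" "vf f = u" by (auto simp: a_def in_keys_iff split: if_splits)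
    then have g: "F - {u} \<in> K" "card (F - {u}) = p" "f \<in> GS (F - {u}) (Suc m)" using GG_keys[OF x(1)] by auto
    have v: "u \<in> V" "f \<in> Sx (Suc m) (subtopology T (U u))" using vf[OF GS_small[OF g(1,3)]] u2 by auto
    have FV: "F \<subseteq> V" using KV[OF g(1)] v(1) by blast
    have finF: "finite F" using finV FV finite_subset by blast
    have sf: "f \<in> Sx (Suc m) (subtopology T (\<Inter>v\<in>F. U v))"
    proof (cases "F = {u}")
      case True then show ?thesis using v by simp
    next
      case False
      then have "F - {u} \<noteq> {}" using u by blast
      then have "f \<in> Sx (Suc m) (subtopology T (\<Inter>v\<in>F - {u}. U v))" using g(3) by (simp add: GS_def)
      then show ?thesis using v(2) unfolding Sx_Suc singular_simplex_subtopology mem_Collect_eq by blast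
    qed
    \<comment> \<open>A singular simplex has a nonempty image, so one lying in all the sets
      \<open>U v\<close> witnesses that \<open>F\<close> belongs to the nerve.\<close>
    have "topspace T \<inter> (\<Inter>v\<in>F. U v) \<noteq> {}"
      using sf singular_simplex_empty[of "subtopology T (\<Inter>v\<in>F. U v)" m f] unfolding Sx_Suc by auto
    then have "F \<in> K" using nonem[OF FV] u by blast
    moreover have "card F = Suc p" using g(2) card_Suc_Diff1[OF finF u(1)] by simp
    ultimately show "F \<in> K \<and> card F = Suc p \<and> f \<in> GS F (Suc m)" using sf u by (auto simp: GS_def)
  qed
  have "dd (Suc p) y F = x F" for F
  proof (cases "F \<in> K \<and> card F = p")
    case False
    then show ?thesis using GG_zero[OF GG_dd_in[OF y] False] GG_zero[OF x(1) False] by simp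
  next
    case True
    then have FV: "F \<subseteq> V" using KV by blast
    have "up r V idw (dn r a x) F + dn r a (up r V idw x) F = (\<Sum>u\<in>V. a u (x F))"
      by (rule up_dn[OF finV inj_r FV]) (auto simp: a_def additive_pr)
    also have "\<dots> = x F"
    proof (rule poly_mapping_eqI)
      fix f
      show "coef (\<Sum>u\<in>V. a u (x F)) f = coef (x F) f"
      proof (cases "f \<in> supp (x F)")
        case True
        then have "vf f \<in> V" using GG_keys[OF x(1) True] vf GS_small by blast
        then show ?thesis using finV by (simp add: lookup_sum a_def sum.delta)
      next
        case False
        then show ?thesis by (auto simp: lookup_sum a_def in_keys_iff intro!: sum.neutral)
      qed
    qed
    also have "dn r a (up r V idw x) F = 0"
    proof (cases "p \<ge> 1")
      case pos: True
      have "up r V idw x G = 0" for G using fun_cong[OF x(2)[OF pos], of G] by (simp add: dd_def)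
      then show ?thesis by (simp add: dn_def a_def additive_fun_0[OF additive_pr])
    next
      case False
      then have "card F = 0" using True by simp
      then have "F = {}" using True finK[of F] by (metis card_eq_0_iff)
      then show ?thesis by (simp add: dn_def)
    qed
    finally show ?thesis by (simp add: dd_def y_def)
  qed
  then show ?thesis using y by (intro bexI[of _ y]) (rule ext)
qed

lemma GG_col:
  assumes x: "x \<in> GG (Suc p) m" "m \<ge> 1 \<Longrightarrow> bb m x = (0 :: 'v set \<Rightarrow> (((nat \<Rightarrow> real) \<Rightarrow> 'a) \<Rightarrow>\<^sub>0 'k::field))"
  shows "\<exists>y\<in>GG (Suc p) (Suc m). bb (Suc m) y = x"
proof -
  have "\<exists>b. (F \<in> K \<and> card F = Suc p \<longrightarrow> b \<in> aug_chains (int m) (subtopology T (\<Inter>v\<in>F. U v))) \<and> (\<not> (F \<in> K \<and> card F = Suc p) \<longrightarrow> b = 0) \<and> aug_boundary (int m) b = x F" for F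
  proof (cases "F \<in> K \<and> card F = Suc p")
    case True
    then have F: "F \<in> K" "F \<noteq> {}" "F \<subseteq> V" using KV by auto
    have "x F \<in> aug_chains (int m - 1) (subtopology T (\<Inter>v\<in>F. U v))"
      unfolding aug_chains_def mem_Collect_eq
    proof
      fix f assume "f \<in> supp (x F)"
      then have "f \<in> GS F m" using GG_keys[OF x(1)] by blast
      then show "f \<in> Sx m (subtopology T (\<Inter>v\<in>F. U v))" using F(2) by (simp add: GS_def)
    qed
    moreover have "m \<ge> 1 \<Longrightarrow> aug_boundary (int m - 1) (x F) = 0" using fun_cong[OF x(2), of F] by (simp add: bb_def)
    moreover have "topspace (subtopology T (\<Inter>v\<in>F. U v)) \<noteq> {}" using nonem[OF F(3,2)] F(1) by simp
    ultimately obtain b where "b \<in> aug_chains (int m) (subtopology T (\<Inter>v\<in>F. U v))" "aug_boundary (int m) b = x F"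
      using contractible_acyclic[OF contr[OF F(1,2)]] by blast
    then show ?thesis using True by blast
  next
    case False
    then show ?thesis using GG_zero[OF x(1) False] by (intro exI[of _ 0]) (auto simp: aug_boundary_kext)
  qed
  then have "\<forall>F. \<exists>b. (F \<in> K \<and> card F = Suc p \<longrightarrow> b \<in> aug_chains (int m) (subtopology T (\<Inter>v\<in>F. U v))) \<and> (\<not> (F \<in> K \<and> card F = Suc p) \<longrightarrow> b = 0) \<and> aug_boundary (int m) b = x F" by (rule allI)
  from choice[OF this] obtain y where y: "\<forall>F. (F \<in> K \<and> card F = Suc p \<longrightarrow> y F \<in> aug_chains (int m) (subtopology T (\<Inter>v\<in>F. U v))) \<and> (\<not> (F \<in> K \<and> card F = Suc p) \<longrightarrow> y F = 0) \<and> aug_boundary (int m) (y F) = x F" ..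
  have "y \<in> GG (Suc p) (Suc m)"
  proof (rule GG_I)
    fix F f assume f: "f \<in> supp (y F)"
    then have F: "F \<in> K \<and> card F = Suc p" using y by (metis keys_zero empty_iff)
    then have "y F \<in> aug_chains (int m) (subtopology T (\<Inter>v\<in>F. U v))" using y by blast
    then show "F \<in> K \<and> card F = Suc p \<and> f \<in> GS F (Suc m)" using F f by (auto simp: GS_def aug_chains_def)
  qed
  moreover have "bb (Suc m) y = x" using y by (intro ext) (simp add: bb_def)
  ultimately show ?thesis by blast
qed

lemma dc: "double_complex (GG :: nat \<Rightarrow> nat \<Rightarrow> ('v set \<Rightarrow> (((nat \<Rightarrow> real) \<Rightarrow> 'a) \<Rightarrow>\<^sub>0 'k::field)) set) dd bb"
proof
  fix p m and x y :: "'v set \<Rightarrow> (((nat \<Rightarrow> real) \<Rightarrow> 'a) \<Rightarrow>\<^sub>0 'k)"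
  show "x \<in> GG p m \<Longrightarrow> y \<in> GG p m \<Longrightarrow> x - y \<in> GG p m"
  proof (rule GG_I)
    fix F f assume *: "x \<in> GG p m" "y \<in> GG p m" "f \<in> supp ((x - y) F)"
    then have "f \<in> supp (x F) \<or> f \<in> supp (y F)" using keys_diff[of "x F" "y F"] by auto
    then show "F \<in> K \<and> card F = p \<and> f \<in> GS F m" using GG_keys * by blast
  qed
  show "additive_fun (dd p :: ('v set \<Rightarrow> (((nat \<Rightarrow> real) \<Rightarrow> 'a) \<Rightarrow>\<^sub>0 'k)) \<Rightarrow> _)"
    unfolding additive_fun_def dd_def by (intro allI ext) (simp add: up_def sg_add sum.distrib)
  show "additive_fun (bb p :: ('v set \<Rightarrow> (((nat \<Rightarrow> real) \<Rightarrow> 'a) \<Rightarrow>\<^sub>0 'k)) \<Rightarrow> _)"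
    unfolding additive_fun_def bb_def by (intro allI ext) (simp add: aug_boundary_kext kext_add)
  show "x \<in> GG (Suc p) m \<Longrightarrow> dd (Suc p) x \<in> GG p m" by (rule GG_dd_in)
  show "x \<in> GG p (Suc m) \<Longrightarrow> bb (Suc m) x \<in> GG p m"
  proof (rule GG_I)
    fix F f assume x: "x \<in> GG p (Suc m)" and f: "f \<in> supp (bb (Suc m) x F)"
    then obtain g where g: "g \<in> supp (x F)" "f \<in> supp (ab (int m) g)"
      using keys_kext[of "ab (int m)" "x F"] by (auto simp: bb_def aug_boundary_kext)
    then show "F \<in> K \<and> card F = p \<and> f \<in> GS F m" using GG_keys[OF x g(1)] ab_GS by blast
  qed
  show "x \<in> GG (Suc (Suc p)) m \<Longrightarrow> dd (Suc p) (dd (Suc (Suc p)) x) = 0"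
  proof (rule ext)
    fix F assume x: "x \<in> GG (Suc (Suc p)) m"
    show "dd (Suc p) (dd (Suc (Suc p)) x) F = 0 F"
    proof (cases "F \<subseteq> V")
      case True
      then show ?thesis using up_up[OF finV inj_r True, of idw x] by (simp add: dd_def)
    next
      case False
      then have "\<not> (F \<in> K \<and> card F = p)" using KV by blast
      then show ?thesis using GG_zero[OF GG_dd_in[OF GG_dd_in[OF x]]] by simp
    qed
  qed
  show "x \<in> GG p (Suc (Suc m)) \<Longrightarrow> bb (Suc m) (bb (Suc (Suc m)) x) = 0"
  proof (rule ext)
    fix F assume x: "x \<in> GG p (Suc (Suc m))"
    have "x F \<in> aug_chains (int (Suc (Suc m)) - 1) T"
      unfolding aug_chains_def mem_Collect_eq
    proof
      fix f assume "f \<in> supp (x F)"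
      then show "f \<in> Sx (Suc (Suc m)) T" using GG_keys[OF x] GS_small small_sub by blast
    qed
    from aug_boundary_boundary[OF this] show "bb (Suc m) (bb (Suc (Suc m)) x) F = 0 F" by (simp add: bb_def)
  qed
  show "dd (Suc p) (bb (Suc m) x) = bb (Suc m) (dd (Suc p) x)"
    unfolding dd_def bb_def by (intro ext, rule up_hom[symmetric]) (auto simp: additive_fun_def aug_boundary_kext kext_add)
  show "x \<in> GG p (Suc m) \<Longrightarrow> (p \<ge> 1 \<Longrightarrow> dd p x = 0) \<Longrightarrow> \<exists>y\<in>GG (Suc p) (Suc m). dd (Suc p) y = x"
    by (rule GG_row)
  show "x \<in> GG (Suc p) m \<Longrightarrow> (m \<ge> 1 \<Longrightarrow> bb m x = 0) \<Longrightarrow> \<exists>y\<in>GG (Suc p) (Suc m). bb (Suc m) y = x"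
    by (rule GG_col)
qed

end

lemma keys_scal: "supp (scal a p) \<subseteq> supp p"
  by (auto simp: in_keys_iff)

lemma additive_scal: "additive_fun (scal a)"
  by (simp add: additive_fun_def scal_add)

lemma keys_aug_chains: "c \<in> aug_chains (int m - 1) T \<longleftrightarrow> supp c \<subseteq> Sx m T"
  by (simp add: aug_chains_def)

lemma aug_boundary_simps:
  "aug_boundary n (x + y) = aug_boundary n x + aug_boundary n y"
  "aug_boundary n (x - y) = aug_boundary n x - aug_boundary n y"
  "aug_boundary n 0 = 0"
  "aug_boundary n (scal a x) = scal a (aug_boundary n x)"
  by (simp_all add: aug_boundary_kext kext_add kext_diff kext_scal)

lemma aug_chains_diff: "x \<in> aug_chains n T \<Longrightarrow> y \<in> aug_chains n T \<Longrightarrow> x - y \<in> aug_chains n T"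
  using keys_diff[of x y] by (auto simp: aug_chains_def)
lemma aug_chains_add: "x \<in> aug_chains n T \<Longrightarrow> y \<in> aug_chains n T \<Longrightarrow> x + y \<in> aug_chains n T"
  using Poly_Mapping.keys_add[of x y] by (auto simp: aug_chains_def)
lemma aug_chains_scal: "x \<in> aug_chains n T \<Longrightarrow> scal a x \<in> aug_chains n T"
  using keys_scal[of a x] by (auto simp: aug_chains_def)

lemma reduced_boundaries_closed:
  "x \<in> reduced_boundaries n T \<Longrightarrow> y \<in> reduced_boundaries n T \<Longrightarrow> x - y \<in> reduced_boundaries n T"
  "x \<in> reduced_boundaries n T \<Longrightarrow> y \<in> reduced_boundaries n T \<Longrightarrow> x + y \<in> reduced_boundaries n T"
  "x \<in> reduced_boundaries n T \<Longrightarrow> scal a x \<in> reduced_boundaries n T"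
  "0 \<in> reduced_boundaries n T"
proof -
  assume x: "x \<in> reduced_boundaries n T"
  then obtain a where a: "a \<in> aug_chains (n + 1) T" "x = aug_boundary (n + 1) a" unfolding reduced_boundaries_def by blast
  show "scal b x \<in> reduced_boundaries n T" for b
    unfolding reduced_boundaries_def by (rule image_eqI[of _ _ "scal b a"]) (simp_all add: a aug_boundary_simps aug_chains_scal)
  assume y: "y \<in> reduced_boundaries n T"
  then obtain b where b: "b \<in> aug_chains (n + 1) T" "y = aug_boundary (n + 1) b" unfolding reduced_boundaries_def by blast
  show "x - y \<in> reduced_boundaries n T"
    unfolding reduced_boundaries_def by (rule image_eqI[of _ _ "a - b"]) (simp_all add: a b aug_boundary_simps aug_chains_diff)
  show "x + y \<in> reduced_boundaries n T"
    unfolding reduced_boundaries_def by (rule image_eqI[of _ _ "a + b"]) (simp_all add: a b aug_boundary_simps aug_chains_add)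
next
  show "0 \<in> reduced_boundaries n T"
    unfolding reduced_boundaries_def by (rule image_eqI[of _ _ 0]) (simp_all add: aug_boundary_simps aug_chains_def)
qed

lemma simp_chains_D: "c \<in> simp_chains K N \<Longrightarrow> coef c F \<noteq> 0 \<Longrightarrow> F \<in> K \<and> card F = N"
  unfolding simp_chains_def by (auto simp: in_keys_iff)
lemma simp_chains_I: "(\<And>F. coef c F \<noteq> 0 \<Longrightarrow> F \<in> K \<and> card F = N) \<Longrightarrow> c \<in> simp_chains K N"
  unfolding simp_chains_def by (auto simp: in_keys_iff)

text \<open>\<open>i1\<close> and \<open>i2\<close> are the inclusions of the two edges: small
  singular chains placed at the empty face, and simplicial chains placed as multiples of the empty
  simplex.\<close>

definition i1 :: "'b::zero \<Rightarrow> 'v set \<Rightarrow> 'b" where "i1 z F = (if F = {} then z else 0)"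
definition i2 :: "('v set \<Rightarrow>\<^sub>0 'k::field) \<Rightarrow> 'v set \<Rightarrow> (((nat \<Rightarrow> real) \<Rightarrow> 'a) \<Rightarrow>\<^sub>0 'k)" where
  "i2 c F = mon (\<lambda>_. undefined) (coef c F)"

lemma single_inj: "mon a x = mon a y \<longleftrightarrow> x = y"
  by (rule iffI, drule arg_cong[of _ _ "\<lambda>f. coef f a"]) simp_all

context nerve begin

lemma GS_0: "GS F 0 = {\<lambda>_. undefined}"
  by (simp add: GS_def small_def aug_simplices_def)

lemma i1_GG: "supp z \<subseteq> small U V T m \<Longrightarrow> i1 z \<in> GG 0 m"
  by (rule GG_I) (auto simp: i1_def GS_def K0 split: if_splits)

lemma GG_i1: assumes "x \<in> GG 0 m" shows "x = i1 (x {})" "supp (x {}) \<subseteq> small U V T m"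
proof -
  show "x = i1 (x {})"
  proof
    fix F show "x F = i1 (x {}) F"
    proof (cases "F = {}")
      case False
      then have "\<not> (F \<in> K \<and> card F = 0)" using finK card_0_eq by blast
      then show ?thesis using GG_zero[OF assms] False by (simp add: i1_def)
    qed (simp add: i1_def)
  qed
  show "supp (x {}) \<subseteq> small U V T m" using GG_keys[OF assms, of _ "{}"] by (auto simp: GS_def)
qed

lemma bb_i1: "bb m (i1 z) = i1 (aug_boundary (int m - 1) z)"
  by (rule ext) (simp add: bb_def i1_def aug_boundary_simps)

lemma i2_GG: "c \<in> simp_chains K N \<Longrightarrow> i2 c \<in> GG N 0"
  by (rule GG_I) (auto simp: i2_def GS_0 split: if_splits dest: simp_chains_D)

lemma GG_i2: assumes x: "x \<in> GG N 0" shows "\<exists>c\<in>simp_chains K N. x = (i2 c :: 'v set \<Rightarrow> (((nat \<Rightarrow> real) \<Rightarrow> 'a) \<Rightarrow>\<^sub>0 'k::field))"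
proof -
  have "K \<subseteq> Pow V" using KV by blast
  then have fK: "finite K" using finV finite_subset by blast
  define c where "c = (\<Sum>F\<in>K. mon F (coef (x F) (\<lambda>_. undefined)))"
  have c: "coef c F = (if F \<in> K then coef (x F) (\<lambda>_. undefined) else 0)" for F
    unfolding c_def by (rule lookup_sum_single[OF fK])
  have "c \<in> simp_chains K N"
  proof (rule simp_chains_I)
    fix F assume "coef c F \<noteq> 0"
    then have "(\<lambda>_. undefined) \<in> supp (x F)" by (auto simp: c in_keys_iff split: if_splits)
    then show "F \<in> K \<and> card F = N" using GG_keys[OF x] by blast
  qed
  moreover have "x F = i2 c F" for F
  proof (rule poly_mapping_eqI)
    fix f
    show "coef (x F) f = coef (i2 c F) f"
    proof (cases "f \<in> supp (x F)")
      case True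
      then have "F \<in> K" "f = (\<lambda>_. undefined)" using GG_keys[OF x True] by (auto simp: GS_0)
      then show ?thesis by (simp add: i2_def c)
    next
      case False
      then show ?thesis by (cases "f = (\<lambda>_. undefined)") (auto simp: i2_def c in_keys_iff lookup_single when_def)
    qed
  qed
  ultimately show ?thesis by (intro bexI[of _ c]) auto
qed

lemma dd_i2: "dd n (i2 c) F = (mon (\<lambda>_. undefined) (up r V idw (coef c) F) :: ((nat \<Rightarrow> real) \<Rightarrow> 'a) \<Rightarrow>\<^sub>0 'k::field)"
proof -
  have h: "additive_fun (mon (\<lambda>_. undefined) :: _ \<Rightarrow> (((nat \<Rightarrow> real) \<Rightarrow> 'a) \<Rightarrow>\<^sub>0 'k::field))"
    by (simp add: additive_fun_def single_add)
  show ?thesis unfolding dd_def up_def i2_def by (simp add: additive_fun_sum[OF h] sg_hom[OF h])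
qed

lemma dd_i2_0: "dd n (i2 c) = (0 :: 'v set \<Rightarrow> (((nat \<Rightarrow> real) \<Rightarrow> 'a) \<Rightarrow>\<^sub>0 'k::field)) \<longleftrightarrow> (\<forall>F. up r V idw (coef c) F = 0)"
  by (simp add: fun_eq_iff dd_i2 single_inj[where y = 0, simplified])

lemma i2_eq_dd: "i2 c = (dd n (i2 b) :: 'v set \<Rightarrow> (((nat \<Rightarrow> real) \<Rightarrow> 'a) \<Rightarrow>\<^sub>0 'k::field)) \<longleftrightarrow> (\<forall>F. coef c F = up r V idw (coef b) F)"
  by (simp add: fun_eq_iff dd_i2 single_inj) (simp add: i2_def single_inj)

lemma simp_chains_0_up: assumes "c \<in> simp_chains K 0" shows "up r V idw (coef c) F = 0"
proof -
  have "coef c (insert u F) = 0" for u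
    using simp_chains_D[OF assms, of "insert u F"] finK[of "insert u F"] card_0_eq by blast
  then show ?thesis by (simp add: up_def)
qed

lemma GG_add: "x \<in> GG p m \<Longrightarrow> y \<in> GG p m \<Longrightarrow> x + y \<in> GG p m"
proof (rule GG_I)
  fix F f assume *: "x \<in> GG p m" "y \<in> GG p m" "f \<in> supp ((x + y) F)"
  then have "f \<in> supp (x F) \<or> f \<in> supp (y F)" using Poly_Mapping.keys_add[of "x F" "y F"] by auto
  then show "F \<in> K \<and> card F = p \<and> f \<in> GS F m" using GG_keys * by blast
qed

lemma GG_scal: "x \<in> GG p m \<Longrightarrow> (\<lambda>F. scal a (x F)) \<in> GG p m"
proof (rule GG_I)
  fix F f assume *: "x \<in> GG p m" "f \<in> supp (scal a (x F))"
  then have "f \<in> supp (x F)" using keys_scal[of a "x F"] by auto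
  then show "F \<in> K \<and> card F = p \<and> f \<in> GS F m" using GG_keys * by blast
qed

lemma small_cycle:
  fixes z :: "((nat \<Rightarrow> real) \<Rightarrow> 'a) \<Rightarrow>\<^sub>0 'k::field"
  assumes z: "z \<in> reduced_cycles (int N - 1) T"
  shows "\<exists>z'. supp z' \<subseteq> small U V T N \<and> z' - z \<in> reduced_boundaries (int N - 1) T \<and> aug_boundary (int N - 1) z' = 0"
proof (cases N)
  case 0
  then show ?thesis using z reduced_boundaries_closed(4) unfolding reduced_cycles_def aug_chains_def
    by (intro exI[of _ z]) (simp add: small_def)
next
  case (Suc p)
  have zigzag: "z \<in> aug_chains (int p) T" "aug_boundary (int p) z = 0" using z by (auto simp: reduced_cycles_def Suc)
  from subdivision_k[of V T U, OF opn cov zigzag(1)] obtain s H H' where s: "supp s \<subseteq> small U V T (Suc p)"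
    and H: "H z \<in> aug_chains (int (Suc p)) T" and H': "H' (0 :: ((nat \<Rightarrow> real) \<Rightarrow> 'a) \<Rightarrow>\<^sub>0 'k) = 0" 
    and e: "aug_boundary (int (Suc p)) (H z) + (if p = 0 then 0 else H' (aug_boundary (int p) z)) = s - z" by blast
  have q: "(if p = 0 then 0 else H' (aug_boundary (int p) z)) = 0" by (simp add: zigzag(2) H')
  have e': "s - z = aug_boundary (int (Suc p)) (H z)" using e unfolding q by (simp only: add_0_right)
  have n: "int (Suc p) - 1 = int p" "int p + 1 = int (Suc p)" by simp_all
  have "aug_boundary (int p) (s - z) = 0" unfolding e' using aug_boundary_boundary[of "H z" "Suc p" T] H by (simp add: n)
  then have "aug_boundary (int p) s = 0" using zigzag(2) by (simp add: aug_boundary_simps)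
  moreover have "s - z \<in> reduced_boundaries (int p) T" unfolding e' reduced_boundaries_def n using H by blast
  ultimately show ?thesis unfolding Suc n using s by blast
qed

text \<open>Let \<open>b\<close> bound \<open>z\<close>. The subdivision \<open>s\<close> of
  \<open>b\<close>, corrected by the homotopy \<open>H'\<close> applied to \<open>z\<close>, differs
  from \<open>b\<close> by a boundary and so still bounds \<open>z\<close>; the correction is small
  because \<open>z\<close> is.\<close>

lemma small_bd:
  fixes z :: "((nat \<Rightarrow> real) \<Rightarrow> 'a) \<Rightarrow>\<^sub>0 'k::field"
  assumes z: "supp z \<subseteq> small U V T N" "z \<in> reduced_boundaries (int N - 1) T"
  shows "\<exists>b. supp b \<subseteq> small U V T (Suc N) \<and> aug_boundary (int N) b = z"
proof -
  have n: "int N - 1 + 1 = int N" "int (Suc N) - 1 = int N" by simp_all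
  obtain b where b: "b \<in> aug_chains (int N) T" "z = aug_boundary (int N) b" using z(2) unfolding reduced_boundaries_def n by blast
  from subdivision_k[of V T U, OF opn cov b(1)] obtain s H H' where s: "supp s \<subseteq> small U V T (Suc N)"
    and H: "H b \<in> aug_chains (int (Suc N)) T" 
    and H': "\<forall>e::((nat \<Rightarrow> real) \<Rightarrow> 'a) \<Rightarrow>\<^sub>0 'k. N \<ge> 1 \<longrightarrow> supp e \<subseteq> small U V T N \<longrightarrow> supp (H' e) \<subseteq> small U V T (Suc N)" 
    and e: "aug_boundary (int (Suc N)) (H b) + (if N = 0 then 0 else H' (aug_boundary (int N) b)) = s - b" by blast
  have "aug_boundary (int N) (aug_boundary (int (Suc N)) (H b)) = 0"
    using aug_boundary_boundary[of "H b" "Suc N" T] H by (simp add: n)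
  then have bd: "aug_boundary (int N) (s - (if N = 0 then 0 else H' z)) = z"
    using arg_cong[OF e, of "aug_boundary (int N)"] b(2) by (cases "N = 0") (simp_all add: aug_boundary_simps del: of_nat_Suc)
  have "supp (s - (if N = 0 then 0 else H' z)) \<subseteq> small U V T (Suc N)"
  proof (cases "N = 0")
    case False
    then show ?thesis using H'[rule_format, OF _ z(1)] s keys_diff[of s "H' z"] by auto
  qed (use s in simp)
  then show ?thesis using bd by blast
qed

text \<open>Cycles are compared by the relation that some small cycle homologous to the singular one
  is joined to the simplicial one by a zigzag. The staircase lemmas and their transposes give
  totality on both sides and compatibility with boundaries.\<close>

theorem nerve_dim:
  "reduced_homology_dim (k :: 'k::field itself) (int N - 1) T = quotient_dim (simp_cycles r V K N :: ('v set \<Rightarrow>\<^sub>0 'k) set) (simp_boundaries r V K N)"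
proof -
  let ?G = "GG :: nat \<Rightarrow> nat \<Rightarrow> ('v set \<Rightarrow> (((nat \<Rightarrow> real) \<Rightarrow> 'a) \<Rightarrow>\<^sub>0 'k)) set"
  interpret D: double_complex ?G dd bb by (rule dc)
  interpret S: double_complex "\<lambda>p m. ?G m p" bb dd by (rule double_complex_swap, rule dc)
  have n: "int (Suc N) - 1 = int N" "int N - 1 + 1 = int N" by simp_all
  define R where "R z c \<longleftrightarrow> (\<exists>z'. supp z' \<subseteq> small U V T N \<and> z' - z \<in> reduced_boundaries (int N - 1) T \<and> D.zigzag N (i1 z') (i2 c))"
    for z :: "((nat \<Rightarrow> real) \<Rightarrow> 'a) \<Rightarrow>\<^sub>0 'k" and c
  show ?thesis unfolding reduced_homology_dim_def
  proof (rule quotient_dim_eq[where R = R])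
    fix z :: "((nat \<Rightarrow> real) \<Rightarrow> 'a) \<Rightarrow>\<^sub>0 'k" assume "z \<in> reduced_cycles (int N - 1) T"
    from small_cycle[OF this] obtain z' where z': "supp z' \<subseteq> small U V T N" "z' - z \<in> reduced_boundaries (int N - 1) T" "aug_boundary (int N - 1) z' = 0"
      by blast
    have "bb N (i1 z') = (0 :: 'v set \<Rightarrow> (((nat \<Rightarrow> real) \<Rightarrow> 'a) \<Rightarrow>\<^sub>0 'k))" unfolding bb_i1 z'(3) by (rule ext) (simp add: i1_def)
    then obtain x where x: "x \<in> GG N 0" "D.zigzag N (i1 z') x" "N \<ge> 1 \<longrightarrow> dd N x = 0" using D.zigzag_total[OF i1_GG[OF z'(1)]] by blast
    obtain c where c: "c \<in> simp_chains K N" "x = i2 c" using GG_i2[OF x(1)] by blast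
    have "up r V idw (coef c) F = 0" for F
    proof (cases N)
      case 0 then show ?thesis using simp_chains_0_up c by blast
    next
      case (Suc p)
      then have "dd N (i2 c) = (0 :: 'v set \<Rightarrow> (((nat \<Rightarrow> real) \<Rightarrow> 'a) \<Rightarrow>\<^sub>0 'k))" using x(3) c(2) by simp
      then show ?thesis using dd_i2_0 by blast
    qed
    then have "c \<in> simp_cycles r V K N" using c(1) by (simp add: simp_cycles_def)
    moreover have "R z c" unfolding R_def using z'(1,2) x(2) c(2) by blast
    ultimately show "\<exists>c\<in>simp_cycles r V K N. R z c" by blast
  next
    fix c :: "'v set \<Rightarrow>\<^sub>0 'k" assume c: "c \<in> simp_cycles r V K N"
    then have "i2 c \<in> ?G N 0" "dd N (i2 c) = (0 :: 'v set \<Rightarrow> (((nat \<Rightarrow> real) \<Rightarrow> 'a) \<Rightarrow>\<^sub>0 'k))" using i2_GG dd_i2_0 by (auto simp: simp_cycles_def)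
    then obtain x where x: "x \<in> ?G 0 N" "S.zigzag N (i2 c) x" "N \<ge> 1 \<longrightarrow> bb N x = 0" using S.zigzag_total[of "i2 c" N] by blast
    have D: "D.zigzag N x (i2 c)" using zigzag_swap[OF S.double_complex_axioms x(2)] by simp
    note xx = GG_i1[OF x(1)]
    have "aug_boundary (int N - 1) (x {}) = 0"
    proof (cases N)
      case 0 then show ?thesis by (simp add: aug_boundary_def)
    next
      case (Suc p)
      then have "bb N x {} = 0" using x(3) by simp
      then show ?thesis by (simp add: bb_def)
    qed
    moreover have "x {} \<in> aug_chains (int N - 1) T" unfolding keys_aug_chains using xx(2) small_sub by blast
    ultimately have "x {} \<in> reduced_cycles (int N - 1) T" by (simp add: reduced_cycles_def)
    moreover have "R (x {}) c" unfolding R_def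
      using xx D reduced_boundaries_closed(4) by (intro exI[of _ "x {}"]) simp
    ultimately show "\<exists>z\<in>reduced_cycles (int N - 1) T. R z c" by blast
  next
    fix z c z' c' assume "R z c" "R z' c'"
    then obtain y y' where y: "supp y \<subseteq> small U V T N" "y - z \<in> reduced_boundaries (int N - 1) T" "D.zigzag N (i1 y) (i2 c)"
      "supp y' \<subseteq> small U V T N" "y' - z' \<in> reduced_boundaries (int N - 1) T" "D.zigzag N (i1 y') (i2 c')" unfolding R_def by blast
    have "i1 y + i1 y' = (i1 (y + y') :: 'v set \<Rightarrow> _)" "i2 c + i2 c' = (i2 (c + c') :: _ \<Rightarrow> (((nat \<Rightarrow> real) \<Rightarrow> 'a) \<Rightarrow>\<^sub>0 'k))"
      by (auto simp: fun_eq_iff i1_def i2_def lookup_add single_add)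
    then have "D.zigzag N (i1 (y + y')) (i2 (c + c'))" using D.zigzag_add[OF y(3,6) GG_add] by simp
    moreover have "supp (y + y') \<subseteq> small U V T N" using Poly_Mapping.keys_add[of y y'] y by blast
    moreover have "(y + y') - (z + z') \<in> reduced_boundaries (int N - 1) T"
      using reduced_boundaries_closed(2)[OF y(2,5)] by (simp add: algebra_simps)
    ultimately show "R (z + z') (c + c')" unfolding R_def by blast
  next
    fix a z c assume "R z c"
    then obtain y where y: "supp y \<subseteq> small U V T N" "y - z \<in> reduced_boundaries (int N - 1) T" "D.zigzag N (i1 y) (i2 c)" unfolding R_def by blast
    have "D.zigzag N (\<lambda>F. scal a (i1 y F)) (\<lambda>F. scal a (i2 c F))"
    proof (rule D.zigzag_map[OF y(3), where s = "\<lambda>x F. scal a (x F)"])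
      show "\<And>x p m. x \<in> ?G p m \<Longrightarrow> (\<lambda>F. scal a (x F)) \<in> ?G p m" by (rule GG_scal)
      show "\<And>x p. (\<lambda>F. scal a (dd p x F)) = dd p (\<lambda>F. scal a (x F))"
        unfolding dd_def by (rule ext, rule up_hom[OF additive_scal]) simp
      show "\<And>x p. (\<lambda>F. scal a (bb p x F)) = bb p (\<lambda>F. scal a (x F))"
        unfolding bb_def by (simp add: aug_boundary_simps)
    qed
    moreover have "(\<lambda>F. scal a (i1 y F)) = (i1 (scal a y) :: 'v set \<Rightarrow> _)" "(\<lambda>F. scal a (i2 c F)) = (i2 (scal a c) :: _ \<Rightarrow> (((nat \<Rightarrow> real) \<Rightarrow> 'a) \<Rightarrow>\<^sub>0 'k))"
      by (auto simp: fun_eq_iff i1_def i2_def intro!: poly_mapping_eqI simp: lookup_single when_def)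
    moreover have "supp (scal a y) \<subseteq> small U V T N" using keys_scal[of a y] y by blast
    moreover have "scal a y - scal a z \<in> reduced_boundaries (int N - 1) T"
      using reduced_boundaries_closed(3)[OF y(2), of a] by (simp add: additive_fun_diff[OF additive_scal])
    ultimately show "R (scal a z) (scal a c)" unfolding R_def by auto
  next
    have "(0 :: 'v set \<Rightarrow> (((nat \<Rightarrow> real) \<Rightarrow> 'a) \<Rightarrow>\<^sub>0 'k)) \<in> GG p m" for p m by (rule GG_I) simp
    then have "D.zigzag N 0 0" unfolding D.zigzag_def
      by (intro exI[of _ "\<lambda>_. 0"]) (simp add: additive_fun_0[OF D.d_add] additive_fun_0[OF D.e_add])
    moreover have "(0 :: 'v set \<Rightarrow> (((nat \<Rightarrow> real) \<Rightarrow> 'a) \<Rightarrow>\<^sub>0 'k)) = i1 0" "(0 :: 'v set \<Rightarrow> (((nat \<Rightarrow> real) \<Rightarrow> 'a) \<Rightarrow>\<^sub>0 'k)) = i2 0"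
      by (auto simp: fun_eq_iff i1_def i2_def)
    ultimately show "R 0 0" unfolding R_def using reduced_boundaries_closed(4) by (intro exI[of _ 0]) simp
  next
    show "0 \<in> reduced_boundaries (int N - 1) T" by (rule reduced_boundaries_closed(4))
    have "0 \<in> simp_chains K n" for n by (rule simp_chains_I) simp
    then show "0 \<in> simp_boundaries r V K N" unfolding simp_boundaries_def mem_Collect_eq
      by (intro conjI bexI[of _ 0]) (simp_all add: up_def)
  next
    fix z :: "((nat \<Rightarrow> real) \<Rightarrow> 'a) \<Rightarrow>\<^sub>0 'k" and c assume "R z c"
    then obtain y where y: "supp y \<subseteq> small U V T N" "y - z \<in> reduced_boundaries (int N - 1) T" "D.zigzag N (i1 y) (i2 c)" unfolding R_def by blast
    have yz: "z \<in> reduced_boundaries (int N - 1) T \<longleftrightarrow> y \<in> reduced_boundaries (int N - 1) T"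
      using reduced_boundaries_closed(1)[of y "int N - 1" T "y - z"] reduced_boundaries_closed(2)[of z "int N - 1" T "y - z"] y(2) by auto
    show "c \<in> simp_boundaries r V K N \<longleftrightarrow> z \<in> reduced_boundaries (int N - 1) T" unfolding yz
    proof
      assume "c \<in> simp_boundaries r V K N"
      then obtain b where b: "b \<in> simp_chains K (Suc N)" "i2 c = (dd (Suc N) (i2 b) :: 'v set \<Rightarrow> (((nat \<Rightarrow> real) \<Rightarrow> 'a) \<Rightarrow>\<^sub>0 'k))" unfolding simp_boundaries_def i2_eq_dd by blast
      have "S.zigzag N (i2 c) (i1 y)" by (rule zigzag_swap[OF D.double_complex_axioms y(3)])
      from S.zigzag_bd[OF this i2_GG[OF b(1)] b(2)] obtain x where x: "x \<in> GG 0 (Suc N)" "i1 y = bb (Suc N) x" by blast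
      note xx = GG_i1[OF x(1)]
      have "x {} \<in> aug_chains (int (Suc N) - 1) T" unfolding keys_aug_chains using xx(2) small_sub by blast
      moreover have "y = aug_boundary (int N) (x {})" using fun_cong[OF x(2), of "{}"] by (simp add: i1_def bb_def)
      ultimately show "y \<in> reduced_boundaries (int N - 1) T" unfolding reduced_boundaries_def n by blast
    next
      assume "y \<in> reduced_boundaries (int N - 1) T"
      from small_bd[OF y(1) this] obtain b where b: "supp b \<subseteq> small U V T (Suc N)" "aug_boundary (int N) b = y" by blast
      have "(i1 y :: 'v set \<Rightarrow> _) = bb (Suc N) (i1 b)" unfolding bb_i1 n b(2) ..
      from D.zigzag_bd[OF y(3) i1_GG[OF b(1)] this] obtain x where x: "x \<in> GG (Suc N) 0" "i2 c = dd (Suc N) x" by blast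
      obtain e where e: "e \<in> simp_chains K (Suc N)" "x = i2 e" using GG_i2[OF x(1)] by blast
      have "i2 c \<in> ?G N 0" unfolding x(2) by (rule GG_dd_in[OF x(1)])
      then have "c \<in> simp_chains K N" using GG_keys[of "i2 c" N 0 "\<lambda>_. undefined"] by (intro simp_chains_I) (simp add: i2_def)
      then show "c \<in> simp_boundaries r V K N" unfolding simp_boundaries_def using e x(2) i2_eq_dd[of c "Suc N" e] by blast
    qed
  qed
qed

end

section \<open>Homology of the realization and of its punctured versions\<close>

lemma contractible_star:
  fixes S :: "('v \<Rightarrow> real) set"
  assumes star: "\<And>x t. x \<in> S \<Longrightarrow> 0 \<le> t \<Longrightarrow> t \<le> 1 \<Longrightarrow> (\<lambda>v. (1 - t) * x v + t * b v) \<in> S"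
  shows "contractible_space (subtopology (powertop_real UNIV) S)"
proof -
  define h :: "real \<times> ('v \<Rightarrow> real) \<Rightarrow> 'v \<Rightarrow> real" where "h = (\<lambda>z v. (1 - fst z) * snd z v + fst z * b v)"
  have "continuous_on ({0..1} \<times> S) (\<lambda>z. snd z v)" for v
    by (rule continuous_on_compose2[of UNIV "\<lambda>x. x v"]) (auto intro!: continuous_on_product_coordinates continuous_on_snd continuous_on_id)
  then have "continuous_on ({0..1} \<times> S) (\<lambda>z. h z v)" for v
    unfolding h_def by (intro continuous_intros)
  then have h: "continuous_on ({0..1} \<times> S) h" by (rule continuous_on_coordinatewise_then_product)
  have "h \<in> {0..1} \<times> S \<rightarrow> S" using star by (auto simp: h_def)
  then have "homotopic_with_canon (\<lambda>_. True) S S id (\<lambda>_. b)"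
    unfolding homotopic_with_def using h
    by (intro exI[of _ h]) (auto simp: h_def subtopology_Times[symmetric] continuous_map_subtopology_eu)
  then show ?thesis unfolding contractible_space_def euclidean_product_topology by blast
qed

definition bary :: "'v set \<Rightarrow> 'v \<Rightarrow> real" where "bary F v = (if v \<in> F then 1 / real (card F) else 0)"

lemma bary_supp: "finite F \<Longrightarrow> {v. bary F v \<noteq> 0} = F"
  by (auto simp: bary_def)

lemma bary_pos: "finite F \<Longrightarrow> v \<in> F \<Longrightarrow> bary F v > 0"
  by (auto simp: bary_def card_gt_0_iff)

locale complex_in =
  fixes V :: "'v set" and \<Gamma> :: "'v set set"
  assumes finV: "finite V" and sc: "simplicial_complex \<Gamma>" and G0: "{} \<in> \<Gamma>" and GV: "\<Gamma> \<subseteq> Pow V"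
begin

lemma down: "F \<in> \<Gamma> \<Longrightarrow> G \<subseteq> F \<Longrightarrow> G \<in> \<Gamma>" using sc by (auto simp: simplicial_complex_def)
lemma finG: "F \<in> \<Gamma> \<Longrightarrow> finite F" using sc by (auto simp: simplicial_complex_def)

lemma rs_iff: "x \<in> realization_set \<Gamma> \<longleftrightarrow> (\<forall>v. 0 \<le> x v) \<and> {v. x v \<noteq> 0} \<in> \<Gamma> \<and> (\<Sum>v\<in>V. x v) = 1"
proof -
  have "(\<Sum>v | x v \<noteq> 0. x v) = (\<Sum>v\<in>V. x v)" if "{v. x v \<noteq> 0} \<in> \<Gamma>"
    using that GV finV by (intro sum.mono_neutral_left) auto
  then show ?thesis unfolding realization_set_def by auto
qed

lemma bary_in: assumes "F \<in> \<Gamma>" "F \<noteq> {}" shows "bary F \<in> realization_set \<Gamma>"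
proof -
  have f: "finite F" "F \<subseteq> V" using assms finG GV by auto
  have "(\<Sum>v\<in>V. bary F v) = (\<Sum>v\<in>F. 1 / real (card F))"
    using f finV unfolding bary_def by (subst sum.inter_restrict[symmetric]) (auto simp: Int_absorb1)
  also have "\<dots> = 1" using f assms(2) by simp
  finally show ?thesis unfolding rs_iff using assms(1) bary_supp[OF f(1)] by (auto simp: bary_def)
qed

text \<open>\<open>F\<close> lies in the carrier of \<open>x\<close>, so the segment to its
  barycenter stays in the closed simplex spanned by this carrier.\<close>

lemma segment:
  assumes x: "x \<in> realization_set \<Gamma>" and F: "F \<noteq> {}" "\<And>v. v \<in> F \<Longrightarrow> x v > 0" and t: "0 \<le> t" "t \<le> 1"
  shows "(\<lambda>v. (1 - t) * x v + t * bary F v) \<in> realization_set \<Gamma>"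
proof -
  have F': "F \<subseteq> {v. x v \<noteq> 0}" using F(2) by fastforce
  then have Fg: "F \<in> \<Gamma>" using x down unfolding rs_iff by blast
  note b = bary_in[OF Fg F(1)]
  have "{v. (1 - t) * x v + t * bary F v \<noteq> 0} \<subseteq> {v. x v \<noteq> 0}"
    using F' bary_supp[OF finG[OF Fg]] by auto
  then have "{v. (1 - t) * x v + t * bary F v \<noteq> 0} \<in> \<Gamma>" using x down unfolding rs_iff by blast
  then show ?thesis using x b t unfolding rs_iff by (simp add: sum.distrib sum_distrib_left[symmetric])
qed

lemma face_of_pos: assumes "x \<in> realization_set \<Gamma>" "\<And>v. v \<in> F \<Longrightarrow> x v > 0" shows "F \<in> \<Gamma>"
proof -
  have "F \<subseteq> {v. x v \<noteq> 0}" using assms(2) by fastforce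
  then show ?thesis using assms(1) down unfolding rs_iff by blast
qed

lemma openin_real: assumes "open W" "S \<subseteq> realization_set \<Gamma>" shows "openin (subtopology (powertop_real UNIV) S) (S \<inter> W)"
  unfolding euclidean_product_topology using assms(1) by (rule openin_open_Int)

lemma cont_coord: "continuous_on S (\<lambda>x::'v \<Rightarrow> real. x v)" 
  by (rule continuous_on_subset[OF continuous_on_product_coordinates]) simp

text \<open>The open stars of the vertices form a good cover with nerve \<Gamma>; the intersection
  over a face is star-shaped around the barycenter of that face, which itself lies in the
  intersection.\<close>

theorem realization_dim:
  assumes r: "inj_on r V"
  shows "reduced_homology_dim (k :: 'k::field itself) (int N - 1) (realization \<Gamma>) = quotient_dim (simp_cycles r V \<Gamma> N :: ('v set \<Rightarrow>\<^sub>0 'k) set) (simp_boundaries r V \<Gamma> N)"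
proof -
  let ?S = "realization_set \<Gamma>"
  define U where "U v = ?S \<inter> {x. 0 < x v}" for v :: 'v
  interpret nerve r V \<Gamma> "realization \<Gamma>" U
  proof
    show "finite V" "inj_on r V" "{} \<in> \<Gamma>" by (rule finV r G0)+
    show "\<And>F. F \<in> \<Gamma> \<Longrightarrow> F \<subseteq> V" using GV by blast
    show "\<And>F G. F \<in> \<Gamma> \<Longrightarrow> G \<subseteq> F \<Longrightarrow> G \<in> \<Gamma>" by (rule down)
    show "openin (realization \<Gamma>) (U v)" for v
      unfolding U_def realization_def by (intro openin_real open_Collect_less continuous_on_const cont_coord subset_refl)
    show "topspace (realization \<Gamma>) \<subseteq> (\<Union>v\<in>V. U v)"
    proof
      fix x assume "x \<in> topspace (realization \<Gamma>)"
      then have x: "x \<in> ?S" by (simp add: realization_def)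
      then have "(\<Sum>v\<in>V. x v) \<noteq> 0" unfolding rs_iff by simp
      then obtain v where v: "v \<in> V" "x v \<noteq> 0" by (metis sum.neutral)
      then have "x v > 0" using x unfolding rs_iff by (metis order_le_less)
      then show "x \<in> (\<Union>v\<in>V. U v)" using v x by (auto simp: U_def)
    qed
    show "contractible_space (subtopology (realization \<Gamma>) (\<Inter>v\<in>F. U v))" if F: "F \<in> \<Gamma>" "F \<noteq> {}" for F
      unfolding realization_def subtopology_subtopology
    proof (rule contractible_star[of _ "bary F"])
      fix x and t :: real assume x: "x \<in> ?S \<inter> (\<Inter>v\<in>F. U v)" and t: "0 \<le> t" "t \<le> 1"
      then have xU: "x \<in> ?S" "\<And>v. v \<in> F \<Longrightarrow> x \<in> U v" by blast+
      have xs: "x \<in> ?S" "\<And>v. v \<in> F \<Longrightarrow> x v > 0" using xU unfolding U_def by blast+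
      have "(1 - t) * x v + t * bary F v > 0" if "v \<in> F" for v
        using xs(2)[OF that] bary_pos[OF finG[OF F(1)] that] t by (cases "t = 1") (auto intro: add_pos_nonneg)
      then show "(\<lambda>v. (1 - t) * x v + t * bary F v) \<in> ?S \<inter> (\<Inter>v\<in>F. U v)"
        using segment[OF xs(1) F(2) xs(2) t] by (simp add: U_def)
    qed
    show "F \<in> \<Gamma> \<longleftrightarrow> topspace (realization \<Gamma>) \<inter> (\<Inter>v\<in>F. U v) \<noteq> {}" if F: "F \<subseteq> V" "F \<noteq> {}" for F
    proof
      assume f: "F \<in> \<Gamma>"
      have "bary F \<in> topspace (realization \<Gamma>) \<inter> (\<Inter>v\<in>F. U v)"
        using bary_in[OF f F(2)] bary_pos[OF finG[OF f]] by (simp add: realization_def U_def)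
      then show "topspace (realization \<Gamma>) \<inter> (\<Inter>v\<in>F. U v) \<noteq> {}" by blast
    next
      assume "topspace (realization \<Gamma>) \<inter> (\<Inter>v\<in>F. U v) \<noteq> {}"
      then obtain x where x: "x \<in> ?S" "\<forall>v\<in>F. x \<in> U v" by (auto simp: realization_def)
      then show "F \<in> \<Gamma>" by (intro face_of_pos[of x]) (auto simp: U_def)
    qed
  qed
  show ?thesis by (rule nerve_dim)
qed

text \<open>A point \<open>x\<close> of \<open>V\<^sub>v\<close> is pushed away from \<open>p\<close> to a point at which \<open>v\<close> still has positive weight,
  so these sets are the preimages of the open stars under the retraction onto the faces not containing the support of \<open>p\<close>.\<close>

theorem punctured_dim:
  assumes r: "inj_on r V" and p: "p \<in> realization_set \<Gamma>" and \<sigma>: "\<sigma> = {v. p v \<noteq> 0}"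
  shows "reduced_homology_dim (k :: 'k::field itself) (int N - 1) (subtopology (realization \<Gamma>) (realization_set \<Gamma> - {p}))
     = quotient_dim (simp_cycles r V {\<tau>\<in>\<Gamma>. \<not> \<sigma> \<subseteq> \<tau>} N :: ('v set \<Rightarrow>\<^sub>0 'k) set) (simp_boundaries r V {\<tau>\<in>\<Gamma>. \<not> \<sigma> \<subseteq> \<tau>} N)"
proof -
  let ?S = "realization_set \<Gamma>" and ?K = "{\<tau>\<in>\<Gamma>. \<not> \<sigma> \<subseteq> \<tau>}"
  have pos: "p w > 0" if "w \<in> \<sigma>" for w using p that \<sigma> unfolding rs_iff by (metis (mono_tags) mem_Collect_eq order_le_less)
  have p0: "p v \<ge> 0" for v using p unfolding rs_iff by blast
  have \<sigma>G: "\<sigma> \<in> \<Gamma>" "finite \<sigma>" "\<sigma> \<subseteq> V" using p \<sigma> finG GV unfolding rs_iff by auto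
  have \<sigma>0: "\<sigma> \<noteq> {}"
  proof
    assume "\<sigma> = {}"
    then have "p v = 0" for v using \<sigma> by blast
    then show False using p unfolding rs_iff by simp
  qed
  have T: "subtopology (realization \<Gamma>) (?S - {p}) = subtopology (powertop_real UNIV) (?S - {p})"
    by (simp add: realization_def subtopology_subtopology Int_absorb1)
  \<comment> \<open>\<open>U v\<close> asks that the ratio of \<open>x v\<close> to
    \<open>p v\<close> exceed the smallest ratio of \<open>x w\<close> to \<open>p w\<close> over
    \<open>w \<in> \<sigma>\<close>. Cross multiplication gives it a meaning also where
    \<open>p v = 0\<close>.\<close>
  define U where "U v = (?S - {p}) \<inter> (\<Union>w\<in>\<sigma>. {x. x w * p v < x v * p w})" for v :: 'v
  have Upos: "x v > 0" if "x \<in> U v" for x v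
  proof -
    obtain w where w: "w \<in> \<sigma>" "x w * p v < x v * p w" "x \<in> ?S" using \<open>x \<in> U v\<close> unfolding U_def by blast
    then have "0 \<le> x w * p v" using p0 unfolding rs_iff by simp
    then have "0 < x v * p w" using w(2) by linarith
    then show ?thesis using pos[OF w(1)] by (simp add: zero_less_mult_iff)
  qed
  \<comment> \<open>A vertex of \<sigma> with the smallest ratio \<open>x w / p w\<close> serves all
    \<open>v \<in> F\<close> simultaneously. The inequality is strict, so this vertex is not in
    \<open>F\<close>: faces of the nerve cannot contain \<sigma>.\<close>
  have common: "\<exists>w\<in>\<sigma> - F. \<forall>v\<in>F. x w * p v < x v * p w" if x: "x \<in> (\<Inter>v\<in>F. U v)" "x \<in> ?S" for x F
  proof -
    obtain w where w: "w \<in> \<sigma>" "\<forall>u\<in>\<sigma>. x w / p w \<le> x u / p u"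
      using ex_is_arg_min_if_finite[OF \<sigma>G(2) \<sigma>0, of "\<lambda>u. x u / p u"] unfolding is_arg_min_def by (meson not_less)
    have le: "x w * p v < x v * p w" if v: "v \<in> F" for v
    proof -
      obtain u where u: "u \<in> \<sigma>" "x u * p v < x v * p u" using x(1) v unfolding U_def by blast
      have "x w / p w * p v \<le> x u / p u * p v" using w(2) u(1) p0 by (intro mult_right_mono) auto
      also have "\<dots> < x v" using u pos[OF u(1)] by (simp add: field_simps)
      finally show ?thesis using pos[OF w(1)] by (simp add: field_simps)
    qed
    then have "w \<notin> F" by fastforce
    then show ?thesis using w(1) le by blast
  qed
  have Uopen: "open (\<Union>w\<in>\<sigma>. {x. x w * p v < x v * p w})" for v
    by (intro open_UN ballI open_Collect_less continuous_on_mult continuous_on_const cont_coord)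
  interpret nerve r V ?K "subtopology (realization \<Gamma>) (?S - {p})" U
  proof
    show "finite V" "inj_on r V" by (rule finV r)+
    show "{} \<in> ?K" using G0 \<sigma>0 by blast
    show "\<And>F. F \<in> ?K \<Longrightarrow> F \<subseteq> V" using GV by blast
    show "F \<in> ?K \<Longrightarrow> G \<subseteq> F \<Longrightarrow> G \<in> ?K" for F G using down[of F G] by blast
    show "openin (subtopology (realization \<Gamma>) (?S - {p})) (U v)" for v
      unfolding U_def T by (rule openin_real[OF Uopen]) blast
    show "topspace (subtopology (realization \<Gamma>) (?S - {p})) \<subseteq> (\<Union>v\<in>V. U v)"
    proof
      fix x assume "x \<in> topspace (subtopology (realization \<Gamma>) (?S - {p}))"
      then have x: "x \<in> ?S" "x \<noteq> p" by (simp_all add: T)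
      show "x \<in> (\<Union>v\<in>V. U v)"
      proof (rule ccontr)
        \<comment> \<open>Outside all cover sets \<open>x\<close> would be proportional to
          \<open>p\<close>; both have coordinate sum 1, so \<open>x\<close> would be the removed
          point.\<close>
        assume n: "x \<notin> (\<Union>v\<in>V. U v)"
        have le: "x v * p w \<le> x w * p v" if "v \<in> V" "w \<in> \<sigma>" for v w
          using n x that unfolding U_def by (auto simp: not_less)
        have x0: "x v = 0" if "v \<notin> \<sigma>" for v
        proof (cases "v \<in> V")
          case True
          obtain w where w: "w \<in> \<sigma>" using \<sigma>0 by blast
          have "p v = 0" using that \<sigma> by blast
          then have "x v * p w \<le> 0" using le[OF True w] by simp
          moreover have "x v \<ge> 0" using x(1) unfolding rs_iff by blast
          ultimately show ?thesis using pos[OF w] by (simp add: mult_le_0_iff)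
        next
          case False
          then show ?thesis using x(1) GV unfolding rs_iff by blast
        qed
        have "x w = p w" if w: "w \<in> \<sigma>" for w
        proof -
          have eq: "x v * p w = x w * p v" if v: "v \<in> V" for v
          proof (cases "v \<in> \<sigma>")
            case True
            then show ?thesis using le[OF v w] le[of w v] \<sigma>G(3) w by force
          next
            case False
            then have "p v = 0" using \<sigma> by blast
            then show ?thesis using x0[OF False] by simp
          qed
          have "(\<Sum>v\<in>V. x v) * p w = x w * (\<Sum>v\<in>V. p v)"
            unfolding sum_distrib_left sum_distrib_right using eq by (rule sum.cong[OF refl])
          then show ?thesis using x(1) p unfolding rs_iff by simp
        qed
        moreover have "p v = 0" if "v \<notin> \<sigma>" for v using that \<sigma> by blast
        ultimately have "x = p" using x0 by (intro ext) metis
        then show False using x(2) by blast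
      qed
    qed
    show "contractible_space (subtopology (subtopology (realization \<Gamma>) (?S - {p})) (\<Inter>v\<in>F. U v))" if F: "F \<in> ?K" "F \<noteq> {}" for F
      unfolding T subtopology_subtopology
    proof (rule contractible_star[of _ "bary F"])
      fix x and t :: real assume x: "x \<in> (?S - {p}) \<inter> (\<Inter>v\<in>F. U v)" and t: "0 \<le> t" "t \<le> 1"
      then have xs: "x \<in> ?S" "\<And>v. v \<in> F \<Longrightarrow> x v > 0" "x \<in> (\<Inter>v\<in>F. U v)" using Upos by auto
      have fF: "finite F" using F finG by blast
      let ?y = "\<lambda>v. (1 - t) * x v + t * bary F v"
      \<comment> \<open>The same \<open>w\<close> works along the whole segment, since the
        barycenter of \<open>F\<close> vanishes at \<open>w\<close>; the strict inequality also
        keeps the segment away from \<open>p\<close>.\<close>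
      from common[OF xs(3,1)] obtain w where w: "w \<in> \<sigma>" "w \<notin> F" "\<forall>v\<in>F. x w * p v < x v * p w" by blast
      have y: "?y w * p v < ?y v * p w" if v: "v \<in> F" for v
      proof -
        have "0 < (1 - t) * (x v * p w - x w * p v) + t * (bary F v * p w)"
          using w(3) v bary_pos[OF fF v] pos[OF w(1)] t by (cases "t = 1") (auto intro!: add_pos_nonneg mult_pos_pos)
        moreover have "bary F w = 0" using w(2) by (simp add: bary_def)
        ultimately show ?thesis by (simp add: algebra_simps)
      qed
      obtain v where v: "v \<in> F" using F(2) by blast
      have "?y \<noteq> p"
      proof
        assume "?y = p"
        then have "?y w = p w" "?y v = p v" by (auto dest: fun_cong)
        then show False using y[OF v] by simp
      qed
      moreover have "?y \<in> ?S" by (rule segment[OF xs(1) F(2) xs(2) t])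
      ultimately show "?y \<in> (?S - {p}) \<inter> (\<Inter>v\<in>F. U v)" using y w(1) unfolding U_def by blast
    qed
    show "F \<in> ?K \<longleftrightarrow> topspace (subtopology (realization \<Gamma>) (?S - {p})) \<inter> (\<Inter>v\<in>F. U v) \<noteq> {}" if F: "F \<subseteq> V" "F \<noteq> {}" for F
    proof
      assume f: "F \<in> ?K"
      then have f': "F \<in> \<Gamma>" "finite F" using finG by auto
      obtain w where w: "w \<in> \<sigma>" "w \<notin> F" using f by blast
      have bw: "bary F w = 0" using w by (simp add: bary_def)
      then have "bary F \<noteq> p" using pos[OF w(1)] by force
      moreover have "bary F w * p v < bary F v * p w" if "v \<in> F" for v
        using bw bary_pos[OF f'(2) that] pos[OF w(1)] by simp
      ultimately have "bary F \<in> topspace (subtopology (realization \<Gamma>) (?S - {p})) \<inter> (\<Inter>v\<in>F. U v)"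
        using bary_in[OF f'(1) F(2)] w(1) unfolding U_def T by auto
      then show "topspace (subtopology (realization \<Gamma>) (?S - {p})) \<inter> (\<Inter>v\<in>F. U v) \<noteq> {}" by blast
    next
      assume "topspace (subtopology (realization \<Gamma>) (?S - {p})) \<inter> (\<Inter>v\<in>F. U v) \<noteq> {}"
      then obtain x where x: "x \<in> ?S" "x \<in> (\<Inter>v\<in>F. U v)" by (auto simp: T)
      have "F \<in> \<Gamma>" using x Upos by (intro face_of_pos[of x]) auto
      moreover have "\<not> \<sigma> \<subseteq> F" using common[OF x(2,1)] by blast
      ultimately show "F \<in> ?K" by blast
    qed
  qed
  show ?thesis by (rule nerve_dim)
qed

end

section \<open>Relative chains\<close>

text \<open>Induction on the constraints. If the new one is implied by the old ones, it gets
  coefficient 0. Otherwise some \<open>g0\<close> satisfies the old constraints but not the new one,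
  and evaluating at \<open>g0\<close> determines the coefficient \<open>t\<close>.\<close>

lemma functional_span:
  fixes M :: "'a \<Rightarrow> 'b \<Rightarrow> 'k::field"
  assumes A: "finite A" and B: "finite B"
    and y: "\<And>g. (\<And>a. a \<in> A \<Longrightarrow> (\<Sum>b\<in>B. M a b * g b) = 0) \<Longrightarrow> (\<Sum>b\<in>B. y b * g b) = 0"
  shows "\<exists>x. \<forall>b\<in>B. y b = (\<Sum>a\<in>A. M a b * x a)"
  using A y
proof (induction A arbitrary: y rule: finite_induct)
  case empty
  have "y b = 0" if b: "b \<in> B" for b
  proof -
    have "(\<Sum>b'\<in>B. y b' * (if b' = b then 1 else 0)) = 0" by (rule empty.prems) simp
    then show ?thesis using B b by (simp add: if_distrib[of "(*) _"] sum.delta cong: if_cong)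
  qed
  then show ?case by simp
next
  case (insert a0 A)
  show ?case
  proof (cases "\<exists>g. (\<forall>a\<in>A. (\<Sum>b\<in>B. M a b * g b) = 0) \<and> (\<Sum>b\<in>B. M a0 b * g b) \<noteq> 0")
    case False
    then have "\<exists>x. \<forall>b\<in>B. y b = (\<Sum>a\<in>A. M a b * x a)"
      using insert.prems by (intro insert.IH) auto
    then obtain x where x: "\<And>b. b \<in> B \<Longrightarrow> y b = (\<Sum>a\<in>A. M a b * x a)" by blast
    show ?thesis
    proof (intro exI[of _ "x(a0 := 0)"] ballI)
      fix b assume "b \<in> B"
      have "(\<Sum>a\<in>A. M a b * (x(a0 := 0)) a) = (\<Sum>a\<in>A. M a b * x a)" using insert.hyps by (intro sum.cong) auto
      then show "y b = (\<Sum>a\<in>insert a0 A. M a b * (x(a0 := 0)) a)" using insert.hyps x[OF \<open>b \<in> B\<close>] by simp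
    qed
  next
    case True
    then obtain g0 where g0: "\<And>a. a \<in> A \<Longrightarrow> (\<Sum>b\<in>B. M a b * g0 b) = 0" "(\<Sum>b\<in>B. M a0 b * g0 b) \<noteq> 0" by blast
    define m where "m = (\<Sum>b\<in>B. M a0 b * g0 b)"
    define t where "t = (\<Sum>b\<in>B. y b * g0 b) / m"
    have m: "m \<noteq> 0" using g0(2) by (simp add: m_def)
    have "\<exists>x. \<forall>b\<in>B. y b - t * M a0 b = (\<Sum>a\<in>A. M a b * x a)"
    proof (rule insert.IH)
      fix g assume g: "\<And>a. a \<in> A \<Longrightarrow> (\<Sum>b\<in>B. M a b * g b) = 0"
      define s where "s = (\<Sum>b\<in>B. M a0 b * g b) / m"
      have ex: "(\<Sum>b\<in>B. f b * (g b - s * g0 b)) = (\<Sum>b\<in>B. f b * g b) - s * (\<Sum>b\<in>B. f b * g0 b)" for f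
        by (simp add: right_diff_distrib sum_subtractf sum_distrib_left mult.left_commute)
      have "(\<Sum>b\<in>B. M a b * (g b - s * g0 b)) = 0" if a: "a \<in> insert a0 A" for a
        unfolding ex using a g g0(1) m by (auto simp: s_def m_def[symmetric])
      then have "(\<Sum>b\<in>B. y b * (g b - s * g0 b)) = 0" by (rule insert.prems)
      then have e: "(\<Sum>b\<in>B. y b * g b) = s * (t * m)" unfolding ex using m by (simp add: t_def)
      have "(\<Sum>b\<in>B. (y b - t * M a0 b) * g b) = (\<Sum>b\<in>B. y b * g b) - t * (\<Sum>b\<in>B. M a0 b * g b)"
        by (simp add: left_diff_distrib sum_subtractf sum_distrib_left mult.assoc)
      also have "\<dots> = 0" unfolding e using m by (simp add: s_def)
      finally show "(\<Sum>b\<in>B. (y b - t * M a0 b) * g b) = 0" .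
    qed
    then obtain x where x: "\<And>b. b \<in> B \<Longrightarrow> y b - t * M a0 b = (\<Sum>a\<in>A. M a b * x a)" by blast
    show ?thesis
    proof (intro exI[of _ "x(a0 := t)"] ballI)
      fix b assume "b \<in> B"
      have "(\<Sum>a\<in>A. M a b * (x(a0 := t)) a) = (\<Sum>a\<in>A. M a b * x a)" using insert.hyps by (intro sum.cong) auto
      then show "y b = (\<Sum>a\<in>insert a0 A. M a b * (x(a0 := t)) a)" using insert.hyps x[OF \<open>b \<in> B\<close>] by (simp add: algebra_simps)
    qed
  qed
qed

text \<open>A vector killed by \<open>M\<close> is in the image of \<open>N\<close> by exactness,
  hence pairs to zero with \<open>y\<close>; \<open>functional_span\<close> then writes
  \<open>y\<close> through the rows of \<open>M\<close>. This transposes an exact sequence of finite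
  matrices.\<close>

lemma exact_dual:
  fixes M :: "'a \<Rightarrow> 'b \<Rightarrow> 'k::field" and N :: "'b \<Rightarrow> 'c \<Rightarrow> 'k"
  assumes fin: "finite A" "finite B" "finite C"
    and ex: "\<And>g. (\<And>a. a \<in> A \<Longrightarrow> (\<Sum>b\<in>B. M a b * g b) = 0) \<Longrightarrow> \<exists>h. \<forall>b\<in>B. g b = (\<Sum>c\<in>C. N b c * h c)"
    and y: "\<And>c. c \<in> C \<Longrightarrow> (\<Sum>b\<in>B. N b c * y b) = 0"
  shows "\<exists>x. \<forall>b\<in>B. y b = (\<Sum>a\<in>A. M a b * x a)"
proof (rule functional_span[OF fin(1,2)])
  fix g assume "\<And>a. a \<in> A \<Longrightarrow> (\<Sum>b\<in>B. M a b * g b) = 0"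
  from ex[OF this] obtain h where h: "\<forall>b\<in>B. g b = (\<Sum>c\<in>C. N b c * h c)" by blast
  have "(\<Sum>b\<in>B. y b * g b) = (\<Sum>b\<in>B. \<Sum>c\<in>C. h c * (N b c * y b))"
    using h by (intro sum.cong refl) (simp add: sum_distrib_left ac_simps)
  also have "\<dots> = (\<Sum>c\<in>C. h c * (\<Sum>b\<in>B. N b c * y b))"
    by (subst sum.swap) (simp add: sum_distrib_left)
  also have "\<dots> = 0" using y by simp
  finally show "(\<Sum>b\<in>B. y b * g b) = 0" .
qed

definition chn :: "'v set set \<Rightarrow> nat \<Rightarrow> ('v set \<Rightarrow> 'k::field) set" where
  "chn K N = {c. \<forall>F. c F \<noteq> 0 \<longrightarrow> F \<in> K \<and> card F = N}"

lemma chn_I: "(\<And>F. c F \<noteq> 0 \<Longrightarrow> F \<in> K \<and> card F = N) \<Longrightarrow> c \<in> chn K N" by (simp add: chn_def)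
lemma chn_D: "c \<in> chn K N \<Longrightarrow> c F \<noteq> 0 \<Longrightarrow> F \<in> K \<and> card F = N" by (simp add: chn_def)
lemma chn_0: "c \<in> chn K N \<Longrightarrow> \<not> (F \<in> K \<and> card F = N) \<Longrightarrow> c F = 0" using chn_D by blast
lemma chn_minus: "b \<in> chn K N \<Longrightarrow> c \<in> chn K N \<Longrightarrow> (\<lambda>F. b F - c F) \<in> chn K N"
  by (rule chn_I) (metis chn_0 diff_zero)

text \<open>The incidence number of \<open>E\<close> in \<open>F\<close>. At most one term of the
  sum is nonzero; writing it as a sum avoids choosing the vertex in which the two sets
  differ.\<close>

definition inc :: "('v \<Rightarrow> nat) \<Rightarrow> 'v set \<Rightarrow> 'v set \<Rightarrow> 'k::field" where
  "inc r E F = (\<Sum>u\<in>F. if u \<in> F \<and> F - {u} = E then sg r u E 1 else 0)"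

text \<open>The ambient vertex set is a parameter, so that a complex and its subcomplexes share one
  boundary operator \<open>D\<close>.\<close>

locale ord_complex = complex_in V \<Gamma> for V :: "'v set" and \<Gamma> +
  fixes r :: "'v \<Rightarrow> nat"
  assumes inj_r: "inj_on r V"
begin

abbreviation D :: "('v set \<Rightarrow> 'k::field) \<Rightarrow> 'v set \<Rightarrow> 'k" where "D \<equiv> up r V idw"

definition rel :: "'v set \<Rightarrow> nat \<Rightarrow> 'v set set" where "rel F0 p = {F\<in>\<Gamma>. F0 \<subseteq> F \<and> card F = p}"

lemma fin_rel: "finite (rel F0 p)" using sc by (auto simp: rel_def simplicial_complex_def)

text \<open>Expresses the boundary over faces containing \<open>F0\<close> by incidence numbers;
  with \<open>co_rel\<close> it shows boundary and coboundary to be given by transposed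
  matrices.\<close>

lemma D_rel:
  fixes c :: "'v set \<Rightarrow> 'k::field"
  assumes c: "c \<in> chn \<Gamma> (Suc p)" and E: "finite E" "F0 \<subseteq> E"
  shows "D c E = (\<Sum>F\<in>rel F0 (Suc p). inc r E F * c F)"
proof -
  have i: "inc r E F = (\<Sum>u\<in>V - E. if F = insert u E then sg r u E 1 else 0 :: 'k)" if F: "F \<in> \<Gamma>" for F
  proof -
    have fF: "finite F" "F \<subseteq> V" using F finG GV by auto
    have "(\<Sum>u\<in>F. if u \<in> F \<and> F - {u} = E then sg r u E 1 else 0) = (\<Sum>u\<in>V. if u \<in> F \<and> F - {u} = E then sg r u E 1 else (0::'k))"
      using fF finV by (intro sum.mono_neutral_left) auto
    also have "\<dots> = (\<Sum>u\<in>V - E. if u \<in> F \<and> F - {u} = E then sg r u E 1 else (0::'k))"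
      using finV by (intro sum.mono_neutral_right) auto
    also have "\<dots> = (\<Sum>u\<in>V - E. if F = insert u E then sg r u E 1 else (0::'k))"
    proof (rule sum.cong[OF refl])
      fix u assume u: "u \<in> V - E"
      have "(u \<in> F \<and> F - {u} = E) \<longleftrightarrow> F = insert u E" using u by auto
      then show "(if u \<in> F \<and> F - {u} = E then sg r u E 1 else (0::'k)) = (if F = insert u E then sg r u E 1 else 0)" by simp
    qed
    finally show ?thesis unfolding inc_def .
  qed
  have "(\<Sum>F\<in>rel F0 (Suc p). inc r E F * c F) = (\<Sum>F\<in>rel F0 (Suc p). \<Sum>u\<in>V - E. if F = insert u E then sg r u E (c F) else 0)"
    by (intro sum.cong refl) (auto simp: i rel_def sum_distrib_right sg_def intro!: sum.cong)
  also have "\<dots> = (\<Sum>u\<in>V - E. \<Sum>F\<in>rel F0 (Suc p). if F = insert u E then sg r u E (c F) else 0)" by (rule sum.swap)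
  also have "\<dots> = (\<Sum>u\<in>V - E. sg r u E (c (insert u E)))"
  proof (rule sum.cong[OF refl])
    fix u assume u: "u \<in> V - E"
    have "(\<Sum>F\<in>rel F0 (Suc p). if F = insert u E then sg r u E (c F) else 0) = (if insert u E \<in> rel F0 (Suc p) then sg r u E (c (insert u E)) else 0)"
      using fin_rel by (simp add: sum.delta)
    also have "\<dots> = sg r u E (c (insert u E))" using chn_0[OF c, of "insert u E"] E(2) by (auto simp: rel_def)
    finally show "(\<Sum>F\<in>rel F0 (Suc p). if F = insert u E then sg r u E (c F) else 0) = sg r u E (c (insert u E))" .
  qed
  finally show ?thesis by (simp add: up_def)
qed

lemma co_rel:
  fixes h :: "'v set \<Rightarrow> 'k::field"
  assumes F: "F \<in> \<Gamma>" "F0 \<subseteq> F" "card F = Suc p"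
  shows "(\<Sum>u\<in>F - F0. sg r u F (h (F - {u}))) = (\<Sum>E\<in>rel F0 p. inc r E F * h E)"
proof -
  have fF: "finite F" using F finG by auto
  have "(\<Sum>E\<in>rel F0 p. inc r E F * h E) = (\<Sum>E\<in>rel F0 p. \<Sum>u\<in>F. if E = F - {u} then sg r u F (h E) else 0)"
    unfolding inc_def sum_distrib_right
    by (intro sum.cong refl) (auto simp: sg_remove_same sg_def cong: conj_cong)
  also have "\<dots> = (\<Sum>u\<in>F. \<Sum>E\<in>rel F0 p. if E = F - {u} then sg r u F (h E) else 0)" by (rule sum.swap)
  also have "\<dots> = (\<Sum>u\<in>F. if u \<in> F0 then 0 else sg r u F (h (F - {u})))"
  proof (rule sum.cong[OF refl])
    fix u assume u: "u \<in> F"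
    have "F - {u} \<in> rel F0 p \<longleftrightarrow> u \<notin> F0" using F u fF down[OF F(1)] by (auto simp: rel_def)
    then show "(\<Sum>E\<in>rel F0 p. if E = F - {u} then sg r u F (h E) else 0) = (if u \<in> F0 then 0 else sg r u F (h (F - {u})))"
      using fin_rel by (simp add: sum.delta)
  qed
  also have "\<dots> = (\<Sum>u\<in>F - F0. sg r u F (h (F - {u})))"
    using fF by (intro sum.mono_neutral_cong_right) auto
  finally show ?thesis by simp
qed

text \<open>The dual of \<^const>\<open>cochain_exact\<close>, in terms of chains relative to the faces not containing \<open>F0\<close>.\<close>

definition chain_exact :: "'k::field itself \<Rightarrow> 'v set \<Rightarrow> nat \<Rightarrow> bool" where
  "chain_exact k F0 p \<longleftrightarrow> (\<forall>c\<in>chn \<Gamma> p :: ('v set \<Rightarrow> 'k) set. (\<forall>F. F0 \<subseteq> F \<longrightarrow> D c F = 0) \<longrightarrow>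
     (\<exists>b\<in>chn \<Gamma> (Suc p). \<forall>F. F0 \<subseteq> F \<longrightarrow> c F = D b F))"

lemma D_supp: assumes "b \<in> chn \<Gamma> (Suc p)" "D b F \<noteq> 0" shows "F \<in> \<Gamma> \<and> card F = p"
proof -
  obtain u where u: "u \<in> V - F" "b (insert u F) \<noteq> 0"
    using assms(2) unfolding up_def by (metis (no_types, lifting) sg_0 sum.neutral)
  then have g: "insert u F \<in> \<Gamma>" "card (insert u F) = Suc p" using chn_D[OF assms(1)] by auto
  then show ?thesis using u(1) finG[OF g(1)] down[OF g(1), of F] by auto
qed

lemma D_chn: "b \<in> chn \<Gamma> (Suc p) \<Longrightarrow> D b \<in> chn \<Gamma> p"
  by (rule chn_I) (rule D_supp)

lemma D_D: assumes b: "b \<in> chn \<Gamma> (Suc (Suc p))" shows "D (D b) F = 0"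
proof (cases "F \<subseteq> V")
  case True then show ?thesis by (intro up_up[OF finV inj_r]) (simp_all add: additive_fun_def)
next
  case False
  then show ?thesis using D_supp[OF D_chn[OF b]] GV by blast
qed

text \<open>Duality of finite-dimensional sequences. The chain form is the one suited to
  subcomplexes, whose chains are chains of the whole complex. Cardinality 0 is split off because no
  term lies below it; no face containing the nonempty \<open>F0\<close> has that size.\<close>

lemma cochain_exact_iff_chain_exact: 
  fixes k :: "'k::field itself"
  assumes "F0 \<noteq> {}" shows "cochain_exact r k \<Gamma> F0 p \<longleftrightarrow> chain_exact k F0 p"
proof (cases p)
  case 0
  have e: "\<not> (F \<in> \<Gamma> \<and> F0 \<subseteq> F \<and> card F = 0)" for F using assms finG[of F] by auto
  have "cochain_exact r k \<Gamma> F0 p" unfolding cochain_exact_def 0 by (intro allI impI exI[of _ "\<lambda>_. 0"] ballI) (metis e)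
  moreover have "chain_exact k F0 p" unfolding chain_exact_def
  proof (intro ballI impI bexI[of _ "\<lambda>_. 0"] allI)
    fix c :: "'v set \<Rightarrow> 'k" and F assume "c \<in> chn \<Gamma> p" "F0 \<subseteq> F"
    then have "c F = 0" using chn_0[of c \<Gamma> p F] e[of F] 0 by blast
    then show "c F = D (\<lambda>_. 0) F" by (simp add: up_def)
  qed (simp add: chn_def)
  ultimately show ?thesis by simp
next
  case (Suc q)
  let ?A = "rel F0 (Suc p)" and ?B = "rel F0 p" and ?C = "rel F0 q"
  let ?M = "\<lambda>F E. inc r E F :: 'k"
  note fin = fin_rel[of F0 "Suc p"] fin_rel[of F0 p] fin_rel[of F0 q]
  have L: "cochain_exact r k \<Gamma> F0 p \<longleftrightarrow> (\<forall>g. (\<forall>F\<in>?A. (\<Sum>E\<in>?B. ?M F E * g E) = 0) \<longrightarrow> (\<exists>h. \<forall>F\<in>?B. g F = (\<Sum>E\<in>?C. ?M F E * h E)))"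
  proof -
    have 1: "(\<forall>F\<in>\<Gamma>. F0 \<subseteq> F \<longrightarrow> card F = Suc p \<longrightarrow> (\<Sum>u\<in>F - F0. sg r u F (g (F - {u}))) = 0) \<longleftrightarrow> (\<forall>F\<in>?A. (\<Sum>E\<in>?B. ?M F E * g E) = 0)" for g :: "'v set \<Rightarrow> 'k"
      using co_rel[of _ F0 p g] by (auto simp: rel_def)
    have 2: "(\<forall>F\<in>\<Gamma>. F0 \<subseteq> F \<longrightarrow> card F = p \<longrightarrow> g F = (\<Sum>u\<in>F - F0. sg r u F (h (F - {u})))) \<longleftrightarrow> (\<forall>F\<in>?B. g F = (\<Sum>E\<in>?C. ?M F E * h E))" for g h :: "'v set \<Rightarrow> 'k"
      using co_rel[of _ F0 q h] by (auto simp: rel_def Suc)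
    show ?thesis unfolding cochain_exact_def 1 2 ..
  qed
  have Dz: "(\<forall>F. F0 \<subseteq> F \<longrightarrow> D c F = 0) \<longleftrightarrow> (\<forall>E\<in>?C. (\<Sum>F\<in>?B. ?M F E * c F) = 0)" if c: "c \<in> chn \<Gamma> p" for c :: "'v set \<Rightarrow> 'k"
  proof -
    have s: "D c E = (\<Sum>F\<in>?B. ?M F E * c F)" if "E \<in> ?C" for E
      using D_rel[OF c[unfolded Suc], of E F0] that finG unfolding rel_def Suc by blast
    have "D c F = 0" if "F0 \<subseteq> F" "F \<notin> ?C" for F using D_supp[OF c[unfolded Suc], of F] that unfolding rel_def by blast
    then show ?thesis using s unfolding rel_def by (metis (mono_tags, lifting) mem_Collect_eq)
  qed
  define ext where "ext S f F = (if F \<in> S then f F else 0)" for S and f :: "'v set \<Rightarrow> 'k" and F :: "'v set"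
  have ext: "ext (rel F0 n) f \<in> chn \<Gamma> n" for n f by (rule chn_I) (auto simp: ext_def rel_def split: if_splits)
  have ext_sum: "(\<Sum>F\<in>S. a F * ext S f F) = (\<Sum>F\<in>S. a F * f F)" for S f a by (rule sum.cong) (auto simp: ext_def)
  show ?thesis
  proof
    assume "cochain_exact r k \<Gamma> F0 p"
    note LL = this[unfolded L]
    show "chain_exact k F0 p" unfolding chain_exact_def
    proof (intro ballI impI)
      fix c :: "'v set \<Rightarrow> 'k" assume c: "c \<in> chn \<Gamma> p" "\<forall>F. F0 \<subseteq> F \<longrightarrow> D c F = 0"
      have "\<exists>x. \<forall>b\<in>?B. c b = (\<Sum>a\<in>?A. ?M a b * x a)"
      proof (rule exact_dual[OF fin, where N = ?M])
        fix g :: "'v set \<Rightarrow> 'k" assume g: "\<And>a. a \<in> ?A \<Longrightarrow> (\<Sum>b\<in>?B. ?M a b * g b) = 0"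
        show "\<exists>h. \<forall>b\<in>?B. g b = (\<Sum>c\<in>?C. ?M b c * h c)"
          by (rule LL[THEN spec, THEN mp], rule ballI, rule g)
      next
        show "\<And>E. E \<in> ?C \<Longrightarrow> (\<Sum>b\<in>?B. ?M b E * c b) = 0" using c(2)[unfolded Dz[OF c(1)]] by (rule bspec)
      qed
      then obtain x where x: "\<And>b. b \<in> ?B \<Longrightarrow> c b = (\<Sum>a\<in>?A. ?M a b * x a)" by (elim exE) simp
      have "c F = D (ext ?A x) F" if F: "F0 \<subseteq> F" for F
      proof (cases "F \<in> ?B")
        case True
        then have "finite F" using finG by (auto simp: rel_def)
        show ?thesis unfolding D_rel[OF ext \<open>finite F\<close> F] x[OF True] ext_sum ..
      next
        case False
        then have n: "\<not> (F \<in> \<Gamma> \<and> card F = p)" using F by (simp add: rel_def)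
        then have "c F = 0" by (rule chn_0[OF c(1)])
        moreover have "D (ext ?A x) F = 0" using D_supp[OF ext, of p x F] n by blast
        ultimately show ?thesis by simp
      qed
      then show "\<exists>b\<in>chn \<Gamma> (Suc p). \<forall>F. F0 \<subseteq> F \<longrightarrow> c F = D b F" using ext by blast
    qed
  next
    assume R: "chain_exact k F0 p"
    show "cochain_exact r k \<Gamma> F0 p" unfolding L
    proof (intro allI impI)
      fix g :: "'v set \<Rightarrow> 'k" assume g: "\<forall>F\<in>?A. (\<Sum>E\<in>?B. ?M F E * g E) = 0"
      show "\<exists>h. \<forall>F\<in>?B. g F = (\<Sum>E\<in>?C. ?M F E * h E)"
      proof (rule exact_dual[OF fin(3,2,1), of "\<lambda>E F. ?M F E" "\<lambda>E F. ?M F E" g])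
        fix c assume "\<And>a. a \<in> ?C \<Longrightarrow> (\<Sum>b\<in>?B. ?M b a * c b) = 0"
        then have "\<forall>a\<in>?C. (\<Sum>b\<in>?B. ?M b a * ext ?B c b) = 0" unfolding ext_sum by (rule ballI)
        then have "\<forall>F. F0 \<subseteq> F \<longrightarrow> D (ext ?B c) F = 0" using Dz[OF ext] by blast
        then obtain b where b: "b \<in> chn \<Gamma> (Suc p)" "\<And>F. F0 \<subseteq> F \<Longrightarrow> ext ?B c F = D b F" using R ext unfolding chain_exact_def by blast
        have "\<forall>F\<in>?B. c F = (\<Sum>E\<in>?A. ?M E F * b E)"
        proof
          fix F assume F: "F \<in> ?B"
          have "finite F" "F0 \<subseteq> F" using F finG by (auto simp: rel_def)
          then show "c F = (\<Sum>E\<in>?A. ?M E F * b E)" using b(2)[of F] D_rel[OF b(1), of F F0] F by (simp add: ext_def)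
        qed
        then show "\<exists>h. \<forall>F\<in>?B. c F = (\<Sum>E\<in>?A. ?M E F * h E)" by - (rule exI[of _ b], assumption)
      next
        show "\<And>c. c \<in> ?A \<Longrightarrow> (\<Sum>b\<in>?B. ?M c b * g b) = 0" using g by (rule bspec)
      qed
    qed
  qed
qed

end

text \<open>A surjection between spaces of the same finite dimension is injective. Concretely, an
  independent family of maximal size modulo \<open>B\<close> is lifted to \<open>Z'\<close>; a
  \<open>c\<close> outside \<open>B'\<close> could be joined to it and would exceed the common
  dimension. The finite set \<open>T\<close> of possible supports bounds the dimension.\<close>

lemma quotient_inj:
  fixes Z B Z' B' :: "('b \<Rightarrow>\<^sub>0 'k::field) set"
  assumes fT: "finite T" and ZT: "\<And>z. z \<in> Z \<Longrightarrow> supp z \<subseteq> T" and sub: "B' \<subseteq> B"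
    and tot: "\<And>z. z \<in> Z \<Longrightarrow> \<exists>c\<in>Z'. z - c \<in> B"
    and B: "0 \<in> B" "\<And>x y. x \<in> B \<Longrightarrow> y \<in> B \<Longrightarrow> x + y \<in> B" "\<And>a x. x \<in> B \<Longrightarrow> scal a x \<in> B"
    and B': "\<And>a x. x \<in> B' \<Longrightarrow> scal a x \<in> B'"
    and eq: "quotient_dim Z B = quotient_dim Z' B'" and c: "c \<in> Z'" "c \<in> B"
  shows "c \<in> B'"
proof (rule ccontr)
  assume nc: "c \<notin> B'"
  define indep where "indep Z B S \<longleftrightarrow> finite S \<and> S \<subseteq> Z \<and> (\<forall>a. (\<Sum>s\<in>S. scal (a s) s) \<in> B \<longrightarrow> (\<forall>s\<in>S. a s = 0))" for Z B and S :: "('b \<Rightarrow>\<^sub>0 'k) set"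
  have hom_dim: "quotient_dim Z B = (SUP S\<in>{S. indep Z B S}. enat (card S))" for Z B :: "('b \<Rightarrow>\<^sub>0 'k) set"
    unfolding quotient_dim_def indep_def ..
  have B_sum: "(\<Sum>s\<in>S. f s) \<in> B" if "\<And>s. s \<in> S \<Longrightarrow> f s \<in> B" for f and S :: "('b \<Rightarrow>\<^sub>0 'k) set"
    using that by (induction S rule: infinite_finite_induct) (auto intro: B)
  have B_minus: "x - y \<in> B" if "x \<in> B" "y \<in> B" for x y
  proof -
    have "x - y = x + scal (- 1) y" by (rule poly_mapping_eqI) (simp add: lookup_add lookup_minus)
    show ?thesis unfolding \<open>x - y = x + scal (- 1) y\<close> by (rule B(2)[OF that(1) B(3)[OF that(2)]])
  qed
  have bound: "card S \<le> card T" if S: "indep Z B S" for S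
  proof (rule ccontr)
    assume "\<not> card S \<le> card T"
    then have "card T < card S" "finite S" using S by (auto simp: indep_def)
    from lin_dep[OF fT this(2,1), of coef] obtain a where a: "\<exists>s\<in>S. a s \<noteq> 0" "\<And>t. t \<in> T \<Longrightarrow> (\<Sum>s\<in>S. a s * coef s t) = 0" by blast
    have "(\<Sum>s\<in>S. scal (a s) s) = 0"
    proof (rule poly_mapping_eqI)
      fix t
      have "coef s t = 0" if "t \<notin> T" "s \<in> S" for s
      proof -
        have "s \<in> Z" using S that(2) unfolding indep_def by blast
        then have "t \<notin> supp s" using ZT that(1) by blast
        then show ?thesis by (simp add: in_keys_iff)
      qed
      then show "coef (\<Sum>s\<in>S. scal (a s) s) t = coef 0 t"
        using a(2)[of t] by (cases "t \<in> T") (simp_all add: lookup_sum)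
    qed
    then have "(\<Sum>s\<in>S. scal (a s) s) \<in> B" using B(1) by simp
    then have "\<forall>s\<in>S. a s = 0" using S unfolding indep_def by blast
    then show False using a(1) by blast
  qed
  have "quotient_dim Z B \<le> enat (card T)" unfolding hom_dim by (rule SUP_least) (use bound in simp)
  then obtain n where n: "quotient_dim Z B = enat n" by (cases "quotient_dim Z B") auto
  have "\<exists>S. indep Z B S \<and> n \<le> card S"
  proof (rule ccontr)
    assume "\<not> ?thesis"
    then have l: "\<And>S. indep Z B S \<Longrightarrow> card S < n" by (meson not_less)
    have "indep Z B {}" by (simp add: indep_def)
    then have "0 < n" using l by fastforce
    have "enat (card S) \<le> enat (n - 1)" if "S \<in> {S. indep Z B S}" for S using l[of S] that by simp
    then have "quotient_dim Z B \<le> enat (n - 1)" unfolding hom_dim by (rule SUP_least)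
    then show False using n \<open>0 < n\<close> by simp
  qed
  then obtain S where S: "indep Z B S" "n \<le> card S" by blast
  have fS: "finite S" and simp_cycles: "S \<subseteq> Z" and ind: "\<And>a s. (\<Sum>s\<in>S. scal (a s) s) \<in> B \<Longrightarrow> s \<in> S \<Longrightarrow> a s = 0"
    using S(1) unfolding indep_def by blast+
  have "\<forall>s\<in>S. \<exists>c. c \<in> Z' \<and> s - c \<in> B" using tot simp_cycles by blast
  from bchoice[OF this] obtain f where f: "\<forall>s\<in>S. f s \<in> Z' \<and> s - f s \<in> B" ..
  have indf: "a s = 0" if e: "(\<Sum>s\<in>S. scal (a s) (f s)) \<in> B" and s: "s \<in> S" for a s
  proof (rule ind[OF _ s])
    have "(\<Sum>s\<in>S. scal (a s) s) = (\<Sum>s\<in>S. scal (a s) (f s)) + (\<Sum>s\<in>S. scal (a s) (s - f s))"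
      unfolding sum.distrib[symmetric] scal_add[symmetric] by simp
    moreover have "(\<Sum>s\<in>S. scal (a s) (s - f s)) \<in> B" using f B(3) by (intro B_sum) blast
    ultimately show "(\<Sum>s\<in>S. scal (a s) s) \<in> B" using B(2)[OF e] by simp
  qed
  have delta: "(\<Sum>u\<in>S. scal (if u = s then 1 else 0) u) = s" if "s \<in> S" for s
  proof (rule poly_mapping_eqI)
    fix t
    have "(\<Sum>u\<in>S. (if u = s then 1 else 0) * coef u t) = (\<Sum>u\<in>S. if u = s then coef u t else 0)"
      by (rule sum.cong) auto
    then show "coef (\<Sum>u\<in>S. scal (if u = s then 1 else 0) u) t = coef s t"
      using fS that by (simp add: lookup_sum)
  qed
  have notB: "s \<notin> B" if "s \<in> S" for s
    using ind[of "\<lambda>u. if u = s then 1 else 0" s] delta[OF that] that by auto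
  have inj: "inj_on f S"
  proof (rule inj_onI, rule ccontr)
    fix s t assume st: "s \<in> S" "t \<in> S" "f s = f t" "s \<noteq> t"
    have "(s - f s) - (t - f t) \<in> B" by (rule B_minus) (use f st in blast)+
    then have "s - t \<in> B" using st(3) by simp
    moreover have "(\<Sum>u\<in>S. scal ((if u = s then 1 else 0) - (if u = t then 1 else 0)) u) = s - t"
    proof -
      have "scal (x - y) u = scal x u - scal y u" for x y and u :: "'b \<Rightarrow>\<^sub>0 'k"
        by (rule poly_mapping_eqI) (simp add: lookup_minus left_diff_distrib)
      then have "(\<Sum>u\<in>S. scal ((if u = s then 1 else 0) - (if u = t then 1 else 0)) u)
          = (\<Sum>u\<in>S. scal (if u = s then 1 else 0) u) - (\<Sum>u\<in>S. scal (if u = t then 1 else 0) u)"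
        by (simp only: sum_subtractf)
      then show ?thesis unfolding delta[OF st(1)] delta[OF st(2)] .
    qed
    ultimately have "(if s = s then 1 else 0) - (if s = t then 1 else (0::'k)) = 0"
      by (intro ind[of "\<lambda>u. (if u = s then 1 else 0) - (if u = t then 1 else 0)" s]) (simp_all add: st(1))
    then show False using st(4) by simp
  qed
  have cf: "c \<notin> f ` S"
  proof
    assume "c \<in> f ` S"
    then obtain s where s: "s \<in> S" "c = f s" by blast
    have "(s - f s) + c \<in> B" by (rule B(2)) (use f s c(2) in blast)+
    then show False using notB s by simp
  qed
  have "indep Z' B' (insert c (f ` S))" unfolding indep_def
  proof (intro conjI allI impI)
    show "finite (insert c (f ` S))" using fS by simp
    show "insert c (f ` S) \<subseteq> Z'" using f c by blast
    fix a assume "(\<Sum>s\<in>insert c (f ` S). scal (a s) s) \<in> B'"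
    moreover have "(\<Sum>s\<in>insert c (f ` S). scal (a s) s) = scal (a c) c + (\<Sum>s\<in>S. scal (a (f s)) (f s))"
      using fS cf by (simp add: sum.reindex[OF inj])
    ultimately have m: "scal (a c) c + (\<Sum>s\<in>S. scal (a (f s)) (f s)) \<in> B'" by simp
    have "(scal (a c) c + (\<Sum>s\<in>S. scal (a (f s)) (f s))) - scal (a c) c \<in> B"
      by (rule B_minus) (use m sub B(3)[OF c(2)] in blast)+
    then have "(\<Sum>s\<in>S. scal (a (f s)) (f s)) \<in> B" by simp
    then have az: "a (f s) = 0" if "s \<in> S" for s using indf[of "\<lambda>s. a (f s)" s] that by blast
    have z0: "scal 0 x = 0" for x :: "'b \<Rightarrow>\<^sub>0 'k" by (rule poly_mapping_eqI) simp
    have "(\<Sum>s\<in>S. scal (a (f s)) (f s)) = 0" using az by (intro sum.neutral) (simp add: z0)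
    then have "scal (a c) c \<in> B'" using m by simp
    from B'[OF this, of "1 / a c"] have "a c \<noteq> 0 \<Longrightarrow> c \<in> B'"
    proof -
      assume "a c \<noteq> 0"
      then have "scal (1 / a c) (scal (a c) c) = c" by (intro poly_mapping_eqI) simp
      then show "c \<in> B'" using B'[OF \<open>scal (a c) c \<in> B'\<close>, of "1 / a c"] by simp
    qed
    then have "a c = 0" using nc by blast
    then show "\<forall>s\<in>insert c (f ` S). a s = 0" using az by blast
  qed
  then have "enat (card (insert c (f ` S))) \<le> quotient_dim Z' B'" unfolding hom_dim by (intro SUP_upper) simp
  moreover have "card (insert c (f ` S)) = Suc (card S)" using fS cf by (simp add: card_image[OF inj])
  ultimately have "enat (Suc (card S)) \<le> enat n" unfolding eq[symmetric] n by simp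
  then show False using S(2) by simp
qed

section \<open>Homology dimensions of skeleta and deletion of a vertex\<close>

lemma simp_chains_chn: "c \<in> simp_chains K N \<longleftrightarrow> coef c \<in> chn K N"
  by (auto simp: simp_chains_def chn_def in_keys_iff)

lemma chn_simp_chains: assumes "finite K" "f \<in> chn K N" shows "\<exists>c\<in>simp_chains K N. coef c = f"
proof -
  have "coef (\<Sum>F\<in>K. mon F (f F)) = f"
    using chn_0[OF assms(2)] by (intro ext) (auto simp: lookup_sum_single[OF assms(1)])
  then show ?thesis using assms(2) by (intro bexI[of _ "\<Sum>F\<in>K. mon F (f F)"]) (simp_all add: simp_chains_chn)
qed

lemma simp_cycles_iff: "c \<in> simp_cycles r V K N \<longleftrightarrow> coef c \<in> chn K N \<and> (\<forall>F. up r V idw (coef c) F = 0)"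
  by (simp add: simp_cycles_def simp_chains_chn)

lemma simp_boundaries_iff: assumes "finite K" shows "c \<in> simp_boundaries r V K N \<longleftrightarrow> coef c \<in> chn K N \<and> (\<exists>b\<in>chn K (Suc N). \<forall>F. coef c F = up r V idw b F)"
  unfolding simp_boundaries_def simp_chains_chn mem_Collect_eq
  using chn_simp_chains[OF assms, of _ "Suc N"] by (metis simp_chains_chn)

lemma chn_add: "b \<in> chn K N \<Longrightarrow> c \<in> chn K N \<Longrightarrow> (\<lambda>F. b F + c F) \<in> chn K N"
  by (rule chn_I) (metis chn_0 add_0)
lemma chn_scal: "b \<in> chn K N \<Longrightarrow> (\<lambda>F. a * b F) \<in> chn K N"
  by (rule chn_I) (metis chn_0 mult_zero_right)
lemma chn_zero: "(\<lambda>_. 0) \<in> chn K N" by (simp add: chn_def)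

lemma lookup_fun: "coef (x + y) = (\<lambda>F. coef x F + coef y F)"
  "coef (x - y) = (\<lambda>F. coef x F - coef y F)"
  "coef (scal a x) = (\<lambda>F. a * coef x F)"
  by (rule ext, simp add: lookup_add lookup_minus)+

context ord_complex begin

lemma D_lin:
  "D (\<lambda>F. b F + c F) F = D b F + D c F" "D (\<lambda>F. b F - c F) F = D b F - D c F" "D (\<lambda>F. a * b F) F = a * D b F" "D (\<lambda>_. 0) F = 0"
proof -
  show "D (\<lambda>F. b F + c F) F = D b F + D c F" by (rule up_add) (simp add: additive_fun_def)
  show "D (\<lambda>F. b F - c F) F = D b F - D c F" by (rule up_minus) (simp add: additive_fun_def)
  show "D (\<lambda>F. a * b F) F = a * D b F" by (rule up_hom[symmetric]) (simp_all add: additive_fun_def distrib_left)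
  show "D (\<lambda>_. 0) F = 0" by (simp add: up_def)
qed

lemma DD: assumes b: "b \<in> chn \<Gamma> (Suc N)" shows "D (D b) F = 0"
proof (cases N)
  case 0
  have "D b (insert u F) = 0" for u
  proof (rule chn_0[OF D_chn[OF b]])
    show "\<not> (insert u F \<in> \<Gamma> \<and> card (insert u F) = N)"
      using finG[of "insert u F"] card_0_eq[of "insert u F"] 0 by blast
  qed
  then show ?thesis unfolding up_def[of r V idw "D b"] by simp
next
  case (Suc q) then show ?thesis using D_D[of b q F] b by simp
qed

lemma finGam: "K \<subseteq> \<Gamma> \<Longrightarrow> finite K" using sc finite_subset by (auto simp: simplicial_complex_def)

lemma simp_boundaries_closed:
  assumes K: "K \<subseteq> \<Gamma>"
  shows "0 \<in> simp_boundaries r V K N" "x \<in> simp_boundaries r V K N \<Longrightarrow> y \<in> simp_boundaries r V K N \<Longrightarrow> x + y \<in> simp_boundaries r V K N" "x \<in> simp_boundaries r V K N \<Longrightarrow> scal a x \<in> simp_boundaries r V K N"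
proof -
  note S = simp_boundaries_iff[OF finGam[OF K]]
  show "0 \<in> simp_boundaries r V K N" unfolding S
    by (intro conjI bexI[of _ "\<lambda>_. 0"]) (simp_all add: D_lin chn_def)
  assume x: "x \<in> simp_boundaries r V K N"
  then obtain b where b: "coef x \<in> chn K N" "b \<in> chn K (Suc N)" "\<And>F. coef x F = D b F" unfolding S by blast
  show "scal a x \<in> simp_boundaries r V K N" unfolding S lookup_fun
    by (intro conjI chn_scal b bexI[of _ "\<lambda>F. a * b F"] allI) (simp only: D_lin b(3))
  assume y: "y \<in> simp_boundaries r V K N"
  then obtain b' where b': "coef y \<in> chn K N" "b' \<in> chn K (Suc N)" "\<And>F. coef y F = D b' F" unfolding S by blast
  show "x + y \<in> simp_boundaries r V K N" unfolding S lookup_fun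
    by (intro conjI chn_add b b' bexI[of _ "\<lambda>F. b F + b' F"] allI) (simp only: D_lin b(3) b'(3))
qed

text \<open>Exactness at \<open>N\<close> moves a cycle off the faces containing \<sigma>. Exactness
  at \<open>Suc N\<close> does the same for bounding chains, and here it draws on faces of \<Gamma>
  with \<open>Suc (Suc N)\<close> vertices: they are missing in the skeleton, but their boundaries
  are present. This is how a complex that is only Buchsbaum acquires a skeleton with the Buchsbaum*
  equality.\<close>

lemma hom_dim_skeleton:
  fixes k :: "'k::field itself"
  assumes R: "chain_exact k \<sigma> N" "chain_exact k \<sigma> (Suc N)" and \<sigma>: "\<sigma> \<noteq> {}"
    and G: "\<Gamma>' = {F\<in>\<Gamma>. card F \<le> Suc N}" and K: "K = {F\<in>\<Gamma>'. \<not> \<sigma> \<subseteq> F}"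
  shows "quotient_dim (simp_cycles r V \<Gamma>' N :: ('v set \<Rightarrow>\<^sub>0 'k) set) (simp_boundaries r V \<Gamma>' N) = quotient_dim (simp_cycles r V K N :: ('v set \<Rightarrow>\<^sub>0 'k) set) (simp_boundaries r V K N)"
proof -
  have sub: "\<Gamma>' \<subseteq> \<Gamma>" "K \<subseteq> \<Gamma>" "K \<subseteq> \<Gamma>'" by (auto simp: G K)
  note SBG = simp_boundaries_iff[OF finGam[OF sub(1)]] and SBK = simp_boundaries_iff[OF finGam[OF sub(2)]]
  have up: "c \<in> chn \<Gamma>' p \<longleftrightarrow> c \<in> chn \<Gamma> p" if "p \<le> Suc N" for c :: "'v set \<Rightarrow> 'k" and p
    using that by (auto simp: chn_def G)
  have KG: "c \<in> chn K p \<Longrightarrow> c \<in> chn \<Gamma>' p" for c :: "'v set \<Rightarrow> 'k" and p using sub(3) by (auto simp: chn_def)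
  have toK: "c \<in> chn \<Gamma>' p \<Longrightarrow> (\<And>F. \<sigma> \<subseteq> F \<Longrightarrow> c F = 0) \<Longrightarrow> c \<in> chn K p" for c :: "'v set \<Rightarrow> 'k" and p by (auto simp: chn_def K)
  define R where "R z c \<longleftrightarrow> coef z \<in> chn \<Gamma>' N \<and> coef c \<in> chn K N \<and>
     (\<exists>b\<in>chn \<Gamma>' (Suc N). \<forall>F. coef z F - coef c F = D b F)" for z c :: "'v set \<Rightarrow>\<^sub>0 'k"
  show ?thesis
  proof (rule quotient_dim_eq[where R = R])
    fix z :: "'v set \<Rightarrow>\<^sub>0 'k" assume z: "z \<in> simp_cycles r V \<Gamma>' N"
    then have zigzag: "coef z \<in> chn \<Gamma>' N" "\<forall>F. D (coef z) F = 0" by (auto simp: simp_cycles_iff)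
    then obtain b where b: "b \<in> chn \<Gamma> (Suc N)" "\<forall>F. \<sigma> \<subseteq> F \<longrightarrow> coef z F = D b F"
      using assms(1) up[of N] unfolding chain_exact_def by auto
    have "D b \<in> chn \<Gamma>' N" using D_chn[OF b(1)] up by simp
    with zigzag(1) have d: "(\<lambda>F. coef z F - D b F) \<in> chn \<Gamma>' N" by (rule chn_minus)
    then have "(\<lambda>F. coef z F - D b F) \<in> chn K N" using b(2) by (intro toK) auto
    from chn_simp_chains[OF finGam[OF sub(2)] this] obtain c where c: "c \<in> simp_chains K N" "coef c = (\<lambda>F. coef z F - D b F)" by blast
    have "D (D b) F = 0" for F by (rule DD[OF b(1)])
    then have "c \<in> simp_cycles r V K N" using c zigzag(2) unfolding simp_cycles_iff c(2) simp_chains_chn by (simp add: D_lin)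
    moreover have "R z c" unfolding R_def using zigzag(1) c b(1) up[of "Suc N"] unfolding simp_chains_chn
      by (intro conjI bexI[of _ b]) auto
    ultimately show "\<exists>c\<in>simp_cycles r V K N. R z c" by blast
  next
    fix c :: "'v set \<Rightarrow>\<^sub>0 'k" assume c: "c \<in> simp_cycles r V K N"
    then have "c \<in> simp_cycles r V \<Gamma>' N" using KG by (simp add: simp_cycles_iff)
    moreover have "R c c" using c KG unfolding R_def simp_cycles_iff by (intro conjI bexI[of _ "\<lambda>_. 0"]) (simp_all add: D_lin chn_zero)
    ultimately show "\<exists>z\<in>simp_cycles r V \<Gamma>' N. R z c" by blast
  next
    fix z c z' c' assume "R z c" "R z' c'"
    then obtain b b' where *: "coef z \<in> chn \<Gamma>' N" "coef c \<in> chn K N" "b \<in> chn \<Gamma>' (Suc N)" "\<forall>F. coef z F - coef c F = D b F"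
      "coef z' \<in> chn \<Gamma>' N" "coef c' \<in> chn K N" "b' \<in> chn \<Gamma>' (Suc N)" "\<forall>F. coef z' F - coef c' F = D b' F"
      unfolding R_def by blast
    show "R (z + z') (c + c')" unfolding R_def lookup_fun
      by (intro conjI chn_add * bexI[of _ "\<lambda>F. b F + b' F"] allI) (simp add: D_lin *(4,8)[rule_format, symmetric])
  next
    fix a z c assume "R z c"
    then obtain b where *: "coef z \<in> chn \<Gamma>' N" "coef c \<in> chn K N" "b \<in> chn \<Gamma>' (Suc N)" "\<forall>F. coef z F - coef c F = D b F"
      unfolding R_def by blast
    show "R (scal a z) (scal a c)" unfolding R_def lookup_fun
      by (intro conjI chn_scal * bexI[of _ "\<lambda>F. a * b F"] allI) (simp add: D_lin *(4)[rule_format, symmetric] right_diff_distrib)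
  next
    show "R 0 0" unfolding R_def by (intro conjI bexI[of _ "\<lambda>_. 0"]) (simp_all add: D_lin chn_def)
    show "0 \<in> simp_boundaries r V \<Gamma>' N" "0 \<in> simp_boundaries r V K N" using simp_boundaries_closed(1) sub by auto
  next
    fix z c assume "R z c"
    then obtain b where *: "coef z \<in> chn \<Gamma>' N" "coef c \<in> chn K N" "b \<in> chn \<Gamma>' (Suc N)" "\<forall>F. coef z F - coef c F = D b F"
      unfolding R_def by blast
    show "c \<in> simp_boundaries r V K N \<longleftrightarrow> z \<in> simp_boundaries r V \<Gamma>' N"
    proof
      assume "c \<in> simp_boundaries r V K N"
      then obtain e where e: "e \<in> chn K (Suc N)" "\<forall>F. coef c F = D e F" unfolding SBK by blast
      have "coef z F = D (\<lambda>F. b F + e F) F" for F using *(4)[rule_format, of F] e(2) by (simp add: D_lin diff_eq_eq)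
      then show "z \<in> simp_boundaries r V \<Gamma>' N" unfolding SBG using *(1) chn_add[OF *(3) KG[OF e(1)]] by blast
    next
      assume "z \<in> simp_boundaries r V \<Gamma>' N"
      then obtain e where e: "e \<in> chn \<Gamma>' (Suc N)" "\<forall>F. coef z F = D e F" unfolding SBG by blast
      let ?b = "\<lambda>F. e F - b F"
      have bb: "?b \<in> chn \<Gamma>' (Suc N)" by (rule chn_minus[OF e(1) *(3)])
      have cD: "coef c F = D ?b F" for F using *(4)[rule_format, of F] e(2) by (simp add: D_lin algebra_simps)
      have "\<forall>F. \<sigma> \<subseteq> F \<longrightarrow> D ?b F = 0" unfolding cD[symmetric] using chn_0[OF *(2)] by (auto simp: K)
      then obtain f where f: "f \<in> chn \<Gamma> (Suc (Suc N))" "\<forall>F. \<sigma> \<subseteq> F \<longrightarrow> ?b F = D f F"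
        using assms(2) bb up[of "Suc N"] unfolding chain_exact_def by auto
      have "D f \<in> chn \<Gamma>' (Suc N)" using D_chn[OF f(1)] up by simp
      from chn_minus[OF bb this] have "(\<lambda>F. ?b F - D f F) \<in> chn K (Suc N)" using f(2) by (intro toK) auto
      moreover have "coef c F = D (\<lambda>F. ?b F - D f F) F" for F
        using cD[of F] D_D[OF f(1), of F] D_lin(2)[of ?b "D f" F] by simp
      ultimately show "c \<in> simp_boundaries r V K N" unfolding SBK using *(2) by blast
    qed
  qed
qed

text \<open>Below the top degree a relative cycle is a relative boundary, and the corresponding
  absolute boundary extends it. At \<open>p = N\<close> the boundary of \<open>c\<close> is a cycle
  without faces containing \<sigma> that bounds in \<Gamma>. Equality of dimensions makes it bound
  within \<open>K\<close> as well, and subtracting a bounding chain in \<open>K\<close> closes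
  \<open>c\<close> up without changing it over \<sigma>.\<close>

lemma extend_cycle:
  fixes k :: "'k::field itself" and c :: "'v set \<Rightarrow> 'k"
  assumes R: "\<And>q. q \<le> N \<Longrightarrow> chain_exact k \<sigma> q" and K: "K = {F\<in>\<Gamma>. \<not> \<sigma> \<subseteq> F}"
    and hom_dim: "quotient_dim (simp_cycles r V \<Gamma> N :: ('v set \<Rightarrow>\<^sub>0 'k) set) (simp_boundaries r V \<Gamma> N) = quotient_dim (simp_cycles r V K N :: ('v set \<Rightarrow>\<^sub>0 'k) set) (simp_boundaries r V K N)"
    and p: "p \<le> N" and c: "c \<in> chn \<Gamma> (Suc p)" "\<And>F. \<sigma> \<subseteq> F \<Longrightarrow> D c F = 0"
  shows "\<exists>y\<in>chn \<Gamma> (Suc p). (\<forall>F. D y F = 0) \<and> (\<forall>F. \<sigma> \<subseteq> F \<longrightarrow> y F = c F)"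
proof (cases "p < N")
  case True
  then obtain e where e: "e \<in> chn \<Gamma> (Suc (Suc p))" "\<forall>F. \<sigma> \<subseteq> F \<longrightarrow> c F = D e F"
    using R[of "Suc p"] c unfolding chain_exact_def by auto
  show ?thesis using D_chn[OF e(1)] D_D[OF e(1)] e(2) by (intro bexI[of _ "D e"]) auto
next
  case False
  then have p: "p = N" using p by simp
  have sub: "K \<subseteq> \<Gamma>" by (auto simp: K)
  note SBG = simp_boundaries_iff[OF finGam[OF subset_refl]] and SBK = simp_boundaries_iff[OF finGam[OF sub]]
  have KG: "c \<in> chn K p \<Longrightarrow> c \<in> chn \<Gamma> p" for c :: "'v set \<Rightarrow> 'k" and p using sub by (auto simp: chn_def)
  have toK: "c \<in> chn \<Gamma> p \<Longrightarrow> (\<And>F. \<sigma> \<subseteq> F \<Longrightarrow> c F = 0) \<Longrightarrow> c \<in> chn K p" for c :: "'v set \<Rightarrow> 'k" and p by (auto simp: chn_def K)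
  have "D c \<in> chn K N" using c(2) D_chn[OF c(1)] p by (intro toK) auto
  from chn_simp_chains[OF finGam[OF sub] this] obtain z where z: "z \<in> simp_chains K N" "coef z = D c" by blast
  have "z \<in> simp_boundaries r V K N"
  proof (rule quotient_inj[OF _ _ _ _ _ _ _ _ hom_dim])
    show "finite \<Gamma>" by (rule finGam) simp
    show "supp x \<subseteq> \<Gamma>" if "x \<in> simp_cycles r V \<Gamma> N" for x :: "'v set \<Rightarrow>\<^sub>0 'k" using that by (auto simp: simp_cycles_def simp_chains_def)
    show "simp_boundaries r V K N \<subseteq> (simp_boundaries r V \<Gamma> N :: ('v set \<Rightarrow>\<^sub>0 'k) set)" using KG unfolding SBG SBK subset_iff by blast
    show "0 \<in> simp_boundaries r V \<Gamma> N" "\<And>x y. x \<in> simp_boundaries r V \<Gamma> N \<Longrightarrow> y \<in> simp_boundaries r V \<Gamma> N \<Longrightarrow> x + y \<in> simp_boundaries r V \<Gamma> N"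
      "\<And>a x. x \<in> simp_boundaries r V \<Gamma> N \<Longrightarrow> scal a x \<in> simp_boundaries r V \<Gamma> N" "\<And>a x. x \<in> simp_boundaries r V K N \<Longrightarrow> scal a x \<in> simp_boundaries r V K N"
      using simp_boundaries_closed[OF subset_refl] simp_boundaries_closed[OF sub] by blast+
    show "z \<in> simp_cycles r V K N" using z DD[of c] c(1) p by (simp add: simp_cycles_iff simp_chains_chn)
    show "z \<in> simp_boundaries r V \<Gamma> N" unfolding SBG using z c(1) p KG unfolding simp_chains_chn by auto
    fix x :: "'v set \<Rightarrow>\<^sub>0 'k" assume "x \<in> simp_cycles r V \<Gamma> N"
    then have x: "coef x \<in> chn \<Gamma> N" "\<forall>F. D (coef x) F = 0" by (auto simp: simp_cycles_iff)
    then obtain b where b: "b \<in> chn \<Gamma> (Suc N)" "\<forall>F. \<sigma> \<subseteq> F \<longrightarrow> coef x F = D b F"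
      using R[of N] unfolding chain_exact_def by auto
    from chn_minus[OF x(1) D_chn[OF b(1)]] have "(\<lambda>F. coef x F - D b F) \<in> chn K N" using b(2) by (intro toK) auto
    from chn_simp_chains[OF finGam[OF sub] this] obtain y where y: "y \<in> simp_chains K N" "coef y = (\<lambda>F. coef x F - D b F)" by blast
    have "y \<in> simp_cycles r V K N" using y x(2) DD[OF b(1)] unfolding simp_cycles_iff y(2) simp_chains_chn by (simp add: D_lin)
    moreover have "x - y \<in> simp_boundaries r V \<Gamma> N" unfolding SBG lookup_fun y(2)
      using b(1) D_chn[OF b(1)] by (intro conjI bexI[of _ b]) simp_all
    ultimately show "\<exists>y\<in>simp_cycles r V K N. x - y \<in> simp_boundaries r V \<Gamma> N" by blast
  qed
  then obtain b where b: "b \<in> chn K (Suc N)" "\<forall>F. D c F = D b F" unfolding SBK z(2) by blast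
  have "(\<lambda>F. c F - b F) \<in> chn \<Gamma> (Suc p)" unfolding p by (rule chn_minus[OF c(1)[unfolded p] KG[OF b(1)]])
  moreover have "b F = 0" if "\<sigma> \<subseteq> F" for F using chn_0[OF b(1)] that by (auto simp: K)
  ultimately show ?thesis using b(2) by (intro bexI[of _ "\<lambda>F. c F - b F"]) (auto simp: D_lin)
qed

text \<open>Let \<open>c\<close> be the boundary of \<open>b\<close> over \<open>F0\<close> in
  \<Gamma>. Over \<open>insert v F0\<close> the chain \<open>b\<close> is a relative cycle, as
  \<open>c\<close> avoids \<open>v\<close>; let \<open>y\<close> be an absolute cycle extending it.
  Then \<open>b - y\<close> vanishes on all faces containing \<open>F0\<close> and \<open>v\<close>,
  so discarding its faces through \<open>v\<close> does not affect the boundary over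
  \<open>F0\<close>, and the result lives in the deletion.\<close>

lemma chain_exact_delete:
  fixes k :: "'k::field itself"
  assumes R: "\<And>\<sigma> q. \<sigma> \<in> \<Gamma> \<Longrightarrow> \<sigma> \<noteq> {} \<Longrightarrow> q \<le> N \<Longrightarrow> chain_exact k \<sigma> q"
    and hom_dim: "\<And>\<sigma>. \<sigma> \<in> \<Gamma> \<Longrightarrow> \<sigma> \<noteq> {} \<Longrightarrow> quotient_dim (simp_cycles r V \<Gamma> N :: ('v set \<Rightarrow>\<^sub>0 'k) set) (simp_boundaries r V \<Gamma> N) =
        quotient_dim (simp_cycles r V {F\<in>\<Gamma>. \<not> \<sigma> \<subseteq> F} N :: ('v set \<Rightarrow>\<^sub>0 'k) set) (simp_boundaries r V {F\<in>\<Gamma>. \<not> \<sigma> \<subseteq> F} N)"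
    and G': "\<Gamma>' = {F\<in>\<Gamma>. v \<notin> F}" "ord_complex V \<Gamma>' r" and F0: "F0 \<in> \<Gamma>'" "F0 \<noteq> {}" and p: "p \<le> N"
  shows "ord_complex.chain_exact V \<Gamma>' r k F0 p"
  unfolding ord_complex.chain_exact_def[OF G'(2)]
proof (intro ballI impI)
  fix c :: "'v set \<Rightarrow> 'k" assume c: "c \<in> chn \<Gamma>' p" "\<forall>F. F0 \<subseteq> F \<longrightarrow> D c F = 0"
  have F0G: "F0 \<in> \<Gamma>" using F0 by (simp add: G')
  have cG: "c \<in> chn \<Gamma> p" using c(1) by (auto simp: chn_def G')
  obtain b where b: "b \<in> chn \<Gamma> (Suc p)" "\<forall>F. F0 \<subseteq> F \<longrightarrow> c F = D b F" using R[OF F0G F0(2) p] cG c(2) unfolding chain_exact_def by blast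
  have "\<exists>y\<in>chn \<Gamma> (Suc p). (\<forall>F. D y F = 0) \<and> (\<forall>F. insert v F0 \<subseteq> F \<longrightarrow> y F = b F)"
  proof (cases "insert v F0 \<in> \<Gamma>")
    case True
    have "D b F = 0" if "insert v F0 \<subseteq> F" for F
    proof -
      have "c F = 0" using chn_0[OF c(1)] that by (auto simp: G')
      then show ?thesis using b(2) that by auto
    qed
    then show ?thesis by (intro extend_cycle[OF R[OF True] refl hom_dim[OF True] p b(1)]) auto
  next
    case False
    then have "b F = 0" if "insert v F0 \<subseteq> F" for F using chn_0[OF b(1)] down that by blast
    then show ?thesis by (intro bexI[of _ "\<lambda>_. 0"]) (auto simp: D_lin chn_zero)
  qed
  then obtain y where y: "y \<in> chn \<Gamma> (Suc p)" "\<forall>F. D y F = 0" "\<forall>F. insert v F0 \<subseteq> F \<longrightarrow> y F = b F" by blast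
  define e where "e F = (if v \<in> F then 0 else b F - y F)" for F
  have "e \<in> chn \<Gamma>' (Suc p)"
  proof (rule chn_I)
    fix F assume "e F \<noteq> 0"
    then have "v \<notin> F" "b F - y F \<noteq> 0" by (auto simp: e_def split: if_splits)
    then show "F \<in> \<Gamma>' \<and> card F = Suc p" using chn_D[OF chn_minus[OF b(1) y(1)], of F] by (simp add: G')
  qed
  moreover have "c F = D e F" if F: "F0 \<subseteq> F" for F
  proof -
    have "e (insert u F) = b (insert u F) - y (insert u F)" for u
    proof (cases "v \<in> insert u F")
      case True
      then have "y (insert u F) = b (insert u F)" using y(3) F by blast
      then show ?thesis using True by (simp only: e_def if_True diff_self)
    qed (simp only: e_def if_False)
    then have "D e F = D (\<lambda>F. b F - y F) F" unfolding up_def by (simp only:)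
    then show ?thesis using b(2) y(2) F by (simp add: D_lin)
  qed
  ultimately show "\<exists>b\<in>chn \<Gamma>' (Suc p). \<forall>F. F0 \<subseteq> F \<longrightarrow> c F = D b F" by blast
qed

end

section \<open>Skeleta of m-Buchsbaum* complexes\<close>

lemma complex_dim_eq:
  assumes "simplicial_complex \<Delta>" "\<And>\<sigma>. \<sigma> \<in> \<Delta> \<Longrightarrow> card \<sigma> \<le> d" "\<exists>\<sigma>\<in>\<Delta>. card \<sigma> = d"
  shows "complex_dim \<Delta> = int d - 1"
  unfolding complex_dim_def
proof (rule Max_eqI)
  show "finite (insert (- 1) ((\<lambda>\<sigma>. int (card \<sigma>) - 1) ` \<Delta>))" using assms(1) by (simp add: simplicial_complex_def)
  show "int d - 1 \<in> insert (- 1) ((\<lambda>\<sigma>. int (card \<sigma>) - 1) ` \<Delta>)" using assms(3) by blast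
  fix y assume "y \<in> insert (- 1) ((\<lambda>\<sigma>. int (card \<sigma>) - 1) ` \<Delta>)"
  then consider "y = - 1" | \<sigma> where "\<sigma> \<in> \<Delta>" "y = int (card \<sigma>) - 1" by blast
  then show "y \<le> int d - 1"
  proof cases
    case 2
    then show ?thesis using assms(2)[OF 2(1)] by simp
  qed simp
qed

lemma complex_dim_D:
  assumes sc: "simplicial_complex \<Delta>" and d: "complex_dim \<Delta> = int d - 1" "d \<ge> 1"
  shows "\<sigma> \<in> \<Delta> \<Longrightarrow> card \<sigma> \<le> d" "\<exists>\<sigma>\<in>\<Delta>. card \<sigma> = d"
proof -
  let ?S = "insert (- 1) ((\<lambda>\<sigma>. int (card \<sigma>) - 1) ` \<Delta>)"
  have fin: "finite ?S" using sc by (simp add: simplicial_complex_def)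
  show "card \<sigma> \<le> d" if "\<sigma> \<in> \<Delta>"
  proof -
    have "int (card \<sigma>) - 1 \<le> Max ?S" using that by (intro Max_ge[OF fin]) blast
    then show ?thesis using d(1) by (simp add: complex_dim_def)
  qed
  have "int d - 1 \<in> ?S" using Max_in[OF fin] d(1) by (simp add: complex_dim_def)
  then have "int d - 1 \<in> (\<lambda>\<sigma>. int (card \<sigma>) - 1) ` \<Delta>" using d(2) by auto
  then obtain \<sigma> where "\<sigma> \<in> \<Delta>" "int d - 1 = int (card \<sigma>) - 1" by (rule imageE)
  then show "\<exists>\<sigma>\<in>\<Delta>. card \<sigma> = d" by (intro bexI[of _ \<sigma>]) simp_all
qed

abbreviation face_loc :: "'k::field itself \<Rightarrow> 'v set set \<Rightarrow> _" where
  "face_loc k \<Delta> \<equiv> localization (face_ring k \<Delta>) (carrier (face_ring k \<Delta>) - irrelevant_ideal k \<Delta>)"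

lemma ord_complexI:
  assumes "finite V" "inj_on r V" "simplicial_complex \<Delta>" "{} \<in> \<Delta>" "\<Delta> \<subseteq> Pow V"
  shows "ord_complex V \<Delta> r" "complex_face \<Delta>" "ordered_complex \<Delta> r"
proof -
  show "ord_complex V \<Delta> r" by unfold_locales (rule assms)+
  show "complex_face \<Delta>" by unfold_locales (rule assms)+
  moreover have "inj_on r (vertices \<Delta>)" by (rule inj_on_subset[OF assms(2)]) (use assms(5) in blast)
  ultimately show "ordered_complex \<Delta> r" unfolding ordered_complex_def ordered_complex_axioms_def by blast
qed

lemma ord_complex_subset:
  assumes "ord_complex V \<Delta> r" "simplicial_complex \<Gamma>" "{} \<in> \<Gamma>" "\<Gamma> \<subseteq> \<Delta>"
  shows "ord_complex V \<Gamma> r"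
proof -
  interpret ord_complex V \<Delta> r by fact
  show ?thesis by (rule ord_complexI(1)[OF finV inj_r assms(2,3)]) (use assms(4) GV in blast)
qed

lemma buchsbaum_imp_chain_exact:
  fixes k :: "'k::field itself"
  assumes O: "ord_complex V \<Delta> r" and B: "buchsbaum_complex k \<Delta>" and d: "\<And>\<sigma>. \<sigma> \<in> \<Delta> \<Longrightarrow> card \<sigma> \<le> d" "\<exists>\<sigma>\<in>\<Delta>. card \<sigma> = d"
    and F0: "F0 \<in> \<Delta>" "F0 \<noteq> {}" and p: "p < d"
  shows "ord_complex.chain_exact V \<Delta> r k F0 p"
proof -
  interpret A: ord_complex V \<Delta> r by fact
  interpret B: ordered_complex k \<Delta> r by (rule ord_complexI(3)[OF A.finV A.inj_r A.sc A.G0 A.GV])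
  show ?thesis using B.buchsbaum_imp_cochain_exact[OF B d F0 p] A.cochain_exact_iff_chain_exact[OF F0(2)] by blast
qed

lemma chain_exact_imp_buchsbaum:
  fixes k :: "'k::field itself"
  assumes O: "ord_complex V \<Delta> r" and R: "\<And>F0 p. F0 \<in> \<Delta> \<Longrightarrow> F0 \<noteq> {} \<Longrightarrow> p < d \<Longrightarrow> ord_complex.chain_exact V \<Delta> r k F0 p"
    and d: "\<And>\<sigma>. \<sigma> \<in> \<Delta> \<Longrightarrow> card \<sigma> \<le> d" and N: "noetherian_ring (face_loc k \<Delta>)"
  shows "buchsbaum_complex k \<Delta>"
proof -
  interpret A: ord_complex V \<Delta> r by fact
  interpret B: ordered_complex k \<Delta> r by (rule ord_complexI(3)[OF A.finV A.inj_r A.sc A.G0 A.GV])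
  show ?thesis
    by (rule B.cochain_exact_imp_buchsbaum[OF _ d N]) (use A.cochain_exact_iff_chain_exact R in blast)
qed

lemma buchsbaum_noetherian: "buchsbaum_complex k \<Delta> \<Longrightarrow> noetherian_ring (face_loc k \<Delta>)"
  by (auto simp: buchsbaum_complex_def buchsbaum_local_ring_def noetherian_local_ring_def)

lemma noetherian_sub:
  fixes k :: "'k::field itself"
  assumes "ord_complex V \<Delta> r" "ord_complex V \<Gamma> r" "\<Gamma> \<subseteq> \<Delta>" "noetherian_ring (face_loc k \<Delta>)"
  shows "noetherian_ring (face_loc k \<Gamma>)"
proof -
  interpret A: ord_complex V \<Delta> r by fact
  interpret B: ord_complex V \<Gamma> r by fact
  show ?thesis
    by (rule noetherian_transfer[OF ord_complexI(2)[OF A.finV A.inj_r A.sc A.G0 A.GV] ord_complexI(2)[OF B.finV B.inj_r B.sc B.G0 B.GV] assms(3,4)])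
qed

text \<open>Exactness at \<open>p\<close> involves only faces with \<open>p\<close> or
  \<open>Suc p\<close> vertices, and these are the same in the skeleton as long as
  \<open>p < Suc N\<close>.\<close>

lemma skeleton_chain_exact:
  fixes k :: "'k::field itself" and \<Delta> \<Gamma> :: "'v set set"
  assumes O: "ord_complex V \<Delta> r" "ord_complex V \<Gamma> r" and G: "\<Gamma> = {F\<in>\<Delta>. card F \<le> Suc N}" and p: "p < Suc N"
    and R: "ord_complex.chain_exact V \<Delta> r k F0 p"
  shows "ord_complex.chain_exact V \<Gamma> r k F0 p"
proof -
  have c: "chn \<Gamma> q = (chn \<Delta> q :: ('v set \<Rightarrow> 'k) set)" if "q \<le> Suc N" for q using that by (auto simp: chn_def G)
  have "p \<le> Suc N" "Suc p \<le> Suc N" using p by auto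
  then show ?thesis using R unfolding ord_complex.chain_exact_def[OF O(1)] ord_complex.chain_exact_def[OF O(2)] by (simp only: c)
qed

text \<open>Exactness below \<open>Suc N\<close> makes the skeleton Buchsbaum; the one further
  degree, available in the larger complex only, enters through \<open>hom_dim_skeleton\<close> and
  gives the equality of dimensions for every removed point.\<close>

lemma skeleton_star:
  fixes k :: "'k::field itself"
  assumes O: "ord_complex V \<Delta> r" and R: "\<And>F0 p. F0 \<in> \<Delta> \<Longrightarrow> F0 \<noteq> {} \<Longrightarrow> p < Suc (Suc N) \<Longrightarrow> ord_complex.chain_exact V \<Delta> r k F0 p"
    and N: "noetherian_ring (face_loc k \<Delta>)" and ex: "\<exists>\<sigma>\<in>\<Delta>. card \<sigma> = Suc N"
    and G: "\<Gamma> = {F\<in>\<Delta>. card F \<le> Suc N}"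
  shows "buchsbaum_star k \<Gamma> \<and> complex_dim \<Gamma> = int N"
proof -
  interpret A: ord_complex V \<Delta> r by fact
  have scG: "simplicial_complex \<Gamma>" unfolding simplicial_complex_def
  proof (intro conjI ballI allI impI)
    show "finite \<Gamma>" by (rule A.finGam) (simp add: G)
    show "finite \<sigma>" if "\<sigma> \<in> \<Gamma>" for \<sigma> using that A.finG by (simp add: G)
    show "\<tau> \<in> \<Gamma>" if "\<sigma> \<in> \<Gamma>" "\<tau> \<subseteq> \<sigma>" for \<sigma> \<tau>
      using that A.down[of \<sigma> \<tau>] card_mono[OF A.finG[of \<sigma>] that(2)] by (simp add: G)
  qed
  have OG: "ord_complex V \<Gamma> r" by (rule ord_complex_subset[OF O scG]) (use A.G0 in \<open>auto simp: G\<close>)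
  interpret B: ord_complex V \<Gamma> r by fact
  have RG: "B.chain_exact k F0 p" if "F0 \<in> \<Gamma>" "F0 \<noteq> {}" "p < Suc N" for F0 p
    by (rule skeleton_chain_exact[OF O OG G that(3)], rule R) (use that in \<open>auto simp: G\<close>)
  have dim: "complex_dim \<Gamma> = int (Suc N) - 1"
    by (rule complex_dim_eq[OF scG]) (use ex in \<open>auto simp: G\<close>)
  then have dim': "complex_dim \<Gamma> = int N" by simp
  have "buchsbaum_complex k \<Gamma>"
  proof (rule chain_exact_imp_buchsbaum[OF OG])
    show "\<And>F0 p. F0 \<in> \<Gamma> \<Longrightarrow> F0 \<noteq> {} \<Longrightarrow> p < Suc N \<Longrightarrow> B.chain_exact k F0 p" by (rule RG)
    show "\<And>\<sigma>. \<sigma> \<in> \<Gamma> \<Longrightarrow> card \<sigma> \<le> Suc N" by (simp add: G)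
    show "noetherian_ring (face_loc k \<Gamma>)" by (rule noetherian_sub[OF O OG _ N]) (simp add: G)
  qed
  moreover have "reduced_homology_dim k (complex_dim \<Gamma> - 1) (subtopology (realization \<Gamma>) (realization_set \<Gamma> - {p}))
      = reduced_homology_dim k (complex_dim \<Gamma> - 1) (realization \<Gamma>)" if p: "p \<in> realization_set \<Gamma>" for p
  proof -
    let ?s = "{v. p v \<noteq> 0}"
    have s: "?s \<in> \<Gamma>" using p by (simp add: B.rs_iff)
    have sn: "?s \<noteq> {}" 
    proof
      assume e: "?s = {}"
      have "(\<Sum>v\<in>?s. p v) = 1" using p by (simp add: realization_set_def)
      then show False unfolding e by simp
    qed
    have "?s \<in> \<Delta>" using s by (simp add: G)
    then have RR: "A.chain_exact k ?s N" "A.chain_exact k ?s (Suc N)" using R sn by simp_all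
    show ?thesis unfolding dim' B.realization_dim[OF B.inj_r] B.punctured_dim[OF B.inj_r p refl]
      by (rule A.hom_dim_skeleton[OF RR sn G refl, symmetric])
  qed
  ultimately show ?thesis unfolding buchsbaum_star_def using dim' by blast
qed

lemma delete_complex: "simplicial_complex \<Delta> \<Longrightarrow> simplicial_complex (delete_vertices \<Delta> \<tau>)"
  unfolding simplicial_complex_def delete_vertices_def by auto

lemma skeleton_complex: assumes "simplicial_complex \<Delta>" shows "simplicial_complex (skeleton i \<Delta>)"
  unfolding simplicial_complex_def
proof (intro conjI ballI allI impI)
  show "finite (skeleton i \<Delta>)" using assms by (simp add: simplicial_complex_def skeleton_def)
  show "finite \<sigma>" if "\<sigma> \<in> skeleton i \<Delta>" for \<sigma> using that assms by (simp add: simplicial_complex_def skeleton_def)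
  fix \<sigma> \<tau> assume s: "\<sigma> \<in> skeleton i \<Delta>" "\<tau> \<subseteq> \<sigma>"
  then have "finite \<sigma>" "\<tau> \<in> \<Delta>" using assms by (auto simp: simplicial_complex_def skeleton_def)
  then show "\<tau> \<in> skeleton i \<Delta>" using s card_mono[of \<sigma> \<tau>] by (simp add: skeleton_def)
qed

text \<open>Sets \<tau> of up to \<open>m\<close> vertices have to be deleted, one more than the
  hypothesis allows. For a set of exactly \<open>m \<ge> 1\<close> vertices one vertex
  \<open>v\<close> is held back: deleting the others leaves a Buchsbaum* complex, and
  \<open>chain_exact_delete\<close> carries exactness, though not the Buchsbaum* equality, across
  the deletion of \<open>v\<close>. This is enough for \<open>skeleton_star\<close>.\<close>

lemma m_buchsbaum_star_skeleton_step:
  fixes k :: "'k::field itself" and \<Delta> :: "'v set set"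
  assumes sc: "simplicial_complex \<Delta>" and dim: "complex_dim \<Delta> = int (Suc (Suc N)) - 1" and m: "m_buchsbaum_star k m \<Delta>"
  shows "m_buchsbaum_star k (Suc m) (skeleton N \<Delta>) \<and> complex_dim (skeleton N \<Delta>) = int N"
proof -
  let ?d = "Suc (Suc N)"
  have d1: "?d \<ge> 1" by simp
  note face = complex_dim_D[OF sc dim d1]
  obtain \<sigma>0 where \<sigma>0: "\<sigma>0 \<in> \<Delta>" "card \<sigma>0 = ?d" using face(2) by blast
  have e0: "{} \<in> \<Delta>" using sc \<sigma>0(1) by (auto simp: simplicial_complex_def)
  let ?V = "vertices \<Delta>"
  have fV: "finite ?V" using sc by (auto simp: simplicial_complex_def)
  obtain r :: "'v \<Rightarrow> nat" where r: "inj_on r ?V" using finite_imp_inj_to_nat_seg[OF fV] by blast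
  have O: "ord_complex ?V (delete_vertices \<Delta> \<tau>) r" for \<tau>
    by (rule ord_complexI(1)[OF fV r delete_complex[OF sc]]) (use e0 in \<open>auto simp: delete_vertices_def\<close>)
  have skel: "delete_vertices (skeleton N \<Delta>) \<tau> = {F \<in> delete_vertices \<Delta> \<tau>. card F \<le> Suc N}" for \<tau>
    by (auto simp: delete_vertices_def skeleton_def)
  have small: "\<exists>\<sigma>\<in>\<Delta>'. card \<sigma> = Suc N" if s: "simplicial_complex \<Delta>'" "\<sigma> \<in> \<Delta>'" "card \<sigma> = ?d" for \<Delta>' :: "'v set set" and \<sigma>
  proof -
    obtain v where v: "v \<in> \<sigma>" using s(3) by fastforce
    have "\<sigma> - {v} \<in> \<Delta>'" using s(1,2) by (auto simp: simplicial_complex_def)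
    moreover have "card (\<sigma> - {v}) = Suc N" using s(3) v by (simp add: card_Diff_singleton)
    ultimately show ?thesis by blast
  qed
  have direct: "buchsbaum_star k (delete_vertices (skeleton N \<Delta>) \<tau>) \<and> complex_dim (delete_vertices (skeleton N \<Delta>) \<tau>) = int N"
    if B: "buchsbaum_complex k (delete_vertices \<Delta> \<tau>)" and D: "complex_dim (delete_vertices \<Delta> \<tau>) = int ?d - 1" for \<tau>
  proof (rule skeleton_star[OF O _ buchsbaum_noetherian[OF B] _ skel])
    note f = complex_dim_D[OF delete_complex[OF sc] D d1]
    show "\<exists>\<sigma>\<in>delete_vertices \<Delta> \<tau>. card \<sigma> = Suc N" using f(2) small[OF delete_complex[OF sc]] by blast
    show "\<And>F0 p. F0 \<in> delete_vertices \<Delta> \<tau> \<Longrightarrow> F0 \<noteq> {} \<Longrightarrow> p < ?d \<Longrightarrow> ord_complex.chain_exact ?V (delete_vertices \<Delta> \<tau>) r k F0 p"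
      by (rule buchsbaum_imp_chain_exact[OF O B f])
  qed
  have del0: "delete_vertices K {} = K" for K :: "'v set set" by (auto simp: delete_vertices_def)
  have main: "buchsbaum_star k (delete_vertices (skeleton N \<Delta>) \<tau>) \<and> complex_dim (delete_vertices (skeleton N \<Delta>) \<tau>) = int N"
    if \<tau>: "\<tau> \<subseteq> ?V" "card \<tau> < Suc m" for \<tau>
  proof (cases "m = 0")
    case True
    have "finite \<tau>" using fV \<tau>(1) finite_subset by blast
    then have "\<tau> = {}" using \<tau>(2) True by simp
    moreover have "buchsbaum_complex k \<Delta>" using m True by (simp add: m_buchsbaum_star_def)
    ultimately show ?thesis using direct[of "{}"] dim by (simp only: del0)
  next
    case False
    then have M: "\<And>\<tau>. \<tau> \<subseteq> ?V \<Longrightarrow> card \<tau> < m \<Longrightarrow> buchsbaum_star k (delete_vertices \<Delta> \<tau>) \<and> complex_dim (delete_vertices \<Delta> \<tau>) = int ?d - 1"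
      using m dim unfolding m_buchsbaum_star_def by auto
    show ?thesis
    proof (cases "card \<tau> < m")
      case True
      from M[OF \<tau>(1) True] show ?thesis by (intro direct) (auto simp: buchsbaum_star_def)
    next
      case ge: False
      then obtain v where v: "v \<in> \<tau>" using False by fastforce
      have f\<tau>: "finite \<tau>" using fV \<tau>(1) finite_subset by blast
      let ?\<tau> = "\<tau> - {v}"
      let ?D = "delete_vertices \<Delta> ?\<tau>"
      have "card ?\<tau> < m" using v f\<tau> \<tau>(2) False by (simp add: card_Diff_singleton)
      then have BD: "buchsbaum_star k ?D" "complex_dim ?D = int ?d - 1" using M[of ?\<tau>] \<tau>(1) by blast+
      then have B: "buchsbaum_complex k ?D" by (simp add: buchsbaum_star_def)
      note f = complex_dim_D[OF delete_complex[OF sc] BD(2) d1]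
      interpret A: ord_complex ?V ?D r by (rule O)
      have RA: "A.chain_exact k F0 p" if "F0 \<in> ?D" "F0 \<noteq> {}" "p < ?d" for F0 p by (rule buchsbaum_imp_chain_exact[OF O B f that])
      have del: "delete_vertices \<Delta> \<tau> = {F \<in> ?D. v \<notin> F}" using v by (auto simp: delete_vertices_def)
      \<comment> \<open>The barycenter of \<sigma> is a point whose support is \<sigma>; removing it
        translates the Buchsbaum* equality into one about the faces not containing \<sigma>.\<close>
      have hom_dim: "quotient_dim (simp_cycles r ?V ?D (Suc N) :: ('v set \<Rightarrow>\<^sub>0 'k) set) (simp_boundaries r ?V ?D (Suc N)) =
          quotient_dim (simp_cycles r ?V {F\<in>?D. \<not> \<sigma> \<subseteq> F} (Suc N) :: ('v set \<Rightarrow>\<^sub>0 'k) set) (simp_boundaries r ?V {F\<in>?D. \<not> \<sigma> \<subseteq> F} (Suc N))"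
        if \<sigma>: "\<sigma> \<in> ?D" "\<sigma> \<noteq> {}" for \<sigma>
      proof -
        have b: "bary \<sigma> \<in> realization_set ?D" by (rule A.bary_in[OF \<sigma>])
        have s: "\<sigma> = {v. bary \<sigma> v \<noteq> 0}" by (rule bary_supp[OF A.finG[OF \<sigma>(1)], symmetric])
        have "int ?d - 1 - 1 = int (Suc N) - 1" by simp
        then have "reduced_homology_dim k (int (Suc N) - 1) (subtopology (realization ?D) (realization_set ?D - {bary \<sigma>}))
            = reduced_homology_dim k (int (Suc N) - 1) (realization ?D)"
          using BD(1) b unfolding buchsbaum_star_def BD(2) by (simp only:)
        then show ?thesis unfolding A.realization_dim[OF A.inj_r] A.punctured_dim[OF A.inj_r b s] by (rule sym)
      qed
      have RD: "ord_complex.chain_exact ?V (delete_vertices \<Delta> \<tau>) r k F0 p" if "F0 \<in> delete_vertices \<Delta> \<tau>" "F0 \<noteq> {}" "p < ?d" for F0 p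
      proof (rule A.chain_exact_delete[OF _ hom_dim del O that(1,2)])
        show "p \<le> Suc N" using that(3) by simp
        show "\<And>\<sigma> q. \<sigma> \<in> ?D \<Longrightarrow> \<sigma> \<noteq> {} \<Longrightarrow> q \<le> Suc N \<Longrightarrow> A.chain_exact k \<sigma> q" by (rule RA) simp_all
      qed
      obtain \<sigma> where \<sigma>: "\<sigma> \<in> ?D" "card \<sigma> = ?d" using f(2) by blast
      \<comment> \<open>The chosen top-dimensional face \<sigma> may contain \<open>v\<close>; even
        then \<open>\<sigma> - {v}\<close> keeps the \<open>Suc N\<close> vertices which the
        skeleton needs for its dimension.\<close>
      have ex: "\<exists>\<sigma>\<in>delete_vertices \<Delta> \<tau>. card \<sigma> = Suc N"
      proof (cases "v \<in> \<sigma>")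
        case True
        have "\<sigma> - {v} \<in> delete_vertices \<Delta> \<tau>" unfolding del using A.down[OF \<sigma>(1), of "\<sigma> - {v}"] by simp
        moreover have "card (\<sigma> - {v}) = Suc N" using \<sigma>(2) True by (simp add: card_Diff_singleton)
        ultimately show ?thesis by blast
      next
        case False
        then have "\<sigma> \<in> delete_vertices \<Delta> \<tau>" unfolding del using \<sigma>(1) by simp
        then show ?thesis using small[OF delete_complex[OF sc]] \<sigma>(2) by blast
      qed
      have no: "noetherian_ring (face_loc k (delete_vertices \<Delta> \<tau>))"
        by (rule noetherian_sub[OF O O _ buchsbaum_noetherian[OF B]]) (auto simp: delete_vertices_def)
      show ?thesis by (rule skeleton_star[OF O RD no ex skel])
    qed
  qed
  have dimS: "complex_dim (skeleton N \<Delta>) = int N" using main[of "{}"] by (simp add: del0)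
  have sub: "vertices (skeleton N \<Delta>) \<subseteq> ?V" by (auto simp: skeleton_def)
  have "m_buchsbaum_star k (Suc m) (skeleton N \<Delta>)" unfolding m_buchsbaum_star_def dimS
  proof (rule disjI2, intro conjI allI impI)
    fix \<tau> assume \<tau>: "\<tau> \<subseteq> vertices (skeleton N \<Delta>) \<and> card \<tau> < Suc m"
    then have "\<tau> \<subseteq> ?V" "card \<tau> < Suc m" using subset_trans[OF _ sub] by simp_all
    from main[OF this] show "buchsbaum_star k (delete_vertices (skeleton N \<Delta>) \<tau>)"
      "complex_dim (delete_vertices (skeleton N \<Delta>) \<tau>) = int N" by simp_all
  qed simp
  then show ?thesis using dimS by simp
qed

theorem theorem5p9:
  fixes k :: "'k::field itself" and m d i :: nat and \<Delta> :: "'v set set"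
  assumes "simplicial_complex \<Delta>"
    and "complex_dim \<Delta> = int d - 1"
    and "m_buchsbaum_star k m \<Delta>"
    and "i < d"
  shows "m_buchsbaum_star k (m + d - i - 1) (skeleton i \<Delta>)"
  using assms
\<comment> \<open>Each step to the skeleton of codimension one lowers \<open>d\<close> by one and
  raises \<open>m\<close> by one, so \<open>m + d\<close> stays fixed.\<close>
proof (induction "d - Suc i" arbitrary: d m \<Delta>)
  case 0
  then have d: "d = Suc i" by simp
  have "skeleton i \<Delta> = \<Delta>"
    using complex_dim_D(1)[OF 0(2,3)] d by (force simp: skeleton_def)
  then show ?case using 0(4) d by simp
next
  case (Suc n)
  define N where "N = d - 2"
  have d: "d = Suc (Suc N)" "i \<le> N" using Suc.hyps(2) by (simp_all add: N_def)
  have step: "m_buchsbaum_star k (Suc m) (skeleton N \<Delta>)" "complex_dim (skeleton N \<Delta>) = int (Suc N) - 1"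
    using m_buchsbaum_star_skeleton_step[OF Suc.prems(1) Suc.prems(2)[unfolded d(1)] Suc.prems(3)] by simp_all
  have "m_buchsbaum_star k (Suc m + Suc N - i - 1) (skeleton i (skeleton N \<Delta>))"
    by (rule Suc.hyps(1)[OF _ skeleton_complex[OF Suc.prems(1)] step(2,1)]) (use Suc.hyps(2) d in simp_all)
  moreover have "skeleton i (skeleton N \<Delta>) = skeleton i \<Delta>" using d(2) by (auto simp: skeleton_def)
  moreover have "Suc m + Suc N - i - 1 = m + d - i - 1" using d by simp
  ultimately show ?case by simp
qed

end
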